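(* Let $\mathcal{C}$ be a semi-monoidal 2-category, let $\mathscr{E}$ be the 2-category of (cancellable-idempotent) units in $\mathcal{C}$, $\mathscr{G}$ the 2-category of GPS units in $\mathcal{C}$, and $\mathscr{U}$ the 2-category of septuples $(I,\alpha,\lambda,\rho,L,R,K)$ described in the context. Then the forgetful strict 2-functors $$\Phi:\mathscr{U}\to\mathscr{E},\qquad \Psi:\mathscr{U}\to\mathscr{G}$$ are 2-equivalences. More precisely, both are surjective on objects and strongly fully faithful (i.e. isomorphisms on hom categories).
   Context: A semi-monoidal 2-category $\mathcal{C}$ is a strict 2-category with a strict 2-functor $\mathcal{C}\times\mathcal{C}\to\mathcal{C}$, $(X,Y)\mapsto XY$ (juxtaposition), strictly associative; no unit assumed. $\#$ is composition of arrows and horizontal composition of 2-cells (including whiskering), written left to right; $\bullet$ is vertical composition of 2-cells, also left to right. Names of objects/arrows also denote their identities. An equi-arrow is an arrow admitting a pseudo-inverse. Natural transformations are pseudo-natural: $\lambda$ with components $\lambda_X: IX\to X$ has invertible 2-cells $\lambda_f: If\#\lambda_Y\Rightarrow\lambda_X\#f$ for $f:X\to Y$, and $\rho$ with components $\rho_X:XI\to X$ has invertible $\rho_f: fI\#\rho_Y\Rightarrow\rho_X\#f$, with the usual compatibilities. Families of 2-cells called natural are modifications. **$\mathscr{E}$.** Objects: pairs $(I,\alpha)$ with $\alpha:II\to I$ an equi-arrow and $I$ cancellable (the 2-functors $X\mapsto IX$, $X\mapsto XI$ induce equivalences on hom categories). Arrows $(I,\alpha)\to(J,\beta)$: pairs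 $(u,U)$, $u:I\to J$ an equi-arrow, $U:\alpha\#u\Rightarrow uu\#\beta$ invertible. 2-cells $(u,U)\Rightarrow(v,V)$: invertible 2-cells $T:u\Rightarrow v$ with (T0) $U\bullet(TT\#\beta)=(\alpha\#T)\bullet V$. **$\mathscr{G}$.** Objects (GPS units): quadruples $(I,\lambda,\rho,K)$ where $I$ is an object, $\lambda,\rho$ are natural transformations with equi-arrow components $\lambda_X:IX\to X$, $\rho_X:XI\to X$, and $K_{X,Y}:X\lambda_Y\Rightarrow\rho_XY$ are invertible 2-cells natural in $X,Y$, coherent in the following sense. ($I$ is automatically cancellable.) Let $K^\lambda_{X,Y}:\lambda_{XY}\Rightarrow\lambda_XY$ and $K^\rho_{X,Y}:X\rho_Y\Rightarrow\rho_{XY}$ be the unique 2-cells with $IK^\lambda_{X,Y}\bullet K_{I,X}Y=K_{I,XY}$ and $XK_{Y,I}\bullet K^\rho_{X,Y}I=K_{XY,I}$. Coherence: for all $X,Y,Z$, $XK^\lambda_{Y,Z}\bullet K_{X,Y}Z=K_{X,YZ}$ and $XK_{Y,Z}\bullet K^\rho_{X,Y}Z=K_{XY,Z}$. Arrows $(I,\lambda,\rho,K)\to(J,\ell,r,H)$: triples $(u,U^{\mathrm{left}},U^{\mathrm{right}})$ with $u:I\to J$ an arrow and natural families of invertible 2-cells $U^{\mathrm{left}}_X:\lambda_X\Rightarrow uX\#\ell_X$, $U^{\mathrm{right}}_X:\rho_X\Rightarrow Xu\#r_X$ satisfying (PK) $K_{X,Y}\bullet(U^{\mathrm{right}}_XY)=(XU^{\mathrm{left}}_Y)\bullet(XuY\#H_{X,Y})$.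 2-cells $(u,U^{\mathrm{left}},U^{\mathrm{right}})\Rightarrow(v,V^{\mathrm{left}},V^{\mathrm{right}})$: 2-cells $T:u\Rightarrow v$ with (T1) $U^{\mathrm{left}}_X\bullet(TX\#\ell_X)=V^{\mathrm{left}}_X$ and (T2) $U^{\mathrm{right}}_X\bullet(XT\#r_X)=V^{\mathrm{right}}_X$ for all $X$. **$\mathscr{U}$.** Objects: septuples $(I,\alpha,\lambda,\rho,L,R,K)$ with $\alpha:II\to I$ an equi-arrow, $\lambda,\rho$ natural transformations with equi-arrow components $\lambda_X:IX\to X$, $\rho_X:XI\to X$, and natural invertible 2-cells $L_X:I\lambda_X\Rightarrow\alpha X$, $R_X:X\alpha\Rightarrow\rho_XI$, $K_{X,Y}:X\lambda_Y\Rightarrow\rho_XY$, such that $$(R_XY\#X\lambda_Y)\bullet(XL_Y\#\rho_XY)=X\alpha Y\#K_{X,Y}$$ (composite $X\alpha Y\#X\lambda_Y\Rightarrow\rho_XIY\#X\lambda_Y=XI\lambda_Y\#\rho_XY\Rightarrow X\alpha Y\#\rho_XY$). Arrows to $(J,\beta,\ell,r,L',R',H)$: quadruples $(u,U^{\mathrm{left}},U^{\mathrm{right}},U)$ with $u:I\to J$ an arrow, $U^{\mathrm{left}},U^{\mathrm{right}}$ natural families of invertible 2-cells as in $\mathscr{G}$, and $U:\alpha\#u\Rightarrow uu\#\beta$ invertible, satisfying (PK) and $$(L_X\#uX)\bullet(UX)=(uU^{\mathrm{left}}_X)\bullet(uuX\#L'_X),\qquad (R_X\#Xu)\bullet(U^{\mathrm{right}}_Xu)=(XU)\bullet(Xuu\#R'_X).$$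 2-cells: 2-cells $T:u\Rightarrow v$ satisfying (T0), (T1), (T2). In all three 2-categories composition is given by composition and pasting in $\mathcal{C}$. $\Phi$ sends $(I,\alpha,\lambda,\rho,L,R,K)$ to $(I,\alpha)$, $(u,U^{\mathrm{left}},U^{\mathrm{right}},U)$ to $(u,U)$ and $T$ to $T$; $\Psi$ sends them to $(I,\lambda,\rho,K)$, $(u,U^{\mathrm{left}},U^{\mathrm{right}})$ and $T$. *)

theory Defs
  imports Main "HOL-Library.FuncSet"
begin

section \<open>Categories, functors, equivalences\<close>

text \<open>All compositions are written in diagrammatic order, i.e. from left to right.\<close>

record ('o, 'a) cat =
  Obj :: "'o set"
  Arr :: "'a set"
  Dom :: "'a \<Rightarrow> 'o"
  Cod :: "'a \<Rightarrow> 'o"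
  Ident :: "'o \<Rightarrow> 'a"
  Comp :: "'a \<Rightarrow> 'a \<Rightarrow> 'a"

locale category =
  fixes C :: "('o, 'a, 'm) cat_scheme"
  assumes Dom_Obj: "f \<in> Arr C \<Longrightarrow> Dom C f \<in> Obj C"
    and Cod_Obj: "f \<in> Arr C \<Longrightarrow> Cod C f \<in> Obj C"
    and Ident_Arr: "X \<in> Obj C \<Longrightarrow> Ident C X \<in> Arr C"
    and Dom_Ident: "X \<in> Obj C \<Longrightarrow> Dom C (Ident C X) = X"
    and Cod_Ident: "X \<in> Obj C \<Longrightarrow> Cod C (Ident C X) = X"
    and Comp_Arr: "\<lbrakk>f \<in> Arr C; g \<in> Arr C; Cod C f = Dom C g\<rbrakk> \<Longrightarrow> Comp C f g \<in> Arr C"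
    and Dom_Comp: "\<lbrakk>f \<in> Arr C; g \<in> Arr C; Cod C f = Dom C g\<rbrakk> \<Longrightarrow> Dom C (Comp C f g) = Dom C f"
    and Cod_Comp: "\<lbrakk>f \<in> Arr C; g \<in> Arr C; Cod C f = Dom C g\<rbrakk> \<Longrightarrow> Cod C (Comp C f g) = Cod C g"
    and Ident_left: "f \<in> Arr C \<Longrightarrow> Comp C (Ident C (Dom C f)) f = f"
    and Ident_right: "f \<in> Arr C \<Longrightarrow> Comp C f (Ident C (Cod C f)) = f"
    and Comp_assoc: "\<lbrakk>f \<in> Arr C; g \<in> Arr C; h \<in> Arr C; Cod C f = Dom C g; Cod C g = Dom C h\<rbrakk>
      \<Longrightarrow> Comp C (Comp C f g) h = Comp C f (Comp C g h)"

definition homset :: "('o, 'a, 'm) cat_scheme \<Rightarrow> 'o \<Rightarrow> 'o \<Rightarrow> 'a set" where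
  "homset C X Y = {f \<in> Arr C. Dom C f = X \<and> Cod C f = Y}"

definition is_iso :: "('o, 'a, 'm) cat_scheme \<Rightarrow> 'a \<Rightarrow> bool" where
  "is_iso C f \<longleftrightarrow> f \<in> Arr C \<and> (\<exists>g \<in> homset C (Cod C f) (Dom C f).
     Comp C f g = Ident C (Dom C f) \<and> Comp C g f = Ident C (Cod C f))"

locale cat_functor = A: category A + B: category B
  for A :: "('o, 'a, 'm) cat_scheme" and B :: "('p, 'b, 'n) cat_scheme"
    and F0 :: "'o \<Rightarrow> 'p" and F1 :: "'a \<Rightarrow> 'b" +
  assumes map_Obj: "X \<in> Obj A \<Longrightarrow> F0 X \<in> Obj B"
    and map_Arr: "f \<in> Arr A \<Longrightarrow> F1 f \<in> homset B (F0 (Dom A f)) (F0 (Cod A f))"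
    and map_Ident: "X \<in> Obj A \<Longrightarrow> F1 (Ident A X) = Ident B (F0 X)"
    and map_Comp: "\<lbrakk>f \<in> Arr A; g \<in> Arr A; Cod A f = Dom A g\<rbrakk>
      \<Longrightarrow> F1 (Comp A f g) = Comp B (F1 f) (F1 g)"

definition nat_iso ::
  "('o, 'a, 'm) cat_scheme \<Rightarrow> ('p, 'b, 'n) cat_scheme
    \<Rightarrow> ('o \<Rightarrow> 'p) \<Rightarrow> ('a \<Rightarrow> 'b) \<Rightarrow> ('o \<Rightarrow> 'p) \<Rightarrow> ('a \<Rightarrow> 'b) \<Rightarrow> ('o \<Rightarrow> 'b) \<Rightarrow> bool" where
  "nat_iso A B F0 F1 G0 G1 t \<longleftrightarrow>
     (\<forall>X \<in> Obj A. t X \<in> homset B (F0 X) (G0 X) \<and> is_iso B (t X)) \<and>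
     (\<forall>f \<in> Arr A. Comp B (F1 f) (t (Cod A f)) = Comp B (t (Dom A f)) (G1 f))"

definition cat_equivalence ::
  "('o, 'a, 'm) cat_scheme \<Rightarrow> ('p, 'b, 'n) cat_scheme \<Rightarrow> ('o \<Rightarrow> 'p) \<Rightarrow> ('a \<Rightarrow> 'b) \<Rightarrow> bool" where
  "cat_equivalence A B F0 F1 \<longleftrightarrow> cat_functor A B F0 F1 \<and>
     (\<exists>G0 G1 \<eta> \<epsilon>. cat_functor B A G0 G1 \<and>
        nat_iso A A id id (G0 \<circ> F0) (G1 \<circ> F1) \<eta> \<and>
        nat_iso B B (F0 \<circ> G0) (F1 \<circ> G1) id id \<epsilon>)"

definition cat_isomorphism ::
  "('o, 'a, 'm) cat_scheme \<Rightarrow> ('p, 'b, 'n) cat_scheme \<Rightarrow> ('o \<Rightarrow> 'p) \<Rightarrow> ('a \<Rightarrow> 'b) \<Rightarrow> bool" where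
  "cat_isomorphism A B F0 F1 \<longleftrightarrow> cat_functor A B F0 F1 \<and>
     (\<exists>G0 G1. cat_functor B A G0 G1 \<and>
        (\<forall>X \<in> Obj A. G0 (F0 X) = X) \<and> (\<forall>f \<in> Arr A. G1 (F1 f) = f) \<and>
        (\<forall>Y \<in> Obj B. F0 (G0 Y) = Y) \<and> (\<forall>g \<in> Arr B. F1 (G1 g) = g))"


section \<open>Strict 2-categories\<close>

record ('o, 'a, 'c) twocat = "('o, 'a) cat" +
  Cell :: "'c set"
  Src :: "'c \<Rightarrow> 'a"
  Trg :: "'c \<Rightarrow> 'a"
  Icell :: "'a \<Rightarrow> 'c"
  Vcomp :: "'c \<Rightarrow> 'c \<Rightarrow> 'c"
  Hcomp :: "'c \<Rightarrow> 'c \<Rightarrow> 'c"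

definition vert :: "('o, 'a, 'c, 'm) twocat_scheme \<Rightarrow> ('a, 'c) cat" where
  "vert C = \<lparr>Obj = Arr C, Arr = Cell C, Dom = Src C, Cod = Trg C, Ident = Icell C, Comp = Vcomp C\<rparr>"

definition horiz :: "('o, 'a, 'c, 'm) twocat_scheme \<Rightarrow> ('o, 'c) cat" where
  "horiz C = \<lparr>Obj = Obj C, Arr = Cell C, Dom = (\<lambda>a. Dom C (Src C a)), Cod = (\<lambda>a. Cod C (Src C a)),
     Ident = (\<lambda>X. Icell C (Ident C X)), Comp = Hcomp C\<rparr>"

locale strict_2category = category C + vert: category "vert C" + horiz: category "horiz C"
  for C :: "('o, 'a, 'c, 'm) twocat_scheme" +
  assumes Dom_parallel: "a \<in> Cell C \<Longrightarrow> Dom C (Src C a) = Dom C (Trg C a)"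
    and Cod_parallel: "a \<in> Cell C \<Longrightarrow> Cod C (Src C a) = Cod C (Trg C a)"
    and Src_Hcomp: "\<lbrakk>a \<in> Cell C; b \<in> Cell C; Cod C (Src C a) = Dom C (Src C b)\<rbrakk>
      \<Longrightarrow> Src C (Hcomp C a b) = Comp C (Src C a) (Src C b)"
    and Trg_Hcomp: "\<lbrakk>a \<in> Cell C; b \<in> Cell C; Cod C (Src C a) = Dom C (Src C b)\<rbrakk>
      \<Longrightarrow> Trg C (Hcomp C a b) = Comp C (Trg C a) (Trg C b)"
    and Icell_Comp: "\<lbrakk>f \<in> Arr C; g \<in> Arr C; Cod C f = Dom C g\<rbrakk>
      \<Longrightarrow> Icell C (Comp C f g) = Hcomp C (Icell C f) (Icell C g)"
    and interchange: "\<lbrakk>a \<in> Cell C; a' \<in> Cell C; b \<in> Cell C; b' \<in> Cell C;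
        Trg C a = Src C a'; Trg C b = Src C b'; Cod C (Src C a) = Dom C (Src C b)\<rbrakk>
      \<Longrightarrow> Hcomp C (Vcomp C a a') (Vcomp C b b') = Vcomp C (Hcomp C a b) (Hcomp C a' b')"

definition homcat :: "('o, 'a, 'c, 'm) twocat_scheme \<Rightarrow> 'o \<Rightarrow> 'o \<Rightarrow> ('a, 'c) cat" where
  "homcat C X Y = \<lparr>Obj = homset C X Y, Arr = {a \<in> Cell C. Src C a \<in> homset C X Y},
     Dom = Src C, Cod = Trg C, Ident = Icell C, Comp = Vcomp C\<rparr>"

definition cells :: "('o, 'a, 'c, 'm) twocat_scheme \<Rightarrow> 'a \<Rightarrow> 'a \<Rightarrow> 'c set" where
  "cells C f g = homset (vert C) f g"

definition isocells :: "('o, 'a, 'c, 'm) twocat_scheme \<Rightarrow> 'a \<Rightarrow> 'a \<Rightarrow> 'c set" where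
  "isocells C f g = {a \<in> cells C f g. is_iso (vert C) a}"

definition equi_arrow :: "('o, 'a, 'c, 'm) twocat_scheme \<Rightarrow> 'a \<Rightarrow> bool" where
  "equi_arrow C u \<longleftrightarrow> u \<in> Arr C \<and> (\<exists>v \<in> homset C (Cod C u) (Dom C u).
     isocells C (Comp C u v) (Ident C (Dom C u)) \<noteq> {} \<and>
     isocells C (Comp C v u) (Ident C (Cod C u)) \<noteq> {})"

definition prod2 ::
  "('o, 'a, 'c, 'm) twocat_scheme \<Rightarrow> ('p, 'b, 'd, 'n) twocat_scheme
    \<Rightarrow> ('o \<times> 'p, 'a \<times> 'b, 'c \<times> 'd) twocat" where
  "prod2 C D = \<lparr>Obj = Obj C \<times> Obj D, Arr = Arr C \<times> Arr D,
     Dom = map_prod (Dom C) (Dom D), Cod = map_prod (Cod C) (Cod D),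
     Ident = map_prod (Ident C) (Ident D),
     Comp = (\<lambda>(f, f') (g, g'). (Comp C f g, Comp D f' g')),
     Cell = Cell C \<times> Cell D,
     Src = map_prod (Src C) (Src D), Trg = map_prod (Trg C) (Trg D),
     Icell = map_prod (Icell C) (Icell D),
     Vcomp = (\<lambda>(a, a') (b, b'). (Vcomp C a b, Vcomp D a' b')),
     Hcomp = (\<lambda>(a, a') (b, b'). (Hcomp C a b, Hcomp D a' b'))\<rparr>"


section \<open>Strict 2-functors and 2-equivalences\<close>

record ('o, 'a, 'c, 'p, 'b, 'd) twofun =
  on_obj :: "'o \<Rightarrow> 'p"
  on_arr :: "'a \<Rightarrow> 'b"
  on_cell :: "'c \<Rightarrow> 'd"

locale strict_2functor = S: strict_2category C + T: strict_2category D
    + arr: cat_functor C D "on_obj F" "on_arr F"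
    + vert: cat_functor "vert C" "vert D" "on_arr F" "on_cell F"
    + horiz: cat_functor "horiz C" "horiz D" "on_obj F" "on_cell F"
  for C :: "('o, 'a, 'c, 'm) twocat_scheme" and D :: "('p, 'b, 'd, 'n) twocat_scheme"
    and F :: "('o, 'a, 'c, 'p, 'b, 'd) twofun"

definition id2 :: "('o, 'a, 'c, 'o, 'a, 'c) twofun" where
  "id2 = \<lparr>on_obj = id, on_arr = id, on_cell = id\<rparr>"

definition comp2 ::
  "('o, 'a, 'c, 'p, 'b, 'd) twofun \<Rightarrow> ('p, 'b, 'd, 'q, 'e, 'f) twofun
    \<Rightarrow> ('o, 'a, 'c, 'q, 'e, 'f) twofun" where
  "comp2 F G = \<lparr>on_obj = on_obj G \<circ> on_obj F, on_arr = on_arr G \<circ> on_arr F,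
     on_cell = on_cell G \<circ> on_cell F\<rparr>"

definition two_nat_iso ::
  "('o, 'a, 'c, 'm) twocat_scheme \<Rightarrow> ('p, 'b, 'd, 'n) twocat_scheme
    \<Rightarrow> ('o, 'a, 'c, 'p, 'b, 'd) twofun \<Rightarrow> ('o, 'a, 'c, 'p, 'b, 'd) twofun \<Rightarrow> ('o \<Rightarrow> 'b) \<Rightarrow> bool" where
  "two_nat_iso C D F G t \<longleftrightarrow>
     nat_iso C D (on_obj F) (on_arr F) (on_obj G) (on_arr G) t \<and>
     (\<forall>a \<in> Cell C. Hcomp D (on_cell F a) (Icell D (t (Cod C (Src C a))))
                  = Hcomp D (Icell D (t (Dom C (Src C a)))) (on_cell G a))"

definition two_equivalence ::
  "('o, 'a, 'c, 'm) twocat_scheme \<Rightarrow> ('p, 'b, 'd, 'n) twocat_scheme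
    \<Rightarrow> ('o, 'a, 'c, 'p, 'b, 'd) twofun \<Rightarrow> bool" where
  "two_equivalence C D F \<longleftrightarrow> strict_2functor C D F \<and>
     (\<exists>G \<eta> \<epsilon>. strict_2functor D C G \<and>
        two_nat_iso C C id2 (comp2 F G) \<eta> \<and> two_nat_iso D D (comp2 G F) id2 \<epsilon>)"

definition surjective_on_objects ::
  "('o, 'a, 'c, 'm) twocat_scheme \<Rightarrow> ('p, 'b, 'd, 'n) twocat_scheme
    \<Rightarrow> ('o, 'a, 'c, 'p, 'b, 'd) twofun \<Rightarrow> bool" where
  "surjective_on_objects C D F \<longleftrightarrow> on_obj F ` Obj C = Obj D"

definition strongly_fully_faithful ::
  "('o, 'a, 'c, 'm) twocat_scheme \<Rightarrow> ('p, 'b, 'd, 'n) twocat_scheme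
    \<Rightarrow> ('o, 'a, 'c, 'p, 'b, 'd) twofun \<Rightarrow> bool" where
  "strongly_fully_faithful C D F \<longleftrightarrow> (\<forall>X \<in> Obj C. \<forall>Y \<in> Obj C.
     cat_isomorphism (homcat C X Y) (homcat D (on_obj F X) (on_obj F Y)) (on_arr F) (on_cell F))"


section \<open>Pseudo-natural transformations and modifications\<close>

record ('o, 'a, 'b, 'd) ptrans =
  comp_at :: "'o \<Rightarrow> 'b"
  cell_at :: "'a \<Rightarrow> 'd"

text \<open>
  Pseudo-natural transformations and modifications occur below as parts of objects and arrows
  of 2-categories, where equality matters.  They are therefore required to be extensional, so
  that they are determined by their values on the carriers.
\<close>

definition pseudonatural ::
  "('o, 'a, 'c, 'm) twocat_scheme \<Rightarrow> ('p, 'b, 'd, 'n) twocat_scheme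
    \<Rightarrow> ('o, 'a, 'c, 'p, 'b, 'd) twofun \<Rightarrow> ('o, 'a, 'c, 'p, 'b, 'd) twofun
    \<Rightarrow> ('o, 'a, 'b, 'd) ptrans \<Rightarrow> bool" where
  "pseudonatural C D F G t \<longleftrightarrow>
     comp_at t \<in> extensional (Obj C) \<and> cell_at t \<in> extensional (Arr C) \<and>
     (\<forall>X \<in> Obj C. comp_at t X \<in> homset D (on_obj F X) (on_obj G X)) \<and>
     (\<forall>f \<in> Arr C. cell_at t f \<in>
        isocells D (Comp D (on_arr F f) (comp_at t (Cod C f))) (Comp D (comp_at t (Dom C f)) (on_arr G f))) \<and>
     (\<forall>a \<in> Cell C.
        Vcomp D (Hcomp D (on_cell F a) (Icell D (comp_at t (Cod C (Src C a))))) (cell_at t (Trg C a))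
        = Vcomp D (cell_at t (Src C a)) (Hcomp D (Icell D (comp_at t (Dom C (Src C a)))) (on_cell G a))) \<and>
     (\<forall>X \<in> Obj C. cell_at t (Ident C X) = Icell D (comp_at t X)) \<and>
     (\<forall>f \<in> Arr C. \<forall>g \<in> Arr C. Cod C f = Dom C g \<longrightarrow>
        cell_at t (Comp C f g)
        = Vcomp D (Hcomp D (Icell D (on_arr F f)) (cell_at t g)) (Hcomp D (cell_at t f) (Icell D (on_arr G g))))"

definition modification ::
  "('o, 'a, 'c, 'm) twocat_scheme \<Rightarrow> ('p, 'b, 'd, 'n) twocat_scheme
    \<Rightarrow> ('o, 'a, 'c, 'p, 'b, 'd) twofun \<Rightarrow> ('o, 'a, 'c, 'p, 'b, 'd) twofun
    \<Rightarrow> ('o, 'a, 'b, 'd) ptrans \<Rightarrow> ('o, 'a, 'b, 'd) ptrans \<Rightarrow> ('o \<Rightarrow> 'd) \<Rightarrow> bool" where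
  "modification C D F G s t m \<longleftrightarrow>
     m \<in> extensional (Obj C) \<and>
     (\<forall>X \<in> Obj C. m X \<in> cells D (comp_at s X) (comp_at t X)) \<and>
     (\<forall>f \<in> Arr C.
        Vcomp D (Hcomp D (Icell D (on_arr F f)) (m (Cod C f))) (cell_at t f)
        = Vcomp D (cell_at s f) (Hcomp D (m (Dom C f)) (Icell D (on_arr G f))))"

definition inv_modification ::
  "('o, 'a, 'c, 'm) twocat_scheme \<Rightarrow> ('p, 'b, 'd, 'n) twocat_scheme
    \<Rightarrow> ('o, 'a, 'c, 'p, 'b, 'd) twofun \<Rightarrow> ('o, 'a, 'c, 'p, 'b, 'd) twofun
    \<Rightarrow> ('o, 'a, 'b, 'd) ptrans \<Rightarrow> ('o, 'a, 'b, 'd) ptrans \<Rightarrow> ('o \<Rightarrow> 'd) \<Rightarrow> bool" where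
  "inv_modification C D F G s t m \<longleftrightarrow>
     modification C D F G s t m \<and> (\<forall>X \<in> Obj C. is_iso (vert D) (m X))"

definition pcomp ::
  "('o, 'a, 'c, 'm) twocat_scheme \<Rightarrow> ('p, 'b, 'd, 'n) twocat_scheme
    \<Rightarrow> ('o, 'a, 'b, 'd) ptrans \<Rightarrow> ('o, 'a, 'b, 'd) ptrans \<Rightarrow> ('o, 'a, 'b, 'd) ptrans" where
  "pcomp C D s t = \<lparr>comp_at = (\<lambda>X. Comp D (comp_at s X) (comp_at t X)),
     cell_at = (\<lambda>f. Vcomp D (Hcomp D (cell_at s f) (Icell D (comp_at t (Cod C f))))
                            (Hcomp D (Icell D (comp_at s (Dom C f))) (cell_at t f)))\<rparr>"


section \<open>2-categories of objects with structure\<close>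

text \<open>
  The 2-category with object set \<open>Ob\<close> in which an arrow from \<open>X\<close> to \<open>Y\<close> is an element \<open>f\<close> of
  \<open>hom X Y\<close>, and a 2-cell from \<open>f\<close> to \<open>g\<close> is a 2-cell of \<open>C\<close> in \<open>cell X Y f g\<close>; 2-cells compose
  as in \<open>C\<close>.  The function \<open>und\<close> gives the underlying arrow in \<open>C\<close>.  Arrows and 2-cells are
  tagged with their domain and codomain, so that these are well defined.
\<close>

definition two_cat_over ::
  "('o, 'a, 'c, 'm) twocat_scheme \<Rightarrow> 'p set \<Rightarrow> ('p \<Rightarrow> 'p \<Rightarrow> 'q set)
    \<Rightarrow> ('p \<Rightarrow> 'p \<Rightarrow> 'q \<Rightarrow> 'q \<Rightarrow> 'c set) \<Rightarrow> ('q \<Rightarrow> 'a) \<Rightarrow> ('p \<Rightarrow> 'q) \<Rightarrow> ('q \<Rightarrow> 'q \<Rightarrow> 'q)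
    \<Rightarrow> ('p, 'p \<times> 'p \<times> 'q, ('p \<times> 'p \<times> 'q) \<times> ('p \<times> 'p \<times> 'q) \<times> 'c) twocat" where
  "two_cat_over C Ob hom cell und idn cmp =
    (let arr = {(X, Y, f). X \<in> Ob \<and> Y \<in> Ob \<and> f \<in> hom X Y};
         cmp' = (\<lambda>(X, _, f) (_, Z, g). (X, Z, cmp f g))
     in \<lparr>Obj = Ob, Arr = arr, Dom = (\<lambda>(X, Y, f). X), Cod = (\<lambda>(X, Y, f). Y),
         Ident = (\<lambda>X. (X, X, idn X)), Comp = cmp',
         Cell = {((X, Y, f), (X', Y', g), T). (X, Y, f) \<in> arr \<and> (X', Y', g) \<in> arr \<and>
                    X = X' \<and> Y = Y' \<and> T \<in> cell X Y f g},
         Src = (\<lambda>(f, g, T). f), Trg = (\<lambda>(f, g, T). g),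
         Icell = (\<lambda>(X, Y, f). ((X, Y, f), (X, Y, f), Icell C (und f))),
         Vcomp = (\<lambda>(f, _, S) (_, h, T). (f, h, Vcomp C S T)),
         Hcomp = (\<lambda>(f, g, S) (f', g', T). (cmp' f f', cmp' g g', Hcomp C S T))\<rparr>)"

definition forget ::
  "('p \<Rightarrow> 'r) \<Rightarrow> ('q \<Rightarrow> 's)
    \<Rightarrow> ('p, 'p \<times> 'p \<times> 'q, ('p \<times> 'p \<times> 'q) \<times> ('p \<times> 'p \<times> 'q) \<times> 'c,
        'r, 'r \<times> 'r \<times> 's, ('r \<times> 'r \<times> 's) \<times> ('r \<times> 'r \<times> 's) \<times> 'c) twofun" where
  "forget P Q =
    (let arr = (\<lambda>(X, Y, f). (P X, P Y, Q f))
     in \<lparr>on_obj = P, on_arr = arr, on_cell = (\<lambda>(f, g, T). (arr f, arr g, T))\<rparr>)"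


section \<open>Unit data and the forgetful 2-functors\<close>

text \<open>
  The data of an object, respectively arrow, of the three 2-categories of units: pairs
  \<open>(I, \<alpha>)\<close>, quadruples \<open>(I, \<lambda>, \<rho>, K)\<close> and septuples \<open>(I, \<alpha>, \<lambda>, \<rho>, L, R, K)\<close>, respectively
  \<open>(u, U)\<close>, \<open>(u, Ul, Ur)\<close> and \<open>(u, Ul, Ur, U)\<close>.
\<close>

type_synonym ('o, 'a) E_unit = "'o \<times> 'a"
type_synonym ('o, 'a, 'c) G_unit =
  "'o \<times> ('o, 'a, 'a, 'c) ptrans \<times> ('o, 'a, 'a, 'c) ptrans \<times> ('o \<times> 'o \<Rightarrow> 'c)"
type_synonym ('o, 'a, 'c) U_unit =
  "'o \<times> 'a \<times> ('o, 'a, 'a, 'c) ptrans \<times> ('o, 'a, 'a, 'c) ptrans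
     \<times> ('o \<Rightarrow> 'c) \<times> ('o \<Rightarrow> 'c) \<times> ('o \<times> 'o \<Rightarrow> 'c)"

type_synonym ('a, 'c) E_arrow = "'a \<times> 'c"
type_synonym ('o, 'a, 'c) G_arrow = "'a \<times> ('o \<Rightarrow> 'c) \<times> ('o \<Rightarrow> 'c)"
type_synonym ('o, 'a, 'c) U_arrow = "'a \<times> ('o \<Rightarrow> 'c) \<times> ('o \<Rightarrow> 'c) \<times> 'c"

definition Phi_obj ::"('o, 'a, 'c) U_unit \<Rightarrow> ('o, 'a) E_unit" where
  "Phi_obj = (\<lambda>(I, \<alpha>, l, r, L, R, K). (I, \<alpha>))"

definition Phi_hom :: "('o, 'a, 'c) U_arrow \<Rightarrow> ('a, 'c) E_arrow" where
  "Phi_hom = (\<lambda>(u, Ul, Ur, U). (u, U))"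

definition Psi_obj ::"('o, 'a, 'c) U_unit \<Rightarrow> ('o, 'a, 'c) G_unit" where
  "Psi_obj = (\<lambda>(I, \<alpha>, l, r, L, R, K). (I, l, r, K))"

definition Psi_hom ::"('o, 'a, 'c) U_arrow \<Rightarrow> ('o, 'a, 'c) G_arrow" where
  "Psi_hom = (\<lambda>(u, Ul, Ur, U). (u, Ul, Ur))"

definition Phi where "Phi = forget Phi_obj Phi_hom"

definition Psi where "Psi = forget Psi_obj Psi_hom"


section \<open>Semi-monoidal 2-categories and their units\<close>

record ('o, 'a, 'c) semi_monoidal = "('o, 'a, 'c) twocat" +
  Tensor :: "('o \<times> 'o, 'a \<times> 'a, 'c \<times> 'c, 'o, 'a, 'c) twofun"

locale semi_monoidal_2category =
  strict_2category C + tensor: strict_2functor "prod2 C C" C "Tensor C"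
  for C :: "('o, 'a, 'c) semi_monoidal" +
  assumes tensor_obj_assoc: "\<lbrakk>X \<in> Obj C; Y \<in> Obj C; Z \<in> Obj C\<rbrakk> \<Longrightarrow>
      on_obj (Tensor C) (on_obj (Tensor C) (X, Y), Z) = on_obj (Tensor C) (X, on_obj (Tensor C) (Y, Z))"
    and tensor_arr_assoc: "\<lbrakk>f \<in> Arr C; g \<in> Arr C; h \<in> Arr C\<rbrakk> \<Longrightarrow>
      on_arr (Tensor C) (on_arr (Tensor C) (f, g), h) = on_arr (Tensor C) (f, on_arr (Tensor C) (g, h))"
    and tensor_cell_assoc: "\<lbrakk>a \<in> Cell C; b \<in> Cell C; c \<in> Cell C\<rbrakk> \<Longrightarrow>
      on_cell (Tensor C) (on_cell (Tensor C) (a, b), c) = on_cell (Tensor C) (a, on_cell (Tensor C) (b, c))"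
begin

text \<open>Subscripts 0, 1, 2 distinguish the operations on objects, arrows and 2-cells.\<close>

abbreviation tensor0 (infixr "\<otimes>\<^sub>0" 85) where "X \<otimes>\<^sub>0 Y \<equiv> on_obj (Tensor C) (X, Y)"
abbreviation tensor1 (infixr "\<otimes>\<^sub>1" 85) where "f \<otimes>\<^sub>1 g \<equiv> on_arr (Tensor C) (f, g)"
abbreviation tensor2 (infixr "\<otimes>\<^sub>2" 85) where "a \<otimes>\<^sub>2 b \<equiv> on_cell (Tensor C) (a, b)"
abbreviation comp_arr (infixr "\<sharp>\<^sub>1" 80) where "f \<sharp>\<^sub>1 g \<equiv> Comp C f g"
abbreviation comp_cell (infixr "\<sharp>\<^sub>2" 80) where "a \<sharp>\<^sub>2 b \<equiv> Hcomp C a b"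
abbreviation comp_vert (infixr "\<bullet>" 75) where "a \<bullet> b \<equiv> Vcomp C a b"

text \<open>Objects and arrows regarded as identity arrows and identity 2-cells.\<close>

abbreviation o1 where "o1 X \<equiv> Ident C X"
abbreviation o2 where "o2 X \<equiv> Icell C (Ident C X)"
abbreviation a2 where "a2 f \<equiv> Icell C f"

text \<open>
  The 2-functors \<open>X \<mapsto> IX\<close>, \<open>X \<mapsto> XI\<close> and \<open>(X, Y) \<mapsto> XIY\<close>.  By strict associativity,
  \<open>X \<mapsto> IIX\<close> is \<open>lten (I \<otimes>\<^sub>0 I)\<close>, and similarly on the right.
\<close>

definition lten :: "'o \<Rightarrow> ('o, 'a, 'c, 'o, 'a, 'c) twofun" where
  "lten I = \<lparr>on_obj = (\<lambda>X. I \<otimes>\<^sub>0 X), on_arr = (\<lambda>f. o1 I \<otimes>\<^sub>1 f), on_cell = (\<lambda>a. o2 I \<otimes>\<^sub>2 a)\<rparr>"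

definition rten :: "'o \<Rightarrow> ('o, 'a, 'c, 'o, 'a, 'c) twofun" where
  "rten I = \<lparr>on_obj = (\<lambda>X. X \<otimes>\<^sub>0 I), on_arr = (\<lambda>f. f \<otimes>\<^sub>1 o1 I), on_cell = (\<lambda>a. a \<otimes>\<^sub>2 o2 I)\<rparr>"

definition mten ::
  "'o \<Rightarrow> ('o \<times> 'o, 'a \<times> 'a, 'c \<times> 'c, 'o, 'a, 'c) twofun" where
  "mten I = \<lparr>on_obj = (\<lambda>(X, Y). X \<otimes>\<^sub>0 I \<otimes>\<^sub>0 Y), on_arr = (\<lambda>(f, g). f \<otimes>\<^sub>1 o1 I \<otimes>\<^sub>1 g),
     on_cell = (\<lambda>(a, b). a \<otimes>\<^sub>2 o2 I \<otimes>\<^sub>2 b)\<rparr>"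

text \<open>
  The transformations with components \<open>uX\<close> and \<open>Xu\<close>.  They are strictly natural:
  \<open>If # uY = uf = uX # Jf\<close> for \<open>u : I \<rightarrow> J\<close> and \<open>f : X \<rightarrow> Y\<close>.
\<close>

definition larr :: "'a \<Rightarrow> ('o, 'a, 'a, 'c) ptrans" where
  "larr u = \<lparr>comp_at = (\<lambda>X. u \<otimes>\<^sub>1 o1 X), cell_at = (\<lambda>f. a2 (u \<otimes>\<^sub>1 f))\<rparr>"

definition rarr :: "'a \<Rightarrow> ('o, 'a, 'a, 'c) ptrans" where
  "rarr u = \<lparr>comp_at = (\<lambda>X. o1 X \<otimes>\<^sub>1 u), cell_at = (\<lambda>f. a2 (f \<otimes>\<^sub>1 u))\<rparr>"

text \<open>
  For a transformation \<open>t\<close>, the transformations with components \<open>It\<^sub>X\<close>, \<open>t\<^sub>XI\<close>, and, as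
  transformations in two variables, \<open>Xt\<^sub>Y\<close>, \<open>t\<^sub>XY\<close>.
\<close>

definition lwhisk ::
  "'o \<Rightarrow> ('o, 'a, 'a, 'c) ptrans \<Rightarrow> ('o, 'a, 'a, 'c) ptrans" where
  "lwhisk I t = \<lparr>comp_at = (\<lambda>X. o1 I \<otimes>\<^sub>1 comp_at t X), cell_at = (\<lambda>f. o2 I \<otimes>\<^sub>2 cell_at t f)\<rparr>"

definition rwhisk ::
  "('o, 'a, 'a, 'c) ptrans \<Rightarrow> 'o \<Rightarrow> ('o, 'a, 'a, 'c) ptrans" where
  "rwhisk t I = \<lparr>comp_at = (\<lambda>X. comp_at t X \<otimes>\<^sub>1 o1 I), cell_at = (\<lambda>f. cell_at t f \<otimes>\<^sub>2 o2 I)\<rparr>"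

definition lext ::
  "('o, 'a, 'a, 'c) ptrans \<Rightarrow> ('o \<times> 'o, 'a \<times> 'a, 'a, 'c) ptrans" where
  "lext t = \<lparr>comp_at = (\<lambda>(X, Y). o1 X \<otimes>\<^sub>1 comp_at t Y), cell_at = (\<lambda>(f, g). a2 f \<otimes>\<^sub>2 cell_at t g)\<rparr>"

definition rext ::
  "('o, 'a, 'a, 'c) ptrans \<Rightarrow> ('o \<times> 'o, 'a \<times> 'a, 'a, 'c) ptrans" where
  "rext t = \<lparr>comp_at = (\<lambda>(X, Y). comp_at t X \<otimes>\<^sub>1 o1 Y), cell_at = (\<lambda>(f, g). cell_at t f \<otimes>\<^sub>2 a2 g)\<rparr>"

definition cancellable :: "'o \<Rightarrow> bool" where
  "cancellable I \<longleftrightarrow> I \<in> Obj C \<and> (\<forall>X \<in> Obj C. \<forall>Y \<in> Obj C.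
     cat_equivalence (homcat C X Y) (homcat C (I \<otimes>\<^sub>0 X) (I \<otimes>\<^sub>0 Y)) (on_arr (lten I)) (on_cell (lten I)) \<and>
     cat_equivalence (homcat C X Y) (homcat C (X \<otimes>\<^sub>0 I) (Y \<otimes>\<^sub>0 I)) (on_arr (rten I)) (on_cell (rten I)))"


subsection \<open>Cancellable-idempotent units\<close>

definition E_obj :: "('o, 'a) E_unit set" where
  "E_obj = {(I, \<alpha>). cancellable I \<and> \<alpha> \<in> homset C (I \<otimes>\<^sub>0 I) I \<and> equi_arrow C \<alpha>}"

definition E_hom ::
  "('o, 'a) E_unit \<Rightarrow> ('o, 'a) E_unit \<Rightarrow> ('a, 'c) E_arrow set" where
  "E_hom = (\<lambda>(I, \<alpha>) (J, \<beta>). {(u, U). u \<in> homset C I J \<and> equi_arrow C u \<and>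
     U \<in> isocells C (\<alpha> \<sharp>\<^sub>1 u) ((u \<otimes>\<^sub>1 u) \<sharp>\<^sub>1 \<beta>)})"

definition T0 :: "('o, 'a) E_unit \<Rightarrow> ('o, 'a) E_unit \<Rightarrow> ('a, 'c) E_arrow \<Rightarrow> ('a, 'c) E_arrow \<Rightarrow> 'c \<Rightarrow> bool" where
  "T0 = (\<lambda>(I, \<alpha>) (J, \<beta>) (u, U) (v, V) T.
     U \<bullet> ((T \<otimes>\<^sub>2 T) \<sharp>\<^sub>2 a2 \<beta>) = (a2 \<alpha> \<sharp>\<^sub>2 T) \<bullet> V)"

definition E_cell :: "('o, 'a) E_unit \<Rightarrow> ('o, 'a) E_unit \<Rightarrow> ('a, 'c) E_arrow \<Rightarrow> ('a, 'c) E_arrow \<Rightarrow> 'c set" where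
  "E_cell X Y f g = {T \<in> isocells C (fst f) (fst g). T0 X Y f g T}"

definition E_id :: "('o, 'a) E_unit \<Rightarrow> ('a, 'c) E_arrow" where
  "E_id = (\<lambda>(I, \<alpha>). (o1 I, a2 \<alpha>))"

definition E_comp ::
  "('a, 'c) E_arrow \<Rightarrow> ('a, 'c) E_arrow \<Rightarrow> ('a, 'c) E_arrow" where
  "E_comp = (\<lambda>(u, U) (v, V). (u \<sharp>\<^sub>1 v, (U \<sharp>\<^sub>2 a2 v) \<bullet> (a2 (u \<otimes>\<^sub>1 u) \<sharp>\<^sub>2 V)))"

definition E_cat where
  "E_cat = two_cat_over C E_obj E_hom E_cell fst E_id E_comp"


subsection \<open>GPS units\<close>

text \<open>In a unit \<open>l\<close> and \<open>r\<close> stand for the transformations written \<open>\<lambda>\<close> and \<open>\<rho>\<close> in the literature.\<close>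

definition left_constraint :: "'o \<Rightarrow> ('o, 'a, 'a, 'c) ptrans \<Rightarrow> bool" where
  "left_constraint I l \<longleftrightarrow> pseudonatural C C (lten I) id2 l \<and> (\<forall>X \<in> Obj C. equi_arrow C (comp_at l X))"

definition right_constraint :: "'o \<Rightarrow> ('o, 'a, 'a, 'c) ptrans \<Rightarrow> bool" where
  "right_constraint I r \<longleftrightarrow> pseudonatural C C (rten I) id2 r \<and> (\<forall>X \<in> Obj C. equi_arrow C (comp_at r X))"

text \<open>
  Naturality of \<open>K\<close> in \<open>X\<close> and \<open>Y\<close>: it is a modification between transformations of 2-functors
  on \<open>C \<times> C\<close>, from \<open>X\<lambda>\<^sub>Y\<close> to \<open>\<rho>\<^sub>XY\<close>.
\<close>

definition Kelly_cells ::
  "'o \<Rightarrow> ('o, 'a, 'a, 'c) ptrans \<Rightarrow> ('o, 'a, 'a, 'c) ptrans \<Rightarrow> ('o \<times> 'o \<Rightarrow> 'c) \<Rightarrow> bool" where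
  "Kelly_cells I l r K \<longleftrightarrow>
     inv_modification (prod2 C C) C (mten I) (Tensor C) (lext l) (rext r) K"

definition Klam :: "'o \<Rightarrow> ('o, 'a, 'a, 'c) ptrans \<Rightarrow> ('o \<times> 'o \<Rightarrow> 'c) \<Rightarrow> 'o \<Rightarrow> 'o \<Rightarrow> 'c" where
  "Klam I l K X Y = (THE k. k \<in> cells C (comp_at l (X \<otimes>\<^sub>0 Y)) (comp_at l X \<otimes>\<^sub>1 o1 Y) \<and>
     (o2 I \<otimes>\<^sub>2 k) \<bullet> (K (I, X) \<otimes>\<^sub>2 o2 Y) = K (I, X \<otimes>\<^sub>0 Y))"

definition Krho :: "'o \<Rightarrow> ('o, 'a, 'a, 'c) ptrans \<Rightarrow> ('o \<times> 'o \<Rightarrow> 'c) \<Rightarrow> 'o \<Rightarrow> 'o \<Rightarrow> 'c" where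
  "Krho I r K X Y = (THE k. k \<in> cells C (o1 X \<otimes>\<^sub>1 comp_at r Y) (comp_at r (X \<otimes>\<^sub>0 Y)) \<and>
     (o2 X \<otimes>\<^sub>2 K (Y, I)) \<bullet> (k \<otimes>\<^sub>2 o2 I) = K (X \<otimes>\<^sub>0 Y, I))"

definition coherent ::
  "'o \<Rightarrow> ('o, 'a, 'a, 'c) ptrans \<Rightarrow> ('o, 'a, 'a, 'c) ptrans \<Rightarrow> ('o \<times> 'o \<Rightarrow> 'c) \<Rightarrow> bool" where
  "coherent I l r K \<longleftrightarrow> (\<forall>X \<in> Obj C. \<forall>Y \<in> Obj C. \<forall>Z \<in> Obj C.
     (o2 X \<otimes>\<^sub>2 Klam I l K Y Z) \<bullet> (K (X, Y) \<otimes>\<^sub>2 o2 Z) = K (X, Y \<otimes>\<^sub>0 Z) \<and>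
     (o2 X \<otimes>\<^sub>2 K (Y, Z)) \<bullet> (Krho I r K X Y \<otimes>\<^sub>2 o2 Z) = K (X \<otimes>\<^sub>0 Y, Z))"

definition G_obj ::"('o, 'a, 'c) G_unit set" where
  "G_obj = {(I, l, r, K). I \<in> Obj C \<and> left_constraint I l \<and> right_constraint I r \<and>
     Kelly_cells I l r K \<and> coherent I l r K}"

definition G_hom ::
  "('o, 'a, 'c) G_unit
    \<Rightarrow> ('o, 'a, 'c) G_unit
    \<Rightarrow> ('o, 'a, 'c) G_arrow set" where
  "G_hom = (\<lambda>(I, l, r, K) (J, l', r', H). {(u, Ul, Ur). u \<in> homset C I J \<and>
     inv_modification C C (lten I) id2 l (pcomp C C (larr u) l') Ul \<and>
     inv_modification C C (rten I) id2 r (pcomp C C (rarr u) r') Ur \<and>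
     (\<forall>X \<in> Obj C. \<forall>Y \<in> Obj C.
        K (X, Y) \<bullet> (Ur X \<otimes>\<^sub>2 o2 Y)
        = (o2 X \<otimes>\<^sub>2 Ul Y) \<bullet> (a2 (o1 X \<otimes>\<^sub>1 u \<otimes>\<^sub>1 o1 Y) \<sharp>\<^sub>2 H (X, Y)))})"

definition T12 ::
  "('o, 'a, 'c) G_unit
    \<Rightarrow> ('o, 'a, 'c) G_unit
    \<Rightarrow> ('o, 'a, 'c) G_arrow \<Rightarrow> ('o, 'a, 'c) G_arrow \<Rightarrow> 'c \<Rightarrow> bool" where
  "T12 = (\<lambda>(I, l, r, K) (J, l', r', H) (u, Ul, Ur) (v, Vl, Vr) T.
     (\<forall>X \<in> Obj C. Ul X \<bullet> ((T \<otimes>\<^sub>2 o2 X) \<sharp>\<^sub>2 a2 (comp_at l' X)) = Vl X) \<and>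
     (\<forall>X \<in> Obj C. Ur X \<bullet> ((o2 X \<otimes>\<^sub>2 T) \<sharp>\<^sub>2 a2 (comp_at r' X)) = Vr X))"

definition G_cell ::
  "('o, 'a, 'c) G_unit
    \<Rightarrow> ('o, 'a, 'c) G_unit
    \<Rightarrow> ('o, 'a, 'c) G_arrow \<Rightarrow> ('o, 'a, 'c) G_arrow \<Rightarrow> 'c set" where
  "G_cell X Y f g = {T \<in> cells C (fst f) (fst g). T12 X Y f g T}"

definition G_id ::"('o, 'a, 'c) G_unit \<Rightarrow> ('o, 'a, 'c) G_arrow" where
  "G_id = (\<lambda>(I, l, r, K). (o1 I, \<lambda>X\<in>Obj C. a2 (comp_at l X), \<lambda>X\<in>Obj C. a2 (comp_at r X)))"

definition G_comp ::
  "('o, 'a, 'c) G_arrow \<Rightarrow> ('o, 'a, 'c) G_arrow \<Rightarrow> ('o, 'a, 'c) G_arrow" where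
  "G_comp = (\<lambda>(u, Ul, Ur) (v, Vl, Vr). (u \<sharp>\<^sub>1 v,
     \<lambda>X\<in>Obj C. Ul X \<bullet> (a2 (u \<otimes>\<^sub>1 o1 X) \<sharp>\<^sub>2 Vl X),
     \<lambda>X\<in>Obj C. Ur X \<bullet> (a2 (o1 X \<otimes>\<^sub>1 u) \<sharp>\<^sub>2 Vr X)))"

definition G_cat where
  "G_cat = two_cat_over C G_obj G_hom G_cell fst G_id G_comp"


subsection \<open>Units with both kinds of structure\<close>

definition U_obj ::"('o, 'a, 'c) U_unit set" where
  "U_obj = {(I, \<alpha>, l, r, L, R, K). I \<in> Obj C \<and> \<alpha> \<in> homset C (I \<otimes>\<^sub>0 I) I \<and> equi_arrow C \<alpha> \<and>
     left_constraint I l \<and> right_constraint I r \<and>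
     inv_modification C C (lten (I \<otimes>\<^sub>0 I)) (lten I) (lwhisk I l) (larr \<alpha>) L \<and>
     inv_modification C C (rten (I \<otimes>\<^sub>0 I)) (rten I) (rarr \<alpha>) (rwhisk r I) R \<and>
     Kelly_cells I l r K \<and>
     (\<forall>X \<in> Obj C. \<forall>Y \<in> Obj C.
        ((R X \<otimes>\<^sub>2 o2 Y) \<sharp>\<^sub>2 a2 (o1 X \<otimes>\<^sub>1 comp_at l Y)) \<bullet>
        ((o2 X \<otimes>\<^sub>2 L Y) \<sharp>\<^sub>2 a2 (comp_at r X \<otimes>\<^sub>1 o1 Y))
        = a2 (o1 X \<otimes>\<^sub>1 \<alpha> \<otimes>\<^sub>1 o1 Y) \<sharp>\<^sub>2 K (X, Y))}"

text \<open>
  Unlike in \<open>E_hom\<close>, the arrow \<open>u\<close> is not required to be an equi-arrow.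
\<close>

definition U_hom ::
  "('o, 'a, 'c) U_unit
    \<Rightarrow> ('o, 'a, 'c) U_unit
    \<Rightarrow> ('o, 'a, 'c) U_arrow set" where
  "U_hom = (\<lambda>(I, \<alpha>, l, r, L, R, K) (J, \<beta>, l', r', L', R', H). {(u, Ul, Ur, U).
     (u, Ul, Ur) \<in> G_hom (I, l, r, K) (J, l', r', H) \<and>
     U \<in> isocells C (\<alpha> \<sharp>\<^sub>1 u) ((u \<otimes>\<^sub>1 u) \<sharp>\<^sub>1 \<beta>) \<and>
     (\<forall>X \<in> Obj C.
        (L X \<sharp>\<^sub>2 a2 (u \<otimes>\<^sub>1 o1 X)) \<bullet> (U \<otimes>\<^sub>2 o2 X)
        = (a2 u \<otimes>\<^sub>2 Ul X) \<bullet> (a2 (u \<otimes>\<^sub>1 u \<otimes>\<^sub>1 o1 X) \<sharp>\<^sub>2 L' X)) \<and>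
     (\<forall>X \<in> Obj C.
        (R X \<sharp>\<^sub>2 a2 (o1 X \<otimes>\<^sub>1 u)) \<bullet> (Ur X \<otimes>\<^sub>2 a2 u)
        = (o2 X \<otimes>\<^sub>2 U) \<bullet> (a2 (o1 X \<otimes>\<^sub>1 u \<otimes>\<^sub>1 u) \<sharp>\<^sub>2 R' X))})"

definition U_cell where
  "U_cell X Y f g = {T \<in> cells C (fst f) (fst g).
     T0 (Phi_obj X) (Phi_obj Y) (Phi_hom f) (Phi_hom g) T \<and>
     T12 (Psi_obj X) (Psi_obj Y) (Psi_hom f) (Psi_hom g) T}"

definition U_id ::"('o, 'a, 'c) U_unit \<Rightarrow> ('o, 'a, 'c) U_arrow" where
  "U_id = (\<lambda>(I, \<alpha>, l, r, L, R, K).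
     (o1 I, \<lambda>X\<in>Obj C. a2 (comp_at l X), \<lambda>X\<in>Obj C. a2 (comp_at r X), a2 \<alpha>))"

definition U_comp ::
  "('o, 'a, 'c) U_arrow \<Rightarrow> ('o, 'a, 'c) U_arrow \<Rightarrow> ('o, 'a, 'c) U_arrow" where
  "U_comp = (\<lambda>(u, Ul, Ur, U) (v, Vl, Vr, V). (u \<sharp>\<^sub>1 v,
     \<lambda>X\<in>Obj C. Ul X \<bullet> (a2 (u \<otimes>\<^sub>1 o1 X) \<sharp>\<^sub>2 Vl X),
     \<lambda>X\<in>Obj C. Ur X \<bullet> (a2 (o1 X \<otimes>\<^sub>1 u) \<sharp>\<^sub>2 Vr X),
     (U \<sharp>\<^sub>2 a2 v) \<bullet> (a2 (u \<otimes>\<^sub>1 u) \<sharp>\<^sub>2 V)))"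

definition U_cat where
  "U_cat = two_cat_over C U_obj U_hom U_cell fst U_id U_comp"

end

abbreviation "\<E> \<equiv> semi_monoidal_2category.E_cat"
abbreviation "\<G> \<equiv> semi_monoidal_2category.G_cat"
abbreviation "\<U> \<equiv> semi_monoidal_2category.U_cat"

end

theory Submission
  imports Defs
begin

text \<open>
  Cancellability of \<open>I\<close> and the fact that whiskering with an equi-arrow is fully faithful allow one to
  solve equations between pasted 2-cells uniquely.  From \<open>\<alpha>\<close> one obtains \<open>\<lambda>\<close> with \<open>L\<close> and \<open>\<rho>\<close> with \<open>R\<close>,
  objectwise by essential surjectivity, and then \<open>K\<close> from its equation with \<open>L\<close> and \<open>R\<close>.  The cells
  \<open>\<lambda>\<^sub>f\<close>, \<open>U\<^sup>l\<^sub>X\<close> and \<open>K\<^sup>\<lambda>\<^sub>X\<^sub>Y\<close> are all instances of one kind of square which lies over a 2-cell built from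
  \<open>\<alpha>\<close> and is determined by it; their naturality and compatibilities follow from uniqueness, since
  squares can be composed.  Finally a single prism shows that, in the presence of the squares on the left,
  compatibility with \<open>K\<close> is equivalent to the equation for the squares on the right.  This gives
  naturality and coherence of \<open>K\<close> as well as (PK), and conversely it recovers \<open>U\<close> from (PK).
\<close>

text \<open>The three 2-categories impose different conditions: \<open>\<E>\<close> demands
  equi-arrows and invertible 2-cells, \<open>\<G>\<close> and \<open>\<U>\<close> do not. Bijections
  between hom-sets are possible only because these conditions are automatic: the cell at
  \<open>J\<close> on the left makes uJ followed by the constraint of \<open>J\<close> isomorphic to
  an equi-arrow, and (T1) at the single object \<open>J\<close> makes \<open>T\<close> invertible.
  Recovering \<open>U\<close> from (PK) has to produce one 2-cell from two families, the candidates
  for UX and for XU. (PK) says that the second tensored with Y agrees with X tensored with the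
  first; cancelling \<open>J\<close> on one side and then on the other yields a common
  \<open>U\<close>. That \<open>\<E>\<close> and \<open>\<G>\<close> are 2-categories is transported
  from \<open>\<U>\<close> along these bijections instead of being checked separately. The
  2-equivalences are then formal: lifts of arrows and 2-cells are unique, so any choice of preimages
  of objects extends to a strict 2-functor.\<close>

lemma homset_iff [simp]: "f \<in> homset C X Y \<longleftrightarrow> f \<in> Arr C \<and> Dom C f = X \<and> Cod C f = Y"
  by (simp add: homset_def)

lemma vert_simps [simp]:
  "Obj (vert C) = Arr C" "Arr (vert C) = Cell C" "Dom (vert C) = Src C" "Cod (vert C) = Trg C"
  "Ident (vert C) = Icell C" "Comp (vert C) = Vcomp C"
  by (simp_all add: vert_def)

lemma horiz_simps [simp]:
  "Obj (horiz C) = Obj C" "Arr (horiz C) = Cell C" "Dom (horiz C) = (\<lambda>a. Dom C (Src C a))"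
  "Cod (horiz C) = (\<lambda>a. Cod C (Src C a))" "Ident (horiz C) = (\<lambda>X. Icell C (Ident C X))"
  "Comp (horiz C) = Hcomp C"
  by (simp_all add: horiz_def)

lemma prod2_simps [simp]:
  "Obj (prod2 C D) = Obj C \<times> Obj D" "Arr (prod2 C D) = Arr C \<times> Arr D"
  "Dom (prod2 C D) = map_prod (Dom C) (Dom D)" "Cod (prod2 C D) = map_prod (Cod C) (Cod D)"
  "Ident (prod2 C D) = map_prod (Ident C) (Ident D)"
  "Comp (prod2 C D) (f, f') (g, g') = (Comp C f g, Comp D f' g')"
  "Cell (prod2 C D) = Cell C \<times> Cell D"
  "Src (prod2 C D) = map_prod (Src C) (Src D)" "Trg (prod2 C D) = map_prod (Trg C) (Trg D)"
  "Icell (prod2 C D) = map_prod (Icell C) (Icell D)"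
  "Vcomp (prod2 C D) (a, a') (b, b') = (Vcomp C a b, Vcomp D a' b')"
  "Hcomp (prod2 C D) (a, a') (b, b') = (Hcomp C a b, Hcomp D a' b')"
  by (simp_all add: prod2_def)

lemma homcat_simps [simp]:
  "Obj (homcat C X Y) = homset C X Y"
  "Arr (homcat C X Y) = {a \<in> Cell C. Src C a \<in> homset C X Y}"
  "Dom (homcat C X Y) = Src C" "Cod (homcat C X Y) = Trg C"
  "Ident (homcat C X Y) = Icell C" "Comp (homcat C X Y) = Vcomp C"
  by (simp_all add: homcat_def)

lemma cells_iff [simp]: "a \<in> cells C f g \<longleftrightarrow> a \<in> Cell C \<and> Src C a = f \<and> Trg C a = g"
  by (simp add: cells_def)

lemma isocells_iff [simp]:
  "a \<in> isocells C f g \<longleftrightarrow> a \<in> Cell C \<and> Src C a = f \<and> Trg C a = g \<and> is_iso (vert C) a"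
  by (auto simp: isocells_def)

lemma (in strict_2category) homcat_category: "category (homcat C X Y)"
  using vert.category_axioms by (auto simp: category_def Dom_parallel Cod_parallel)

section \<open>Normal forms for composites and tensor products of arrows and 2-cells\<close>

context semi_monoidal_2category
begin

lemma obj_simps [simp]:
  "f \<in> Arr C \<Longrightarrow> Dom C f \<in> Obj C" "f \<in> Arr C \<Longrightarrow> Cod C f \<in> Obj C"
  "\<lbrakk>X \<in> Obj C; Y \<in> Obj C\<rbrakk> \<Longrightarrow> X \<otimes>\<^sub>0 Y \<in> Obj C"
  using tensor.arr.map_Obj[of "(X, Y)"] by (simp_all add: Dom_Obj Cod_Obj)

lemma arr_simps [simp]:
  "X \<in> Obj C \<Longrightarrow> o1 X \<in> Arr C" "X \<in> Obj C \<Longrightarrow> Dom C (o1 X) = X" "X \<in> Obj C \<Longrightarrow> Cod C (o1 X) = X"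
  "\<lbrakk>f \<in> Arr C; g \<in> Arr C; Cod C f = Dom C g\<rbrakk> \<Longrightarrow> f \<sharp>\<^sub>1 g \<in> Arr C"
  "\<lbrakk>f \<in> Arr C; g \<in> Arr C; Cod C f = Dom C g\<rbrakk> \<Longrightarrow> Dom C (f \<sharp>\<^sub>1 g) = Dom C f"
  "\<lbrakk>f \<in> Arr C; g \<in> Arr C; Cod C f = Dom C g\<rbrakk> \<Longrightarrow> Cod C (f \<sharp>\<^sub>1 g) = Cod C g"
  "\<lbrakk>f \<in> Arr C; X = Dom C f\<rbrakk> \<Longrightarrow> o1 X \<sharp>\<^sub>1 f = f"
  "\<lbrakk>f \<in> Arr C; X = Cod C f\<rbrakk> \<Longrightarrow> f \<sharp>\<^sub>1 o1 X = f"
  by (simp_all add: Ident_Arr Dom_Ident Cod_Ident Comp_Arr Dom_Comp Cod_Comp Ident_left Ident_right)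

lemma tensor_arr_simps [simp]:
  assumes "f \<in> Arr C" "g \<in> Arr C"
  shows "f \<otimes>\<^sub>1 g \<in> Arr C" "Dom C (f \<otimes>\<^sub>1 g) = Dom C f \<otimes>\<^sub>0 Dom C g"
    "Cod C (f \<otimes>\<^sub>1 g) = Cod C f \<otimes>\<^sub>0 Cod C g"
  using assms tensor.arr.map_Arr[of "(f, g)"] by simp_all

lemma Src_Trg_simps [simp]:
  assumes "a \<in> Cell C"
  shows "Src C a \<in> Arr C" "Trg C a \<in> Arr C" "Dom C (Trg C a) = Dom C (Src C a)"
    "Cod C (Trg C a) = Cod C (Src C a)"
  using assms vert.Dom_Obj[simplified] vert.Cod_Obj[simplified]
  by (simp_all add: Dom_parallel Cod_parallel)

lemma arr_assoc [simp]:
  "\<lbrakk>f \<in> Arr C; g \<in> Arr C; h \<in> Arr C; Cod C f = Dom C g; Cod C g = Dom C h\<rbrakk>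
    \<Longrightarrow> (f \<sharp>\<^sub>1 g) \<sharp>\<^sub>1 h = f \<sharp>\<^sub>1 g \<sharp>\<^sub>1 h"
  by (rule Comp_assoc)

text \<open>As simplification rules the associativity laws fix right-nested normal forms. The price
  is that a left factor such as \<open>f \<otimes>\<^sub>1 g\<close> gets broken up, so some rules
  for moving tensor products are needed again for regrouped factors.\<close>

lemma tensor_assoc [simp]:
  "\<lbrakk>X \<in> Obj C; Y \<in> Obj C; Z \<in> Obj C\<rbrakk> \<Longrightarrow> (X \<otimes>\<^sub>0 Y) \<otimes>\<^sub>0 Z = X \<otimes>\<^sub>0 Y \<otimes>\<^sub>0 Z"
  "\<lbrakk>f \<in> Arr C; g \<in> Arr C; h \<in> Arr C\<rbrakk> \<Longrightarrow> (f \<otimes>\<^sub>1 g) \<otimes>\<^sub>1 h = f \<otimes>\<^sub>1 g \<otimes>\<^sub>1 h"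
  "\<lbrakk>a \<in> Cell C; b \<in> Cell C; c \<in> Cell C\<rbrakk> \<Longrightarrow> (a \<otimes>\<^sub>2 b) \<otimes>\<^sub>2 c = a \<otimes>\<^sub>2 b \<otimes>\<^sub>2 c"
  by (simp_all add: tensor_obj_assoc tensor_arr_assoc tensor_cell_assoc)

lemma cell_simps [simp]:
  "f \<in> Arr C \<Longrightarrow> a2 f \<in> Cell C" "f \<in> Arr C \<Longrightarrow> Src C (a2 f) = f" "f \<in> Arr C \<Longrightarrow> Trg C (a2 f) = f"
  "\<lbrakk>a \<in> Cell C; f = Src C a\<rbrakk> \<Longrightarrow> a2 f \<bullet> a = a"
  "\<lbrakk>a \<in> Cell C; f = Trg C a\<rbrakk> \<Longrightarrow> a \<bullet> a2 f = a"
  "\<lbrakk>a \<in> Cell C; X = Dom C (Src C a)\<rbrakk> \<Longrightarrow> o2 X \<sharp>\<^sub>2 a = a"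
  "\<lbrakk>a \<in> Cell C; X = Cod C (Src C a)\<rbrakk> \<Longrightarrow> a \<sharp>\<^sub>2 o2 X = a"
  by (simp_all add: vert.Ident_Arr[simplified] vert.Dom_Ident[simplified] vert.Cod_Ident[simplified]
      vert.Ident_left[simplified] vert.Ident_right[simplified]
      horiz.Ident_left[simplified] horiz.Ident_right[simplified])

lemma Vcomp_simps [simp]:
  assumes "a \<in> Cell C" "b \<in> Cell C" "Trg C a = Src C b"
  shows "a \<bullet> b \<in> Cell C" "Src C (a \<bullet> b) = Src C a" "Trg C (a \<bullet> b) = Trg C b"
  using assms by (simp_all add: vert.Comp_Arr[simplified] vert.Dom_Comp[simplified] vert.Cod_Comp[simplified])

lemma Hcomp_simps [simp]:
  assumes "a \<in> Cell C" "b \<in> Cell C" "Cod C (Src C a) = Dom C (Src C b)"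
  shows "a \<sharp>\<^sub>2 b \<in> Cell C" "Src C (a \<sharp>\<^sub>2 b) = Src C a \<sharp>\<^sub>1 Src C b"
    "Trg C (a \<sharp>\<^sub>2 b) = Trg C a \<sharp>\<^sub>1 Trg C b"
  using assms by (simp_all add: horiz.Comp_Arr[simplified] Src_Hcomp Trg_Hcomp)

lemma tensor_simps [simp]:
  assumes "a \<in> Cell C" "b \<in> Cell C"
  shows "a \<otimes>\<^sub>2 b \<in> Cell C" "Src C (a \<otimes>\<^sub>2 b) = Src C a \<otimes>\<^sub>1 Src C b"
    "Trg C (a \<otimes>\<^sub>2 b) = Trg C a \<otimes>\<^sub>1 Trg C b"
  using assms tensor.vert.map_Arr[of "(a, b)"] by simp_all

lemma a2_simps [simp]:
  "\<lbrakk>f \<in> Arr C; g \<in> Arr C; Cod C f = Dom C g\<rbrakk> \<Longrightarrow> a2 f \<sharp>\<^sub>2 a2 g = a2 (f \<sharp>\<^sub>1 g)"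
  "\<lbrakk>f \<in> Arr C; g \<in> Arr C\<rbrakk> \<Longrightarrow> a2 f \<otimes>\<^sub>2 a2 g = a2 (f \<otimes>\<^sub>1 g)"
  using tensor.vert.map_Ident[of "(f, g)"] by (simp_all add: Icell_Comp)

lemma tensor_Ident [simp]:
  "\<lbrakk>X \<in> Obj C; Y \<in> Obj C\<rbrakk> \<Longrightarrow> o1 X \<otimes>\<^sub>1 o1 Y = o1 (X \<otimes>\<^sub>0 Y)"
  using tensor.arr.map_Ident[of "(X, Y)"] by simp

lemma cell_assoc [simp]:
  "\<lbrakk>a \<in> Cell C; b \<in> Cell C; c \<in> Cell C; Trg C a = Src C b; Trg C b = Src C c\<rbrakk>
    \<Longrightarrow> (a \<bullet> b) \<bullet> c = a \<bullet> b \<bullet> c"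
  "\<lbrakk>a \<in> Cell C; b \<in> Cell C; c \<in> Cell C; Cod C (Src C a) = Dom C (Src C b); Cod C (Src C b) = Dom C (Src C c)\<rbrakk>
    \<Longrightarrow> (a \<sharp>\<^sub>2 b) \<sharp>\<^sub>2 c = a \<sharp>\<^sub>2 b \<sharp>\<^sub>2 c"
  using vert.Comp_assoc[of a b c] horiz.Comp_assoc[of a b c] by simp_all

text \<open>In a right-nested composite two adjacent identity 2-cells are no longer a subterm, so
  \<open>a2_simps\<close> does not apply; this is the same rule with the rest of the composite
  attached.\<close>

lemma a2_whisker_assoc [simp]:
  "\<lbrakk>f \<in> Arr C; g \<in> Arr C; a \<in> Cell C; Cod C f = Dom C g; Cod C g = Dom C (Src C a)\<rbrakk>
    \<Longrightarrow> a2 f \<sharp>\<^sub>2 a2 g \<sharp>\<^sub>2 a = a2 (f \<sharp>\<^sub>1 g) \<sharp>\<^sub>2 a"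
  using cell_assoc(2)[of "a2 f" "a2 g" a] by simp

lemma tensor_Comp:
  "\<lbrakk>f \<in> Arr C; g \<in> Arr C; h \<in> Arr C; k \<in> Arr C; Cod C f = Dom C g; Cod C h = Dom C k\<rbrakk>
    \<Longrightarrow> (f \<otimes>\<^sub>1 h) \<sharp>\<^sub>1 (g \<otimes>\<^sub>1 k) = (f \<sharp>\<^sub>1 g) \<otimes>\<^sub>1 (h \<sharp>\<^sub>1 k)"
  using tensor.arr.map_Comp[of "(f, h)" "(g, k)"] by simp

lemma tensor_Hcomp:
  "\<lbrakk>a \<in> Cell C; b \<in> Cell C; c \<in> Cell C; d \<in> Cell C;
    Cod C (Src C a) = Dom C (Src C b); Cod C (Src C c) = Dom C (Src C d)\<rbrakk>
    \<Longrightarrow> (a \<otimes>\<^sub>2 c) \<sharp>\<^sub>2 (b \<otimes>\<^sub>2 d) = (a \<sharp>\<^sub>2 b) \<otimes>\<^sub>2 (c \<sharp>\<^sub>2 d)"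
  using tensor.horiz.map_Comp[of "(a, c)" "(b, d)"] by simp

lemma tensor_Vcomp:
  "\<lbrakk>a \<in> Cell C; b \<in> Cell C; c \<in> Cell C; d \<in> Cell C; Trg C a = Src C b; Trg C c = Src C d\<rbrakk>
    \<Longrightarrow> (a \<otimes>\<^sub>2 c) \<bullet> (b \<otimes>\<^sub>2 d) = (a \<bullet> b) \<otimes>\<^sub>2 (c \<bullet> d)"
  using tensor.vert.map_Comp[of "(a, c)" "(b, d)"] by simp

lemma whisker_Vcomp [simp]:
  "\<lbrakk>f \<in> Arr C; a \<in> Cell C; b \<in> Cell C; Trg C a = Src C b; Cod C f = Dom C (Src C a)\<rbrakk>
    \<Longrightarrow> a2 f \<sharp>\<^sub>2 (a \<bullet> b) = (a2 f \<sharp>\<^sub>2 a) \<bullet> (a2 f \<sharp>\<^sub>2 b)"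
  "\<lbrakk>f \<in> Arr C; a \<in> Cell C; b \<in> Cell C; Trg C a = Src C b; Dom C f = Cod C (Src C a)\<rbrakk>
    \<Longrightarrow> (a \<bullet> b) \<sharp>\<^sub>2 a2 f = (a \<sharp>\<^sub>2 a2 f) \<bullet> (b \<sharp>\<^sub>2 a2 f)"
  "\<lbrakk>f \<in> Arr C; a \<in> Cell C; b \<in> Cell C; Trg C a = Src C b\<rbrakk>
    \<Longrightarrow> a2 f \<otimes>\<^sub>2 (a \<bullet> b) = (a2 f \<otimes>\<^sub>2 a) \<bullet> (a2 f \<otimes>\<^sub>2 b)"
  "\<lbrakk>f \<in> Arr C; a \<in> Cell C; b \<in> Cell C; Trg C a = Src C b\<rbrakk>
    \<Longrightarrow> (a \<bullet> b) \<otimes>\<^sub>2 a2 f = (a \<otimes>\<^sub>2 a2 f) \<bullet> (b \<otimes>\<^sub>2 a2 f)"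
  using interchange[of "a2 f" "a2 f" a b] interchange[of a b "a2 f" "a2 f"]
    tensor_Vcomp[of "a2 f" "a2 f" a b] tensor_Vcomp[of a b "a2 f" "a2 f"] by simp_all

text \<open>Sliding two cells past each other in either order computes their horizontal composite.
  The boundaries are variables with defining equations, so that the rule also unifies when they are
  written in some other form.\<close>

lemma exchange:
  assumes "a \<in> Cell C" "b \<in> Cell C" "Cod C (Src C a) = Dom C (Src C b)"
    "f = Src C a" "f' = Trg C a" "g = Src C b" "g' = Trg C b"
  shows "(a \<sharp>\<^sub>2 a2 g) \<bullet> (a2 f' \<sharp>\<^sub>2 b) = a \<sharp>\<^sub>2 b"
    and "(a2 f \<sharp>\<^sub>2 b) \<bullet> (a \<sharp>\<^sub>2 a2 g') = a \<sharp>\<^sub>2 b"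
  using assms(1-3) by (simp_all add: assms(4-) interchange[symmetric])

lemma tensor_exchange:
  assumes "a \<in> Cell C" "b \<in> Cell C"
    "f = Src C a" "f' = Trg C a" "g = Src C b" "g' = Trg C b"
  shows "(a \<otimes>\<^sub>2 a2 g) \<bullet> (a2 f' \<otimes>\<^sub>2 b) = a \<otimes>\<^sub>2 b"
    and "(a2 f \<otimes>\<^sub>2 b) \<bullet> (a \<otimes>\<^sub>2 a2 g') = a \<otimes>\<^sub>2 b"
  using assms(1,2) by (simp_all add: assms(3-) tensor_Vcomp)

subsection \<open>Invertible 2-cells\<close>

abbreviation iso where "iso \<equiv> is_iso (vert C)"

text \<open>An explicit choice makes inverses available to the simplifier; by
  \<open>inv2_unique\<close> an invertible 2-cell leaves nothing to choose.\<close>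

definition inv2 :: "'c \<Rightarrow> 'c" where
  "inv2 a = (SOME b. b \<in> cells C (Trg C a) (Src C a) \<and> a \<bullet> b = a2 (Src C a) \<and> b \<bullet> a = a2 (Trg C a))"

lemma isoI:
  "\<lbrakk>a \<in> Cell C; b \<in> Cell C; Src C b = Trg C a; Trg C b = Src C a; a \<bullet> b = a2 (Src C a);
    b \<bullet> a = a2 (Trg C a)\<rbrakk> \<Longrightarrow> iso a"
  by (auto simp: is_iso_def)

lemma inv2:
  assumes "iso a"
  shows "inv2 a \<in> cells C (Trg C a) (Src C a) \<and> a \<bullet> inv2 a = a2 (Src C a) \<and> inv2 a \<bullet> a = a2 (Trg C a)"
  unfolding inv2_def by (rule someI_ex) (use assms in \<open>auto simp: is_iso_def\<close>)

lemma inv2_simps [simp]: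
  assumes "iso a"
  shows "inv2 a \<in> Cell C" "Src C (inv2 a) = Trg C a" "Trg C (inv2 a) = Src C a"
    "a \<bullet> inv2 a = a2 (Src C a)" "inv2 a \<bullet> a = a2 (Trg C a)" "iso (inv2 a)"
  using inv2[OF assms] assms by (auto simp: is_iso_def)

lemma iso_Cell: "iso a \<Longrightarrow> a \<in> Cell C"
  by (simp add: is_iso_def)

lemma inv2_cancel [simp]:
  assumes "iso a" "b \<in> Cell C"
  shows "Src C b = Src C a \<Longrightarrow> a \<bullet> inv2 a \<bullet> b = b" "Src C b = Trg C a \<Longrightarrow> inv2 a \<bullet> a \<bullet> b = b"
  using assms cell_assoc(1)[of a "inv2 a" b] cell_assoc(1)[of "inv2 a" a b] iso_Cell[OF assms(1)]
  by simp_all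

lemma Vcomp_cancel_left:
  assumes "iso a" "b \<in> Cell C" "c \<in> Cell C" "Src C b = Trg C a" "Src C c = Trg C a"
  shows "a \<bullet> b = a \<bullet> c \<longleftrightarrow> b = c"
  by (metis assms inv2_cancel(2))

lemma Vcomp_cancel_right:
  assumes "iso a" "b \<in> Cell C" "c \<in> Cell C" "Trg C b = Src C a" "Trg C c = Src C a"
  shows "b \<bullet> a = c \<bullet> a \<longleftrightarrow> b = c"
proof
  assume "b \<bullet> a = c \<bullet> a"
  then have "(b \<bullet> a) \<bullet> inv2 a = (c \<bullet> a) \<bullet> inv2 a" by simp
  then show "b = c" using assms iso_Cell[OF assms(1)] by simp
qed simp

lemma iso_a2 [simp]: "f \<in> Arr C \<Longrightarrow> iso (a2 f)"
  by (rule isoI[where b = "a2 f"]) simp_all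

lemma iso_Vcomp [simp]:
  assumes "iso a" "iso b" "Trg C a = Src C b" shows "iso (a \<bullet> b)"
  by (rule isoI[where b = "inv2 b \<bullet> inv2 a"]) (use assms in \<open>simp_all add: iso_Cell\<close>)

lemma iso_Hcomp [simp]:
  assumes "iso a" "iso b" "Cod C (Src C a) = Dom C (Src C b)" shows "iso (a \<sharp>\<^sub>2 b)"
  by (rule isoI[where b = "inv2 a \<sharp>\<^sub>2 inv2 b"])
    (use assms in \<open>simp_all add: iso_Cell interchange[symmetric]\<close>)

lemma iso_tensor [simp]:
  assumes "iso a" "iso b" shows "iso (a \<otimes>\<^sub>2 b)"
  by (rule isoI[where b = "inv2 a \<otimes>\<^sub>2 inv2 b"])
    (use assms in \<open>simp_all add: iso_Cell tensor_Vcomp\<close>)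

lemma inv2_unique:
  assumes "iso a" "b \<in> Cell C" "Src C b = Trg C a" "Trg C b = Src C a" "a \<bullet> b = a2 (Src C a)"
  shows "inv2 a = b"
  using assms by (metis Vcomp_cancel_left inv2_simps(1,2,4))

text \<open>Two out of three for invertible 2-cells, by composing with the inverse of the known
  factor; the remaining case is \<open>iso_Vcomp\<close>.\<close>

lemma iso_cancel:
  assumes "a \<in> Cell C" "b \<in> Cell C" "Trg C a = Src C b" "iso (a \<bullet> b)"
  shows "iso b \<Longrightarrow> iso a" "iso a \<Longrightarrow> iso b"
proof -
  assume "iso b"
  then have "iso ((a \<bullet> b) \<bullet> inv2 b)" by (intro iso_Vcomp[OF assms(4)]) (use assms in simp_all)
  moreover have "(a \<bullet> b) \<bullet> inv2 b = a" using assms \<open>iso b\<close> by simp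
  ultimately show "iso a" by metis
next
  assume "iso a"
  then have "iso (inv2 a \<bullet> a \<bullet> b)" by (intro iso_Vcomp[OF _ assms(4)]) (use assms in simp_all)
  moreover have "inv2 a \<bullet> a \<bullet> b = b" using assms \<open>iso a\<close> by simp
  ultimately show "iso b" by metis
qed

abbreviation equi where "equi \<equiv> equi_arrow C"

lemma equiE:
  assumes "equi u"
  obtains v p q where "u \<in> Arr C" "v \<in> Arr C" "Dom C v = Cod C u" "Cod C v = Dom C u"
    "p \<in> isocells C (u \<sharp>\<^sub>1 v) (o1 (Dom C u))" "q \<in> isocells C (v \<sharp>\<^sub>1 u) (o1 (Cod C u))"
  using assms unfolding equi_arrow_def ex_in_conv[symmetric] by (auto simp del: isocells_iff)

lemma equiI:
  "\<lbrakk>u \<in> Arr C; v \<in> Arr C; Dom C v = Cod C u; Cod C v = Dom C u;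
    p \<in> isocells C (u \<sharp>\<^sub>1 v) (o1 (Dom C u)); q \<in> isocells C (v \<sharp>\<^sub>1 u) (o1 (Cod C u))\<rbrakk> \<Longrightarrow> equi u"
  unfolding equi_arrow_def by (metis empty_iff homset_iff)

lemma equi_Arr: "equi u \<Longrightarrow> u \<in> Arr C"
  by (simp add: equi_arrow_def)

text \<open>The pseudo-inverse of \<open>f\<close> is kept; whiskering \<open>a\<close> with it
  carries the two comparison cells from \<open>f\<close> over to \<open>g\<close>.\<close>

lemma equi_iso:
  assumes "equi f" "a \<in> isocells C f g" shows "equi g"
proof -
  obtain v p q where v: "f \<in> Arr C" "v \<in> Arr C" "Dom C v = Cod C f" "Cod C v = Dom C f"
    "p \<in> isocells C (f \<sharp>\<^sub>1 v) (o1 (Dom C f))" "q \<in> isocells C (v \<sharp>\<^sub>1 f) (o1 (Cod C f))"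
    by (rule equiE[OF assms(1)])
  have g: "g \<in> Arr C" "Dom C g = Dom C f" "Cod C g = Cod C f" using assms(2) by auto
  have "inv2 (a \<sharp>\<^sub>2 a2 v) \<bullet> p \<in> isocells C (g \<sharp>\<^sub>1 v) (o1 (Dom C g))"
    "inv2 (a2 v \<sharp>\<^sub>2 a) \<bullet> q \<in> isocells C (v \<sharp>\<^sub>1 g) (o1 (Cod C g))"
    using v g assms(2) by simp_all
  then show ?thesis using v g by (intro equiI) auto
qed

lemma equi_id: "X \<in> Obj C \<Longrightarrow> equi (o1 X)"
  by (rule equiI[where v = "o1 X" and p = "o2 X" and q = "o2 X"]) simp_all

lemma equi_comp:
  assumes "equi f" "equi g" "Cod C f = Dom C g" shows "equi (f \<sharp>\<^sub>1 g)"
proof -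
  obtain v p q where v: "f \<in> Arr C" "v \<in> Arr C" "Dom C v = Cod C f" "Cod C v = Dom C f"
    "p \<in> isocells C (f \<sharp>\<^sub>1 v) (o1 (Dom C f))" "q \<in> isocells C (v \<sharp>\<^sub>1 f) (o1 (Cod C f))"
    by (rule equiE[OF assms(1)])
  obtain w r s where w: "g \<in> Arr C" "w \<in> Arr C" "Dom C w = Cod C g" "Cod C w = Dom C g"
    "r \<in> isocells C (g \<sharp>\<^sub>1 w) (o1 (Dom C g))" "s \<in> isocells C (w \<sharp>\<^sub>1 g) (o1 (Cod C g))"
    by (rule equiE[OF assms(2)])
  have "(a2 f \<sharp>\<^sub>2 r \<sharp>\<^sub>2 a2 v) \<bullet> p \<in> isocells C ((f \<sharp>\<^sub>1 g) \<sharp>\<^sub>1 w \<sharp>\<^sub>1 v) (o1 (Dom C (f \<sharp>\<^sub>1 g)))"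
    "(a2 w \<sharp>\<^sub>2 q \<sharp>\<^sub>2 a2 g) \<bullet> s \<in> isocells C ((w \<sharp>\<^sub>1 v) \<sharp>\<^sub>1 f \<sharp>\<^sub>1 g) (o1 (Cod C (f \<sharp>\<^sub>1 g)))"
    using v w assms(3) by simp_all
  then show ?thesis
    by (rule equiI[where v = "w \<sharp>\<^sub>1 v", rotated -2]) (use v w assms(3) in simp_all)
qed

text \<open>Two out of three for equi-arrows: compose with a pseudo-inverse of the known factor,
  which is itself an equi-arrow; the result is isomorphic to the other factor, and
  \<open>equi_iso\<close> applies.\<close>

lemma equi_cancel:
  assumes "equi (f \<sharp>\<^sub>1 g)" "f \<in> Arr C" "g \<in> Arr C" "Cod C f = Dom C g"
  shows "equi g \<Longrightarrow> equi f" "equi f \<Longrightarrow> equi g"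
proof -
  assume "equi g"
  then obtain w r s where w: "w \<in> Arr C" "Dom C w = Cod C g" "Cod C w = Dom C g"
    "r \<in> isocells C (g \<sharp>\<^sub>1 w) (o1 (Dom C g))" "s \<in> isocells C (w \<sharp>\<^sub>1 g) (o1 (Cod C g))"
    by (rule equiE) auto
  have "equi w" by (rule equiI[where v = g]) (use w assms in simp_all)
  then have "equi ((f \<sharp>\<^sub>1 g) \<sharp>\<^sub>1 w)" by (intro equi_comp[OF assms(1)]) (use assms w in simp_all)
  then show "equi f"
    by (rule equi_iso[where a = "a2 f \<sharp>\<^sub>2 r"]) (use w assms in simp)
next
  assume "equi f"
  then obtain v p q where v: "v \<in> Arr C" "Dom C v = Cod C f" "Cod C v = Dom C f"
    "p \<in> isocells C (f \<sharp>\<^sub>1 v) (o1 (Dom C f))" "q \<in> isocells C (v \<sharp>\<^sub>1 f) (o1 (Cod C f))"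
    by (rule equiE) auto
  have "equi v" by (rule equiI[where v = f]) (use v assms in simp_all)
  then have "equi (v \<sharp>\<^sub>1 f \<sharp>\<^sub>1 g)" by (intro equi_comp[OF _ assms(1)]) (use assms v in simp_all)
  then show "equi g"
    by (rule equi_iso[where a = "q \<sharp>\<^sub>2 a2 g"]) (use v assms in simp)
qed

lemma equi_tensor:
  assumes "equi f" "equi g" shows "equi (f \<otimes>\<^sub>1 g)"
proof -
  obtain v p q where v: "f \<in> Arr C" "v \<in> Arr C" "Dom C v = Cod C f" "Cod C v = Dom C f"
    "p \<in> isocells C (f \<sharp>\<^sub>1 v) (o1 (Dom C f))" "q \<in> isocells C (v \<sharp>\<^sub>1 f) (o1 (Cod C f))"
    by (rule equiE[OF assms(1)])
  obtain w r s where w: "g \<in> Arr C" "w \<in> Arr C" "Dom C w = Cod C g" "Cod C w = Dom C g"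
    "r \<in> isocells C (g \<sharp>\<^sub>1 w) (o1 (Dom C g))" "s \<in> isocells C (w \<sharp>\<^sub>1 g) (o1 (Cod C g))"
    by (rule equiE[OF assms(2)])
  have "p \<otimes>\<^sub>2 r \<in> isocells C ((f \<otimes>\<^sub>1 g) \<sharp>\<^sub>1 (v \<otimes>\<^sub>1 w)) (o1 (Dom C (f \<otimes>\<^sub>1 g)))"
    "q \<otimes>\<^sub>2 s \<in> isocells C ((v \<otimes>\<^sub>1 w) \<sharp>\<^sub>1 (f \<otimes>\<^sub>1 g)) (o1 (Cod C (f \<otimes>\<^sub>1 g)))"
    using v w by (simp_all add: tensor_Comp)
  then show ?thesis
    by (rule equiI[where v = "v \<otimes>\<^sub>1 w", rotated -2]) (use v w in simp_all)
qed

subsection \<open>Fully faithful maps between hom categories\<close>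

text \<open>A fully faithful functor out of one hom category. The hom category it lands in is not
  named, since bijectivity only involves the 2-cells between \<open>F1 f\<close> and
  \<open>F1 g\<close>; thus one predicate covers whiskering, tensoring and composites of
  both.\<close>

definition ff_on :: "'o \<Rightarrow> 'o \<Rightarrow> ('a \<Rightarrow> 'a) \<Rightarrow> ('c \<Rightarrow> 'c) \<Rightarrow> bool" where
  "ff_on X Y F1 F2 \<longleftrightarrow>
     (\<forall>f \<in> homset C X Y. \<forall>g \<in> homset C X Y. bij_betw F2 (cells C f g) (cells C (F1 f) (F1 g))) \<and>
     (\<forall>f \<in> homset C X Y. F2 (a2 f) = a2 (F1 f)) \<and>
     (\<forall>a \<in> Cell C. \<forall>b \<in> Cell C. Src C a \<in> homset C X Y \<longrightarrow> Trg C a = Src C b \<longrightarrow> F2 (a \<bullet> b) = F2 a \<bullet> F2 b)"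

lemma ff_onI:
  assumes id: "\<And>f. f \<in> homset C X Y \<Longrightarrow> F2 (a2 f) = a2 (F1 f)"
    and comp: "\<And>a b. \<lbrakk>a \<in> Cell C; b \<in> Cell C; Src C a \<in> homset C X Y; Trg C a = Src C b\<rbrakk>
      \<Longrightarrow> F2 (a \<bullet> b) = F2 a \<bullet> F2 b"
    and cell: "\<And>f g a. \<lbrakk>f \<in> homset C X Y; g \<in> homset C X Y; a \<in> cells C f g\<rbrakk> \<Longrightarrow> F2 a \<in> cells C (F1 f) (F1 g)"
    and inj: "\<And>f g a b. \<lbrakk>f \<in> homset C X Y; g \<in> homset C X Y; a \<in> cells C f g; b \<in> cells C f g; F2 a = F2 b\<rbrakk> \<Longrightarrow> a = b"
    and surj: "\<And>f g c. \<lbrakk>f \<in> homset C X Y; g \<in> homset C X Y; c \<in> cells C (F1 f) (F1 g)\<rbrakk>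
      \<Longrightarrow> \<exists>a \<in> cells C f g. F2 a = c"
  shows "ff_on X Y F1 F2"
  unfolding ff_on_def
proof (intro conjI ballI impI)
  fix f g assume fg: "f \<in> homset C X Y" "g \<in> homset C X Y"
  show "bij_betw F2 (cells C f g) (cells C (F1 f) (F1 g))"
    unfolding bij_betw_def inj_on_def using cell[OF fg] inj[OF fg] surj[OF fg] by blast
qed (use id comp in auto)

lemma ff_on_cell:
  assumes "ff_on X Y F1 F2" "a \<in> Cell C" "Src C a \<in> homset C X Y"
  shows "F2 a \<in> cells C (F1 (Src C a)) (F1 (Trg C a))"
proof -
  have "bij_betw F2 (cells C (Src C a) (Trg C a)) (cells C (F1 (Src C a)) (F1 (Trg C a)))"
    using assms unfolding ff_on_def by simp
  then show ?thesis using assms(2) unfolding bij_betw_def by (metis (mono_tags, lifting) cells_iff image_eqI)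
qed

lemma ff_on_inj:
  assumes "ff_on X Y F1 F2" "a \<in> Cell C" "b \<in> Cell C" "Src C b = Src C a" "Trg C b = Trg C a"
    "Src C a \<in> homset C X Y" "F2 a = F2 b"
  shows "a = b"
proof -
  have "inj_on F2 (cells C (Src C a) (Trg C a))"
    using assms unfolding ff_on_def bij_betw_def by simp
  then show ?thesis using assms(2-5,7) by (simp add: inj_on_def)
qed

lemma ff_on_surj:
  assumes "ff_on X Y F1 F2" "f \<in> homset C X Y" "g \<in> homset C X Y" "c \<in> cells C (F1 f) (F1 g)"
  obtains a where "a \<in> cells C f g" "F2 a = c"
proof -
  have "c \<in> F2 ` cells C f g" using assms unfolding ff_on_def bij_betw_def by (simp del: cells_iff)
  then show thesis using that by blast
qed

text \<open>By fullness the inverse of \<open>F2 a\<close> has a preimage, and by faithfulness this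
  preimage is inverse to \<open>a\<close>.\<close>

lemma ff_on_iso:
  assumes F: "ff_on X Y F1 F2" and a: "a \<in> Cell C" "Src C a \<in> homset C X Y"
  shows "iso (F2 a) \<longleftrightarrow> iso a"
proof -
  have F_id: "F2 (a2 f) = a2 (F1 f)" if "f \<in> homset C X Y" for f
    using F that unfolding ff_on_def by simp
  have F_comp: "F2 (b \<bullet> c) = F2 b \<bullet> F2 c"
    if "b \<in> Cell C" "c \<in> Cell C" "Src C b \<in> homset C X Y" "Trg C b = Src C c" for b c
    using F that unfolding ff_on_def by simp
  have t: "Trg C a \<in> homset C X Y" using a by simp
  have Fa: "F2 a \<in> cells C (F1 (Src C a)) (F1 (Trg C a))" by (rule ff_on_cell[OF F a])
  show ?thesis
  proof
    assume i: "iso (F2 a)"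
    obtain b where b: "b \<in> cells C (Trg C a) (Src C a)" "F2 b = inv2 (F2 a)"
      by (rule ff_on_surj[OF F t a(2), of "inv2 (F2 a)"]) (use Fa i in auto)
    have "a \<bullet> b = a2 (Src C a)"
      by (rule ff_on_inj[OF F]) (use a b t i Fa in \<open>simp_all add: F_id F_comp\<close>)
    moreover have "b \<bullet> a = a2 (Trg C a)"
      by (rule ff_on_inj[OF F]) (use a b t i Fa in \<open>simp_all add: F_id F_comp\<close>)
    ultimately show "iso a" using a b by (intro isoI) auto
  next
    assume i: "iso a"
    have "F2 (inv2 a) \<in> cells C (F1 (Trg C a)) (F1 (Src C a))"
      using ff_on_cell[OF F, of "inv2 a"] a i by simp
    moreover have "F2 a \<bullet> F2 (inv2 a) = a2 (F1 (Src C a))" "F2 (inv2 a) \<bullet> F2 a = a2 (F1 (Trg C a))"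
      using a t i by (simp_all add: F_comp[symmetric] F_id)
    ultimately show "iso (F2 a)" using Fa by (intro isoI[of _ "F2 (inv2 a)"]) simp_all
  qed
qed

lemma ff_on_isocell:
  assumes "ff_on X Y F1 F2" "f \<in> homset C X Y" "g \<in> homset C X Y" "c \<in> isocells C (F1 f) (F1 g)"
  obtains a where "a \<in> isocells C f g" "F2 a = c"
proof -
  obtain a where a: "a \<in> cells C f g" "F2 a = c"
    by (rule ff_on_surj[OF assms(1-3), of c]) (use assms(4) in simp_all)
  then show thesis using that[of a] ff_on_iso[OF assms(1), of a] assms(2,4) by simp
qed

lemma ff_on_comp:
  assumes F: "ff_on X Y F1 F2" and G: "ff_on X' Y' G1 G2"
    and FG: "\<And>f. f \<in> homset C X Y \<Longrightarrow> F1 f \<in> homset C X' Y'"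
  shows "ff_on X Y (\<lambda>f. G1 (F1 f)) (\<lambda>a. G2 (F2 a))"
  unfolding ff_on_def
proof (intro conjI ballI impI)
  fix f g assume "f \<in> homset C X Y" "g \<in> homset C X Y"
  then show "bij_betw (\<lambda>a. G2 (F2 a)) (cells C f g) (cells C (G1 (F1 f)) (G1 (F1 g)))"
    using F G FG[of f] FG[of g] bij_betw_trans[of F2 "cells C f g" "cells C (F1 f) (F1 g)" G2]
    unfolding ff_on_def comp_def by blast
next
  fix f assume "f \<in> homset C X Y"
  then show "G2 (F2 (a2 f)) = a2 (G1 (F1 f))" using F G FG[of f] unfolding ff_on_def by simp
next
  fix a b assume a: "a \<in> Cell C" "b \<in> Cell C" "Src C a \<in> homset C X Y" "Trg C a = Src C b"
  have b: "Src C b \<in> homset C X Y" using a by (simp add: a(4)[symmetric])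
  have "F2 a \<in> cells C (F1 (Src C a)) (F1 (Trg C a))" "F2 b \<in> cells C (F1 (Src C b)) (F1 (Trg C b))"
    using ff_on_cell[OF F] a b by blast+
  then show "G2 (F2 (a \<bullet> b)) = G2 (F2 a) \<bullet> G2 (F2 b)"
    using F G FG[of "Src C a"] a unfolding ff_on_def by simp
qed

lemma ff_on_cong:
  assumes "ff_on X Y F1 F2" "\<And>f. f \<in> homset C X Y \<Longrightarrow> G1 f = F1 f"
    "\<And>a. \<lbrakk>a \<in> Cell C; Src C a \<in> homset C X Y\<rbrakk> \<Longrightarrow> G2 a = F2 a"
  shows "ff_on X Y G1 G2"
  unfolding ff_on_def
proof (intro conjI ballI impI)
  fix f g assume fg: "f \<in> homset C X Y" "g \<in> homset C X Y"
  then have "bij_betw G2 (cells C f g) (cells C (F1 f) (F1 g)) \<longleftrightarrow> bij_betw F2 (cells C f g) (cells C (F1 f) (F1 g))"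
    using assms(3) by (intro bij_betw_cong) auto
  then show "bij_betw G2 (cells C f g) (cells C (G1 f) (G1 g))"
    using assms(1,2) fg unfolding ff_on_def by simp
next
  fix f assume f: "f \<in> homset C X Y"
  then have "G2 (a2 f) = F2 (a2 f)" by (intro assms(3)) simp_all
  then show "G2 (a2 f) = a2 (G1 f)" using assms(1,2) f unfolding ff_on_def by simp
next
  fix a b assume a: "a \<in> Cell C" "b \<in> Cell C" "Src C a \<in> homset C X Y" "Trg C a = Src C b"
  have b: "Src C b \<in> homset C X Y" using a by (simp add: a(4)[symmetric])
  have "G2 (a \<bullet> b) = F2 (a \<bullet> b)" "G2 a = F2 a" "G2 b = F2 b"
    using a b by (auto intro!: assms(3))
  then show "G2 (a \<bullet> b) = G2 a \<bullet> G2 b" using assms(1) a unfolding ff_on_def by simp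
qed

text \<open>Exchanging \<open>q\<close> with a 2-cell \<open>c\<close> expresses \<open>c\<close>
  through its whiskering with \<open>u\<close>, which gives faithfulness. The comparison cells are
  not assumed to satisfy triangle identities, so fullness is reached in two steps: a candidate is
  right after further whiskering with \<open>v\<close>, and whiskering with \<open>v\<close> is
  faithful as well.\<close>

lemma ff_pre:
  assumes "equi u" "X = Cod C u"
  shows "ff_on X Y (\<lambda>f. u \<sharp>\<^sub>1 f) (\<lambda>a. a2 u \<sharp>\<^sub>2 a)"
proof -
  \<comment> \<open>Stated for every equi-arrow, because below it is applied to the pseudo-inverse
    \<open>v\<close> as well as to \<open>u\<close>.\<close>
  have inj: "a = b"
    if u: "equi u" and a: "a \<in> cells C f g" "b \<in> cells C f g" "Dom C f = Cod C u" "a2 u \<sharp>\<^sub>2 a = a2 u \<sharp>\<^sub>2 b"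
    for u a b f g
  proof -
    obtain v p q where v: "u \<in> Arr C" "v \<in> Arr C" "Dom C v = Cod C u" "Cod C v = Dom C u"
      "q \<in> isocells C (v \<sharp>\<^sub>1 u) (o1 (Cod C u))"
      by (rule equiE[OF u])
    have "(q \<sharp>\<^sub>2 a2 f) \<bullet> c = (a2 v \<sharp>\<^sub>2 (a2 u \<sharp>\<^sub>2 c)) \<bullet> (q \<sharp>\<^sub>2 a2 g)" if c: "c \<in> cells C f g" for c
      using exchange[of q c, OF _ _ _ refl refl refl refl] v a c by simp
    from this[OF a(1)] this[OF a(2)] have "(q \<sharp>\<^sub>2 a2 f) \<bullet> a = (q \<sharp>\<^sub>2 a2 f) \<bullet> b" using a(4) by simp
    then show "a = b" by (subst (asm) Vcomp_cancel_left) (use a v in auto)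
  qed
  obtain v p q where v: "u \<in> Arr C" "v \<in> Arr C" "Dom C v = Cod C u" "Cod C v = Dom C u"
    "p \<in> isocells C (u \<sharp>\<^sub>1 v) (o1 (Dom C u))" "q \<in> isocells C (v \<sharp>\<^sub>1 u) (o1 (Cod C u))"
    by (rule equiE[OF assms(1)])
  have v': "equi v" by (rule equiI[where v = u]) (use v in simp_all)
  show ?thesis
  proof (rule ff_onI)
    fix f g c assume f: "f \<in> homset C X Y" "g \<in> homset C X Y" "c \<in> cells C (u \<sharp>\<^sub>1 f) (u \<sharp>\<^sub>1 g)"
    \<comment> \<open>\<open>c\<close> whiskered with the pseudo-inverse and transported along
      \<open>q\<close>: the only value that the exchange law with \<open>q\<close> allows.\<close>
    define a where "a = inv2 (q \<sharp>\<^sub>2 a2 f) \<bullet> (a2 v \<sharp>\<^sub>2 c) \<bullet> (q \<sharp>\<^sub>2 a2 g)"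
    have a: "a \<in> cells C f g" using f v assms unfolding a_def by simp
    have "(q \<sharp>\<^sub>2 a2 f) \<bullet> a = (a2 v \<sharp>\<^sub>2 (a2 u \<sharp>\<^sub>2 a)) \<bullet> (q \<sharp>\<^sub>2 a2 g)"
      using exchange[of q a, OF _ _ _ refl refl refl refl] v a f assms by simp
    moreover have "(q \<sharp>\<^sub>2 a2 f) \<bullet> a = (a2 v \<sharp>\<^sub>2 c) \<bullet> (q \<sharp>\<^sub>2 a2 g)"
      unfolding a_def using f v assms by simp
    ultimately have "(a2 v \<sharp>\<^sub>2 (a2 u \<sharp>\<^sub>2 a)) \<bullet> (q \<sharp>\<^sub>2 a2 g) = (a2 v \<sharp>\<^sub>2 c) \<bullet> (q \<sharp>\<^sub>2 a2 g)"
      by simp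
    then have *: "a2 v \<sharp>\<^sub>2 (a2 u \<sharp>\<^sub>2 a) = a2 v \<sharp>\<^sub>2 c"
      by (subst (asm) Vcomp_cancel_right) (use f v a assms in auto)
    have "a2 u \<sharp>\<^sub>2 a = c"
      by (rule inj[OF v' _ f(3) _ *]) (use f a v assms in simp_all)
    then show "\<exists>a \<in> cells C f g. a2 u \<sharp>\<^sub>2 a = c" using a by blast
  next
    fix f g a b assume f: "f \<in> homset C X Y" and g: "g \<in> homset C X Y"
      and a: "a \<in> cells C f g" "b \<in> cells C f g" "a2 u \<sharp>\<^sub>2 a = a2 u \<sharp>\<^sub>2 b"
    show "a = b" by (rule inj[OF assms(1) a(1,2) _ a(3)]) (use f assms(2) in simp)
  qed (use v assms in simp_all)
qed

text \<open>The mirror image of \<open>ff_pre\<close>, with \<open>p\<close> in the role of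
  \<open>q\<close>. It is a duality for composition of arrows, which the reversal of the tensor
  product used later does not provide.\<close>

lemma ff_post:
  assumes "equi u" "Y = Dom C u"
  shows "ff_on X Y (\<lambda>f. f \<sharp>\<^sub>1 u) (\<lambda>a. a \<sharp>\<^sub>2 a2 u)"
proof -
  have inj: "a = b"
    if u: "equi u" and a: "a \<in> cells C f g" "b \<in> cells C f g" "Cod C f = Dom C u" "a \<sharp>\<^sub>2 a2 u = b \<sharp>\<^sub>2 a2 u"
    for u a b f g
  proof -
    obtain v p q where v: "u \<in> Arr C" "v \<in> Arr C" "Dom C v = Cod C u" "Cod C v = Dom C u"
      "p \<in> isocells C (u \<sharp>\<^sub>1 v) (o1 (Dom C u))"
      by (rule equiE[OF u])
    have "(a2 f \<sharp>\<^sub>2 p) \<bullet> c = ((c \<sharp>\<^sub>2 a2 u) \<sharp>\<^sub>2 a2 v) \<bullet> (a2 g \<sharp>\<^sub>2 p)" if c: "c \<in> cells C f g" for c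
      using exchange[of c p, OF _ _ _ refl refl refl refl] v a c by simp
    from this[OF a(1)] this[OF a(2)] have "(a2 f \<sharp>\<^sub>2 p) \<bullet> a = (a2 f \<sharp>\<^sub>2 p) \<bullet> b" using a(4) by simp
    then show "a = b" by (subst (asm) Vcomp_cancel_left) (use a v in auto)
  qed
  obtain v p q where v: "u \<in> Arr C" "v \<in> Arr C" "Dom C v = Cod C u" "Cod C v = Dom C u"
    "p \<in> isocells C (u \<sharp>\<^sub>1 v) (o1 (Dom C u))" "q \<in> isocells C (v \<sharp>\<^sub>1 u) (o1 (Cod C u))"
    by (rule equiE[OF assms(1)])
  have v': "equi v" by (rule equiI[where v = u]) (use v in simp_all)
  show ?thesis
  proof (rule ff_onI)
    fix f g c assume f: "f \<in> homset C X Y" "g \<in> homset C X Y" "c \<in> cells C (f \<sharp>\<^sub>1 u) (g \<sharp>\<^sub>1 u)"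
    define a where "a = inv2 (a2 f \<sharp>\<^sub>2 p) \<bullet> (c \<sharp>\<^sub>2 a2 v) \<bullet> (a2 g \<sharp>\<^sub>2 p)"
    have a: "a \<in> cells C f g" using f v assms unfolding a_def by simp
    have "(a2 f \<sharp>\<^sub>2 p) \<bullet> a = ((a \<sharp>\<^sub>2 a2 u) \<sharp>\<^sub>2 a2 v) \<bullet> (a2 g \<sharp>\<^sub>2 p)"
      using exchange[of a p, OF _ _ _ refl refl refl refl] v a f assms by simp
    moreover have "(a2 f \<sharp>\<^sub>2 p) \<bullet> a = (c \<sharp>\<^sub>2 a2 v) \<bullet> (a2 g \<sharp>\<^sub>2 p)"
      unfolding a_def using f v assms by simp
    ultimately have "((a \<sharp>\<^sub>2 a2 u) \<sharp>\<^sub>2 a2 v) \<bullet> (a2 g \<sharp>\<^sub>2 p) = (c \<sharp>\<^sub>2 a2 v) \<bullet> (a2 g \<sharp>\<^sub>2 p)"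
      by simp
    then have *: "(a \<sharp>\<^sub>2 a2 u) \<sharp>\<^sub>2 a2 v = c \<sharp>\<^sub>2 a2 v"
      by (subst (asm) Vcomp_cancel_right) (use f v a assms in auto)
    have "a \<sharp>\<^sub>2 a2 u = c"
      by (rule inj[OF v' _ f(3) _ *]) (use f a v assms in simp_all)
    then show "\<exists>a \<in> cells C f g. a \<sharp>\<^sub>2 a2 u = c" using a by blast
  next
    fix f g a b assume f: "f \<in> homset C X Y" and g: "g \<in> homset C X Y"
      and a: "a \<in> cells C f g" "b \<in> cells C f g" "a \<sharp>\<^sub>2 a2 u = b \<sharp>\<^sub>2 a2 u"
    show "a = b" by (rule inj[OF assms(1) a(1,2) _ a(3)]) (use f assms(2) in simp)
  qed (use v assms in simp_all)
qed

end

section \<open>Equivalences of categories as fully faithful and essentially surjective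
  functors\<close>

context category
begin

lemma homset_Comp: "\<lbrakk>f \<in> homset C X Y; g \<in> homset C Y Z\<rbrakk> \<Longrightarrow> Comp C f g \<in> homset C X Z"
  by (simp add: Comp_Arr Dom_Comp Cod_Comp)

lemma homset_Comp_assoc:
  "\<lbrakk>f \<in> homset C W X; g \<in> homset C X Y; h \<in> homset C Y Z\<rbrakk>
    \<Longrightarrow> Comp C (Comp C f g) h = Comp C f (Comp C g h)"
  by (simp add: Comp_assoc)

lemma homset_Ident: "X \<in> Obj C \<Longrightarrow> Ident C X \<in> homset C X X"
  by (simp add: Ident_Arr Dom_Ident Cod_Ident)

lemma homset_Ident_left: "f \<in> homset C X Y \<Longrightarrow> Comp C (Ident C X) f = f"
  using Ident_left[of f] by auto

lemma homset_Ident_right: "f \<in> homset C X Y \<Longrightarrow> Comp C f (Ident C Y) = f"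
  using Ident_right[of f] by auto

lemma homset_Obj: "f \<in> homset C X Y \<Longrightarrow> X \<in> Obj C" "f \<in> homset C X Y \<Longrightarrow> Y \<in> Obj C"
  by (auto simp: Dom_Obj Cod_Obj)

lemma is_isoE:
  assumes "is_iso C f" "f \<in> homset C X Y"
  obtains g where "g \<in> homset C Y X" "Comp C f g = Ident C X" "Comp C g f = Ident C Y"
  using assms unfolding is_iso_def by auto

lemma is_isoI:
  assumes "f \<in> homset C X Y" "g \<in> homset C Y X" "Comp C f g = Ident C X" "Comp C g f = Ident C Y"
  shows "is_iso C f"
  using assms unfolding is_iso_def by auto

lemma iso_epi:
  assumes "is_iso C t" "t \<in> homset C W X" "f \<in> homset C X Y" "g \<in> homset C X Y" "Comp C t f = Comp C t g"
  shows "f = g"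
proof -
  obtain i where i: "i \<in> homset C X W" "Comp C i t = Ident C X"
    by (rule is_isoE[OF assms(1,2)]) blast
  have "Comp C i (Comp C t h) = h" if "h \<in> homset C X Y" for h
    using homset_Comp_assoc[OF i(1) assms(2) that] i(2) homset_Ident_left[OF that] by simp
  from this[OF assms(3)] this[OF assms(4)] show ?thesis using assms(5) by metis
qed

lemma iso_mono:
  assumes "is_iso C t" "t \<in> homset C Y Z" "f \<in> homset C X Y" "g \<in> homset C X Y" "Comp C f t = Comp C g t"
  shows "f = g"
proof -
  obtain i where i: "i \<in> homset C Z Y" "Comp C t i = Ident C Y"
    by (rule is_isoE[OF assms(1,2)]) blast
  have "Comp C (Comp C h t) i = h" if "h \<in> homset C X Y" for h
    using homset_Comp_assoc[OF that assms(2) i(1)] i(2) homset_Ident_right[OF that] by simp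
  from this[OF assms(3)] this[OF assms(4)] show ?thesis using assms(5) by metis
qed

end

context cat_functor
begin

lemma map_homset: "f \<in> homset A X Y \<Longrightarrow> F1 f \<in> homset B (F0 X) (F0 Y)"
  using map_Arr[of f] by simp

text \<open>Naturality of \<open>\<eta>\<close> recovers an arrow from its image under the composite
  functor, so \<open>F1\<close> is faithful; naturality of \<open>\<epsilon>\<close> does the same
  for \<open>G1\<close>. For fullness it is therefore enough to match \<open>h\<close> after
  applying \<open>G1\<close>.\<close>

lemma equivalence_fully_faithful:
  assumes "cat_equivalence A B F0 F1"
  shows "f \<in> homset A X Y \<Longrightarrow> g \<in> homset A X Y \<Longrightarrow> F1 f = F1 g \<Longrightarrow> f = g"
    and "X \<in> Obj A \<Longrightarrow> Y \<in> Obj A \<Longrightarrow> h \<in> homset B (F0 X) (F0 Y) \<Longrightarrow> \<exists>f \<in> homset A X Y. F1 f = h"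
    and "Z \<in> Obj B \<Longrightarrow> \<exists>X \<in> Obj A. \<exists>t \<in> homset B (F0 X) Z. is_iso B t"
proof -
  obtain G0 G1 \<eta> \<epsilon> where G: "cat_functor B A G0 G1"
    and \<eta>: "nat_iso A A id id (G0 \<circ> F0) (G1 \<circ> F1) \<eta>"
    and \<epsilon>: "nat_iso B B (F0 \<circ> G0) (F1 \<circ> G1) id id \<epsilon>"
    using assms unfolding cat_equivalence_def by blast
  interpret G: cat_functor B A G0 G1 by (rule G)
  have \<eta>_hom: "\<eta> X \<in> homset A X (G0 (F0 X))" "is_iso A (\<eta> X)" if "X \<in> Obj A" for X
    using \<eta> that unfolding nat_iso_def by (simp_all del: homset_iff)
  have \<eta>_nat: "Comp A f (\<eta> Y) = Comp A (\<eta> X) (G1 (F1 f))" if "f \<in> homset A X Y" for f X Y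
    using \<eta> that unfolding nat_iso_def by auto
  have \<epsilon>_hom: "\<epsilon> X \<in> homset B (F0 (G0 X)) X" "is_iso B (\<epsilon> X)" if "X \<in> Obj B" for X
    using \<epsilon> that unfolding nat_iso_def by (simp_all del: homset_iff)
  have \<epsilon>_nat: "Comp B (F1 (G1 f)) (\<epsilon> Y) = Comp B (\<epsilon> X) f" if "f \<in> homset B X Y" for f X Y
    using \<epsilon> that unfolding nat_iso_def by auto
  have G_inj: "f = g" if "f \<in> homset B X Y" "g \<in> homset B X Y" "G1 f = G1 g" for f g X Y
  proof (rule B.iso_epi)
    show "is_iso B (\<epsilon> X)" "\<epsilon> X \<in> homset B (F0 (G0 X)) X" using \<epsilon>_hom B.homset_Obj[OF that(1)] by auto
    show "Comp B (\<epsilon> X) f = Comp B (\<epsilon> X) g" by (metis \<epsilon>_nat that)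
  qed (use that in auto)
  show "f = g" if "f \<in> homset A X Y" "g \<in> homset A X Y" "F1 f = F1 g"
  proof (rule A.iso_mono)
    show "is_iso A (\<eta> Y)" "\<eta> Y \<in> homset A Y (G0 (F0 Y))" using \<eta>_hom A.homset_Obj[OF that(1)] by auto
    show "Comp A f (\<eta> Y) = Comp A g (\<eta> Y)" by (metis \<eta>_nat that)
  qed (use that in auto)
  show "\<exists>f \<in> homset A X Y. F1 f = h" if X: "X \<in> Obj A" "Y \<in> Obj A" and h: "h \<in> homset B (F0 X) (F0 Y)"
  proof -
    obtain i where i: "i \<in> homset A (G0 (F0 Y)) Y" "Comp A (\<eta> Y) i = Ident A Y" "Comp A i (\<eta> Y) = Ident A (G0 (F0 Y))"
      by (rule A.is_isoE[OF \<eta>_hom(2)[OF X(2)] \<eta>_hom(1)[OF X(2)]])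
    have Gh: "G1 h \<in> homset A (G0 (F0 X)) (G0 (F0 Y))" by (rule G.map_homset[OF h])
    \<comment> \<open>Naturality of \<open>\<eta>\<close> at \<open>f\<close> forces this value as
      soon as \<open>G1 (F1 f)\<close> is to be \<open>G1 h\<close>.\<close>
    define f where "f = Comp A (\<eta> X) (Comp A (G1 h) i)"
    have f: "f \<in> homset A X Y"
      unfolding f_def by (intro A.homset_Comp[OF \<eta>_hom(1)[OF X(1)]] A.homset_Comp[OF Gh] i)
    have "Comp A f (\<eta> Y) = Comp A (\<eta> X) (G1 h)"
      unfolding f_def
      by (simp only: A.homset_Comp_assoc[OF \<eta>_hom(1)[OF X(1)] A.homset_Comp[OF Gh i(1)] \<eta>_hom(1)[OF X(2)]]
          A.homset_Comp_assoc[OF Gh i(1) \<eta>_hom(1)[OF X(2)]] i(3) A.homset_Ident_right[OF Gh])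
    then have "Comp A (\<eta> X) (G1 (F1 f)) = Comp A (\<eta> X) (G1 h)" using \<eta>_nat[OF f] by simp
    then have "G1 (F1 f) = G1 h"
      using A.iso_epi[OF \<eta>_hom(2,1)[OF X(1)] G.map_homset[OF map_homset[OF f]] Gh] by blast
    then show ?thesis using G_inj[OF map_homset[OF f] h] f by blast
  qed
  show "\<exists>X \<in> Obj A. \<exists>t \<in> homset B (F0 X) Z. is_iso B t" if "Z \<in> Obj B"
    using \<epsilon>_hom[OF that] G.map_Obj[OF that] by blast
qed

text \<open>Every object of \<open>B\<close> gets a preimage up to a chosen isomorphism
  \<open>\<epsilon>\<close>, and an arrow \<open>g\<close> goes to the preimage of \<open>g\<close>
  conjugated with these isomorphisms. The functor laws, the naturality of \<open>\<eta>\<close> and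
  its invertibility hold because they hold after applying \<open>F1\<close>. This direction is what
  proves GPS units cancellable.\<close>

lemma equivalenceI:
  assumes inj: "\<And>X Y f g. \<lbrakk>f \<in> homset A X Y; g \<in> homset A X Y; F1 f = F1 g\<rbrakk> \<Longrightarrow> f = g"
    and full: "\<And>X Y h. \<lbrakk>X \<in> Obj A; Y \<in> Obj A; h \<in> homset B (F0 X) (F0 Y)\<rbrakk> \<Longrightarrow> \<exists>f \<in> homset A X Y. F1 f = h"
    and eso: "\<And>Z. Z \<in> Obj B \<Longrightarrow> \<exists>X \<in> Obj A. \<exists>t \<in> homset B (F0 X) Z. is_iso B t"
  shows "cat_equivalence A B F0 F1"
proof -
  have "\<exists>X t i. X \<in> Obj A \<and> t \<in> homset B (F0 X) Z \<and> i \<in> homset B Z (F0 X) \<and>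
      Comp B t i = Ident B (F0 X) \<and> Comp B i t = Ident B Z" if "Z \<in> Obj B" for Z
    using eso[OF that] by (meson B.is_isoE)
  then obtain G0 \<epsilon> \<iota> where G0: "\<And>Z. Z \<in> Obj B \<Longrightarrow> G0 Z \<in> Obj A"
    and \<epsilon>: "\<And>Z. Z \<in> Obj B \<Longrightarrow> \<epsilon> Z \<in> homset B (F0 (G0 Z)) Z"
    and \<iota>: "\<And>Z. Z \<in> Obj B \<Longrightarrow> \<iota> Z \<in> homset B Z (F0 (G0 Z))"
    and \<epsilon>\<iota>: "\<And>Z. Z \<in> Obj B \<Longrightarrow> Comp B (\<epsilon> Z) (\<iota> Z) = Ident B (F0 (G0 Z))"
    and \<iota>\<epsilon>: "\<And>Z. Z \<in> Obj B \<Longrightarrow> Comp B (\<iota> Z) (\<epsilon> Z) = Ident B Z"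
    by metis
  have "\<exists>f \<in> homset A (G0 (Dom B g)) (G0 (Cod B g)). F1 f = Comp B (\<epsilon> (Dom B g)) (Comp B g (\<iota> (Cod B g)))"
    if "g \<in> Arr B" for g
  proof (rule full)
    show "Comp B (\<epsilon> (Dom B g)) (Comp B g (\<iota> (Cod B g))) \<in> homset B (F0 (G0 (Dom B g))) (F0 (G0 (Cod B g)))"
      by (rule B.homset_Comp[OF \<epsilon> B.homset_Comp[OF _ \<iota>]]) (use that B.Dom_Obj B.Cod_Obj in auto)
  qed (use G0 that B.Dom_Obj B.Cod_Obj in auto)
  then obtain G1 where G1: "\<And>g. g \<in> Arr B \<Longrightarrow> G1 g \<in> homset A (G0 (Dom B g)) (G0 (Cod B g)) \<and>
      F1 (G1 g) = Comp B (\<epsilon> (Dom B g)) (Comp B g (\<iota> (Cod B g)))"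
    by metis
  have G1_hom: "G1 g \<in> homset A (G0 X) (G0 Y)" and FG: "F1 (G1 g) = Comp B (\<epsilon> X) (Comp B g (\<iota> Y))"
    if "g \<in> homset B X Y" for g X Y
    using G1[of g] that by auto
  have FG_\<epsilon>: "Comp B (F1 (G1 g)) (\<epsilon> Y) = Comp B (\<epsilon> X) g" if g: "g \<in> homset B X Y" for g X Y
  proof -
    note X = B.homset_Obj(1)[OF g] and Y = B.homset_Obj(2)[OF g]
    show ?thesis
      by (simp only: FG[OF g] B.homset_Comp_assoc[OF \<epsilon>[OF X] B.homset_Comp[OF g \<iota>[OF Y]] \<epsilon>[OF Y]]
          B.homset_Comp_assoc[OF g \<iota>[OF Y] \<epsilon>[OF Y]] \<iota>\<epsilon>[OF Y] B.homset_Ident_right[OF g])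
  qed
  have \<epsilon>_iso: "is_iso B (\<epsilon> Z)" if "Z \<in> Obj B" for Z
    using that by (intro B.is_isoI[OF \<epsilon> \<iota> \<epsilon>\<iota> \<iota>\<epsilon>])
  have G: "cat_functor B A G0 G1"
  proof (intro cat_functor.intro cat_functor_axioms.intro)
    fix X assume X: "X \<in> Obj B"
    show "G1 (Ident B X) = Ident A (G0 X)"
    proof (rule inj[OF G1_hom[OF B.homset_Ident[OF X]] A.homset_Ident[OF G0[OF X]]])
      show "F1 (G1 (Ident B X)) = F1 (Ident A (G0 X))"
        using FG[OF B.homset_Ident[OF X]] B.homset_Ident_left[OF \<iota>[OF X]] \<epsilon>\<iota>[OF X] map_Ident[OF G0[OF X]] by simp
    qed
  next
    fix f g assume "f \<in> Arr B" "g \<in> Arr B" "Cod B f = Dom B g"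
    then have f: "f \<in> homset B (Dom B f) (Cod B f)" "g \<in> homset B (Cod B f) (Cod B g)" by auto
    note fg = B.homset_Comp[OF f]
    note Gf = G1_hom[OF f(1)] and Gg = G1_hom[OF f(2)]
    note g\<iota> = B.homset_Comp[OF f(2) \<iota>[OF B.homset_Obj(2)[OF f(2)]]] \<iota>[OF B.homset_Obj(2)[OF f(2)]]
    show "G1 (Comp B f g) = Comp A (G1 f) (G1 g)"
    proof (rule inj[OF G1_hom[OF fg] A.homset_Comp[OF Gf Gg]])
      have "F1 (Comp A (G1 f) (G1 g)) = Comp B (F1 (G1 f)) (F1 (G1 g))"
        using Gf Gg by (intro map_Comp) auto
      also have "\<dots> = Comp B (\<epsilon> (Dom B f)) (Comp B (Comp B f g) (\<iota> (Cod B g)))"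
        by (simp only: FG[OF f(2)] B.homset_Comp_assoc[OF f g\<iota>(2)] FG_\<epsilon>[OF f(1)]
            B.homset_Comp_assoc[OF map_homset[OF Gf] \<epsilon>[OF B.homset_Obj(2)[OF f(1)]] g\<iota>(1), symmetric]
            B.homset_Comp_assoc[OF \<epsilon>[OF B.homset_Obj(1)[OF f(1)]] f(1) g\<iota>(1)])
      finally show "F1 (G1 (Comp B f g)) = F1 (Comp A (G1 f) (G1 g))" using FG[OF fg] by simp
    qed
  qed (use G0 G1 A.category_axioms B.category_axioms in auto)
  interpret G: cat_functor B A G0 G1 by (rule G)
  have "\<exists>e \<in> homset A X (G0 (F0 X)). F1 e = \<iota> (F0 X)" if "X \<in> Obj A" for X
    by (rule full) (use that G0 \<iota> map_Obj in auto)
  then obtain \<eta> where \<eta>: "\<And>X. X \<in> Obj A \<Longrightarrow> \<eta> X \<in> homset A X (G0 (F0 X))"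
    and F\<eta>: "\<And>X. X \<in> Obj A \<Longrightarrow> F1 (\<eta> X) = \<iota> (F0 X)" by metis
  have "nat_iso A A id id (G0 \<circ> F0) (G1 \<circ> F1) \<eta>"
    unfolding nat_iso_def o_apply id_apply
  proof (intro conjI ballI)
    fix X assume X: "X \<in> Obj A"
    show "\<eta> X \<in> homset A X (G0 (F0 X))" by (rule \<eta>[OF X])
    obtain i where i: "i \<in> homset A (G0 (F0 X)) X" "F1 i = \<epsilon> (F0 X)"
      using full[of "G0 (F0 X)" X "\<epsilon> (F0 X)"] X G0 \<epsilon> map_Obj by blast
    show "is_iso A (\<eta> X)"
    proof (rule A.is_isoI[OF \<eta>[OF X] i(1)])
      show "Comp A (\<eta> X) i = Ident A X"
        by (rule inj[OF A.homset_Comp[OF \<eta>[OF X] i(1)] A.homset_Ident[OF X]])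
          (use \<eta>[OF X] F\<eta>[OF X] i X \<iota>\<epsilon> map_Obj in \<open>simp add: map_Comp map_Ident\<close>)
      show "Comp A i (\<eta> X) = Ident A (G0 (F0 X))"
        by (rule inj[OF A.homset_Comp[OF i(1) \<eta>[OF X]] A.homset_Ident[OF G0[OF map_Obj[OF X]]]])
          (use \<eta>[OF X] F\<eta>[OF X] i X \<epsilon>\<iota> map_Obj G0 in \<open>simp add: map_Comp map_Ident\<close>)
    qed
  next
    fix f assume "f \<in> Arr A"
    then have f: "f \<in> homset A (Dom A f) (Cod A f)" by simp
    note X = A.homset_Obj[OF f] and Ff = map_homset[OF f]
    have FX: "F0 (Dom A f) \<in> Obj B" "F0 (Cod A f) \<in> Obj B" using map_Obj X by auto
    note GFf = G1_hom[OF Ff]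
    have "Comp B (\<iota> (F0 (Dom A f))) (Comp B (\<epsilon> (F0 (Dom A f))) (Comp B (F1 f) (\<iota> (F0 (Cod A f)))))
        = Comp B (F1 f) (\<iota> (F0 (Cod A f)))"
      by (simp only: B.homset_Comp_assoc[OF \<iota>[OF FX(1)] \<epsilon>[OF FX(1)] B.homset_Comp[OF Ff \<iota>[OF FX(2)]], symmetric]
          \<iota>\<epsilon>[OF FX(1)] B.homset_Ident_left[OF B.homset_Comp[OF Ff \<iota>[OF FX(2)]]])
    then have "F1 (Comp A f (\<eta> (Cod A f))) = F1 (Comp A (\<eta> (Dom A f)) (G1 (F1 f)))"
      using f \<eta>[OF X(1)] \<eta>[OF X(2)] GFf F\<eta> X FG[OF Ff] by (simp add: map_Comp)
    then show "Comp A f (\<eta> (Cod A f)) = Comp A (\<eta> (Dom A f)) (G1 (F1 f))"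
      by (rule inj[OF A.homset_Comp[OF f \<eta>[OF X(2)]] A.homset_Comp[OF \<eta>[OF X(1)] GFf]])
  qed
  moreover have "nat_iso B B (F0 \<circ> G0) (F1 \<circ> G1) id id \<epsilon>"
    unfolding nat_iso_def o_apply id_apply using \<epsilon> \<epsilon>_iso FG_\<epsilon> by auto
  ultimately show ?thesis
    unfolding cat_equivalence_def using G cat_functor_axioms by blast
qed

end

subsection \<open>Strongly fully faithful 2-functors which are surjective on objects\<close>

text \<open>A 2-cell between arrows from \<open>X\<close> to \<open>Y\<close> is the same as an
  arrow from \<open>X\<close> to \<open>Y\<close> of \<open>horiz C\<close>. Hence an isomorphism of
  hom categories amounts to bijections on two kinds of hom-sets, which is the form needed to lift
  arrows and 2-cells one at a time.\<close>

lemma (in strict_2functor) strongly_fully_faithful_cases: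
  assumes "strongly_fully_faithful C D F"
  shows "\<lbrakk>f \<in> homset C X Y; g \<in> homset C X Y; on_arr F f = on_arr F g\<rbrakk> \<Longrightarrow> f = g"
    and "\<lbrakk>a \<in> homset (horiz C) X Y; b \<in> homset (horiz C) X Y; on_cell F a = on_cell F b\<rbrakk> \<Longrightarrow> a = b"
    and "\<lbrakk>X \<in> Obj C; Y \<in> Obj C; h \<in> homset D (on_obj F X) (on_obj F Y)\<rbrakk> \<Longrightarrow> \<exists>f \<in> homset C X Y. on_arr F f = h"
    and "\<lbrakk>X \<in> Obj C; Y \<in> Obj C; c \<in> homset (horiz D) (on_obj F X) (on_obj F Y)\<rbrakk>
      \<Longrightarrow> \<exists>a \<in> homset (horiz C) X Y. on_cell F a = c"
proof -
  have iso: "cat_isomorphism (homcat C X Y) (homcat D (on_obj F X) (on_obj F Y)) (on_arr F) (on_cell F)"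
    if "X \<in> Obj C" "Y \<in> Obj C" for X Y
    using assms that unfolding strongly_fully_faithful_def by blast
  have arr: "Arr (homcat E X Y) = homset (horiz E) X Y" if "strict_2category E" for E :: "('x, 'y, 'z, 'w) twocat_scheme" and X Y
    using category.Dom_Obj[OF strict_2category.axioms(2)[OF that]] by auto
  show "f = g" if f: "f \<in> homset C X Y" "g \<in> homset C X Y" "on_arr F f = on_arr F g"
  proof -
    have "X \<in> Obj C" "Y \<in> Obj C" using S.homset_Obj[OF f(1)] by auto
    from iso[OF this] obtain G0 where "\<forall>f \<in> homset C X Y. G0 (on_arr F f) = f"
      unfolding cat_isomorphism_def homcat_simps by blast
    then show ?thesis using f by metis
  qed
  show "a = b" if a: "a \<in> homset (horiz C) X Y" "b \<in> homset (horiz C) X Y" "on_cell F a = on_cell F b"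
  proof -
    have "X \<in> Obj C" "Y \<in> Obj C" using S.horiz.homset_Obj[OF a(1)] by auto
    from iso[OF this] obtain G1 where "\<forall>a \<in> Arr (homcat C X Y). G1 (on_cell F a) = a"
      unfolding cat_isomorphism_def by blast
    then show ?thesis using a unfolding arr[OF S.strict_2category_axioms] by metis
  qed
  assume XY: "X \<in> Obj C" "Y \<in> Obj C"
  obtain G0 G1 where G: "cat_functor (homcat D (on_obj F X) (on_obj F Y)) (homcat C X Y) G0 G1"
    and FG: "\<forall>h \<in> Obj (homcat D (on_obj F X) (on_obj F Y)). on_arr F (G0 h) = h"
      "\<forall>c \<in> Arr (homcat D (on_obj F X) (on_obj F Y)). on_cell F (G1 c) = c"
    using iso[OF XY] unfolding cat_isomorphism_def by blast
  show "\<exists>f \<in> homset C X Y. on_arr F f = h" if "h \<in> homset D (on_obj F X) (on_obj F Y)"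
    using cat_functor.map_Obj[OF G, of h] FG(1) that unfolding homcat_simps by blast
  show "\<exists>a \<in> homset (horiz C) X Y. on_cell F a = c" if c: "c \<in> homset (horiz D) (on_obj F X) (on_obj F Y)"
  proof -
    have c': "c \<in> Arr (homcat D (on_obj F X) (on_obj F Y))" using c arr[OF T.strict_2category_axioms] by blast
    have "G1 c \<in> Arr (homcat C X Y)" using cat_functor.map_Arr[OF G c'] by (auto simp: homset_def)
    then show ?thesis using FG(2) c' arr[OF S.strict_2category_axioms] by blast
  qed
qed

text \<open>Only the preimages \<open>s\<close> of objects are chosen freely. Arrows and 2-cells
  then have unique lifts between the chosen objects, so each law of the inverse 2-functor may be
  checked after applying \<open>F\<close>, where it becomes a law of \<open>D\<close>.\<close>

lemma (in strict_2functor) two_equivalenceI: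
  assumes surj: "surjective_on_objects C D F" and sff: "strongly_fully_faithful C D F"
  shows "two_equivalence C D F"
proof -
  note inj1 = strongly_fully_faithful_cases(1)[OF sff] and inj2 = strongly_fully_faithful_cases(2)[OF sff]
    and full1 = strongly_fully_faithful_cases(3)[OF sff] and full2 = strongly_fully_faithful_cases(4)[OF sff]
  let ?F0 = "on_obj F" and ?F1 = "on_arr F" and ?F2 = "on_cell F"
  have cell_hom: "a \<in> homset (horiz C) X Y \<Longrightarrow> Src C a \<in> homset C X Y \<and> Trg C a \<in> homset C X Y" for a X Y
    using S.vert.Dom_Obj[of a] S.vert.Cod_Obj[of a] S.Dom_parallel[of a] S.Cod_parallel[of a] by auto
  have cell_hom': "a \<in> homset (horiz D) X Y \<Longrightarrow> Src D a \<in> homset D X Y \<and> Trg D a \<in> homset D X Y" for a X Y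
    using T.vert.Dom_Obj[of a] T.vert.Cod_Obj[of a] T.Dom_parallel[of a] T.Cod_parallel[of a] by auto
  have Icell_hom: "f \<in> homset C X Y \<Longrightarrow> Icell C f \<in> homset (horiz C) X Y" for f X Y
    using S.vert.Ident_Arr[of f] S.vert.Dom_Ident[of f] by auto
  have "\<exists>X \<in> Obj C. ?F0 X = Y" if "Y \<in> Obj D" for Y
    using surj that unfolding surjective_on_objects_def by (metis imageE)
  then obtain s where s: "\<And>Y. Y \<in> Obj D \<Longrightarrow> s Y \<in> Obj C" "\<And>Y. Y \<in> Obj D \<Longrightarrow> ?F0 (s Y) = Y" by metis
  have "\<exists>f \<in> homset C (s (Dom D g)) (s (Cod D g)). ?F1 f = g" if "g \<in> Arr D" for g
    by (rule full1) (use that s T.Dom_Obj T.Cod_Obj in auto)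
  then obtain G1 where "\<And>g. g \<in> Arr D \<Longrightarrow> G1 g \<in> homset C (s (Dom D g)) (s (Cod D g)) \<and> ?F1 (G1 g) = g" by metis
  then have G1: "g \<in> homset D X Y \<Longrightarrow> G1 g \<in> homset C (s X) (s Y)" and FG1: "g \<in> homset D X Y \<Longrightarrow> ?F1 (G1 g) = g" for g X Y
    by auto
  have "\<exists>a \<in> homset (horiz C) (s (Dom D (Src D b))) (s (Cod D (Src D b))). ?F2 a = b" if "b \<in> Cell D" for b
    by (rule full2) (use that s T.horiz.Dom_Obj T.horiz.Cod_Obj in auto)
  then obtain G2 where "\<And>b. b \<in> Cell D \<Longrightarrow>
      G2 b \<in> homset (horiz C) (s (Dom D (Src D b))) (s (Cod D (Src D b))) \<and> ?F2 (G2 b) = b" by metis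
  then have G2: "b \<in> homset (horiz D) X Y \<Longrightarrow> G2 b \<in> homset (horiz C) (s X) (s Y)"
    and FG2: "b \<in> homset (horiz D) X Y \<Longrightarrow> ?F2 (G2 b) = b" for b X Y
    by auto
  have h1: "f \<in> Arr D \<Longrightarrow> f \<in> homset D (Dom D f) (Cod D f)" for f by simp
  have h2: "a \<in> Cell D \<Longrightarrow> a \<in> homset (horiz D) (Dom D (Src D a)) (Cod D (Src D a))" for a by simp
  let ?G = "\<lparr>on_obj = s, on_arr = G1, on_cell = G2\<rparr>"
  have arrG: "cat_functor D C s G1"
  proof (intro cat_functor.intro cat_functor_axioms.intro T.category_axioms S.category_axioms s(1))
    fix X assume X: "X \<in> Obj D"
    show "G1 (Ident D X) = Ident C (s X)"
      by (rule inj1[OF G1[OF T.homset_Ident[OF X]] S.homset_Ident[OF s(1)[OF X]]])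
        (use FG1[OF T.homset_Ident[OF X]] arr.map_Ident[OF s(1)[OF X]] s(2)[OF X] in simp)
  next
    fix f g assume f: "f \<in> Arr D" and g: "g \<in> Arr D" and fg: "Cod D f = Dom D g"
    have f': "f \<in> homset D (Dom D f) (Dom D g)" using f fg by simp
    note Gf = G1[OF f'] and Gg = G1[OF h1[OF g]]
    show "G1 (Comp D f g) = Comp C (G1 f) (G1 g)"
      by (rule inj1[OF G1[OF T.homset_Comp[OF f' h1[OF g]]] S.homset_Comp[OF Gf Gg]])
        (use FG1[OF T.homset_Comp[OF f' h1[OF g]]] arr.map_Comp[of "G1 f" "G1 g"] Gf Gg FG1[OF f'] FG1[OF h1[OF g]] in simp)
  next
    fix f assume "f \<in> Arr D" then show "G1 f \<in> homset C (s (Dom D f)) (s (Cod D f))" by (intro G1) simp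
  qed
  have horizG: "cat_functor (horiz D) (horiz C) s G2"
  proof (intro cat_functor.intro cat_functor_axioms.intro T.horiz.category_axioms S.horiz.category_axioms)
    fix X assume "X \<in> Obj (horiz D)"
    then have X: "X \<in> Obj D" by simp
    then have X': "X \<in> Obj (horiz D)" "s X \<in> Obj (horiz C)" using s(1) by simp_all
    show "G2 (Ident (horiz D) X) = Ident (horiz C) (s X)"
      by (rule inj2[OF G2[OF T.horiz.homset_Ident[OF X'(1)]] S.horiz.homset_Ident[OF X'(2)]])
        (use FG2[OF T.horiz.homset_Ident[OF X'(1)]] horiz.map_Ident[OF X'(2)] s(2)[OF X] in simp)
  next
    fix f g assume "f \<in> Arr (horiz D)" "g \<in> Arr (horiz D)" "Cod (horiz D) f = Dom (horiz D) g"
    then have f: "f \<in> homset (horiz D) (Dom D (Src D f)) (Dom D (Src D g))" and g: "g \<in> Cell D" by simp_all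
    note Gf = G2[OF f] and Gg = G2[OF h2[OF g]]
    show "G2 (Comp (horiz D) f g) = Comp (horiz C) (G2 f) (G2 g)"
      by (rule inj2[OF G2[OF T.horiz.homset_Comp[OF f h2[OF g]]] S.horiz.homset_Comp[OF Gf Gg]])
        (use FG2[OF T.horiz.homset_Comp[OF f h2[OF g]]] horiz.map_Comp[of "G2 f" "G2 g"] Gf Gg FG2[OF f] FG2[OF h2[OF g]] in simp)
  next
    fix f assume "f \<in> Arr (horiz D)"
    then show "G2 f \<in> homset (horiz C) (s (Dom (horiz D) f)) (s (Cod (horiz D) f))" by (intro G2) simp
  qed (use s(1) in simp)
  \<comment> \<open>Lifts of 2-cells were obtained without reference to the lifts of arrows; that
    their boundaries match follows from injectivity on arrows.\<close>
  have src: "Src C (G2 b) = G1 (Src D b)" and trg: "Trg C (G2 b) = G1 (Trg D b)" if b: "b \<in> Cell D" for b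
  proof -
    note b' = h2[OF b] and Gb = G2[OF h2[OF b]]
    have F: "?F2 (G2 b) \<in> homset (vert D) (?F1 (Src C (G2 b))) (?F1 (Trg C (G2 b)))"
      using vert.map_Arr[of "G2 b"] Gb by simp
    then show "Src C (G2 b) = G1 (Src D b)"
      by (intro inj1[OF conjunct1[OF cell_hom[OF Gb]] G1[OF conjunct1[OF cell_hom'[OF b']]]])
        (use FG1[OF conjunct1[OF cell_hom'[OF b']]] FG2[OF b'] in simp)
    from F show "Trg C (G2 b) = G1 (Trg D b)"
      by (intro inj1[OF conjunct2[OF cell_hom[OF Gb]] G1[OF conjunct2[OF cell_hom'[OF b']]]])
        (use FG1[OF conjunct2[OF cell_hom'[OF b']]] FG2[OF b'] in simp)
  qed
  have vertG: "cat_functor (vert D) (vert C) G1 G2"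
  proof (intro cat_functor.intro cat_functor_axioms.intro T.vert.category_axioms S.vert.category_axioms)
    fix X assume "X \<in> Obj (vert D)"
    then show "G1 X \<in> Obj (vert C)" using G1[OF h1, of X] by simp
  next
    fix b assume "b \<in> Arr (vert D)"
    then show "G2 b \<in> homset (vert C) (G1 (Dom (vert D) b)) (G1 (Cod (vert D) b))"
      using src trg G2[OF h2, of b] by simp
  next
    fix f assume "f \<in> Obj (vert D)"
    then have f: "f \<in> Arr D" by simp
    have I: "Icell D f \<in> homset (horiz D) (Dom D f) (Cod D f)"
      using T.vert.Ident_Arr[of f] T.vert.Dom_Ident[of f] f by simp
    note Gf = G1[OF h1[OF f]]
    show "G2 (Ident (vert D) f) = Ident (vert C) (G1 f)"
      unfolding vert_simps
      by (rule inj2[OF G2[OF I] Icell_hom[OF Gf]])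
        (use FG2[OF I] vert.map_Ident[of "G1 f"] FG1[OF h1[OF f]] Gf in simp)
  next
    fix a b assume "a \<in> Arr (vert D)" "b \<in> Arr (vert D)" "Cod (vert D) a = Dom (vert D) b"
    then have a: "a \<in> Cell D" and b: "b \<in> Cell D" and ab: "Trg D a = Src D b" by simp_all
    have ab': "Vcomp D a b \<in> homset (horiz D) (Dom D (Src D a)) (Cod D (Src D a))"
      using T.vert.Comp_Arr[of a b] T.vert.Dom_Comp[of a b] a b ab by simp
    have Gab: "Trg C (G2 a) = Src C (G2 b)" using src[OF b] trg[OF a] ab by simp
    have "Vcomp C (G2 a) (G2 b) \<in> homset (horiz C) (s (Dom D (Src D a))) (s (Cod D (Src D a)))"
      using S.vert.Comp_Arr[of "G2 a" "G2 b"] S.vert.Dom_Comp[of "G2 a" "G2 b"] G2[OF h2[OF a]] G2[OF h2[OF b]] Gab by simp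
    then show "G2 (Comp (vert D) a b) = Comp (vert C) (G2 a) (G2 b)"
      unfolding vert_simps
      by (rule inj2[OF G2[OF ab']])
        (use FG2[OF ab'] vert.map_Comp[of "G2 a" "G2 b"] G2[OF h2[OF a]] G2[OF h2[OF b]] FG2[OF h2[OF a]] FG2[OF h2[OF b]] Gab in simp)
  qed
  have G: "strict_2functor D C ?G"
    using arrG horizG vertG S.strict_2category_axioms T.strict_2category_axioms
    by (simp add: strict_2functor_def)
  have F0: "?F0 X \<in> Obj D" if "X \<in> Obj C" for X by (rule arr.map_Obj[OF that])
  \<comment> \<open>\<open>X\<close> and \<open>s (?F0 X)\<close> have the same image, so the
    identity of this image lifts in both directions; the two lifts are strictly inverse to each
    other.\<close>
  have e_ex: "\<exists>e \<in> homset C X (s (?F0 X)). ?F1 e = Ident D (?F0 X)"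
    and d_ex: "\<exists>d \<in> homset C (s (?F0 X)) X. ?F1 d = Ident D (?F0 X)" if X: "X \<in> Obj C" for X
    using full1[OF X s(1)[OF F0[OF X]], of "Ident D (?F0 X)"] full1[OF s(1)[OF F0[OF X]] X, of "Ident D (?F0 X)"]
      T.homset_Ident[OF F0[OF X]] s(2)[OF F0[OF X]] by simp_all
  obtain e where e: "\<And>X. X \<in> Obj C \<Longrightarrow> e X \<in> homset C X (s (?F0 X))" "\<And>X. X \<in> Obj C \<Longrightarrow> ?F1 (e X) = Ident D (?F0 X)"
    using e_ex by metis
  have e_iso: "is_iso C (e X)" if X: "X \<in> Obj C" for X
  proof -
    obtain d where d: "d \<in> homset C (s (?F0 X)) X" "?F1 d = Ident D (?F0 X)" using d_ex[OF X] by blast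
    note I = T.homset_Ident_left[OF T.homset_Ident[OF F0[OF X]]]
    show ?thesis
    proof (rule S.is_isoI[OF e(1)[OF X] d(1)])
      show "Comp C (e X) d = Ident C X"
        by (rule inj1[OF S.homset_Comp[OF e(1)[OF X] d(1)] S.homset_Ident[OF X]])
          (use arr.map_Comp[of "e X" d] arr.map_Ident[OF X] e(1)[OF X] e(2)[OF X] d I in simp)
      show "Comp C d (e X) = Ident C (s (?F0 X))"
        by (rule inj1[OF S.homset_Comp[OF d(1) e(1)[OF X]] S.homset_Ident[OF s(1)[OF F0[OF X]]]])
          (use arr.map_Comp[of d "e X"] arr.map_Ident[OF s(1)[OF F0[OF X]]] s(2)[OF F0[OF X]] e(1)[OF X] e(2)[OF X] d I in simp)
    qed
  qed
  have "two_nat_iso C C id2 (comp2 F ?G) e"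
    unfolding two_nat_iso_def nat_iso_def
  proof (intro conjI ballI)
    fix X assume X: "X \<in> Obj C"
    show "e X \<in> homset C (on_obj id2 X) (on_obj (comp2 F ?G) X)" using e(1)[OF X] by (simp add: id2_def comp2_def)
    show "is_iso C (e X)" by (rule e_iso[OF X])
  next
    fix f assume f: "f \<in> Arr C"
    then have f': "f \<in> homset C (Dom C f) (Cod C f)" by simp
    note X = S.Dom_Obj[OF f] and Y = S.Cod_Obj[OF f] and Ff = arr.map_homset[OF f']
    note GF = G1[OF Ff]
    have "Comp C f (e (Cod C f)) = Comp C (e (Dom C f)) (G1 (?F1 f))"
    proof (rule inj1[OF S.homset_Comp[OF f' e(1)[OF Y]] S.homset_Comp[OF e(1)[OF X] GF]])
      have "?F1 (Comp C f (e (Cod C f))) = ?F1 f"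
        using arr.map_Comp[of f "e (Cod C f)"] f e(1)[OF Y] e(2)[OF Y] T.homset_Ident_right[OF Ff] by simp
      moreover have "?F1 (Comp C (e (Dom C f)) (G1 (?F1 f))) = ?F1 f"
        using arr.map_Comp[of "e (Dom C f)" "G1 (?F1 f)"] GF FG1[OF Ff] e(1)[OF X] e(2)[OF X] T.homset_Ident_left[OF Ff] by simp
      ultimately show "?F1 (Comp C f (e (Cod C f))) = ?F1 (Comp C (e (Dom C f)) (G1 (?F1 f)))" by simp
    qed
    then show "Comp C (on_arr id2 f) (e (Cod C f)) = Comp C (e (Dom C f)) (on_arr (comp2 F ?G) f)"
      by (simp add: id2_def comp2_def)
  next
    fix a assume a: "a \<in> Cell C"
    let ?X = "Dom C (Src C a)" and ?Y = "Cod C (Src C a)"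
    have a': "a \<in> homset (horiz C) ?X ?Y" using a by simp
    have X: "?X \<in> Obj C" and Y: "?Y \<in> Obj C" using S.horiz.homset_Obj[OF a'] by simp_all
    note Fa = horiz.map_homset[OF a']
    note GF = G2[OF Fa]
    have Fe: "?F2 (Icell C (e Z)) = Ident (horiz D) (?F0 Z)" if "Z \<in> Obj C" for Z
      using vert.map_Ident[of "e Z"] e[OF that] by simp
    have "Comp (horiz C) a (Icell C (e ?Y)) = Comp (horiz C) (Icell C (e ?X)) (G2 (?F2 a))"
    proof (rule inj2[OF S.horiz.homset_Comp[OF a' Icell_hom[OF e(1)[OF Y]]] S.horiz.homset_Comp[OF Icell_hom[OF e(1)[OF X]] GF]])
      have "?F2 (Comp (horiz C) a (Icell C (e ?Y))) = Comp (horiz D) (?F2 a) (?F2 (Icell C (e ?Y)))"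
        by (rule horiz.map_Comp) (use a' Icell_hom[OF e(1)[OF Y]] in auto)
      moreover have "?F2 (Comp (horiz C) (Icell C (e ?X)) (G2 (?F2 a))) = Comp (horiz D) (?F2 (Icell C (e ?X))) (?F2 (G2 (?F2 a)))"
        by (rule horiz.map_Comp) (use GF Icell_hom[OF e(1)[OF X]] in auto)
      ultimately show "?F2 (Comp (horiz C) a (Icell C (e ?Y))) = ?F2 (Comp (horiz C) (Icell C (e ?X)) (G2 (?F2 a)))"
        unfolding Fe[OF X] Fe[OF Y] FG2[OF Fa] T.horiz.homset_Ident_left[OF Fa] T.horiz.homset_Ident_right[OF Fa] by simp
    qed
    then show "Hcomp C (on_cell id2 a) (Icell C (e ?Y)) = Hcomp C (Icell C (e ?X)) (on_cell (comp2 F ?G) a)"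
      by (simp add: id2_def comp2_def)
  qed
  \<comment> \<open>Lifting and then applying \<open>F\<close> gives back the original on objects,
    arrows and 2-cells, so identities serve as the components.\<close>
  moreover have "two_nat_iso D D (comp2 ?G F) id2 (Ident D)"
    unfolding two_nat_iso_def nat_iso_def
  proof (intro conjI ballI)
    fix X assume X: "X \<in> Obj D"
    note I = T.homset_Ident[OF X]
    show "Ident D X \<in> homset D (on_obj (comp2 ?G F) X) (on_obj id2 X)" using I s(2)[OF X] by (simp add: id2_def comp2_def)
    show "is_iso D (Ident D X)" by (rule T.is_isoI[OF I I]) (use T.homset_Ident_left[OF I] in simp_all)
  next
    fix f assume f: "f \<in> Arr D"
    show "Comp D (on_arr (comp2 ?G F) f) (Ident D (Cod D f)) = Comp D (Ident D (Dom D f)) (on_arr id2 f)"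
      using FG1[OF h1[OF f]] T.homset_Ident_left[OF h1[OF f]] T.homset_Ident_right[OF h1[OF f]] by (simp add: id2_def comp2_def)
  next
    fix a assume a: "a \<in> Cell D"
    show "Hcomp D (on_cell (comp2 ?G F) a) (Icell D (Ident D (Cod D (Src D a)))) = Hcomp D (Icell D (Ident D (Dom D (Src D a)))) (on_cell id2 a)"
      using FG2[OF h2[OF a]] T.horiz.homset_Ident_left[OF h2[OF a]] T.horiz.homset_Ident_right[OF h2[OF a]] by (simp add: id2_def comp2_def)
  qed
  ultimately show ?thesis
    unfolding two_equivalence_def using strict_2functor_axioms G by blast
qed

subsection \<open>2-categories of objects with structure\<close>

text \<open>Conditions under which \<open>two_cat_over\<close> is a strict 2-category: laws of
  composition for structured arrows, and closure of the sets of 2-cells. The equations between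
  2-cells are inherited from \<open>C\<close>; \<open>ob\<close> locates the underlying arrows in
  its hom categories.\<close>

locale structured = strict_2category C
  for C :: "('o, 'a, 'c, 'm) twocat_scheme" +
  fixes Ob :: "'p set" and hom :: "'p \<Rightarrow> 'p \<Rightarrow> 'q set" and cell :: "'p \<Rightarrow> 'p \<Rightarrow> 'q \<Rightarrow> 'q \<Rightarrow> 'c set"
    and und :: "'q \<Rightarrow> 'a" and idn :: "'p \<Rightarrow> 'q" and cmp :: "'q \<Rightarrow> 'q \<Rightarrow> 'q" and ob :: "'p \<Rightarrow> 'o"
  assumes ob: "X \<in> Ob \<Longrightarrow> ob X \<in> Obj C"
    and und: "\<lbrakk>X \<in> Ob; Y \<in> Ob; f \<in> hom X Y\<rbrakk> \<Longrightarrow> und f \<in> homset C (ob X) (ob Y)"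
    and idn: "X \<in> Ob \<Longrightarrow> idn X \<in> hom X X" "X \<in> Ob \<Longrightarrow> und (idn X) = Ident C (ob X)"
    and cmp: "\<lbrakk>X \<in> Ob; Y \<in> Ob; Z \<in> Ob; f \<in> hom X Y; g \<in> hom Y Z\<rbrakk> \<Longrightarrow> cmp f g \<in> hom X Z"
      "\<lbrakk>X \<in> Ob; Y \<in> Ob; Z \<in> Ob; f \<in> hom X Y; g \<in> hom Y Z\<rbrakk> \<Longrightarrow> und (cmp f g) = Comp C (und f) (und g)"
    and unit: "\<lbrakk>X \<in> Ob; Y \<in> Ob; f \<in> hom X Y\<rbrakk> \<Longrightarrow> cmp (idn X) f = f" "\<lbrakk>X \<in> Ob; Y \<in> Ob; f \<in> hom X Y\<rbrakk> \<Longrightarrow> cmp f (idn Y) = f"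
    and assoc: "\<lbrakk>W \<in> Ob; X \<in> Ob; Y \<in> Ob; Z \<in> Ob; f \<in> hom W X; g \<in> hom X Y; h \<in> hom Y Z\<rbrakk>
      \<Longrightarrow> cmp (cmp f g) h = cmp f (cmp g h)"
    and cell: "\<lbrakk>X \<in> Ob; Y \<in> Ob; f \<in> hom X Y; g \<in> hom X Y; a \<in> cell X Y f g\<rbrakk> \<Longrightarrow> a \<in> cells C (und f) (und g)"
    and cell_Icell: "\<lbrakk>X \<in> Ob; Y \<in> Ob; f \<in> hom X Y\<rbrakk> \<Longrightarrow> Icell C (und f) \<in> cell X Y f f"
    and cell_Vcomp: "\<lbrakk>X \<in> Ob; Y \<in> Ob; f \<in> hom X Y; g \<in> hom X Y; h \<in> hom X Y; a \<in> cell X Y f g; b \<in> cell X Y g h\<rbrakk>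
      \<Longrightarrow> Vcomp C a b \<in> cell X Y f h"
    and cell_Hcomp: "\<lbrakk>X \<in> Ob; Y \<in> Ob; Z \<in> Ob; f \<in> hom X Y; g \<in> hom X Y; f' \<in> hom Y Z; g' \<in> hom Y Z; a \<in> cell X Y f g; b \<in> cell Y Z f' g'\<rbrakk>
      \<Longrightarrow> Hcomp C a b \<in> cell X Z (cmp f f') (cmp g g')"
begin

abbreviation "cat2 \<equiv> two_cat_over C Ob hom cell und idn cmp"

lemma cat2_simps:
  "Obj cat2 = Ob" "(X, Y, f) \<in> Arr cat2 \<longleftrightarrow> X \<in> Ob \<and> Y \<in> Ob \<and> f \<in> hom X Y"
  "Dom cat2 (X, Y, f) = X" "Cod cat2 (X, Y, f) = Y" "Ident cat2 X = (X, X, idn X)"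
  "Comp cat2 (X, Y, f) (Y', Z, g) = (X, Z, cmp f g)"
  "((X, Y, f), (X', Y', g), a) \<in> Cell cat2 \<longleftrightarrow> X' = X \<and> Y' = Y \<and> X \<in> Ob \<and> Y \<in> Ob \<and> f \<in> hom X Y \<and> g \<in> hom X Y \<and> a \<in> cell X Y f g"
  "Src cat2 (k, k', a) = k" "Trg cat2 (k, k', a) = k'" "Icell cat2 (X, Y, f) = ((X, Y, f), (X, Y, f), Icell C (und f))"
  "Vcomp cat2 (k, k1, a) (k2, k', b) = (k, k', Vcomp C a b)"
  "Hcomp cat2 (k, k', a) (m, m', b) = (Comp cat2 k m, Comp cat2 k' m', Hcomp C a b)"
  by (auto simp: two_cat_over_def Let_def)

lemma cat2_category: "category cat2"
  by unfold_locales (auto simp: cat2_simps idn cmp unit assoc)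

lemma cell_facts:
  assumes "X \<in> Ob" "Y \<in> Ob" "f \<in> hom X Y" "g \<in> hom X Y" "a \<in> cell X Y f g"
  shows "a \<in> Cell C" "Src C a = und f" "Trg C a = und g" "Dom C (und f) = ob X" "Cod C (und f) = ob Y" "und f \<in> Arr C"
    "Dom C (und g) = ob X" "Cod C (und g) = ob Y" "und g \<in> Arr C"
  using cell[OF assms] und[OF assms(1,2,3)] und[OF assms(1,2,4)] by auto

lemma cat2_strict_2category: "strict_2category cat2"
proof -
  have v: "category (vert cat2)"
  proof (unfold_locales, unfold vert_simps)
    fix f assume "f \<in> Arr cat2"
    then show "Icell cat2 f \<in> Cell cat2" by (cases f) (simp add: cat2_simps cell_Icell)
  next
    fix a assume a: "a \<in> Cell cat2"
    show "Vcomp cat2 (Icell cat2 (Src cat2 a)) a = a" "Vcomp cat2 a (Icell cat2 (Trg cat2 a)) = a"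
      using a vert.Ident_left[of "snd (snd a)"] vert.Ident_right[of "snd (snd a)"] cell_facts
      by (cases a; auto simp: cat2_simps)+
  next
    fix a b assume "a \<in> Cell cat2" "b \<in> Cell cat2" "Trg cat2 a = Src cat2 b"
    then show "Vcomp cat2 a b \<in> Cell cat2" "Src cat2 (Vcomp cat2 a b) = Src cat2 a" "Trg cat2 (Vcomp cat2 a b) = Trg cat2 b"
      by (cases a; cases b; auto simp: cat2_simps intro: cell_Vcomp)+
  next
    fix a b c assume "a \<in> Cell cat2" "b \<in> Cell cat2" "c \<in> Cell cat2" "Trg cat2 a = Src cat2 b" "Trg cat2 b = Src cat2 c"
    then show "Vcomp cat2 (Vcomp cat2 a b) c = Vcomp cat2 a (Vcomp cat2 b c)"
      using vert.Comp_assoc[of "snd (snd a)" "snd (snd b)" "snd (snd c)"]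
      by (cases a; cases b; cases c; auto simp: cat2_simps cell_facts)
  qed (auto simp: cat2_simps)
  have h: "category (horiz cat2)"
  proof (unfold_locales, unfold horiz_simps)
    fix X assume "X \<in> Obj cat2"
    then show "Icell cat2 (Ident cat2 X) \<in> Cell cat2"
      using cell_Icell[of X X "idn X"] idn[of X] by (simp add: cat2_simps)
  next
    fix a assume a: "a \<in> Cell cat2"
    show "Hcomp cat2 (Icell cat2 (Ident cat2 (Dom cat2 (Src cat2 a)))) a = a"
      "Hcomp cat2 a (Icell cat2 (Ident cat2 (Cod cat2 (Src cat2 a)))) = a"
      using a horiz.Ident_left[of "snd (snd a)"] horiz.Ident_right[of "snd (snd a)"]
      by (cases a; auto simp: cat2_simps idn unit cell_facts)+
  next
    fix a b assume "a \<in> Cell cat2" "b \<in> Cell cat2" "Cod cat2 (Src cat2 a) = Dom cat2 (Src cat2 b)"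
    then show "Hcomp cat2 a b \<in> Cell cat2" "Dom cat2 (Src cat2 (Hcomp cat2 a b)) = Dom cat2 (Src cat2 a)"
      "Cod cat2 (Src cat2 (Hcomp cat2 a b)) = Cod cat2 (Src cat2 b)"
      by (cases a; cases b; auto simp: cat2_simps intro: cmp cell_Hcomp)+
  next
    fix a b c assume "a \<in> Cell cat2" "b \<in> Cell cat2" "c \<in> Cell cat2"
      "Cod cat2 (Src cat2 a) = Dom cat2 (Src cat2 b)" "Cod cat2 (Src cat2 b) = Dom cat2 (Src cat2 c)"
    then show "Hcomp cat2 (Hcomp cat2 a b) c = Hcomp cat2 a (Hcomp cat2 b c)"
      using horiz.Comp_assoc[of "snd (snd a)" "snd (snd b)" "snd (snd c)"]
      by (cases a; cases b; cases c; auto simp: cat2_simps assoc cell_facts)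
  qed (auto simp: cat2_simps)
  show ?thesis
  proof (intro strict_2category.intro strict_2category_axioms.intro cat2_category v h)
    fix a b assume "a \<in> Cell cat2" "b \<in> Cell cat2" "Cod cat2 (Src cat2 a) = Dom cat2 (Src cat2 b)"
    then show "Src cat2 (Hcomp cat2 a b) = Comp cat2 (Src cat2 a) (Src cat2 b)" "Trg cat2 (Hcomp cat2 a b) = Comp cat2 (Trg cat2 a) (Trg cat2 b)"
      by (cases a; cases b; auto simp: cat2_simps)+
  next
    fix f g assume "f \<in> Arr cat2" "g \<in> Arr cat2" "Cod cat2 f = Dom cat2 g"
    then show "Icell cat2 (Comp cat2 f g) = Hcomp cat2 (Icell cat2 f) (Icell cat2 g)"
      using und by (cases f; cases g; auto simp: cat2_simps cmp Icell_Comp)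
  next
    fix a a' b b' assume "a \<in> Cell cat2" "a' \<in> Cell cat2" "b \<in> Cell cat2" "b' \<in> Cell cat2"
      "Trg cat2 a = Src cat2 a'" "Trg cat2 b = Src cat2 b'" "Cod cat2 (Src cat2 a) = Dom cat2 (Src cat2 b)"
    then show "Hcomp cat2 (Vcomp cat2 a a') (Vcomp cat2 b b') = Vcomp cat2 (Hcomp cat2 a b) (Hcomp cat2 a' b')"
      by (cases a; cases a'; cases b; cases b'; auto simp: cat2_simps cell_facts interchange)
  qed (auto simp: cat2_simps)
qed

end

text \<open>Nothing is assumed about the target beyond its being an image: objects are hit by
  \<open>P\<close>, structured arrows correspond under \<open>Q\<close>, and 2-cells are the same
  2-cells of \<open>C\<close>. This suffices to transport all laws from the source, so identities
  and composites in the target need no verification of their own.\<close>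

locale structured_forget = structured C Ob hom cell und idn cmp ob
  for C :: "('o, 'a, 'c, 'm) twocat_scheme"
    and Ob :: "'p set" and hom :: "'p \<Rightarrow> 'p \<Rightarrow> 'q set" and cell :: "'p \<Rightarrow> 'p \<Rightarrow> 'q \<Rightarrow> 'q \<Rightarrow> 'c set"
    and und :: "'q \<Rightarrow> 'a" and idn :: "'p \<Rightarrow> 'q" and cmp :: "'q \<Rightarrow> 'q \<Rightarrow> 'q" and ob :: "'p \<Rightarrow> 'o" +
  fixes Ob' :: "'r set" and hom' :: "'r \<Rightarrow> 'r \<Rightarrow> 's set" and cell' :: "'r \<Rightarrow> 'r \<Rightarrow> 's \<Rightarrow> 's \<Rightarrow> 'c set"
    and und' :: "'s \<Rightarrow> 'a" and idn' :: "'r \<Rightarrow> 's" and cmp' :: "'s \<Rightarrow> 's \<Rightarrow> 's" and P :: "'p \<Rightarrow> 'r" and Q :: "'q \<Rightarrow> 's"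
  assumes P: "P ` Ob = Ob'"
    and Q: "\<lbrakk>X \<in> Ob; Y \<in> Ob\<rbrakk> \<Longrightarrow> bij_betw Q (hom X Y) (hom' (P X) (P Y))"
    and ob_P: "\<lbrakk>X \<in> Ob; X' \<in> Ob; P X = P X'\<rbrakk> \<Longrightarrow> ob X = ob X'"
    and Q_und: "und' (Q f) = und f" and Q_idn: "Q (idn X) = idn' (P X)" and Q_cmp: "Q (cmp f g) = cmp' (Q f) (Q g)"
    and Q_cell: "\<lbrakk>X \<in> Ob; Y \<in> Ob; f \<in> hom X Y; g \<in> hom X Y\<rbrakk> \<Longrightarrow> cell' (P X) (P Y) (Q f) (Q g) = cell X Y f g"
begin

lemma Ob'_cases: assumes "Z \<in> Ob'" obtains X where "X \<in> Ob" "Z = P X"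
  using assms P by blast

lemma hom'_cases:
  assumes "X \<in> Ob" "Y \<in> Ob" "k \<in> hom' (P X) (P Y)" obtains f where "f \<in> hom X Y" "k = Q f"
proof -
  have "k \<in> Q ` hom X Y" using assms(3) unfolding bij_betw_imp_surj_on[OF Q[OF assms(1,2)]] .
  then show thesis using that by blast
qed

lemma Q_hom: "\<lbrakk>X \<in> Ob; Y \<in> Ob; f \<in> hom X Y\<rbrakk> \<Longrightarrow> Q f \<in> hom' (P X) (P Y)"
  by (rule bij_betw_apply[OF Q])

lemma P_Ob: "X \<in> Ob \<Longrightarrow> P X \<in> Ob'"
  using P by blast

text \<open>By \<open>ob_P\<close> the underlying object does not depend on the choice of the preimage.\<close>

sublocale target: structured C Ob' hom' cell' und' idn' cmp' "\<lambda>Z. ob (SOME X. X \<in> Ob \<and> P X = Z)"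
proof unfold_locales
  have ob': "ob (SOME X'. X' \<in> Ob \<and> P X' = P X) = ob X" if "X \<in> Ob" for X
    using someI[of "\<lambda>X'. X' \<in> Ob \<and> P X' = P X", OF conjI[OF that refl]] ob_P that by blast
  let ?ob = "\<lambda>Z. ob (SOME X. X \<in> Ob \<and> P X = Z)"
  fix X' assume X': "X' \<in> Ob'"
  obtain X where X: "X \<in> Ob" and X'_def: "X' = P X" by (rule Ob'_cases[OF X'])
  show "?ob X' \<in> Obj C" unfolding X'_def ob'[OF X] by (rule ob[OF X])
  show "idn' X' \<in> hom' X' X'" unfolding X'_def Q_idn[symmetric] by (rule Q_hom[OF X X idn(1)[OF X]])
  show "und' (idn' X') = Ident C (?ob X')" unfolding X'_def ob'[OF X] Q_idn[symmetric] Q_und by (rule idn(2)[OF X])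
  fix Y' assume Y': "Y' \<in> Ob'"
  obtain Y where Y: "Y \<in> Ob" and Y'_def: "Y' = P Y" by (rule Ob'_cases[OF Y'])
  fix f' assume f': "f' \<in> hom' X' Y'"
  obtain f where f: "f \<in> hom X Y" and f'_def: "f' = Q f" using hom'_cases[OF X Y] f' unfolding X'_def Y'_def by blast
  show "und' f' \<in> homset C (?ob X') (?ob Y')"
    unfolding X'_def Y'_def ob'[OF X] ob'[OF Y] f'_def Q_und by (rule und[OF X Y f])
  show "cmp' (idn' X') f' = f'" "cmp' f' (idn' Y') = f'"
    unfolding X'_def Y'_def f'_def Q_idn[symmetric] Q_cmp[symmetric] unit[OF X Y f] by (rule refl)+
  show "Icell C (und' f') \<in> cell' X' Y' f' f'"
    unfolding X'_def Y'_def f'_def Q_und Q_cell[OF X Y f f] by (rule cell_Icell[OF X Y f])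
  {
    fix g' assume g': "g' \<in> hom' X' Y'"
    obtain g where g: "g \<in> hom X Y" and g'_def: "g' = Q g" using hom'_cases[OF X Y] g' unfolding X'_def Y'_def by blast
    fix a assume "a \<in> cell' X' Y' f' g'"
    then have a: "a \<in> cell X Y f g" unfolding X'_def Y'_def f'_def g'_def Q_cell[OF X Y f g] .
    show "a \<in> cells C (und' f') (und' g')" unfolding f'_def g'_def Q_und by (rule cell[OF X Y f g a])
    {
      fix h' b assume h': "h' \<in> hom' X' Y'" and b': "b \<in> cell' X' Y' g' h'"
      obtain h where h: "h \<in> hom X Y" and h'_def: "h' = Q h" using hom'_cases[OF X Y] h' unfolding X'_def Y'_def by blast
      have b: "b \<in> cell X Y g h" using b' unfolding X'_def Y'_def g'_def h'_def Q_cell[OF X Y g h] .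
      show "Vcomp C a b \<in> cell' X' Y' f' h'"
        unfolding X'_def Y'_def f'_def h'_def Q_cell[OF X Y f h] by (rule cell_Vcomp[OF X Y f g h a b])
    }
    fix Z' h' k' b assume Z': "Z' \<in> Ob'" and h': "h' \<in> hom' Y' Z'" and k': "k' \<in> hom' Y' Z'" and b': "b \<in> cell' Y' Z' h' k'"
    obtain Z where Z: "Z \<in> Ob" and Z'_def: "Z' = P Z" by (rule Ob'_cases[OF Z'])
    obtain h where h: "h \<in> hom Y Z" and h'_def: "h' = Q h" using hom'_cases[OF Y Z] h' unfolding Y'_def Z'_def by blast
    obtain k where k: "k \<in> hom Y Z" and k'_def: "k' = Q k" using hom'_cases[OF Y Z] k' unfolding Y'_def Z'_def by blast
    have b: "b \<in> cell Y Z h k" using b' unfolding Y'_def Z'_def h'_def k'_def Q_cell[OF Y Z h k] .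
    show "Hcomp C a b \<in> cell' X' Z' (cmp' f' h') (cmp' g' k')"
      unfolding X'_def Z'_def f'_def g'_def h'_def k'_def Q_cmp[symmetric]
        Q_cell[OF X Z cmp(1)[OF X Y Z f h] cmp(1)[OF X Y Z g k]]
      by (rule cell_Hcomp[OF X Y Z f g h k a b])
  }
  fix Z' g' assume Z': "Z' \<in> Ob'" and g': "g' \<in> hom' Y' Z'"
  obtain Z where Z: "Z \<in> Ob" and Z'_def: "Z' = P Z" by (rule Ob'_cases[OF Z'])
  obtain g where g: "g \<in> hom Y Z" and g'_def: "g' = Q g" using hom'_cases[OF Y Z] g' unfolding Y'_def Z'_def by blast
  show "cmp' f' g' \<in> hom' X' Z'"
    unfolding X'_def Z'_def f'_def g'_def Q_cmp[symmetric] by (rule Q_hom[OF X Z cmp(1)[OF X Y Z f g]])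
  show "und' (cmp' f' g') = Comp C (und' f') (und' g')"
    unfolding f'_def g'_def Q_cmp[symmetric] Q_und by (rule cmp(2)[OF X Y Z f g])
  fix W' h' assume W': "W' \<in> Ob'" and h': "h' \<in> hom' Z' W'"
  obtain W where W: "W \<in> Ob" and W'_def: "W' = P W" by (rule Ob'_cases[OF W'])
  obtain h where h: "h \<in> hom Z W" and h'_def: "h' = Q h" using hom'_cases[OF Z W] h' unfolding Z'_def W'_def by blast
  show "cmp' (cmp' f' g') h' = cmp' f' (cmp' g' h')"
    unfolding f'_def g'_def h'_def Q_cmp[symmetric] assoc[OF X Y Z W f g h] by (rule refl)
qed

abbreviation fun2 ::
  "('p, 'p \<times> 'p \<times> 'q, ('p \<times> 'p \<times> 'q) \<times> ('p \<times> 'p \<times> 'q) \<times> 'c,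
    'r, 'r \<times> 'r \<times> 's, ('r \<times> 'r \<times> 's) \<times> ('r \<times> 'r \<times> 's) \<times> 'c) twofun" where
  "fun2 \<equiv> forget P Q"

lemma fun2_simps: "on_obj fun2 X = P X" "on_arr fun2 (X, Y, f) = (P X, P Y, Q f)"
  "on_cell fun2 (k, k', a) = (on_arr fun2 k, on_arr fun2 k', a)"
  by (simp_all add: forget_def Let_def)

lemma fun2_strict_2functor: "strict_2functor cat2 target.cat2 fun2"
proof -
  have arr: "cat_functor cat2 target.cat2 (on_obj fun2) (on_arr fun2)"
    by (intro cat_functor.intro cat_functor_axioms.intro cat2_category target.cat2_category)
      (auto simp: cat2_simps target.cat2_simps fun2_simps P_Ob Q_hom Q_idn Q_cmp)
  have cells: "on_cell fun2 a \<in> Cell target.cat2" if "a \<in> Cell cat2" for a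
    using that by (cases a) (auto simp: cat2_simps target.cat2_simps fun2_simps P_Ob Q_hom Q_cell)
  have vert: "cat_functor (vert cat2) (vert target.cat2) (on_arr fun2) (on_cell fun2)"
    by (intro cat_functor.intro cat_functor_axioms.intro strict_2category.axioms(2)[OF cat2_strict_2category]
        strict_2category.axioms(2)[OF target.cat2_strict_2category])
      (auto simp: cat2_simps target.cat2_simps fun2_simps P_Ob Q_hom Q_und cells Q_cell)
  have horiz: "cat_functor (horiz cat2) (horiz target.cat2) (on_obj fun2) (on_cell fun2)"
    by (intro cat_functor.intro cat_functor_axioms.intro strict_2category.axioms(3)[OF cat2_strict_2category]
        strict_2category.axioms(3)[OF target.cat2_strict_2category])
      (auto simp: cat2_simps target.cat2_simps fun2_simps P_Ob Q_hom Q_und[of "idn X" for X, unfolded Q_idn] Q_idn Q_cmp cells Q_cell)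
  show ?thesis
    using arr vert horiz cat2_strict_2category target.cat2_strict_2category by (simp add: strict_2functor_def)
qed

lemma fun2_surjective: "surjective_on_objects cat2 target.cat2 fun2"
  using P by (simp add: surjective_on_objects_def cat2_simps target.cat2_simps fun2_simps image_def)

text \<open>Once the end objects \<open>X\<close> and \<open>Y\<close> are fixed, the inverse of
  \<open>Q\<close> on this one hom-set supplies the inverse on arrows, and the underlying 2-cell of
  \<open>C\<close> is left unchanged.\<close>

lemma fun2_strongly_fully_faithful: "strongly_fully_faithful cat2 target.cat2 fun2"
  unfolding strongly_fully_faithful_def
proof (intro ballI)
  fix X Y assume "X \<in> Obj cat2" "Y \<in> Obj cat2"
  then have XY: "X \<in> Ob" "Y \<in> Ob" by (simp_all add: cat2_simps)
  define Q' where "Q' = inv_into (hom X Y) Q"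
  have Q'Q: "Q' (Q f) = f" if "f \<in> hom X Y" for f
    unfolding Q'_def using that Q[OF XY] by (simp add: bij_betw_inv_into_left)
  have QQ': "Q (Q' k) = k" and Q': "Q' k \<in> hom X Y" if "k \<in> hom' (P X) (P Y)" for k
    unfolding Q'_def using that Q[OF XY] by (simp_all add: bij_betw_inv_into_right bij_betw_apply[OF bij_betw_inv_into])
  have cell': "a \<in> cell X Y (Q' k) (Q' k')" if "a \<in> cell' (P X) (P Y) k k'" "k \<in> hom' (P X) (P Y)" "k' \<in> hom' (P X) (P Y)" for a k k'
    using Q_cell[OF XY Q'[OF that(2)] Q'[OF that(3)]] that QQ' by simp
  let ?G0 = "\<lambda>(_, _, k). (X, Y, Q' k)"
  let ?G1 = "\<lambda>(k, k', a). (?G0 k, ?G0 k', a)"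
  interpret F: strict_2functor cat2 target.cat2 fun2 by (rule fun2_strict_2functor)
  have "cat_functor (homcat cat2 X Y) (homcat target.cat2 (on_obj fun2 X) (on_obj fun2 Y)) (on_arr fun2) (on_cell fun2)"
    by (intro cat_functor.intro cat_functor_axioms.intro F.S.homcat_category F.T.homcat_category)
      (use XY in \<open>auto simp: cat2_simps target.cat2_simps fun2_simps P_Ob Q_hom Q_und Q_cell\<close>)
  moreover have "cat_functor (homcat target.cat2 (on_obj fun2 X) (on_obj fun2 Y)) (homcat cat2 X Y) ?G0 ?G1"
    by (intro cat_functor.intro cat_functor_axioms.intro F.S.homcat_category F.T.homcat_category)
      (use XY in \<open>auto simp: cat2_simps target.cat2_simps fun2_simps Q' QQ' cell' Q_und[symmetric]\<close>)
  ultimately show "cat_isomorphism (homcat cat2 X Y) (homcat target.cat2 (on_obj fun2 X) (on_obj fun2 Y)) (on_arr fun2) (on_cell fun2)"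
    unfolding cat_isomorphism_def
    by (intro conjI exI[of _ ?G0] exI[of _ ?G1]) (auto simp: cat2_simps target.cat2_simps fun2_simps Q'Q QQ')
qed

lemma fun2_two_equivalence: "two_equivalence cat2 target.cat2 fun2"
  by (rule strict_2functor.two_equivalenceI[OF fun2_strict_2functor fun2_surjective fun2_strongly_fully_faithful])

end

subsection \<open>Reversing the tensor product\<close>

text \<open>The source of most right-hand statements: a left-hand lemma is applied to this
  2-category. Composition of arrows and both compositions of 2-cells stay as they are, so no 2-cell
  changes its direction.\<close>

definition rev_tensor :: "('o, 'a, 'c) semi_monoidal \<Rightarrow> ('o, 'a, 'c) semi_monoidal" where
  "rev_tensor C = C\<lparr>Tensor := \<lparr>on_obj = (\<lambda>(X, Y). on_obj (Tensor C) (Y, X)),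
     on_arr = (\<lambda>(f, g). on_arr (Tensor C) (g, f)), on_cell = (\<lambda>(a, b). on_cell (Tensor C) (b, a))\<rparr>\<rparr>"

lemma rev_tensor_simps [simp]:
  "Obj (rev_tensor C) = Obj C" "Arr (rev_tensor C) = Arr C" "Dom (rev_tensor C) = Dom C"
  "Cod (rev_tensor C) = Cod C" "Ident (rev_tensor C) = Ident C" "Comp (rev_tensor C) = Comp C"
  "Cell (rev_tensor C) = Cell C" "Src (rev_tensor C) = Src C" "Trg (rev_tensor C) = Trg C"
  "Icell (rev_tensor C) = Icell C" "Vcomp (rev_tensor C) = Vcomp C" "Hcomp (rev_tensor C) = Hcomp C"
  "on_obj (Tensor (rev_tensor C)) (X, Y) = on_obj (Tensor C) (Y, X)"
  "on_arr (Tensor (rev_tensor C)) (f, g) = on_arr (Tensor C) (g, f)"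
  "on_cell (Tensor (rev_tensor C)) (a, b) = on_cell (Tensor C) (b, a)"
  by (simp_all add: rev_tensor_def)

lemma rev_tensor_derived [simp]:
  "vert (rev_tensor C) = vert C" "horiz (rev_tensor C) = horiz C"
  "prod2 (rev_tensor C) (rev_tensor C) = prod2 C C" "homcat (rev_tensor C) X Y = homcat C X Y"
  "homset (rev_tensor C) X Y = homset C X Y"
  "cells (rev_tensor C) f g = cells C f g" "isocells (rev_tensor C) f g = isocells C f g"
  "equi_arrow (rev_tensor C) u = equi_arrow C u"
  "pseudonatural (rev_tensor C) (rev_tensor C) F G t = pseudonatural C C F G t"
  "modification (rev_tensor C) (rev_tensor C) F G s t m = modification C C F G s t m"
  "inv_modification (rev_tensor C) (rev_tensor C) F G s t m = inv_modification C C F G s t m"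
  by (auto simp: vert_def horiz_def prod2_def homcat_def homset_def cells_def isocells_def
      equi_arrow_def pseudonatural_def modification_def inv_modification_def)

context semi_monoidal_2category
begin

lemma rev_semi_monoidal: "semi_monoidal_2category (rev_tensor C)"
proof -
  have cat: "category (rev_tensor C)"
    using category_axioms by (simp add: category_def)
  have S: "strict_2category (rev_tensor C)"
    using strict_2category_axioms cat unfolding strict_2category_def strict_2category_axioms_def by simp
  have "cat_functor (prod2 C C) (rev_tensor C) (on_obj (Tensor (rev_tensor C))) (on_arr (Tensor (rev_tensor C)))"
    by (intro cat_functor.intro cat_functor_axioms.intro cat tensor.S.category_axioms)
      (auto simp: tensor_Comp)
  moreover have "cat_functor (vert (prod2 C C)) (vert C) (on_arr (Tensor (rev_tensor C))) (on_cell (Tensor (rev_tensor C)))"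
    by (intro cat_functor.intro cat_functor_axioms.intro vert.category_axioms tensor.S.vert.category_axioms)
      (auto simp: tensor_Vcomp)
  moreover have "cat_functor (horiz (prod2 C C)) (horiz C) (on_obj (Tensor (rev_tensor C))) (on_cell (Tensor (rev_tensor C)))"
    by (intro cat_functor.intro cat_functor_axioms.intro horiz.category_axioms tensor.S.horiz.category_axioms)
      (auto simp: tensor_Hcomp)
  ultimately have "strict_2functor (prod2 C C) (rev_tensor C) (Tensor (rev_tensor C))"
    using S tensor.S.strict_2category_axioms by (simp add: strict_2functor_def)
  then show ?thesis
    using S by (simp add: semi_monoidal_2category_def semi_monoidal_2category_axioms_def)
qed

lemma lten_simps [simp]:
  "on_obj (lten I) X = I \<otimes>\<^sub>0 X" "on_arr (lten I) f = o1 I \<otimes>\<^sub>1 f" "on_cell (lten I) a = o2 I \<otimes>\<^sub>2 a"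
  by (simp_all add: lten_def)

lemma rten_simps [simp]:
  "on_obj (rten I) X = X \<otimes>\<^sub>0 I" "on_arr (rten I) f = f \<otimes>\<^sub>1 o1 I" "on_cell (rten I) a = a \<otimes>\<^sub>2 o2 I"
  by (simp_all add: rten_def)

lemma rev_ten:
  "semi_monoidal_2category.lten (rev_tensor C) I = rten I"
  "semi_monoidal_2category.rten (rev_tensor C) I = lten I"
  by (simp_all add: semi_monoidal_2category.lten_def[OF rev_semi_monoidal]
      semi_monoidal_2category.rten_def[OF rev_semi_monoidal] lten_def rten_def)

lemma rev_constraint:
  "semi_monoidal_2category.left_constraint (rev_tensor C) I l = right_constraint I l"
  "semi_monoidal_2category.right_constraint (rev_tensor C) I l = left_constraint I l"
  by (simp_all add: semi_monoidal_2category.left_constraint_def[OF rev_semi_monoidal]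
      semi_monoidal_2category.right_constraint_def[OF rev_semi_monoidal]
      left_constraint_def right_constraint_def rev_ten)

lemma rev_cancellable:
  "semi_monoidal_2category.cancellable (rev_tensor C) I = cancellable I"
  by (auto simp: semi_monoidal_2category.cancellable_def[OF rev_semi_monoidal] cancellable_def rev_ten)

lemma rev_ff_on: "semi_monoidal_2category.ff_on (rev_tensor C) X Y F1 F2 = ff_on X Y F1 F2"
  unfolding semi_monoidal_2category.ff_on_def[OF rev_semi_monoidal] ff_on_def by simp

subsection \<open>Cancellable objects\<close>

lemma homcat_homset:
  "\<lbrakk>f \<in> homset C X Y; g \<in> homset C X Y\<rbrakk> \<Longrightarrow> homset (homcat C X Y) f g = cells C f g"
  by auto

lemma homcat_is_iso:
  "is_iso (homcat C X Y) a \<longleftrightarrow> Src C a \<in> homset C X Y \<and> iso a"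
proof -
  have "a \<in> Cell C \<Longrightarrow> b \<in> Cell C \<Longrightarrow> Src C b = Trg C a \<Longrightarrow> Dom C (Src C b) = Dom C (Src C a) \<and> Cod C (Src C b) = Cod C (Src C a)" for b
    by simp
  then show ?thesis unfolding is_iso_def by auto
qed

text \<open>Cancellability is defined by the existence of a quasi-inverse, but it is used to lift
  arrows up to isomorphism and to solve equations between 2-cells; this translates between the
  two.\<close>

lemma cat_equivalence_homcat:
  assumes F: "cat_functor (homcat C X Y) (homcat C X' Y') F1 F2"
  shows "cat_equivalence (homcat C X Y) (homcat C X' Y') F1 F2 \<longleftrightarrow>
    ff_on X Y F1 F2 \<and> (\<forall>h \<in> homset C X' Y'. \<exists>f \<in> homset C X Y. \<exists>t. t \<in> isocells C (F1 f) h)"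
    (is "?E \<longleftrightarrow> _ \<and> ?S")
proof -
  interpret F: cat_functor "homcat C X Y" "homcat C X' Y'" F1 F2 by (rule F)
  have F1: "F1 f \<in> homset C X' Y'" if "f \<in> homset C X Y" for f
    using F.map_Obj[of f] that by simp
  have F2: "F2 a \<in> cells C (F1 f) (F1 g)" if "f \<in> homset C X Y" "g \<in> homset C X Y" "a \<in> cells C f g" for a f g
    using F.map_homset[of a f g] that by simp
  show ?thesis
  proof (intro iffI conjI)
    assume E: ?E
    note ff = F.equivalence_fully_faithful[OF E]
    show "ff_on X Y F1 F2"
    proof (rule ff_onI)
      fix f g a b assume "f \<in> homset C X Y" "g \<in> homset C X Y" "a \<in> cells C f g" "b \<in> cells C f g" "F2 a = F2 b"
      then show "a = b" using ff(1)[of a f g b] homcat_homset[of f X Y g] by blast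
    next
      fix f g c assume "f \<in> homset C X Y" "g \<in> homset C X Y" "c \<in> cells C (F1 f) (F1 g)"
      then show "\<exists>a \<in> cells C f g. F2 a = c"
        using ff(2)[of f g c] homcat_homset[of f X Y g] homcat_homset[OF F1 F1, of f g]
        by (simp del: cells_iff homset_iff)
    next
      fix a b assume "a \<in> Cell C" "b \<in> Cell C" "Src C a \<in> homset C X Y" "Trg C a = Src C b"
      then show "F2 (a \<bullet> b) = F2 a \<bullet> F2 b"
        using F.map_Comp[of a b] Src_Trg_simps(3,4)[of a] by (simp del: Src_Trg_simps(3,4))
    qed (use F2 F.map_Ident in auto)
    show ?S
    proof
      fix h assume "h \<in> homset C X' Y'"
      then obtain f t where "f \<in> homset C X Y" "t \<in> homset (homcat C X' Y') (F1 f) h" "is_iso (homcat C X' Y') t"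
        using ff(3)[of h] by auto
      then show "\<exists>f \<in> homset C X Y. \<exists>t. t \<in> isocells C (F1 f) h"
        by (intro bexI[of _ f] exI[of _ t]) (simp_all add: homcat_is_iso)
    qed
  next
    assume *: "ff_on X Y F1 F2 \<and> ?S"
    then have ff: "ff_on X Y F1 F2" by simp
    show ?E
    proof (rule F.equivalenceI)
      fix f g a b assume a: "a \<in> homset (homcat C X Y) f g" "b \<in> homset (homcat C X Y) f g" "F2 a = F2 b"
      show "a = b" by (rule ff_on_inj[OF ff _ _ _ _ _ a(3)]) (use a(1,2) in auto)
    next
      fix f g c assume a: "f \<in> Obj (homcat C X Y)" "g \<in> Obj (homcat C X Y)" "c \<in> homset (homcat C X' Y') (F1 f) (F1 g)"
      obtain a where "a \<in> cells C f g" "F2 a = c"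
        by (rule ff_on_surj[OF ff, of f g c]) (use a in simp_all)
      then show "\<exists>a \<in> homset (homcat C X Y) f g. F2 a = c" using a by (intro bexI[of _ a]) simp_all
    next
      fix h assume h: "h \<in> Obj (homcat C X' Y')"
      then obtain f t where "f \<in> homset C X Y" "t \<in> isocells C (F1 f) h"
        using * h unfolding homcat_simps by blast
      then show "\<exists>f \<in> Obj (homcat C X Y). \<exists>t \<in> homset (homcat C X' Y') (F1 f) h. is_iso (homcat C X' Y') t"
        using h F1[of f] by (intro bexI[of _ f] bexI[of _ t]) (simp_all add: homcat_is_iso)
    qed
  qed
qed

lemma lten_functor:
  assumes "I \<in> Obj C"
  shows "cat_functor (homcat C X Y) (homcat C (I \<otimes>\<^sub>0 X) (I \<otimes>\<^sub>0 Y)) (on_arr (lten I)) (on_cell (lten I))"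
  by (intro cat_functor.intro cat_functor_axioms.intro homcat_category) (use assms in auto)

lemma rten_functor:
  assumes "I \<in> Obj C"
  shows "cat_functor (homcat C X Y) (homcat C (X \<otimes>\<^sub>0 I) (Y \<otimes>\<^sub>0 I)) (on_arr (rten I)) (on_cell (rten I))"
  by (intro cat_functor.intro cat_functor_axioms.intro homcat_category) (use assms in auto)

text \<open>If \<open>X\<close> or \<open>Y\<close> is not an object the hom-set is empty and
  \<open>ff_on\<close> holds vacuously, which is why its first part carries no conditions on
  \<open>X\<close> and \<open>Y\<close>.\<close>

lemma cancellable_left:
  assumes "cancellable I"
  shows "ff_on X Y (\<lambda>f. o1 I \<otimes>\<^sub>1 f) (\<lambda>a. o2 I \<otimes>\<^sub>2 a)"
    and "\<lbrakk>X \<in> Obj C; Y \<in> Obj C; h \<in> homset C (I \<otimes>\<^sub>0 X) (I \<otimes>\<^sub>0 Y)\<rbrakk>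
      \<Longrightarrow> \<exists>f \<in> homset C X Y. \<exists>t. t \<in> isocells C (o1 I \<otimes>\<^sub>1 f) h"
proof -
  have I: "I \<in> Obj C" and E: "\<lbrakk>X \<in> Obj C; Y \<in> Obj C\<rbrakk> \<Longrightarrow>
      cat_equivalence (homcat C X Y) (homcat C (I \<otimes>\<^sub>0 X) (I \<otimes>\<^sub>0 Y)) (on_arr (lten I)) (on_cell (lten I))" for X Y
    using assms unfolding cancellable_def by auto
  note E' = E[unfolded cat_equivalence_homcat[OF lten_functor[OF I]] lten_simps]
  have "X \<in> Obj C \<Longrightarrow> Y \<in> Obj C \<Longrightarrow> ff_on X Y (\<lambda>f. o1 I \<otimes>\<^sub>1 f) (\<lambda>a. o2 I \<otimes>\<^sub>2 a)"
    using E' by (auto simp: ff_on_def)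
  moreover have "ff_on X Y F G" if "\<not> (X \<in> Obj C \<and> Y \<in> Obj C)" for F G
    using that by (auto simp: ff_on_def)
  ultimately show "ff_on X Y (\<lambda>f. o1 I \<otimes>\<^sub>1 f) (\<lambda>a. o2 I \<otimes>\<^sub>2 a)" by blast
  show "\<exists>f \<in> homset C X Y. \<exists>t. t \<in> isocells C (o1 I \<otimes>\<^sub>1 f) h"
    if "X \<in> Obj C" "Y \<in> Obj C" "h \<in> homset C (I \<otimes>\<^sub>0 X) (I \<otimes>\<^sub>0 Y)"
    using E'[OF that(1,2)] that(3) by blast
qed

lemma cancellable_right:
  assumes "cancellable I"
  shows "ff_on X Y (\<lambda>f. f \<otimes>\<^sub>1 o1 I) (\<lambda>a. a \<otimes>\<^sub>2 o2 I)"
    and "\<lbrakk>X \<in> Obj C; Y \<in> Obj C; h \<in> homset C (X \<otimes>\<^sub>0 I) (Y \<otimes>\<^sub>0 I)\<rbrakk>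
      \<Longrightarrow> \<exists>f \<in> homset C X Y. \<exists>t. t \<in> isocells C (f \<otimes>\<^sub>1 o1 I) h"
  using semi_monoidal_2category.cancellable_left(1)[OF rev_semi_monoidal,
      unfolded rev_cancellable rev_ff_on rev_tensor_simps, OF assms, of X Y]
    semi_monoidal_2category.cancellable_left(2)[OF rev_semi_monoidal,
      unfolded rev_cancellable rev_tensor_derived rev_tensor_simps, OF assms, of X Y h]
  by blast+

lemma cancellable_Obj: "cancellable I \<Longrightarrow> I \<in> Obj C"
  by (simp add: cancellable_def)

text \<open>By the interchange of composition and tensor product, tensoring with \<open>u\<close> is
  tensoring with its codomain followed by precomposition with uX. The first is fully faithful by
  cancellability and the second since uX is an equi-arrow. This is the means by which a factor
  \<open>u\<close> is removed from the equation of a square.\<close>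

lemma ff_equi_tensor:
  assumes "equi u" "cancellable (Cod C u)"
  shows "ff_on X Y (\<lambda>f. u \<otimes>\<^sub>1 f) (\<lambda>a. a2 u \<otimes>\<^sub>2 a)"
proof (cases "X \<in> Obj C")
  case True
  have u: "u \<in> Arr C" using assms(1) by (rule equi_Arr)
  have "equi (u \<otimes>\<^sub>1 o1 X)" using assms(1) True by (intro equi_tensor equi_id)
  then have "ff_on (Cod C u \<otimes>\<^sub>0 X) (Cod C u \<otimes>\<^sub>0 Y) (\<lambda>f. (u \<otimes>\<^sub>1 o1 X) \<sharp>\<^sub>1 f) (\<lambda>a. a2 (u \<otimes>\<^sub>1 o1 X) \<sharp>\<^sub>2 a)"
    by (rule ff_pre) (use u True in simp)
  from ff_on_comp[OF cancellable_left(1)[OF assms(2)] this]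
  have "ff_on X Y (\<lambda>f. (u \<otimes>\<^sub>1 o1 X) \<sharp>\<^sub>1 (o1 (Cod C u) \<otimes>\<^sub>1 f)) (\<lambda>a. a2 (u \<otimes>\<^sub>1 o1 X) \<sharp>\<^sub>2 (o2 (Cod C u) \<otimes>\<^sub>2 a))"
    using u by simp
  then show ?thesis
  proof (rule ff_on_cong)
    fix f assume "f \<in> homset C X Y"
    then show "u \<otimes>\<^sub>1 f = (u \<otimes>\<^sub>1 o1 X) \<sharp>\<^sub>1 (o1 (Cod C u) \<otimes>\<^sub>1 f)" using u True by (simp add: tensor_Comp)
  next
    fix a assume "a \<in> Cell C" "Src C a \<in> homset C X Y"
    then show "a2 u \<otimes>\<^sub>2 a = a2 (u \<otimes>\<^sub>1 o1 X) \<sharp>\<^sub>2 (o2 (Cod C u) \<otimes>\<^sub>2 a)"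
      using u True tensor_Hcomp[of "a2 u" "o2 (Cod C u)" "o2 X" a] by simp
  qed
qed (auto simp: ff_on_def)

text \<open>A pseudo-inverse of Ih has the form Iw up to isomorphism, by essential surjectivity, and
  the two comparison cells descend to \<open>h\<close> and \<open>w\<close> by full
  faithfulness.\<close>

lemma equi_reflect_left:
  assumes I: "cancellable I" and h: "equi (o1 I \<otimes>\<^sub>1 h)" and h1: "h \<in> Arr C"
  shows "equi h"
proof -
  note I' = cancellable_Obj[OF I]
  obtain v p q where v: "v \<in> homset C (I \<otimes>\<^sub>0 Cod C h) (I \<otimes>\<^sub>0 Dom C h)"
    and p: "p \<in> isocells C ((o1 I \<otimes>\<^sub>1 h) \<sharp>\<^sub>1 v) (o1 I \<otimes>\<^sub>1 o1 (Dom C h))"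
    and q: "q \<in> isocells C (v \<sharp>\<^sub>1 (o1 I \<otimes>\<^sub>1 h)) (o1 I \<otimes>\<^sub>1 o1 (Cod C h))"
    using h h1 I' by (elim equiE) simp_all
  obtain w t where w: "w \<in> homset C (Cod C h) (Dom C h)" and t: "t \<in> isocells C (o1 I \<otimes>\<^sub>1 w) v"
    using cancellable_left(2)[OF I _ _ v] h1 by auto
  have "(a2 (o1 I \<otimes>\<^sub>1 h) \<sharp>\<^sub>2 t) \<bullet> p \<in> isocells C (o1 I \<otimes>\<^sub>1 (h \<sharp>\<^sub>1 w)) (o1 I \<otimes>\<^sub>1 o1 (Dom C h))"
    using h1 w t p v I' by (simp add: tensor_Comp)
  then obtain p' where p': "p' \<in> isocells C (h \<sharp>\<^sub>1 w) (o1 (Dom C h))"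
    by (rule ff_on_isocell[OF cancellable_left(1)[OF I], of _ "Dom C h" "Dom C h", rotated 2])
      (use h1 w in auto)
  have "(t \<sharp>\<^sub>2 a2 (o1 I \<otimes>\<^sub>1 h)) \<bullet> q \<in> isocells C (o1 I \<otimes>\<^sub>1 (w \<sharp>\<^sub>1 h)) (o1 I \<otimes>\<^sub>1 o1 (Cod C h))"
    using h1 w t q v I' by (simp add: tensor_Comp)
  then obtain q' where q': "q' \<in> isocells C (w \<sharp>\<^sub>1 h) (o1 (Cod C h))"
    by (rule ff_on_isocell[OF cancellable_left(1)[OF I], of _ "Cod C h" "Cod C h", rotated 2])
      (use h1 w in auto)
  show ?thesis by (rule equiI[OF h1 _ _ _ p' q']) (use w in simp_all)
qed

lemma equi_reflect_right:
  "\<lbrakk>cancellable I; equi (h \<otimes>\<^sub>1 o1 I); h \<in> Arr C\<rbrakk> \<Longrightarrow> equi h"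
  using semi_monoidal_2category.equi_reflect_left[OF rev_semi_monoidal, unfolded rev_cancellable, of I h] by simp

text \<open>The naturality cells exhibit If followed by the constraint at \<open>Y\<close> as
  isomorphic to the constraint at \<open>X\<close> followed by \<open>f\<close>. Both constraints
  are equi-arrows, so tensoring with \<open>I\<close> inherits full faithfulness and essential
  surjectivity from whiskering.\<close>

lemma left_constraint_ff:
  assumes I: "I \<in> Obj C" and l: "left_constraint I l"
  shows "ff_on X Y (\<lambda>f. o1 I \<otimes>\<^sub>1 f) (\<lambda>a. o2 I \<otimes>\<^sub>2 a)"
    and "\<lbrakk>X \<in> Obj C; Y \<in> Obj C; h \<in> homset C (I \<otimes>\<^sub>0 X) (I \<otimes>\<^sub>0 Y)\<rbrakk>
      \<Longrightarrow> \<exists>f \<in> homset C X Y. \<exists>t. t \<in> isocells C (o1 I \<otimes>\<^sub>1 f) h"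
proof -
  let ?l = "comp_at l" and ?c = "cell_at l"
  have l0: "?l X \<in> Arr C" "Dom C (?l X) = I \<otimes>\<^sub>0 X" "Cod C (?l X) = X" "equi (?l X)" if "X \<in> Obj C" for X
    using l that unfolding left_constraint_def pseudonatural_def by (auto simp: id2_def)
  have l1: "?c f \<in> isocells C ((o1 I \<otimes>\<^sub>1 f) \<sharp>\<^sub>1 ?l (Cod C f)) (?l (Dom C f) \<sharp>\<^sub>1 f)" if "f \<in> Arr C" for f
    using l that unfolding left_constraint_def pseudonatural_def by (auto simp: id2_def)
  have l2: "((o2 I \<otimes>\<^sub>2 a) \<sharp>\<^sub>2 a2 (?l (Cod C (Src C a)))) \<bullet> ?c (Trg C a)
      = ?c (Src C a) \<bullet> (a2 (?l (Dom C (Src C a))) \<sharp>\<^sub>2 a)" if "a \<in> Cell C" for a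
    using l that unfolding left_constraint_def pseudonatural_def by (auto simp: id2_def)
  show "ff_on X Y (\<lambda>f. o1 I \<otimes>\<^sub>1 f) (\<lambda>a. o2 I \<otimes>\<^sub>2 a)"
  proof (rule ff_onI)
    fix f g a b assume f: "f \<in> homset C X Y" "g \<in> homset C X Y" and ab: "a \<in> cells C f g" "b \<in> cells C f g"
      and eq: "o2 I \<otimes>\<^sub>2 a = o2 I \<otimes>\<^sub>2 b"
    have XY: "X \<in> Obj C" "Y \<in> Obj C" using f by auto
    have "?c f \<bullet> (a2 (?l X) \<sharp>\<^sub>2 a) = ?c f \<bullet> (a2 (?l X) \<sharp>\<^sub>2 b)"
      using l2[of a] l2[of b] f ab eq by simp
    then have "a2 (?l X) \<sharp>\<^sub>2 a = a2 (?l X) \<sharp>\<^sub>2 b"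
      by (subst (asm) Vcomp_cancel_left) (use l1[of f] f ab l0[OF XY(1)] in simp_all)
    then show "a = b"
      by (intro ff_on_inj[OF ff_pre[OF l0(4)[OF XY(1)] refl], of a b Y]) (use ab f l0[OF XY(1)] in simp_all)
  next
    fix f g c assume f: "f \<in> homset C X Y" "g \<in> homset C X Y" and c: "c \<in> cells C (o1 I \<otimes>\<^sub>1 f) (o1 I \<otimes>\<^sub>1 g)"
    have XY: "X \<in> Obj C" "Y \<in> Obj C" using f by auto
    note lX = l0[OF XY(1)] and lY = l0[OF XY(2)]
    have cf: "?c f \<in> isocells C ((o1 I \<otimes>\<^sub>1 f) \<sharp>\<^sub>1 ?l Y) (?l X \<sharp>\<^sub>1 f)"
      and cg: "?c g \<in> isocells C ((o1 I \<otimes>\<^sub>1 g) \<sharp>\<^sub>1 ?l Y) (?l X \<sharp>\<^sub>1 g)" using l1[of f] l1[of g] f by auto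
    \<comment> \<open>Naturality in 2-cells prescribes the whiskering of \<open>a\<close> with the
      constraint at \<open>X\<close> once Ia is to be \<open>c\<close>.\<close>
    obtain a where a: "a \<in> cells C f g" "a2 (?l X) \<sharp>\<^sub>2 a = inv2 (?c f) \<bullet> (c \<sharp>\<^sub>2 a2 (?l Y)) \<bullet> ?c g"
      by (rule ff_on_surj[OF ff_pre[OF lX(4) refl], of f Y g "inv2 (?c f) \<bullet> (c \<sharp>\<^sub>2 a2 (?l Y)) \<bullet> ?c g"])
        (use c cf cg lX lY f I in auto)
    have "((o2 I \<otimes>\<^sub>2 a) \<sharp>\<^sub>2 a2 (?l Y)) \<bullet> ?c g = (c \<sharp>\<^sub>2 a2 (?l Y)) \<bullet> ?c g"
      using l2[of a] a f c cf cg lX lY I by simp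
    then have "(o2 I \<otimes>\<^sub>2 a) \<sharp>\<^sub>2 a2 (?l Y) = c \<sharp>\<^sub>2 a2 (?l Y)"
      by (subst (asm) Vcomp_cancel_right) (use a c cg f I lY in simp_all)
    then have "o2 I \<otimes>\<^sub>2 a = c"
      by (intro ff_on_inj[OF ff_post[OF lY(4) refl], of "o2 I \<otimes>\<^sub>2 a" c "I \<otimes>\<^sub>0 X"]) (use a c f I lY in simp_all)
    then show "\<exists>a \<in> cells C f g. o2 I \<otimes>\<^sub>2 a = c" using a(1) by blast
  qed (use I in auto)
  show "\<exists>f \<in> homset C X Y. \<exists>t. t \<in> isocells C (o1 I \<otimes>\<^sub>1 f) h"
    if XY: "X \<in> Obj C" "Y \<in> Obj C" and h: "h \<in> homset C (I \<otimes>\<^sub>0 X) (I \<otimes>\<^sub>0 Y)"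
  proof -
    note lX = l0[OF XY(1)] and lY = l0[OF XY(2)]
    obtain v p where v: "v \<in> homset C X (I \<otimes>\<^sub>0 X)" "p \<in> isocells C (?l X \<sharp>\<^sub>1 v) (o1 (I \<otimes>\<^sub>0 X))"
      by (rule equiE[OF lX(4)]) (use lX in auto)
    \<comment> \<open>A conjugate of \<open>h\<close> by the constraints, with the pseudo-inverse
      \<open>v\<close> in place of an inverse of the constraint at \<open>X\<close>.\<close>
    define f where "f = v \<sharp>\<^sub>1 h \<sharp>\<^sub>1 ?l Y"
    have f: "f \<in> homset C X Y" using v h lY by (simp add: f_def)
    have "?c f \<bullet> (p \<sharp>\<^sub>2 a2 (h \<sharp>\<^sub>1 ?l Y)) \<in> isocells C ((o1 I \<otimes>\<^sub>1 f) \<sharp>\<^sub>1 ?l Y) (h \<sharp>\<^sub>1 ?l Y)"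
      using l1[of f] f v h lX lY by (simp add: f_def)
    then obtain t where "t \<in> isocells C (o1 I \<otimes>\<^sub>1 f) h"
      by (rule ff_on_isocell[OF ff_post[OF lY(4) refl], of _ "I \<otimes>\<^sub>0 X", rotated 2]) (use f h lY I in auto)
    then show ?thesis using f by blast
  qed
qed

lemma right_constraint_ff:
  assumes I: "I \<in> Obj C" and r: "right_constraint I r"
  shows "ff_on X Y (\<lambda>f. f \<otimes>\<^sub>1 o1 I) (\<lambda>a. a \<otimes>\<^sub>2 o2 I)"
    and "\<lbrakk>X \<in> Obj C; Y \<in> Obj C; h \<in> homset C (X \<otimes>\<^sub>0 I) (Y \<otimes>\<^sub>0 I)\<rbrakk>
      \<Longrightarrow> \<exists>f \<in> homset C X Y. \<exists>t. t \<in> isocells C (f \<otimes>\<^sub>1 o1 I) h"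
  using semi_monoidal_2category.left_constraint_ff(1)[OF rev_semi_monoidal,
      unfolded rev_constraint rev_ff_on rev_tensor_simps, OF assms, of X Y]
    semi_monoidal_2category.left_constraint_ff(2)[OF rev_semi_monoidal,
      unfolded rev_constraint rev_tensor_derived rev_tensor_simps, OF assms, of X Y h]
  by blast+

text \<open>This supplies the cancellability that GPS units have without its being part of their
  data.\<close>

lemma constraints_cancellable:
  assumes I: "I \<in> Obj C" "left_constraint I l" "right_constraint I r"
  shows "cancellable I"
proof -
  have e: "on_arr (lten I) = (\<lambda>f. o1 I \<otimes>\<^sub>1 f)" "on_cell (lten I) = (\<lambda>a. o2 I \<otimes>\<^sub>2 a)"
    "on_arr (rten I) = (\<lambda>f. f \<otimes>\<^sub>1 o1 I)" "on_cell (rten I) = (\<lambda>a. a \<otimes>\<^sub>2 o2 I)"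
    by (simp_all add: lten_def rten_def)
  show ?thesis
    unfolding cancellable_def cat_equivalence_homcat[OF lten_functor[OF I(1)]]
      cat_equivalence_homcat[OF rten_functor[OF I(1)]]
    unfolding e
    using left_constraint_ff[OF I(1,2)] right_constraint_ff[OF I(1,3)] I(1) by blast
qed

text \<open>Allows rewriting with an equation between two-step composites at the front of a longer
  right-nested pasting.\<close>

lemma Vcomp_extend:
  "\<lbrakk>a \<bullet> b = c \<bullet> d; a \<in> Cell C; b \<in> Cell C; c \<in> Cell C; d \<in> Cell C; r \<in> Cell C;
    Trg C a = Src C b; Trg C c = Src C d; Trg C b = Src C r; Trg C d = Src C r\<rbrakk>
    \<Longrightarrow> a \<bullet> b \<bullet> r = c \<bullet> d \<bullet> r"
  by (metis cell_assoc(1))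

lemma ff_on_eq_iff:
  assumes "ff_on X Y F1 F2" "a \<in> Cell C" "b \<in> Cell C" "Src C b = Src C a" "Trg C b = Trg C a"
    "Src C a \<in> homset C X Y"
  shows "F2 a = F2 b \<longleftrightarrow> a = b"
  using ff_on_inj[OF assms] by blast

lemma exchange_swap:
  assumes "a \<in> Cell C" "b \<in> Cell C" "Cod C (Src C a) = Dom C (Src C b)"
    "f = Src C a" "f' = Trg C a" "g = Src C b" "g' = Trg C b"
  shows "(a \<sharp>\<^sub>2 a2 g) \<bullet> (a2 f' \<sharp>\<^sub>2 b) = (a2 f \<sharp>\<^sub>2 b) \<bullet> (a \<sharp>\<^sub>2 a2 g')"
  using exchange[OF assms] by simp

text \<open>
  The prism has top face \<open>a = X\<alpha>Y\<close>, \<open>b = \<rho>\<^sub>XIY\<close>, \<open>c = XI\<lambda>\<^sub>Y\<close>, \<open>p = X\<lambda>\<^sub>Y\<close>, \<open>q = \<rho>\<^sub>XY\<close> and a similar bottom face.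
  The equation for \<open>K\<close> whiskered with \<open>a\<close> becomes the one for \<open>R\<close> whiskered with \<open>p'\<close>.
\<close>

lemma prism:
  assumes arr: "a \<in> homset C A B" "b \<in> homset C A B" "c \<in> homset C A B" "p \<in> homset C B D" "q \<in> homset C B D"
    "a' \<in> homset C A' B'" "b' \<in> homset C A' B'" "c' \<in> homset C A' B'" "p' \<in> homset C B' D'" "q' \<in> homset C B' D'"
    "x \<in> homset C A A'" "y \<in> homset C B B'" "z \<in> homset C D D'"
    and bp: "b \<sharp>\<^sub>1 p = c \<sharp>\<^sub>1 q" "b' \<sharp>\<^sub>1 p' = c' \<sharp>\<^sub>1 q'"
    and cells: "R \<in> cells C a b" "L \<in> cells C c a" "K \<in> cells C p q"
    "R' \<in> cells C a' b'" "L' \<in> isocells C c' a'" "K' \<in> cells C p' q'"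
    "ua \<in> isocells C (a \<sharp>\<^sub>1 y) (x \<sharp>\<^sub>1 a')" "ub \<in> cells C (b \<sharp>\<^sub>1 y) (x \<sharp>\<^sub>1 b')" "uc \<in> cells C (c \<sharp>\<^sub>1 y) (x \<sharp>\<^sub>1 c')"
    "up \<in> isocells C (p \<sharp>\<^sub>1 z) (y \<sharp>\<^sub>1 p')" "uq \<in> cells C (q \<sharp>\<^sub>1 z) (y \<sharp>\<^sub>1 q')"
    and K: "(R \<sharp>\<^sub>2 a2 p) \<bullet> (L \<sharp>\<^sub>2 a2 q) = a2 a \<sharp>\<^sub>2 K" "(R' \<sharp>\<^sub>2 a2 p') \<bullet> (L' \<sharp>\<^sub>2 a2 q') = a2 a' \<sharp>\<^sub>2 K'"
    and u: "(a2 b \<sharp>\<^sub>2 up) \<bullet> (ub \<sharp>\<^sub>2 a2 p') = (a2 c \<sharp>\<^sub>2 uq) \<bullet> (uc \<sharp>\<^sub>2 a2 q')"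
    and L: "(L \<sharp>\<^sub>2 a2 y) \<bullet> ua = uc \<bullet> (a2 x \<sharp>\<^sub>2 L')"
    and equi: "equi a" "equi p'"
  shows "(K \<sharp>\<^sub>2 a2 z) \<bullet> uq = up \<bullet> (a2 y \<sharp>\<^sub>2 K') \<longleftrightarrow> (R \<sharp>\<^sub>2 a2 y) \<bullet> ub = ua \<bullet> (a2 x \<sharp>\<^sub>2 R')"
proof -
  note [simp] = arr[unfolded homset_iff] cells[unfolded cells_iff isocells_iff] bp
  have bp3: "b \<sharp>\<^sub>1 p \<sharp>\<^sub>1 z = c \<sharp>\<^sub>1 q \<sharp>\<^sub>1 z" using arg_cong[OF bp(1), of "\<lambda>t. t \<sharp>\<^sub>1 z"] by (simp del: bp)
  let ?l = "a2 a \<sharp>\<^sub>2 ((K \<sharp>\<^sub>2 a2 z) \<bullet> uq)" and ?r = "a2 a \<sharp>\<^sub>2 (up \<bullet> (a2 y \<sharp>\<^sub>2 K'))"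
  let ?L = "a2 x \<sharp>\<^sub>2 L' \<sharp>\<^sub>2 a2 q'"
  have h1: "a2 a \<sharp>\<^sub>2 K \<sharp>\<^sub>2 a2 z = (R \<sharp>\<^sub>2 a2 (p \<sharp>\<^sub>1 z)) \<bullet> (L \<sharp>\<^sub>2 a2 (q \<sharp>\<^sub>1 z))"
    using arg_cong[OF K(1), of "\<lambda>t. t \<sharp>\<^sub>2 a2 z"] by simp
  have h2: "(L \<sharp>\<^sub>2 a2 (q \<sharp>\<^sub>1 z)) \<bullet> (a2 a \<sharp>\<^sub>2 uq) = (a2 c \<sharp>\<^sub>2 uq) \<bullet> (L \<sharp>\<^sub>2 a2 (y \<sharp>\<^sub>1 q'))"
    by (rule exchange_swap) simp_all
  have h3: "(L \<sharp>\<^sub>2 a2 (y \<sharp>\<^sub>1 q')) \<bullet> (ua \<sharp>\<^sub>2 a2 q') = (uc \<sharp>\<^sub>2 a2 q') \<bullet> ?L"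
    using arg_cong[OF L, of "\<lambda>t. t \<sharp>\<^sub>2 a2 q'"] by simp
  have h5: "(R \<sharp>\<^sub>2 a2 (p \<sharp>\<^sub>1 z)) \<bullet> (a2 b \<sharp>\<^sub>2 up) = (a2 a \<sharp>\<^sub>2 up) \<bullet> (R \<sharp>\<^sub>2 a2 (y \<sharp>\<^sub>1 p'))"
    by (rule exchange_swap) simp_all
  have h6: "(a2 (a \<sharp>\<^sub>1 y) \<sharp>\<^sub>2 K') \<bullet> (ua \<sharp>\<^sub>2 a2 q') = (ua \<sharp>\<^sub>2 a2 p') \<bullet> (a2 (x \<sharp>\<^sub>1 a') \<sharp>\<^sub>2 K')"
    by (rule exchange_swap[symmetric]) simp_all
  have h7: "a2 (x \<sharp>\<^sub>1 a') \<sharp>\<^sub>2 K' = (a2 x \<sharp>\<^sub>2 R' \<sharp>\<^sub>2 a2 p') \<bullet> ?L"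
    using arg_cong[OF K(2), of "\<lambda>t. a2 x \<sharp>\<^sub>2 t"] by simp
  \<comment> \<open>The remaining faces are pasted on one after another: the triangle
    \<open>K\<close>, the square \<open>L\<close> and the compatibility \<open>u\<close>, with
    exchange laws in between. What survives is the equation for \<open>R\<close>, whiskered with
    \<open>p'\<close>, between outer cells shared by both sides.\<close>
  have "?l \<bullet> (ua \<sharp>\<^sub>2 a2 q') = (a2 a \<sharp>\<^sub>2 K \<sharp>\<^sub>2 a2 z) \<bullet> (a2 a \<sharp>\<^sub>2 uq) \<bullet> (ua \<sharp>\<^sub>2 a2 q')"
    by simp
  also have "\<dots> = (R \<sharp>\<^sub>2 a2 (p \<sharp>\<^sub>1 z)) \<bullet> (L \<sharp>\<^sub>2 a2 (q \<sharp>\<^sub>1 z)) \<bullet> (a2 a \<sharp>\<^sub>2 uq) \<bullet> (ua \<sharp>\<^sub>2 a2 q')"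
    unfolding h1 by (simp add: bp3)
  also have "\<dots> = (R \<sharp>\<^sub>2 a2 (p \<sharp>\<^sub>1 z)) \<bullet> (a2 c \<sharp>\<^sub>2 uq) \<bullet> (L \<sharp>\<^sub>2 a2 (y \<sharp>\<^sub>1 q')) \<bullet> (ua \<sharp>\<^sub>2 a2 q')"
    by (simp add: Vcomp_extend[OF h2])
  also have "\<dots> = (R \<sharp>\<^sub>2 a2 (p \<sharp>\<^sub>1 z)) \<bullet> (a2 b \<sharp>\<^sub>2 up) \<bullet> (ub \<sharp>\<^sub>2 a2 p') \<bullet> ?L"
    unfolding h3 by (subst Vcomp_extend[OF u[symmetric]]) (simp_all add: bp3)
  also have "\<dots> = (a2 a \<sharp>\<^sub>2 up) \<bullet> (R \<sharp>\<^sub>2 a2 (y \<sharp>\<^sub>1 p')) \<bullet> (ub \<sharp>\<^sub>2 a2 p') \<bullet> ?L"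
    by (subst Vcomp_extend[OF h5]) (simp_all add: bp3)
  finally have 1: "?l \<bullet> (ua \<sharp>\<^sub>2 a2 q') = (a2 a \<sharp>\<^sub>2 up) \<bullet> (((R \<sharp>\<^sub>2 a2 y) \<bullet> ub) \<sharp>\<^sub>2 a2 p') \<bullet> ?L"
    by simp
  have "?r \<bullet> (ua \<sharp>\<^sub>2 a2 q') = (a2 a \<sharp>\<^sub>2 up) \<bullet> (a2 (a \<sharp>\<^sub>1 y) \<sharp>\<^sub>2 K') \<bullet> (ua \<sharp>\<^sub>2 a2 q')"
    by simp
  also have "\<dots> = (a2 a \<sharp>\<^sub>2 up) \<bullet> ((ua \<bullet> (a2 x \<sharp>\<^sub>2 R')) \<sharp>\<^sub>2 a2 p') \<bullet> ?L"
    unfolding h6 h7 by simp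
  finally have 2: "?r \<bullet> (ua \<sharp>\<^sub>2 a2 q') = (a2 a \<sharp>\<^sub>2 up) \<bullet> ((ua \<bullet> (a2 x \<sharp>\<^sub>2 R')) \<sharp>\<^sub>2 a2 p') \<bullet> ?L" .
  \<comment> \<open>Every cell that was pasted on is invertible, and whiskering with
    \<open>a\<close> and with \<open>p'\<close> is faithful, so all passages can be
    reversed.\<close>
  have "(K \<sharp>\<^sub>2 a2 z) \<bullet> uq = up \<bullet> (a2 y \<sharp>\<^sub>2 K') \<longleftrightarrow> ?l = ?r"
    by (rule ff_on_eq_iff[OF ff_pre[OF equi(1) refl, of D'], symmetric]) simp_all
  also have "\<dots> \<longleftrightarrow> ?l \<bullet> (ua \<sharp>\<^sub>2 a2 q') = ?r \<bullet> (ua \<sharp>\<^sub>2 a2 q')"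
    by (subst Vcomp_cancel_right) simp_all
  also have "\<dots> \<longleftrightarrow> (((R \<sharp>\<^sub>2 a2 y) \<bullet> ub) \<sharp>\<^sub>2 a2 p') \<bullet> ?L = ((ua \<bullet> (a2 x \<sharp>\<^sub>2 R')) \<sharp>\<^sub>2 a2 p') \<bullet> ?L"
    unfolding 1 2 by (rule Vcomp_cancel_left) simp_all
  also have "\<dots> \<longleftrightarrow> ((R \<sharp>\<^sub>2 a2 y) \<bullet> ub) \<sharp>\<^sub>2 a2 p' = (ua \<bullet> (a2 x \<sharp>\<^sub>2 R')) \<sharp>\<^sub>2 a2 p'"
    by (rule Vcomp_cancel_right) simp_all
  also have "\<dots> \<longleftrightarrow> (R \<sharp>\<^sub>2 a2 y) \<bullet> ub = ua \<bullet> (a2 x \<sharp>\<^sub>2 R')"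
    by (rule ff_on_eq_iff[OF ff_post[OF equi(2) refl, of A]]) simp_all
  finally show ?thesis .
qed

subsection \<open>Squares\<close>

text \<open>
  The tensor products below are moved to the outside of composites.  Since \<open>\<otimes>\<close> associates to the right,
  the simplifier needs separate rules when the factors of one side have to be regrouped.
\<close>

lemma tensor_Comp3:
  "\<lbrakk>f \<in> Arr C; g \<in> Arr C; h \<in> Arr C; k \<in> Arr C; m \<in> Arr C; Cod C f \<otimes>\<^sub>0 Cod C g = Dom C k; Cod C h = Dom C m\<rbrakk>
    \<Longrightarrow> (f \<otimes>\<^sub>1 g \<otimes>\<^sub>1 h) \<sharp>\<^sub>1 (k \<otimes>\<^sub>1 m) = ((f \<otimes>\<^sub>1 g) \<sharp>\<^sub>1 k) \<otimes>\<^sub>1 (h \<sharp>\<^sub>1 m)"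
  "\<lbrakk>f \<in> Arr C; g \<in> Arr C; h \<in> Arr C; k \<in> Arr C; m \<in> Arr C; Cod C k = Dom C f \<otimes>\<^sub>0 Dom C g; Cod C m = Dom C h\<rbrakk>
    \<Longrightarrow> (k \<otimes>\<^sub>1 m) \<sharp>\<^sub>1 (f \<otimes>\<^sub>1 g \<otimes>\<^sub>1 h) = (k \<sharp>\<^sub>1 (f \<otimes>\<^sub>1 g)) \<otimes>\<^sub>1 (m \<sharp>\<^sub>1 h)"
  using tensor_Comp[of "f \<otimes>\<^sub>1 g" k h m] tensor_Comp[of k "f \<otimes>\<^sub>1 g" m h] by simp_all

lemma tensor_Comp_assoc:
  "\<lbrakk>f \<in> Arr C; g \<in> Arr C; h \<in> Arr C; k \<in> Arr C; r \<in> Arr C; Cod C f = Dom C g; Cod C h = Dom C k;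
    Dom C r = Cod C g \<otimes>\<^sub>0 Cod C k\<rbrakk>
    \<Longrightarrow> (f \<otimes>\<^sub>1 h) \<sharp>\<^sub>1 (g \<otimes>\<^sub>1 k) \<sharp>\<^sub>1 r = ((f \<sharp>\<^sub>1 g) \<otimes>\<^sub>1 (h \<sharp>\<^sub>1 k)) \<sharp>\<^sub>1 r"
  using Comp_assoc[of "f \<otimes>\<^sub>1 h" "g \<otimes>\<^sub>1 k" r] by (simp add: tensor_Comp)

lemma tensor_whisker:
  "\<lbrakk>f \<in> Arr C; h \<in> Arr C; b \<in> Cell C; d \<in> Cell C; Cod C f = Dom C (Src C b); Cod C h = Dom C (Src C d)\<rbrakk>
    \<Longrightarrow> a2 (f \<otimes>\<^sub>1 h) \<sharp>\<^sub>2 (b \<otimes>\<^sub>2 d) = (a2 f \<sharp>\<^sub>2 b) \<otimes>\<^sub>2 (a2 h \<sharp>\<^sub>2 d)"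
  "\<lbrakk>f \<in> Arr C; h \<in> Arr C; b \<in> Cell C; d \<in> Cell C; Cod C (Src C b) = Dom C f; Cod C (Src C d) = Dom C h\<rbrakk>
    \<Longrightarrow> (b \<otimes>\<^sub>2 d) \<sharp>\<^sub>2 a2 (f \<otimes>\<^sub>1 h) = (b \<sharp>\<^sub>2 a2 f) \<otimes>\<^sub>2 (d \<sharp>\<^sub>2 a2 h)"
  using tensor_Hcomp[of "a2 f" b "a2 h" d] tensor_Hcomp[of b "a2 f" d "a2 h"] by simp_all

lemma tensor_whisker3:
  assumes "f \<in> Arr C" "g \<in> Arr C" "h \<in> Arr C" "k \<in> Cell C" "m \<in> Cell C"
  shows "\<lbrakk>Cod C f \<otimes>\<^sub>0 Cod C g = Dom C (Src C k); Cod C h = Dom C (Src C m)\<rbrakk>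
    \<Longrightarrow> a2 (f \<otimes>\<^sub>1 g \<otimes>\<^sub>1 h) \<sharp>\<^sub>2 (k \<otimes>\<^sub>2 m) = (a2 (f \<otimes>\<^sub>1 g) \<sharp>\<^sub>2 k) \<otimes>\<^sub>2 (a2 h \<sharp>\<^sub>2 m)"
  "\<lbrakk>Cod C (Src C k) = Dom C f \<otimes>\<^sub>0 Dom C g; Cod C (Src C m) = Dom C h\<rbrakk>
    \<Longrightarrow> (k \<otimes>\<^sub>2 m) \<sharp>\<^sub>2 a2 (f \<otimes>\<^sub>1 g \<otimes>\<^sub>1 h) = (k \<sharp>\<^sub>2 a2 (f \<otimes>\<^sub>1 g)) \<otimes>\<^sub>2 (m \<sharp>\<^sub>2 a2 h)"
  using assms tensor_whisker[of "f \<otimes>\<^sub>1 g" h k m] by simp_all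

lemma tensor_whisker3':
  assumes "f \<in> Arr C" "g \<in> Arr C" "a \<in> Cell C" "b \<in> Cell C" "d \<in> Cell C"
  shows "\<lbrakk>Cod C f = Dom C (Src C a) \<otimes>\<^sub>0 Dom C (Src C b); Cod C g = Dom C (Src C d)\<rbrakk>
    \<Longrightarrow> a2 (f \<otimes>\<^sub>1 g) \<sharp>\<^sub>2 (a \<otimes>\<^sub>2 b \<otimes>\<^sub>2 d) = (a2 f \<sharp>\<^sub>2 (a \<otimes>\<^sub>2 b)) \<otimes>\<^sub>2 (a2 g \<sharp>\<^sub>2 d)"
  "\<lbrakk>Cod C (Src C a) \<otimes>\<^sub>0 Cod C (Src C b) = Dom C f; Cod C (Src C d) = Dom C g\<rbrakk>
    \<Longrightarrow> (a \<otimes>\<^sub>2 b \<otimes>\<^sub>2 d) \<sharp>\<^sub>2 a2 (f \<otimes>\<^sub>1 g) = ((a \<otimes>\<^sub>2 b) \<sharp>\<^sub>2 a2 f) \<otimes>\<^sub>2 (d \<sharp>\<^sub>2 a2 g)"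
  using assms tensor_whisker[of f g "a \<otimes>\<^sub>2 b" d] by simp_all

lemmas merge = tensor_Comp tensor_Comp3 tensor_Comp_assoc tensor_Hcomp tensor_whisker tensor_whisker3 tensor_whisker3'

text \<open>
  A left square over \<open>u : I \<rightarrow> J\<close> and \<open>f : X \<rightarrow> Y\<close> subsumes the cells \<open>\<lambda>\<^sub>f\<close> (where \<open>u\<close> is an
  identity, and \<open>w\<close> is the inverse of \<open>\<lambda>\<^sub>f\<close>), \<open>U\<^sup>l\<^sub>X\<close> (where \<open>f\<close> is an identity) and \<open>K\<^sup>\<lambda>\<close>.
\<close>

definition left_data :: "'o \<Rightarrow> 'a \<Rightarrow> 'o \<Rightarrow> 'a \<Rightarrow> 'c \<Rightarrow> bool" where
  "left_data I \<alpha> X p L \<longleftrightarrow> I \<in> Obj C \<and> \<alpha> \<in> homset C (I \<otimes>\<^sub>0 I) I \<and> X \<in> Obj C \<and> p \<in> homset C (I \<otimes>\<^sub>0 X) X \<and>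
     L \<in> isocells C (o1 I \<otimes>\<^sub>1 p) (\<alpha> \<otimes>\<^sub>1 o1 X)"

definition left_square :: "'a \<Rightarrow> 'c \<Rightarrow> 'a \<Rightarrow> 'c \<Rightarrow> 'a \<Rightarrow> 'a \<Rightarrow> 'c \<Rightarrow> 'c \<Rightarrow> bool" where
  "left_square p L q M u f W w \<longleftrightarrow> w \<in> isocells C (p \<sharp>\<^sub>1 f) ((u \<otimes>\<^sub>1 f) \<sharp>\<^sub>1 q) \<and>
     (L \<sharp>\<^sub>2 a2 (u \<otimes>\<^sub>1 f)) \<bullet> W = (a2 u \<otimes>\<^sub>2 w) \<bullet> (a2 (u \<otimes>\<^sub>1 u \<otimes>\<^sub>1 f) \<sharp>\<^sub>2 M)"

text \<open>The face of the square built from \<alpha>: it is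
  \<open>a2 (\<alpha> \<otimes>\<^sub>1 f)\<close> when \<open>u\<close> is an identity, and
  \<open>U \<otimes>\<^sub>2 a2 f\<close> for the structure cell \<open>U\<close> of an arrow of
  units.\<close>

definition base_cell :: "'a \<Rightarrow> 'o \<Rightarrow> 'a \<Rightarrow> 'o \<Rightarrow> 'a \<Rightarrow> 'a \<Rightarrow> 'c \<Rightarrow> bool" where
  "base_cell \<alpha> X \<beta> Y u f W \<longleftrightarrow> W \<in> isocells C ((\<alpha> \<otimes>\<^sub>1 o1 X) \<sharp>\<^sub>1 (u \<otimes>\<^sub>1 f)) ((u \<otimes>\<^sub>1 u \<otimes>\<^sub>1 f) \<sharp>\<^sub>1 (\<beta> \<otimes>\<^sub>1 o1 Y))"

lemma left_dataD:
  assumes "left_data I \<alpha> X p L"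
  shows "I \<in> Obj C" "\<alpha> \<in> Arr C" "Dom C \<alpha> = I \<otimes>\<^sub>0 I" "Cod C \<alpha> = I" "X \<in> Obj C" "p \<in> Arr C"
    "Dom C p = I \<otimes>\<^sub>0 X" "Cod C p = X" "L \<in> Cell C" "Src C L = o1 I \<otimes>\<^sub>1 p" "Trg C L = \<alpha> \<otimes>\<^sub>1 o1 X" "iso L"
  using assms unfolding left_data_def by simp_all

text \<open>Whiskering the invertible \<open>M\<close> gives an invertible 2-cell, so the equation
  can be solved for \<open>a2 u \<otimes>\<^sub>2 w\<close>; then \<open>ff_equi_tensor\<close>
  removes the factor \<open>u\<close>.\<close>

lemma left_square_ex1:
  assumes "left_data I \<alpha> X p L" "left_data J \<beta> Y q M" and J: "cancellable J" and u: "equi u" "u \<in> homset C I J"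
    and f: "f \<in> homset C X Y" and W: "base_cell \<alpha> X \<beta> Y u f W"
  shows "\<exists>!w. left_square p L q M u f W w"
proof -
  note [simp] = left_dataD[OF assms(1)] left_dataD[OF assms(2)] u(2)[unfolded homset_iff] f[unfolded homset_iff]
    merge W[unfolded base_cell_def isocells_iff]
  have ff: "ff_on (I \<otimes>\<^sub>0 X) Y (\<lambda>h. u \<otimes>\<^sub>1 h) (\<lambda>a. a2 u \<otimes>\<^sub>2 a)"
    by (rule ff_equi_tensor[OF u(1)]) (use J in simp)
  let ?M = "a2 (u \<otimes>\<^sub>1 u \<otimes>\<^sub>1 f) \<sharp>\<^sub>2 M"
  let ?c = "(L \<sharp>\<^sub>2 a2 (u \<otimes>\<^sub>1 f)) \<bullet> W \<bullet> inv2 ?M"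
  have c: "?c \<in> isocells C (u \<otimes>\<^sub>1 (p \<sharp>\<^sub>1 f)) (u \<otimes>\<^sub>1 ((u \<otimes>\<^sub>1 f) \<sharp>\<^sub>1 q))" by simp
  obtain w where w: "w \<in> isocells C (p \<sharp>\<^sub>1 f) ((u \<otimes>\<^sub>1 f) \<sharp>\<^sub>1 q)" "a2 u \<otimes>\<^sub>2 w = ?c"
    by (rule ff_on_isocell[OF ff _ _ c]) simp_all
  show ?thesis
  proof (rule ex1I)
    show "left_square p L q M u f W w" unfolding left_square_def w(2) using w(1) by simp
  next
    fix w' assume w': "left_square p L q M u f W w'"
    then have t: "w' \<in> isocells C (p \<sharp>\<^sub>1 f) ((u \<otimes>\<^sub>1 f) \<sharp>\<^sub>1 q)" unfolding left_square_def by blast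
    have "(a2 u \<otimes>\<^sub>2 w') \<bullet> ?M = (L \<sharp>\<^sub>2 a2 (u \<otimes>\<^sub>1 f)) \<bullet> W" using w' unfolding left_square_def by metis
    also have "\<dots> = (a2 u \<otimes>\<^sub>2 w) \<bullet> ?M" unfolding w(2) by simp
    finally have "a2 u \<otimes>\<^sub>2 w' = a2 u \<otimes>\<^sub>2 w" by (subst (asm) Vcomp_cancel_right) (use t w(1) in simp_all)
    then show "w' = w" by (subst (asm) ff_on_eq_iff[OF ff]) (use t w(1) in simp_all)
  qed
qed

lemma left_square_id:
  assumes "left_data I \<alpha> X p L"
  shows "left_square p L p L (o1 I) (o1 X) (a2 (\<alpha> \<otimes>\<^sub>1 o1 X)) (a2 p)"
proof -
  note [simp] = left_dataD[OF assms(1)]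
  show ?thesis unfolding left_square_def by simp
qed

text \<open>Together with uniqueness this is the engine for naturality and functoriality: two ways
  of pasting squares agree as soon as the pasted base cells agree, and the latter is a computation
  with tensor products.\<close>

lemma left_square_comp:
  assumes "left_data I \<alpha> X p L" "left_data J \<beta> Y q M" "left_data K \<gamma> Z r N"
    and u: "u \<in> homset C I J" and f: "f \<in> homset C X Y" and W: "base_cell \<alpha> X \<beta> Y u f W"
    and v: "v \<in> homset C J K" and g: "g \<in> homset C Y Z" and V: "base_cell \<beta> Y \<gamma> Z v g V"
    and w: "left_square p L q M u f W w" "left_square q M r N v g V w'"
  shows "left_square p L r N (u \<sharp>\<^sub>1 v) (f \<sharp>\<^sub>1 g) ((W \<sharp>\<^sub>2 a2 (v \<otimes>\<^sub>1 g)) \<bullet> (a2 (u \<otimes>\<^sub>1 u \<otimes>\<^sub>1 f) \<sharp>\<^sub>2 V))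
    ((w \<sharp>\<^sub>2 a2 g) \<bullet> (a2 (u \<otimes>\<^sub>1 f) \<sharp>\<^sub>2 w'))"
proof -
  note [simp] = left_dataD[OF assms(1)] left_dataD[OF assms(2)] left_dataD[OF assms(3)]
    u[unfolded homset_iff] f[unfolded homset_iff] v[unfolded homset_iff] g[unfolded homset_iff]
    W[unfolded base_cell_def isocells_iff] V[unfolded base_cell_def isocells_iff]
    w[unfolded left_square_def isocells_iff, THEN conjunct1]
    merge
  have e1: "(L \<sharp>\<^sub>2 a2 (u \<otimes>\<^sub>1 f)) \<bullet> W = (a2 u \<otimes>\<^sub>2 w) \<bullet> (a2 (u \<otimes>\<^sub>1 u \<otimes>\<^sub>1 f) \<sharp>\<^sub>2 M)"
    and e2: "(M \<sharp>\<^sub>2 a2 (v \<otimes>\<^sub>1 g)) \<bullet> V = (a2 v \<otimes>\<^sub>2 w') \<bullet> (a2 (v \<otimes>\<^sub>1 v \<otimes>\<^sub>1 g) \<sharp>\<^sub>2 N)"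
    using w unfolding left_square_def by blast+
  have "(L \<sharp>\<^sub>2 a2 ((u \<sharp>\<^sub>1 v) \<otimes>\<^sub>1 (f \<sharp>\<^sub>1 g))) \<bullet> (W \<sharp>\<^sub>2 a2 (v \<otimes>\<^sub>1 g)) \<bullet> (a2 (u \<otimes>\<^sub>1 u \<otimes>\<^sub>1 f) \<sharp>\<^sub>2 V)
    = (((L \<sharp>\<^sub>2 a2 (u \<otimes>\<^sub>1 f)) \<bullet> W) \<sharp>\<^sub>2 a2 (v \<otimes>\<^sub>1 g)) \<bullet> (a2 (u \<otimes>\<^sub>1 u \<otimes>\<^sub>1 f) \<sharp>\<^sub>2 V)"
    by simp
  also have "\<dots> = ((a2 u \<otimes>\<^sub>2 w) \<sharp>\<^sub>2 a2 (v \<otimes>\<^sub>1 g)) \<bullet> (a2 (u \<otimes>\<^sub>1 u \<otimes>\<^sub>1 f) \<sharp>\<^sub>2 ((M \<sharp>\<^sub>2 a2 (v \<otimes>\<^sub>1 g)) \<bullet> V))"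
    unfolding e1 by simp
  also have "\<dots> = (a2 (u \<sharp>\<^sub>1 v) \<otimes>\<^sub>2 ((w \<sharp>\<^sub>2 a2 g) \<bullet> (a2 (u \<otimes>\<^sub>1 f) \<sharp>\<^sub>2 w'))) \<bullet>
      (a2 ((u \<sharp>\<^sub>1 v) \<otimes>\<^sub>1 (u \<sharp>\<^sub>1 v) \<otimes>\<^sub>1 (f \<sharp>\<^sub>1 g)) \<sharp>\<^sub>2 N)"
    unfolding e2 by simp
  finally show ?thesis unfolding left_square_def by simp
qed

text \<open>With \<open>T\<close> an identity this yields naturality of the constraint in the 2-cell
  \<open>a\<close>; with \<open>a\<close> an identity it relates (T1) to (T0). Pasting with
  \<open>L\<close> and \<open>M\<close> turns the equation of base cells into the equation of the
  squares tensored with \<open>T\<close>.\<close>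

lemma left_square_cell:
  assumes "left_data I \<alpha> X p L" "left_data J \<beta> Y q M" and J: "cancellable J" and v: "equi v" "v \<in> homset C I J"
    and u: "u \<in> homset C I J" and f: "f \<in> homset C X Y" "g \<in> homset C X Y"
    and W: "base_cell \<alpha> X \<beta> Y u f W" "base_cell \<alpha> X \<beta> Y v g W'"
    and T: "T \<in> isocells C u v" and a: "a \<in> cells C f g"
    and w: "left_square p L q M u f W w" "left_square p L q M v g W' w'"
  shows "w \<bullet> ((T \<otimes>\<^sub>2 a) \<sharp>\<^sub>2 a2 q) = (a2 p \<sharp>\<^sub>2 a) \<bullet> w' \<longleftrightarrow>
    W \<bullet> ((T \<otimes>\<^sub>2 T \<otimes>\<^sub>2 a) \<sharp>\<^sub>2 a2 (\<beta> \<otimes>\<^sub>1 o1 Y)) = (a2 (\<alpha> \<otimes>\<^sub>1 o1 X) \<sharp>\<^sub>2 (T \<otimes>\<^sub>2 a)) \<bullet> W'"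
    (is "?l = ?r \<longleftrightarrow> _")
proof -
  note [simp] = left_dataD[OF assms(1)] left_dataD[OF assms(2)]
    u[unfolded homset_iff] f[unfolded homset_iff] v(2)[unfolded homset_iff]
    W[unfolded base_cell_def isocells_iff] T[unfolded isocells_iff] a[unfolded cells_iff]
    w[unfolded left_square_def isocells_iff, THEN conjunct1]
    merge
  have e1: "(L \<sharp>\<^sub>2 a2 (u \<otimes>\<^sub>1 f)) \<bullet> W = (a2 u \<otimes>\<^sub>2 w) \<bullet> (a2 (u \<otimes>\<^sub>1 u \<otimes>\<^sub>1 f) \<sharp>\<^sub>2 M)"
    and e2: "(L \<sharp>\<^sub>2 a2 (v \<otimes>\<^sub>1 g)) \<bullet> W' = (a2 v \<otimes>\<^sub>2 w') \<bullet> (a2 (v \<otimes>\<^sub>1 v \<otimes>\<^sub>1 g) \<sharp>\<^sub>2 M)"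
    using w unfolding left_square_def by blast+
  let ?W = "W \<bullet> ((T \<otimes>\<^sub>2 T \<otimes>\<^sub>2 a) \<sharp>\<^sub>2 a2 (\<beta> \<otimes>\<^sub>1 o1 Y))"
  let ?W' = "(a2 (\<alpha> \<otimes>\<^sub>1 o1 X) \<sharp>\<^sub>2 (T \<otimes>\<^sub>2 a)) \<bullet> W'"
  let ?N = "a2 (v \<otimes>\<^sub>1 v \<otimes>\<^sub>1 g) \<sharp>\<^sub>2 M"
  have ff: "ff_on (I \<otimes>\<^sub>0 X) Y (\<lambda>h. v \<otimes>\<^sub>1 h) (\<lambda>a. a2 v \<otimes>\<^sub>2 a)"
    by (rule ff_equi_tensor[OF v(1)]) (use J in simp)
  have x1: "(a2 (u \<otimes>\<^sub>1 u \<otimes>\<^sub>1 f) \<sharp>\<^sub>2 M) \<bullet> ((T \<otimes>\<^sub>2 T \<otimes>\<^sub>2 a) \<sharp>\<^sub>2 a2 (\<beta> \<otimes>\<^sub>1 o1 Y))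
      = ((T \<otimes>\<^sub>2 T \<otimes>\<^sub>2 a) \<sharp>\<^sub>2 a2 (o1 J \<otimes>\<^sub>1 q)) \<bullet> ?N"
    by (rule exchange_swap[symmetric]) simp_all
  have x2: "(L \<sharp>\<^sub>2 a2 (u \<otimes>\<^sub>1 f)) \<bullet> (a2 (\<alpha> \<otimes>\<^sub>1 o1 X) \<sharp>\<^sub>2 (T \<otimes>\<^sub>2 a))
      = (a2 (o1 I \<otimes>\<^sub>1 p) \<sharp>\<^sub>2 (T \<otimes>\<^sub>2 a)) \<bullet> (L \<sharp>\<^sub>2 a2 (v \<otimes>\<^sub>1 g))"
    by (rule exchange_swap) simp_all
  have y1: "(T \<otimes>\<^sub>2 T \<otimes>\<^sub>2 a) \<sharp>\<^sub>2 a2 (o1 J \<otimes>\<^sub>1 q) = T \<otimes>\<^sub>2 ((T \<otimes>\<^sub>2 a) \<sharp>\<^sub>2 a2 q)" by simp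
  have y2: "a2 (o1 I \<otimes>\<^sub>1 p) \<sharp>\<^sub>2 (T \<otimes>\<^sub>2 a) = T \<otimes>\<^sub>2 (a2 p \<sharp>\<^sub>2 a)" by simp
  have t1: "(a2 u \<otimes>\<^sub>2 w) \<bullet> (T \<otimes>\<^sub>2 ((T \<otimes>\<^sub>2 a) \<sharp>\<^sub>2 a2 q)) = T \<otimes>\<^sub>2 ?l"
    by (subst tensor_Vcomp) simp_all
  have t2: "(T \<otimes>\<^sub>2 (a2 p \<sharp>\<^sub>2 a)) \<bullet> (a2 v \<otimes>\<^sub>2 w') = T \<otimes>\<^sub>2 ?r"
    by (subst tensor_Vcomp) simp_all
  \<comment> \<open>\<open>T\<close> is invertible, so tensoring with \<open>T\<close> is as
    faithful as tensoring with its target \<open>v\<close>.\<close>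
  have t3: "T \<otimes>\<^sub>2 z = (T \<otimes>\<^sub>2 a2 (p \<sharp>\<^sub>1 f)) \<bullet> (a2 v \<otimes>\<^sub>2 z)"
    if "z \<in> cells C (p \<sharp>\<^sub>1 f) ((v \<otimes>\<^sub>1 g) \<sharp>\<^sub>1 q)" for z
    by (rule tensor_exchange(1)[symmetric]) (use that in simp_all)
  have "(L \<sharp>\<^sub>2 a2 (u \<otimes>\<^sub>1 f)) \<bullet> ?W = ((L \<sharp>\<^sub>2 a2 (u \<otimes>\<^sub>1 f)) \<bullet> W) \<bullet> ((T \<otimes>\<^sub>2 T \<otimes>\<^sub>2 a) \<sharp>\<^sub>2 a2 (\<beta> \<otimes>\<^sub>1 o1 Y))"
    by simp
  also have "\<dots> = (a2 u \<otimes>\<^sub>2 w) \<bullet> (a2 (u \<otimes>\<^sub>1 u \<otimes>\<^sub>1 f) \<sharp>\<^sub>2 M) \<bullet> ((T \<otimes>\<^sub>2 T \<otimes>\<^sub>2 a) \<sharp>\<^sub>2 a2 (\<beta> \<otimes>\<^sub>1 o1 Y))"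
    unfolding e1 by simp
  also have "\<dots> = ((a2 u \<otimes>\<^sub>2 w) \<bullet> (T \<otimes>\<^sub>2 ((T \<otimes>\<^sub>2 a) \<sharp>\<^sub>2 a2 q))) \<bullet> ?N"
    unfolding x1 y1 by simp
  finally have 1: "(L \<sharp>\<^sub>2 a2 (u \<otimes>\<^sub>1 f)) \<bullet> ?W = (T \<otimes>\<^sub>2 ?l) \<bullet> ?N" unfolding t1 .
  have "(L \<sharp>\<^sub>2 a2 (u \<otimes>\<^sub>1 f)) \<bullet> ?W' = ((L \<sharp>\<^sub>2 a2 (u \<otimes>\<^sub>1 f)) \<bullet> (a2 (\<alpha> \<otimes>\<^sub>1 o1 X) \<sharp>\<^sub>2 (T \<otimes>\<^sub>2 a))) \<bullet> W'"
    by simp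
  also have "\<dots> = (T \<otimes>\<^sub>2 (a2 p \<sharp>\<^sub>2 a)) \<bullet> (L \<sharp>\<^sub>2 a2 (v \<otimes>\<^sub>1 g)) \<bullet> W'"
    unfolding x2 y2 by simp
  also have "\<dots> = ((T \<otimes>\<^sub>2 (a2 p \<sharp>\<^sub>2 a)) \<bullet> (a2 v \<otimes>\<^sub>2 w')) \<bullet> ?N"
    unfolding e2 by simp
  finally have 2: "(L \<sharp>\<^sub>2 a2 (u \<otimes>\<^sub>1 f)) \<bullet> ?W' = (T \<otimes>\<^sub>2 ?r) \<bullet> ?N" unfolding t2 .
  have "?W = ?W' \<longleftrightarrow> (L \<sharp>\<^sub>2 a2 (u \<otimes>\<^sub>1 f)) \<bullet> ?W = (L \<sharp>\<^sub>2 a2 (u \<otimes>\<^sub>1 f)) \<bullet> ?W'"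
    by (rule Vcomp_cancel_left[symmetric]) simp_all
  also have "\<dots> \<longleftrightarrow> T \<otimes>\<^sub>2 ?l = T \<otimes>\<^sub>2 ?r"
    unfolding 1 2 by (rule Vcomp_cancel_right) simp_all
  also have "\<dots> \<longleftrightarrow> (T \<otimes>\<^sub>2 a2 (p \<sharp>\<^sub>1 f)) \<bullet> (a2 v \<otimes>\<^sub>2 ?l) = (T \<otimes>\<^sub>2 a2 (p \<sharp>\<^sub>1 f)) \<bullet> (a2 v \<otimes>\<^sub>2 ?r)"
    by (subst (1 2) t3) simp_all
  also have "\<dots> \<longleftrightarrow> a2 v \<otimes>\<^sub>2 ?l = a2 v \<otimes>\<^sub>2 ?r"
    by (rule Vcomp_cancel_left) simp_all
  also have "\<dots> \<longleftrightarrow> ?l = ?r"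
    by (rule ff_on_eq_iff[OF ff]) simp_all
  finally show ?thesis by simp
qed

definition right_data :: "'o \<Rightarrow> 'a \<Rightarrow> 'o \<Rightarrow> 'a \<Rightarrow> 'c \<Rightarrow> bool" where
  "right_data I \<alpha> X p R \<longleftrightarrow> I \<in> Obj C \<and> \<alpha> \<in> homset C (I \<otimes>\<^sub>0 I) I \<and> X \<in> Obj C \<and> p \<in> homset C (X \<otimes>\<^sub>0 I) X \<and>
     R \<in> isocells C (o1 X \<otimes>\<^sub>1 \<alpha>) (p \<otimes>\<^sub>1 o1 I)"

definition right_square :: "'a \<Rightarrow> 'c \<Rightarrow> 'a \<Rightarrow> 'c \<Rightarrow> 'a \<Rightarrow> 'a \<Rightarrow> 'c \<Rightarrow> 'c \<Rightarrow> bool" where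
  "right_square p R q S u f W w \<longleftrightarrow> w \<in> isocells C (p \<sharp>\<^sub>1 f) ((f \<otimes>\<^sub>1 u) \<sharp>\<^sub>1 q) \<and>
     (R \<sharp>\<^sub>2 a2 (f \<otimes>\<^sub>1 u)) \<bullet> (w \<otimes>\<^sub>2 a2 u) = W \<bullet> (a2 (f \<otimes>\<^sub>1 u \<otimes>\<^sub>1 u) \<sharp>\<^sub>2 S)"

definition right_base_cell :: "'a \<Rightarrow> 'o \<Rightarrow> 'a \<Rightarrow> 'o \<Rightarrow> 'a \<Rightarrow> 'a \<Rightarrow> 'c \<Rightarrow> bool" where
  "right_base_cell \<alpha> X \<beta> Y u f W \<longleftrightarrow> W \<in> isocells C ((o1 X \<otimes>\<^sub>1 \<alpha>) \<sharp>\<^sub>1 (f \<otimes>\<^sub>1 u)) ((f \<otimes>\<^sub>1 u \<otimes>\<^sub>1 u) \<sharp>\<^sub>1 (o1 Y \<otimes>\<^sub>1 \<beta>))"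

lemma right_dataD:
  assumes "right_data I \<alpha> X p R"
  shows "I \<in> Obj C" "\<alpha> \<in> Arr C" "Dom C \<alpha> = I \<otimes>\<^sub>0 I" "Cod C \<alpha> = I" "X \<in> Obj C" "p \<in> Arr C"
    "Dom C p = X \<otimes>\<^sub>0 I" "Cod C p = X" "R \<in> Cell C" "Src C R = o1 X \<otimes>\<^sub>1 \<alpha>" "Trg C R = p \<otimes>\<^sub>1 o1 I" "iso R"
  using assms unfolding right_data_def by simp_all

text \<open>\<open>L\<close> ends at the face built from \<alpha> while \<open>R\<close> starts
  there. Reversing the tensor product does not reverse 2-cells, so the left datum of the reversed
  2-category is the inverse of \<open>R\<close>.\<close>

lemma rev_left_data:
  "right_data I \<alpha> X p R \<Longrightarrow> semi_monoidal_2category.left_data (rev_tensor C) I \<alpha> X p (inv2 R)"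
  by (simp add: semi_monoidal_2category.left_data_def[OF rev_semi_monoidal] right_data_def)

lemma rev_base_cell:
  assumes "\<alpha> \<in> Arr C" "\<beta> \<in> Arr C" "u \<in> Arr C" "f \<in> Arr C"
  shows "semi_monoidal_2category.base_cell (rev_tensor C) \<alpha> X \<beta> Y u f W \<longleftrightarrow> right_base_cell \<alpha> X \<beta> Y u f W"
  using assms by (simp add: semi_monoidal_2category.base_cell_def[OF rev_semi_monoidal] right_base_cell_def)

text \<open>Inverting two opposite sides of a commuting square; this turns a square for
  \<open>inv2 R\<close> and \<open>inv2 S\<close> into one for \<open>R\<close> and
  \<open>S\<close>.\<close>

lemma inverse_square:
  assumes "r \<in> Cell C" "w \<in> Cell C" "W \<in> Cell C" "s \<in> Cell C" "i \<in> Cell C" "j \<in> Cell C"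
    "Trg C r = Src C w" "Trg C W = Src C s" "Src C r = Src C W" "Trg C w = Trg C s"
    "Src C i = Trg C r" "Trg C i = Src C r" "Src C j = Trg C s" "Trg C j = Src C s"
    "r \<bullet> i = a2 (Src C r)" "i \<bullet> r = a2 (Trg C r)" "s \<bullet> j = a2 (Src C s)" "j \<bullet> s = a2 (Trg C s)"
  shows "i \<bullet> W = w \<bullet> j \<longleftrightarrow> r \<bullet> w = W \<bullet> s"
proof
  assume "i \<bullet> W = w \<bullet> j"
  then have "r \<bullet> (i \<bullet> W) \<bullet> s = r \<bullet> (w \<bullet> j) \<bullet> s" by simp
  then have "(r \<bullet> i) \<bullet> W \<bullet> s = (r \<bullet> w) \<bullet> (j \<bullet> s)" using assms(1-14) by simp
  then show "r \<bullet> w = W \<bullet> s" unfolding assms(15,18) using assms(1-14) by simp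
next
  assume "r \<bullet> w = W \<bullet> s"
  then have "i \<bullet> (r \<bullet> w) \<bullet> j = i \<bullet> (W \<bullet> s) \<bullet> j" by simp
  then have "(i \<bullet> r) \<bullet> w \<bullet> j = (i \<bullet> W) \<bullet> (s \<bullet> j)" using assms(1-14) by simp
  then show "i \<bullet> W = w \<bullet> j" unfolding assms(16,17) using assms(1-14) by simp
qed

lemma rev_left_square:
  assumes "right_data I \<alpha> X p R" "right_data J \<beta> Y q S" "u \<in> homset C I J" "f \<in> homset C X Y"
    "right_base_cell \<alpha> X \<beta> Y u f W"
  shows "semi_monoidal_2category.left_square (rev_tensor C) p (inv2 R) q (inv2 S) u f W w
    \<longleftrightarrow> right_square p R q S u f W w"
proof -
  note [simp] = right_dataD[OF assms(1)] right_dataD[OF assms(2)] assms(3,4)[unfolded homset_iff]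
    assms(5)[unfolded right_base_cell_def isocells_iff] merge
  show ?thesis
    unfolding semi_monoidal_2category.left_square_def[OF rev_semi_monoidal] right_square_def
      rev_tensor_derived rev_tensor_simps
  proof (rule conj_cong[OF refl])
    assume "w \<in> isocells C (p \<sharp>\<^sub>1 f) ((f \<otimes>\<^sub>1 u) \<sharp>\<^sub>1 q)"
    then have [simp]: "w \<in> Cell C" "Src C w = p \<sharp>\<^sub>1 f" "Trg C w = (f \<otimes>\<^sub>1 u) \<sharp>\<^sub>1 q" "iso w" by simp_all
    have "(R \<sharp>\<^sub>2 a2 (f \<otimes>\<^sub>1 u)) \<bullet> (inv2 R \<sharp>\<^sub>2 a2 (f \<otimes>\<^sub>1 u)) = a2 (Src C (R \<sharp>\<^sub>2 a2 (f \<otimes>\<^sub>1 u)))"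
      "(inv2 R \<sharp>\<^sub>2 a2 (f \<otimes>\<^sub>1 u)) \<bullet> (R \<sharp>\<^sub>2 a2 (f \<otimes>\<^sub>1 u)) = a2 (Trg C (R \<sharp>\<^sub>2 a2 (f \<otimes>\<^sub>1 u)))"
      "(a2 (f \<otimes>\<^sub>1 u \<otimes>\<^sub>1 u) \<sharp>\<^sub>2 S) \<bullet> (a2 (f \<otimes>\<^sub>1 u \<otimes>\<^sub>1 u) \<sharp>\<^sub>2 inv2 S) = a2 (Src C (a2 (f \<otimes>\<^sub>1 u \<otimes>\<^sub>1 u) \<sharp>\<^sub>2 S))"
      "(a2 (f \<otimes>\<^sub>1 u \<otimes>\<^sub>1 u) \<sharp>\<^sub>2 inv2 S) \<bullet> (a2 (f \<otimes>\<^sub>1 u \<otimes>\<^sub>1 u) \<sharp>\<^sub>2 S) = a2 (Trg C (a2 (f \<otimes>\<^sub>1 u \<otimes>\<^sub>1 u) \<sharp>\<^sub>2 S))"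
      by (simp_all flip: whisker_Vcomp)
    moreover have "f \<in> Arr C" "u \<in> Arr C" by simp_all
    ultimately show "((inv2 R \<sharp>\<^sub>2 a2 (f \<otimes>\<^sub>1 u)) \<bullet> W = (w \<otimes>\<^sub>2 a2 u) \<bullet> (a2 ((f \<otimes>\<^sub>1 u) \<otimes>\<^sub>1 u) \<sharp>\<^sub>2 inv2 S)) \<longleftrightarrow>
      ((R \<sharp>\<^sub>2 a2 (f \<otimes>\<^sub>1 u)) \<bullet> (w \<otimes>\<^sub>2 a2 u) = W \<bullet> (a2 (f \<otimes>\<^sub>1 u \<otimes>\<^sub>1 u) \<sharp>\<^sub>2 S))"
      unfolding tensor_assoc(2)[OF \<open>f \<in> Arr C\<close> \<open>u \<in> Arr C\<close> \<open>u \<in> Arr C\<close>]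
      by (intro inverse_square) simp_all
  qed
qed

lemma right_square_ex1:
  assumes "right_data I \<alpha> X p R" "right_data J \<beta> Y q S" and J: "cancellable J" and u: "equi u" "u \<in> homset C I J"
    and f: "f \<in> homset C X Y" and W: "right_base_cell \<alpha> X \<beta> Y u f W"
  shows "\<exists>!w. right_square p R q S u f W w"
  using semi_monoidal_2category.left_square_ex1[OF rev_semi_monoidal rev_left_data[OF assms(1)] rev_left_data[OF assms(2)],
      unfolded rev_cancellable rev_tensor_derived, OF J u f, of W] W
    right_dataD[OF assms(1)] right_dataD[OF assms(2)] u f
  by (simp add: rev_left_square[OF assms(1,2) u(2) f W] rev_base_cell)

lemma right_square_id:
  assumes "right_data I \<alpha> X p R"
  shows "right_square p R p R (o1 I) (o1 X) (a2 (o1 X \<otimes>\<^sub>1 \<alpha>)) (a2 p)"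
proof -
  note [simp] = right_dataD[OF assms(1)]
  show ?thesis unfolding right_square_def by simp
qed

lemma right_base_cell_comp:
  assumes "right_data I \<alpha> X p L" "right_data J \<beta> Y q M" "right_data K \<gamma> Z r N"
    "u \<in> homset C I J" "f \<in> homset C X Y" "right_base_cell \<alpha> X \<beta> Y u f W"
    "v \<in> homset C J K" "g \<in> homset C Y Z" "right_base_cell \<beta> Y \<gamma> Z v g V"
  shows "right_base_cell \<alpha> X \<gamma> Z (u \<sharp>\<^sub>1 v) (f \<sharp>\<^sub>1 g) ((W \<sharp>\<^sub>2 a2 (g \<otimes>\<^sub>1 v)) \<bullet> (a2 (f \<otimes>\<^sub>1 u \<otimes>\<^sub>1 u) \<sharp>\<^sub>2 V))"
proof -
  note [simp] = right_dataD[OF assms(1)] right_dataD[OF assms(2)] right_dataD[OF assms(3)]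
    assms(4,5,7,8)[unfolded homset_iff] assms(6,9)[unfolded right_base_cell_def isocells_iff] merge
  show ?thesis unfolding right_base_cell_def by simp
qed

lemma right_square_comp:
  assumes "right_data I \<alpha> X p L" "right_data J \<beta> Y q M" "right_data K \<gamma> Z r N"
    and u: "u \<in> homset C I J" and f: "f \<in> homset C X Y" and W: "right_base_cell \<alpha> X \<beta> Y u f W"
    and v: "v \<in> homset C J K" and g: "g \<in> homset C Y Z" and V: "right_base_cell \<beta> Y \<gamma> Z v g V"
    and w: "right_square p L q M u f W w" "right_square q M r N v g V w'"
  shows "right_square p L r N (u \<sharp>\<^sub>1 v) (f \<sharp>\<^sub>1 g) ((W \<sharp>\<^sub>2 a2 (g \<otimes>\<^sub>1 v)) \<bullet> (a2 (f \<otimes>\<^sub>1 u \<otimes>\<^sub>1 u) \<sharp>\<^sub>2 V))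
    ((w \<sharp>\<^sub>2 a2 g) \<bullet> (a2 (f \<otimes>\<^sub>1 u) \<sharp>\<^sub>2 w'))"
proof -
  note t = right_dataD[OF assms(1)] right_dataD[OF assms(2)] right_dataD[OF assms(3)]
    u[unfolded homset_iff] f[unfolded homset_iff] v[unfolded homset_iff] g[unfolded homset_iff]
  have uv: "u \<sharp>\<^sub>1 v \<in> homset C I K" and fg: "f \<sharp>\<^sub>1 g \<in> homset C X Z" using t by simp_all
  note b = right_base_cell_comp[OF assms(1-9)]
  note c = semi_monoidal_2category.left_square_comp[OF rev_semi_monoidal rev_left_data[OF assms(1)]
      rev_left_data[OF assms(2)] rev_left_data[OF assms(3)], unfolded rev_tensor_derived rev_tensor_simps, OF u f _ v g]
  have "semi_monoidal_2category.left_square (rev_tensor C) p (inv2 L) r (inv2 N) (u \<sharp>\<^sub>1 v) (f \<sharp>\<^sub>1 g)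
     ((W \<sharp>\<^sub>2 a2 (g \<otimes>\<^sub>1 v)) \<bullet> (a2 ((f \<otimes>\<^sub>1 u) \<otimes>\<^sub>1 u) \<sharp>\<^sub>2 V)) ((w \<sharp>\<^sub>2 a2 g) \<bullet> (a2 (f \<otimes>\<^sub>1 u) \<sharp>\<^sub>2 w'))"
    by (rule c) (use t W V w in \<open>simp_all add: rev_base_cell rev_left_square[OF assms(1,2) u f W]
      rev_left_square[OF assms(2,3) v g V]\<close>)
  then show ?thesis
    using t by (simp add: rev_left_square[OF assms(1,3) uv fg b])
qed

lemma right_square_cell:
  assumes "right_data I \<alpha> X p L" "right_data J \<beta> Y q M" and J: "cancellable J" and v: "equi v" "v \<in> homset C I J"
    and u: "u \<in> homset C I J" and f: "f \<in> homset C X Y" "g \<in> homset C X Y"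
    and W: "right_base_cell \<alpha> X \<beta> Y u f W" "right_base_cell \<alpha> X \<beta> Y v g W'"
    and T: "T \<in> isocells C u v" and a: "a \<in> cells C f g"
    and w: "right_square p L q M u f W w" "right_square p L q M v g W' w'"
  shows "w \<bullet> ((a \<otimes>\<^sub>2 T) \<sharp>\<^sub>2 a2 q) = (a2 p \<sharp>\<^sub>2 a) \<bullet> w' \<longleftrightarrow>
    W \<bullet> ((a \<otimes>\<^sub>2 T \<otimes>\<^sub>2 T) \<sharp>\<^sub>2 a2 (o1 Y \<otimes>\<^sub>1 \<beta>)) = (a2 (o1 X \<otimes>\<^sub>1 \<alpha>) \<sharp>\<^sub>2 (a \<otimes>\<^sub>2 T)) \<bullet> W'"
proof -
  note t = right_dataD[OF assms(1)] right_dataD[OF assms(2)]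
    u[unfolded homset_iff] f[unfolded homset_iff] v[unfolded homset_iff] T[unfolded isocells_iff] a[unfolded cells_iff]
  have "w \<bullet> ((a \<otimes>\<^sub>2 T) \<sharp>\<^sub>2 a2 q) = (a2 p \<sharp>\<^sub>2 a) \<bullet> w' \<longleftrightarrow>
    W \<bullet> (((a \<otimes>\<^sub>2 T) \<otimes>\<^sub>2 T) \<sharp>\<^sub>2 a2 (o1 Y \<otimes>\<^sub>1 \<beta>)) = (a2 (o1 X \<otimes>\<^sub>1 \<alpha>) \<sharp>\<^sub>2 (a \<otimes>\<^sub>2 T)) \<bullet> W'"
    by (rule semi_monoidal_2category.left_square_cell[OF rev_semi_monoidal rev_left_data[OF assms(1)]
      rev_left_data[OF assms(2)], unfolded rev_cancellable rev_tensor_derived rev_tensor_simps,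
      OF J v u f _ _ T a])
      (use t W w in \<open>simp_all add: rev_base_cell rev_left_square[OF assms(1,2) u f(1) W(1)]
        rev_left_square[OF assms(1,2) v(2) f(2) W(2)]\<close>)
  then show ?thesis using t by simp
qed

subsection \<open>Kelly cells\<close>

text \<open>Phrased for single data at \<open>X\<close> and \<open>Y\<close> rather than for a whole
  unit, so that it also applies to tensored data such as \<open>l \<otimes>\<^sub>1 o1 Z\<close>
  with \<open>L \<otimes>\<^sub>2 o2 Z\<close>. Coherence depends on this freedom.\<close>

definition Kelly_rel :: "'o \<Rightarrow> 'a \<Rightarrow> 'o \<Rightarrow> 'o \<Rightarrow> 'a \<Rightarrow> 'c \<Rightarrow> 'a \<Rightarrow> 'c \<Rightarrow> 'c \<Rightarrow> bool" where
  "Kelly_rel I \<alpha> X Y r R l L k \<longleftrightarrow> right_data I \<alpha> X r R \<and> left_data I \<alpha> Y l L \<and>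
     k \<in> isocells C (o1 X \<otimes>\<^sub>1 l) (r \<otimes>\<^sub>1 o1 Y) \<and>
     ((R \<otimes>\<^sub>2 o2 Y) \<sharp>\<^sub>2 a2 (o1 X \<otimes>\<^sub>1 l)) \<bullet> ((o2 X \<otimes>\<^sub>2 L) \<sharp>\<^sub>2 a2 (r \<otimes>\<^sub>1 o1 Y)) = a2 (o1 X \<otimes>\<^sub>1 \<alpha> \<otimes>\<^sub>1 o1 Y) \<sharp>\<^sub>2 k"

text \<open>X\<alpha>Y is an equi-arrow, and precomposition with it is fully faithful, so the
  equation can be divided by it.\<close>

lemma Kelly_rel_exists:
  assumes "right_data I \<alpha> X r R" "left_data I \<alpha> Y l L" "equi \<alpha>"
  shows "\<exists>k. Kelly_rel I \<alpha> X Y r R l L k"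
proof -
  note [simp] = right_dataD[OF assms(1)] left_dataD[OF assms(2)] merge
  have e: "equi (o1 X \<otimes>\<^sub>1 \<alpha> \<otimes>\<^sub>1 o1 Y)" using assms(3) by (intro equi_tensor equi_id) simp_all
  obtain k where "k \<in> isocells C (o1 X \<otimes>\<^sub>1 l) (r \<otimes>\<^sub>1 o1 Y)"
    "a2 (o1 X \<otimes>\<^sub>1 \<alpha> \<otimes>\<^sub>1 o1 Y) \<sharp>\<^sub>2 k
      = ((R \<otimes>\<^sub>2 o2 Y) \<sharp>\<^sub>2 a2 (o1 X \<otimes>\<^sub>1 l)) \<bullet> ((o2 X \<otimes>\<^sub>2 L) \<sharp>\<^sub>2 a2 (r \<otimes>\<^sub>1 o1 Y))"
    by (rule ff_on_isocell[OF ff_pre[OF e refl, of "X \<otimes>\<^sub>0 Y"], of "o1 X \<otimes>\<^sub>1 l" "r \<otimes>\<^sub>1 o1 Y"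
        "((R \<otimes>\<^sub>2 o2 Y) \<sharp>\<^sub>2 a2 (o1 X \<otimes>\<^sub>1 l)) \<bullet> ((o2 X \<otimes>\<^sub>2 L) \<sharp>\<^sub>2 a2 (r \<otimes>\<^sub>1 o1 Y))"]) simp_all
  then show ?thesis using assms unfolding Kelly_rel_def by metis
qed

text \<open>In this instance the compatibility \<open>u\<close> of the prism is the exchange of
  \<open>wl\<close> and \<open>wr\<close>, which act on different tensor factors, and its hypothesis
  \<open>L\<close> is the left square tensored with \<open>f\<close>. Nothing connects
  \<open>wr\<close> with \<open>R\<close> yet; that is the content of the equivalence.\<close>

lemma Kelly_prism:
  assumes K: "Kelly_rel I \<alpha> X Y r R l L k" and K': "Kelly_rel J \<beta> X' Y' r' R' l' L' k'"
    and u: "u \<in> homset C I J" and f: "f \<in> homset C X X'" and g: "g \<in> homset C Y Y'"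
    and W: "base_cell \<alpha> Y \<beta> Y' u g W"
    and wl: "left_square l L l' L' u g W wl" and wr: "wr \<in> isocells C (r \<sharp>\<^sub>1 f) ((f \<otimes>\<^sub>1 u) \<sharp>\<^sub>1 r')"
    and equi: "equi \<alpha>" "equi l'"
  shows "(k \<sharp>\<^sub>2 a2 (f \<otimes>\<^sub>1 g)) \<bullet> (wr \<otimes>\<^sub>2 a2 g) = (a2 f \<otimes>\<^sub>2 wl) \<bullet> (a2 (f \<otimes>\<^sub>1 u \<otimes>\<^sub>1 g) \<sharp>\<^sub>2 k') \<longleftrightarrow>
    ((R \<otimes>\<^sub>2 o2 Y) \<sharp>\<^sub>2 a2 (f \<otimes>\<^sub>1 u \<otimes>\<^sub>1 g)) \<bullet> (wr \<otimes>\<^sub>2 a2 (u \<otimes>\<^sub>1 g)) = (a2 f \<otimes>\<^sub>2 W) \<bullet> (a2 (f \<otimes>\<^sub>1 u \<otimes>\<^sub>1 u \<otimes>\<^sub>1 g) \<sharp>\<^sub>2 (R' \<otimes>\<^sub>2 o2 Y'))"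
proof -
  have d: "right_data I \<alpha> X r R" "left_data I \<alpha> Y l L" "right_data J \<beta> X' r' R'" "left_data J \<beta> Y' l' L'"
    using K K' unfolding Kelly_rel_def by auto
  note [simp] = right_dataD[OF d(1)] left_dataD[OF d(2)] right_dataD[OF d(3)] left_dataD[OF d(4)]
    u[unfolded homset_iff] f[unfolded homset_iff] g[unfolded homset_iff] W[unfolded base_cell_def isocells_iff]
    wr[unfolded isocells_iff] wl[unfolded left_square_def isocells_iff, THEN conjunct1]
    K[unfolded Kelly_rel_def isocells_iff, THEN conjunct2, THEN conjunct2, THEN conjunct1]
    K'[unfolded Kelly_rel_def isocells_iff, THEN conjunct2, THEN conjunct2, THEN conjunct1]
    merge
  have Lsq: "(L \<sharp>\<^sub>2 a2 (u \<otimes>\<^sub>1 g)) \<bullet> W = (a2 u \<otimes>\<^sub>2 wl) \<bullet> (a2 (u \<otimes>\<^sub>1 u \<otimes>\<^sub>1 g) \<sharp>\<^sub>2 L')"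
    using wl unfolding left_square_def by blast
  let ?x = "f \<otimes>\<^sub>1 u \<otimes>\<^sub>1 u \<otimes>\<^sub>1 g" and ?y = "f \<otimes>\<^sub>1 u \<otimes>\<^sub>1 g"
  show ?thesis
  proof (rule prism[where b = "r \<otimes>\<^sub>1 o1 (I \<otimes>\<^sub>0 Y)" and c = "o1 (X \<otimes>\<^sub>0 I) \<otimes>\<^sub>1 l" and p = "o1 X \<otimes>\<^sub>1 l"
      and q = "r \<otimes>\<^sub>1 o1 Y" and a' = "o1 X' \<otimes>\<^sub>1 \<beta> \<otimes>\<^sub>1 o1 Y'" and b' = "r' \<otimes>\<^sub>1 o1 (J \<otimes>\<^sub>0 Y')"
      and c' = "o1 (X' \<otimes>\<^sub>0 J) \<otimes>\<^sub>1 l'" and p' = "o1 X' \<otimes>\<^sub>1 l'" and q' = "r' \<otimes>\<^sub>1 o1 Y'"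
      and L = "o2 X \<otimes>\<^sub>2 L" and L' = "o2 X' \<otimes>\<^sub>2 L'" and uc = "a2 (f \<otimes>\<^sub>1 u) \<otimes>\<^sub>2 wl"
      and a = "o1 X \<otimes>\<^sub>1 \<alpha> \<otimes>\<^sub>1 o1 Y"])
    show "((R \<otimes>\<^sub>2 o2 Y) \<sharp>\<^sub>2 a2 (o1 X \<otimes>\<^sub>1 l)) \<bullet> ((o2 X \<otimes>\<^sub>2 L) \<sharp>\<^sub>2 a2 (r \<otimes>\<^sub>1 o1 Y))
        = a2 (o1 X \<otimes>\<^sub>1 \<alpha> \<otimes>\<^sub>1 o1 Y) \<sharp>\<^sub>2 k"
      "((R' \<otimes>\<^sub>2 o2 Y') \<sharp>\<^sub>2 a2 (o1 X' \<otimes>\<^sub>1 l')) \<bullet> ((o2 X' \<otimes>\<^sub>2 L') \<sharp>\<^sub>2 a2 (r' \<otimes>\<^sub>1 o1 Y'))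
        = a2 (o1 X' \<otimes>\<^sub>1 \<beta> \<otimes>\<^sub>1 o1 Y') \<sharp>\<^sub>2 k'"
      using K K' unfolding Kelly_rel_def by blast+
    show "equi (o1 X \<otimes>\<^sub>1 \<alpha> \<otimes>\<^sub>1 o1 Y)" "equi (o1 X' \<otimes>\<^sub>1 l')"
      using equi by (intro equi_tensor equi_id; simp)+
    have "(a2 (r \<otimes>\<^sub>1 o1 (I \<otimes>\<^sub>0 Y)) \<sharp>\<^sub>2 (a2 f \<otimes>\<^sub>2 wl)) \<bullet> ((wr \<otimes>\<^sub>2 a2 (u \<otimes>\<^sub>1 g)) \<sharp>\<^sub>2 a2 (o1 X' \<otimes>\<^sub>1 l'))
      = (a2 (r \<sharp>\<^sub>1 f) \<otimes>\<^sub>2 wl) \<bullet> (wr \<otimes>\<^sub>2 a2 ((u \<otimes>\<^sub>1 g) \<sharp>\<^sub>1 l'))"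
      by simp
    also have "\<dots> = (wr \<otimes>\<^sub>2 a2 (l \<sharp>\<^sub>1 g)) \<bullet> (a2 ((f \<otimes>\<^sub>1 u) \<sharp>\<^sub>1 r') \<otimes>\<^sub>2 wl)"
      by (rule trans[OF tensor_exchange(2) tensor_exchange(1)[symmetric]]) simp_all
    also have "\<dots> = (a2 (o1 (X \<otimes>\<^sub>0 I) \<otimes>\<^sub>1 l) \<sharp>\<^sub>2 (wr \<otimes>\<^sub>2 a2 g)) \<bullet> ((a2 (f \<otimes>\<^sub>1 u) \<otimes>\<^sub>2 wl) \<sharp>\<^sub>2 a2 (r' \<otimes>\<^sub>1 o1 Y'))"
      by simp
    finally show "(a2 (r \<otimes>\<^sub>1 o1 (I \<otimes>\<^sub>0 Y)) \<sharp>\<^sub>2 (a2 f \<otimes>\<^sub>2 wl)) \<bullet> ((wr \<otimes>\<^sub>2 a2 (u \<otimes>\<^sub>1 g)) \<sharp>\<^sub>2 a2 (o1 X' \<otimes>\<^sub>1 l'))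
      = (a2 (o1 (X \<otimes>\<^sub>0 I) \<otimes>\<^sub>1 l) \<sharp>\<^sub>2 (wr \<otimes>\<^sub>2 a2 g)) \<bullet> ((a2 (f \<otimes>\<^sub>1 u) \<otimes>\<^sub>2 wl) \<sharp>\<^sub>2 a2 (r' \<otimes>\<^sub>1 o1 Y'))" .
    have "((o2 X \<otimes>\<^sub>2 L) \<sharp>\<^sub>2 a2 ?y) \<bullet> (a2 f \<otimes>\<^sub>2 W) = a2 f \<otimes>\<^sub>2 ((L \<sharp>\<^sub>2 a2 (u \<otimes>\<^sub>1 g)) \<bullet> W)"
      by simp
    also have "\<dots> = (a2 f \<otimes>\<^sub>2 (a2 u \<otimes>\<^sub>2 wl)) \<bullet> (a2 ?x \<sharp>\<^sub>2 (o2 X' \<otimes>\<^sub>2 L'))"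
      unfolding Lsq by simp
    also have "a2 f \<otimes>\<^sub>2 (a2 u \<otimes>\<^sub>2 wl) = a2 (f \<otimes>\<^sub>1 u) \<otimes>\<^sub>2 wl"
      using tensor_assoc(3)[of "a2 f" "a2 u" wl] by simp
    finally show "((o2 X \<otimes>\<^sub>2 L) \<sharp>\<^sub>2 a2 ?y) \<bullet> (a2 f \<otimes>\<^sub>2 W)
        = (a2 (f \<otimes>\<^sub>1 u) \<otimes>\<^sub>2 wl) \<bullet> (a2 ?x \<sharp>\<^sub>2 (o2 X' \<otimes>\<^sub>2 L'))" .
  qed (use tensor_assoc(2)[of "o1 X" "o1 I" l] tensor_assoc(2)[of "o1 X'" "o1 J" l'] in simp_all)
qed

text \<open>A regrouping of \<open>Kelly_prism\<close> in which the two sides of a right square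
  appear tensored with \<open>g\<close>. From left to right it extracts information about
  \<open>R\<close> and \<open>U\<close> from \<open>K\<close>; from right to left it proves
  compatibility with \<open>K\<close>.\<close>

lemma Kelly_iff:
  assumes K: "Kelly_rel I \<alpha> X Y r R l L k" and K': "Kelly_rel J \<beta> X' Y' r' R' l' L' k'"
    and u: "u \<in> homset C I J" and f: "f \<in> homset C X X'" and g: "g \<in> homset C Y Y'"
    and W: "base_cell \<alpha> Y \<beta> Y' u g W"
    and wl: "left_square l L l' L' u g W wl" and wr: "wr \<in> isocells C (r \<sharp>\<^sub>1 f) ((f \<otimes>\<^sub>1 u) \<sharp>\<^sub>1 r')"
    and equi: "equi \<alpha>" "equi l'"
  shows "(k \<sharp>\<^sub>2 a2 (f \<otimes>\<^sub>1 g)) \<bullet> (wr \<otimes>\<^sub>2 a2 g) = (a2 f \<otimes>\<^sub>2 wl) \<bullet> (a2 (f \<otimes>\<^sub>1 u \<otimes>\<^sub>1 g) \<sharp>\<^sub>2 k') \<longleftrightarrow>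
    ((R \<sharp>\<^sub>2 a2 (f \<otimes>\<^sub>1 u)) \<bullet> (wr \<otimes>\<^sub>2 a2 u)) \<otimes>\<^sub>2 a2 g = (a2 f \<otimes>\<^sub>2 W) \<bullet> ((a2 (f \<otimes>\<^sub>1 u \<otimes>\<^sub>1 u) \<sharp>\<^sub>2 R') \<otimes>\<^sub>2 a2 g)"
proof -
  have d: "right_data I \<alpha> X r R" "left_data I \<alpha> Y l L" "right_data J \<beta> X' r' R'" "left_data J \<beta> Y' l' L'"
    using K K' unfolding Kelly_rel_def by auto
  note [simp] = right_dataD[OF d(1)] left_dataD[OF d(2)] right_dataD[OF d(3)] left_dataD[OF d(4)]
    u[unfolded homset_iff] f[unfolded homset_iff] g[unfolded homset_iff] W[unfolded base_cell_def isocells_iff]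
    wr[unfolded isocells_iff] merge
  have fa: "f \<in> Arr C" "u \<in> Arr C" "g \<in> Arr C" by simp_all
  have "((R \<sharp>\<^sub>2 a2 (f \<otimes>\<^sub>1 u)) \<bullet> (wr \<otimes>\<^sub>2 a2 u)) \<otimes>\<^sub>2 a2 g
      = ((R \<sharp>\<^sub>2 a2 (f \<otimes>\<^sub>1 u)) \<otimes>\<^sub>2 a2 g) \<bullet> (wr \<otimes>\<^sub>2 a2 (u \<otimes>\<^sub>1 g))"
    by simp
  also have "(R \<sharp>\<^sub>2 a2 (f \<otimes>\<^sub>1 u)) \<otimes>\<^sub>2 a2 g = (R \<otimes>\<^sub>2 o2 Y) \<sharp>\<^sub>2 a2 (f \<otimes>\<^sub>1 u \<otimes>\<^sub>1 g)"
    by simp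
  finally have 1: "((R \<sharp>\<^sub>2 a2 (f \<otimes>\<^sub>1 u)) \<bullet> (wr \<otimes>\<^sub>2 a2 u)) \<otimes>\<^sub>2 a2 g
      = ((R \<otimes>\<^sub>2 o2 Y) \<sharp>\<^sub>2 a2 (f \<otimes>\<^sub>1 u \<otimes>\<^sub>1 g)) \<bullet> (wr \<otimes>\<^sub>2 a2 (u \<otimes>\<^sub>1 g))" .
  have "a2 ((f \<otimes>\<^sub>1 u \<otimes>\<^sub>1 u) \<otimes>\<^sub>1 g) \<sharp>\<^sub>2 (R' \<otimes>\<^sub>2 o2 Y') = (a2 (f \<otimes>\<^sub>1 u \<otimes>\<^sub>1 u) \<sharp>\<^sub>2 R') \<otimes>\<^sub>2 a2 g"
    by (subst tensor_whisker) simp_all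
  then have 2: "(a2 (f \<otimes>\<^sub>1 u \<otimes>\<^sub>1 u) \<sharp>\<^sub>2 R') \<otimes>\<^sub>2 a2 g = a2 (f \<otimes>\<^sub>1 u \<otimes>\<^sub>1 u \<otimes>\<^sub>1 g) \<sharp>\<^sub>2 (R' \<otimes>\<^sub>2 o2 Y')"
    using fa by simp
  show ?thesis unfolding 1 2 by (rule Kelly_prism[OF assms])
qed

text \<open>Condition \<open>eq\<close> says that the left and the right base cell become equal once
  each is tensored with the arrow of the other side; the right square then supplies what
  \<open>Kelly_iff\<close> asks for. Its instances are naturality of \<open>K\<close>, both
  coherence conditions and (PK).\<close>

lemma Kelly_compat:
  assumes K: "Kelly_rel I \<alpha> X Y r R l L k" and K': "Kelly_rel J \<beta> X' Y' r' R' l' L' k'"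
    and u: "u \<in> homset C I J" and f: "f \<in> homset C X X'" and g: "g \<in> homset C Y Y'"
    and W: "base_cell \<alpha> Y \<beta> Y' u g W" and wl: "left_square l L l' L' u g W wl"
    and W': "right_base_cell \<alpha> X \<beta> X' u f W'" and wr: "right_square r R r' R' u f W' wr"
    and eq: "a2 f \<otimes>\<^sub>2 W = W' \<otimes>\<^sub>2 a2 g" and equi: "equi \<alpha>" "equi l'"
  shows "(k \<sharp>\<^sub>2 a2 (f \<otimes>\<^sub>1 g)) \<bullet> (wr \<otimes>\<^sub>2 a2 g) = (a2 f \<otimes>\<^sub>2 wl) \<bullet> (a2 (f \<otimes>\<^sub>1 u \<otimes>\<^sub>1 g) \<sharp>\<^sub>2 k')"
proof -
  have d: "right_data I \<alpha> X r R" "left_data I \<alpha> Y l L" "right_data J \<beta> X' r' R'" "left_data J \<beta> Y' l' L'"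
    using K K' unfolding Kelly_rel_def by auto
  have wr1: "wr \<in> isocells C (r \<sharp>\<^sub>1 f) ((f \<otimes>\<^sub>1 u) \<sharp>\<^sub>1 r')"
    and wr2: "(R \<sharp>\<^sub>2 a2 (f \<otimes>\<^sub>1 u)) \<bullet> (wr \<otimes>\<^sub>2 a2 u) = W' \<bullet> (a2 (f \<otimes>\<^sub>1 u \<otimes>\<^sub>1 u) \<sharp>\<^sub>2 R')"
    using wr unfolding right_square_def by auto
  have "(W' \<bullet> (a2 (f \<otimes>\<^sub>1 u \<otimes>\<^sub>1 u) \<sharp>\<^sub>2 R')) \<otimes>\<^sub>2 a2 g = (W' \<otimes>\<^sub>2 a2 g) \<bullet> ((a2 (f \<otimes>\<^sub>1 u \<otimes>\<^sub>1 u) \<sharp>\<^sub>2 R') \<otimes>\<^sub>2 a2 g)"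
    using right_dataD[OF d(1)] right_dataD[OF d(3)] u f g W'[unfolded right_base_cell_def]
    by (simp add: merge)
  then show ?thesis
    unfolding Kelly_iff[OF K K' u f g W wl wr1 equi] eq wr2 .
qed

subsection \<open>Objects\<close>

lemma id2_simps [simp]: "on_obj id2 X = X" "on_arr id2 f = f" "on_cell id2 a = a"
  by (simp_all add: id2_def)

lemma mten_simps [simp]:
  "on_obj (mten I) (X, Y) = X \<otimes>\<^sub>0 I \<otimes>\<^sub>0 Y" "on_arr (mten I) (f, g) = f \<otimes>\<^sub>1 o1 I \<otimes>\<^sub>1 g"
  "on_cell (mten I) (a, b) = a \<otimes>\<^sub>2 o2 I \<otimes>\<^sub>2 b"
  by (simp_all add: mten_def)

lemma ptrans_simps [simp]:
  "comp_at (larr u) X = u \<otimes>\<^sub>1 o1 X" "cell_at (larr u) f = a2 (u \<otimes>\<^sub>1 f)"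
  "comp_at (rarr u) X = o1 X \<otimes>\<^sub>1 u" "cell_at (rarr u) f = a2 (f \<otimes>\<^sub>1 u)"
  "comp_at (lwhisk I t) X = o1 I \<otimes>\<^sub>1 comp_at t X" "cell_at (lwhisk I t) f = o2 I \<otimes>\<^sub>2 cell_at t f"
  "comp_at (rwhisk t I) X = comp_at t X \<otimes>\<^sub>1 o1 I" "cell_at (rwhisk t I) f = cell_at t f \<otimes>\<^sub>2 o2 I"
  "comp_at (lext t) (X, Y) = o1 X \<otimes>\<^sub>1 comp_at t Y" "cell_at (lext t) (f, g) = a2 f \<otimes>\<^sub>2 cell_at t g"
  "comp_at (rext t) (X, Y) = comp_at t X \<otimes>\<^sub>1 o1 Y" "cell_at (rext t) (f, g) = cell_at t f \<otimes>\<^sub>2 a2 g"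
  "comp_at (pcomp C C s t) X = comp_at s X \<sharp>\<^sub>1 comp_at t X"
  "cell_at (pcomp C C s t) f = (cell_at s f \<sharp>\<^sub>2 a2 (comp_at t (Cod C f))) \<bullet> (a2 (comp_at s (Dom C f)) \<sharp>\<^sub>2 cell_at t f)"
  by (simp_all add: larr_def rarr_def lwhisk_def rwhisk_def lext_def rext_def pcomp_def)

text \<open>Squares and naturality cells of a constraint run in opposite directions; this passes
  from one to the other.\<close>

lemma inv2_swap:
  assumes "iso w" "iso w'" "a \<in> Cell C" "b \<in> Cell C" "Trg C w = Src C a" "Trg C b = Src C w'" "Src C w = Src C b" "Trg C a = Trg C w'"
  shows "w \<bullet> a = b \<bullet> w' \<longleftrightarrow> a \<bullet> inv2 w' = inv2 w \<bullet> b"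
  using inverse_square[of w a b w' "inv2 w" "inv2 w'"] assms iso_Cell[OF assms(1)] iso_Cell[OF assms(2)]
  by auto

lemma inv2_Vcomp: "\<lbrakk>iso a; iso b; Trg C a = Src C b\<rbrakk> \<Longrightarrow> inv2 (a \<bullet> b) = inv2 b \<bullet> inv2 a"
  by (rule inv2_unique) (simp_all add: iso_Cell)

lemma inv2_a2: "f \<in> Arr C \<Longrightarrow> inv2 (a2 f) = a2 f"
  by (rule inv2_unique) simp_all

lemma inv2_Hcomp: "\<lbrakk>iso a; iso b; Cod C (Src C a) = Dom C (Src C b)\<rbrakk> \<Longrightarrow> inv2 (a \<sharp>\<^sub>2 b) = inv2 a \<sharp>\<^sub>2 inv2 b"
  by (rule inv2_unique) (simp_all add: iso_Cell interchange[symmetric])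

lemma inv2_tensor: "\<lbrakk>iso a; iso b\<rbrakk> \<Longrightarrow> inv2 (a \<otimes>\<^sub>2 b) = inv2 a \<otimes>\<^sub>2 inv2 b"
  by (rule inv2_unique) (simp_all add: iso_Cell tensor_Vcomp)

lemma inv2_inv2: "iso a \<Longrightarrow> inv2 (inv2 a) = a"
  by (rule inv2_unique) (simp_all add: iso_Cell)

lemma base_cell_id:
  assumes "I \<in> Obj C" "\<alpha> \<in> homset C (I \<otimes>\<^sub>0 I) I" "f \<in> homset C X Y"
  shows "base_cell \<alpha> X \<alpha> Y (o1 I) f (a2 (\<alpha> \<otimes>\<^sub>1 f))"
proof -
  have "X \<in> Obj C" "Y \<in> Obj C" using assms(3) by auto
  then show ?thesis using assms by (simp add: base_cell_def merge)
qed

lemma right_base_cell_id: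
  assumes "I \<in> Obj C" "\<alpha> \<in> homset C (I \<otimes>\<^sub>0 I) I" "f \<in> homset C X Y"
  shows "right_base_cell \<alpha> X \<alpha> Y (o1 I) f (a2 (f \<otimes>\<^sub>1 \<alpha>))"
proof -
  have "X \<in> Obj C" "Y \<in> Obj C" using assms(3) by auto
  then show ?thesis using assms by (simp add: right_base_cell_def merge)
qed

text \<open>The cell of a square over an identity starts at the constraint followed by
  \<open>f\<close>, hence its inverse is the naturality cell. Each axiom of a pseudo-natural
  transformation compares two squares over equal base cells, or is an instance of
  \<open>left_square_cell\<close>.\<close>

lemma left_constraintI:
  assumes J: "cancellable I"
    and p: "\<And>X. X \<in> Obj C \<Longrightarrow> left_data I \<alpha> X (p X) (L X)" "\<And>X. X \<in> Obj C \<Longrightarrow> equi (p X)"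
    and w: "\<And>f X Y. f \<in> homset C X Y \<Longrightarrow> left_square (p X) (L X) (p Y) (L Y) (o1 I) f (a2 (\<alpha> \<otimes>\<^sub>1 f)) (w f)"
  shows "left_constraint I \<lparr>comp_at = restrict p (Obj C), cell_at = \<lambda>f\<in>Arr C. inv2 (w f)\<rparr>"
proof -
  have I: "I \<in> Obj C" by (rule cancellable_Obj[OF J])
  note pD = left_dataD[OF p(1)]
  have wD: "w f \<in> Cell C" "Src C (w f) = p X \<sharp>\<^sub>1 f" "Trg C (w f) = (o1 I \<otimes>\<^sub>1 f) \<sharp>\<^sub>1 p Y" "iso (w f)" if "f \<in> homset C X Y" for f X Y
    using w[OF that] unfolding left_square_def by auto
  have \<alpha>: "\<alpha> \<in> homset C (I \<otimes>\<^sub>0 I) I" using pD(2-4)[OF I] by simp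
  note b = base_cell_id[OF I \<alpha>]
  have unique: "v = w f" if f: "f \<in> homset C X Y" and v: "left_square (p X) (L X) (p Y) (L Y) (o1 I) f (a2 (\<alpha> \<otimes>\<^sub>1 f)) v" for f X Y v
  proof -
    have XY: "X \<in> Obj C" "Y \<in> Obj C" using f by auto
    have "\<exists>!v. left_square (p X) (L X) (p Y) (L Y) (o1 I) f (a2 (\<alpha> \<otimes>\<^sub>1 f)) v"
      by (rule left_square_ex1[OF p(1)[OF XY(1)] p(1)[OF XY(2)] J equi_id[OF I] _ f b[OF f]]) (use I in simp)
    then show ?thesis using v w[OF f] by blast
  qed
  have id: "w (o1 X) = a2 (p X)" if X: "X \<in> Obj C" for X
    by (rule unique[symmetric, of _ X X]) (use X left_square_id[OF p(1)[OF X]] in simp_all)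
  have comp: "w (f \<sharp>\<^sub>1 g) = (w f \<sharp>\<^sub>2 a2 g) \<bullet> (a2 (o1 I \<otimes>\<^sub>1 f) \<sharp>\<^sub>2 w g)"
    if f: "f \<in> homset C X Y" and g: "g \<in> homset C Y Z" for f g X Y Z
  proof (rule unique[symmetric, of _ X Z])
    have XYZ: "X \<in> Obj C" "Y \<in> Obj C" "Z \<in> Obj C" using f g by auto
    have eq: "(a2 (\<alpha> \<otimes>\<^sub>1 f) \<sharp>\<^sub>2 a2 (o1 I \<otimes>\<^sub>1 g)) \<bullet> (a2 (o1 I \<otimes>\<^sub>1 o1 I \<otimes>\<^sub>1 f) \<sharp>\<^sub>2 a2 (\<alpha> \<otimes>\<^sub>1 g)) = a2 (\<alpha> \<otimes>\<^sub>1 (f \<sharp>\<^sub>1 g))"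
      using f g \<alpha> I XYZ by (simp add: merge)
    have "left_square (p X) (L X) (p Z) (L Z) (o1 I \<sharp>\<^sub>1 o1 I) (f \<sharp>\<^sub>1 g)
        ((a2 (\<alpha> \<otimes>\<^sub>1 f) \<sharp>\<^sub>2 a2 (o1 I \<otimes>\<^sub>1 g)) \<bullet> (a2 (o1 I \<otimes>\<^sub>1 o1 I \<otimes>\<^sub>1 f) \<sharp>\<^sub>2 a2 (\<alpha> \<otimes>\<^sub>1 g)))
        ((w f \<sharp>\<^sub>2 a2 g) \<bullet> (a2 (o1 I \<otimes>\<^sub>1 f) \<sharp>\<^sub>2 w g))"
      by (rule left_square_comp[OF p(1)[OF XYZ(1)] p(1)[OF XYZ(2)] p(1)[OF XYZ(3)] _ f b[OF f] _ g b[OF g] w[OF f] w[OF g]])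
        (use I in simp_all)
    then show "left_square (p X) (L X) (p Z) (L Z) (o1 I) (f \<sharp>\<^sub>1 g) (a2 (\<alpha> \<otimes>\<^sub>1 (f \<sharp>\<^sub>1 g)))
        ((w f \<sharp>\<^sub>2 a2 g) \<bullet> (a2 (o1 I \<otimes>\<^sub>1 f) \<sharp>\<^sub>2 w g))"
      unfolding eq using I by simp
  qed (use f g in simp)
  have cell: "w f \<bullet> ((o2 I \<otimes>\<^sub>2 a) \<sharp>\<^sub>2 a2 (p Y)) = (a2 (p X) \<sharp>\<^sub>2 a) \<bullet> w g"
    if f: "f \<in> homset C X Y" and g: "g \<in> homset C X Y" and a: "a \<in> cells C f g" for a f g X Y
  proof -
    have XY: "X \<in> Obj C" "Y \<in> Obj C" using f by auto
    have "a2 (\<alpha> \<otimes>\<^sub>1 f) \<bullet> ((o2 I \<otimes>\<^sub>2 o2 I \<otimes>\<^sub>2 a) \<sharp>\<^sub>2 a2 (\<alpha> \<otimes>\<^sub>1 o1 Y)) = (a2 (\<alpha> \<otimes>\<^sub>1 o1 X) \<sharp>\<^sub>2 (o2 I \<otimes>\<^sub>2 a)) \<bullet> a2 (\<alpha> \<otimes>\<^sub>1 g)"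
    proof -
      have "(o2 I \<otimes>\<^sub>2 o2 I) \<otimes>\<^sub>2 a = o2 I \<otimes>\<^sub>2 o2 I \<otimes>\<^sub>2 a" by (rule tensor_assoc(3)) (use I a in simp_all)
      moreover have "((o2 I \<otimes>\<^sub>2 o2 I) \<otimes>\<^sub>2 a) \<sharp>\<^sub>2 a2 (\<alpha> \<otimes>\<^sub>1 o1 Y) = a2 \<alpha> \<otimes>\<^sub>2 a"
        using I a f \<alpha> XY by (subst tensor_whisker) simp_all
      moreover have "a2 (\<alpha> \<otimes>\<^sub>1 o1 X) \<sharp>\<^sub>2 (o2 I \<otimes>\<^sub>2 a) = a2 \<alpha> \<otimes>\<^sub>2 a"
        using I a f \<alpha> XY by (subst tensor_whisker) simp_all
      ultimately show ?thesis using I a f g \<alpha> XY by (simp add: merge)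
    qed
    then show ?thesis
      by (subst left_square_cell[OF p(1)[OF XY(1)] p(1)[OF XY(2)] J equi_id[OF I] _ _ f g b[OF f] b[OF g] _ a w[OF f] w[OF g]])
        (use I in simp_all)
  qed
  show ?thesis
    unfolding left_constraint_def pseudonatural_def
  proof (intro conjI ballI impI, simp_all add: p(2) del: homset_iff isocells_iff)
    fix X assume X: "X \<in> Obj C"
    show "p X \<in> homset C (I \<otimes>\<^sub>0 X) X" using pD[OF X] by simp
    show "inv2 (w (o1 X)) = a2 (p X)" using id[OF X] pD[OF X] by (simp add: inv2_a2)
  next
    fix f assume f: "f \<in> Arr C"
    then show "inv2 (w f) \<in> isocells C ((o1 I \<otimes>\<^sub>1 f) \<sharp>\<^sub>1 p (Cod C f)) (p (Dom C f) \<sharp>\<^sub>1 f)"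
      using wD[of f "Dom C f" "Cod C f"] by simp
    fix g assume g: "g \<in> Arr C" and fg: "Cod C f = Dom C g"
    then show "inv2 (w (f \<sharp>\<^sub>1 g)) = (a2 (o1 I \<otimes>\<^sub>1 f) \<sharp>\<^sub>2 inv2 (w g)) \<bullet> (inv2 (w f) \<sharp>\<^sub>2 a2 g)"
      using f comp[of f "Dom C f" "Cod C f" g "Cod C g"] wD[of f "Dom C f" "Cod C f"] wD[of g "Dom C g" "Cod C g"] I
        pD[of "Dom C f"] pD[of "Dom C g"] pD[of "Cod C g"]
      by (simp add: inv2_Vcomp inv2_Hcomp inv2_a2)
  next
    fix a assume a: "a \<in> Cell C"
    let ?X = "Dom C (Src C a)" and ?Y = "Cod C (Src C a)"
    have h: "Src C a \<in> homset C ?X ?Y" "Trg C a \<in> homset C ?X ?Y" "a \<in> cells C (Src C a) (Trg C a)" using a by simp_all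
    have O: "?X \<in> Obj C" "?Y \<in> Obj C" using a by simp_all
    show "((o2 I \<otimes>\<^sub>2 a) \<sharp>\<^sub>2 a2 (p ?Y)) \<bullet> inv2 (w (Trg C a)) = inv2 (w (Src C a)) \<bullet> (a2 (p ?X) \<sharp>\<^sub>2 a)"
      by (subst inv2_swap[symmetric]) (use cell[OF h] wD[OF h(1)] wD[OF h(2)] I pD[OF O(1)] pD[OF O(2)] a in simp_all)
  qed
qed

lemma rev_inv2: "semi_monoidal_2category.inv2 (rev_tensor C) a = inv2 a"
  by (simp add: semi_monoidal_2category.inv2_def[OF rev_semi_monoidal] inv2_def)

lemma right_constraintI:
  assumes J: "cancellable I"
    and p: "\<And>X. X \<in> Obj C \<Longrightarrow> right_data I \<alpha> X (p X) (R X)" "\<And>X. X \<in> Obj C \<Longrightarrow> equi (p X)"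
    and w: "\<And>f X Y. f \<in> homset C X Y \<Longrightarrow> right_square (p X) (R X) (p Y) (R Y) (o1 I) f (a2 (f \<otimes>\<^sub>1 \<alpha>)) (w f)"
  shows "right_constraint I \<lparr>comp_at = restrict p (Obj C), cell_at = \<lambda>f\<in>Arr C. inv2 (w f)\<rparr>"
proof -
  have I: "I \<in> Obj C" by (rule cancellable_Obj[OF J])
  have \<alpha>: "\<alpha> \<in> homset C (I \<otimes>\<^sub>0 I) I" using right_dataD(2-4)[OF p(1)[OF I]] by simp
  have "semi_monoidal_2category.left_constraint (rev_tensor C) I
      \<lparr>comp_at = restrict p (Obj (rev_tensor C)),
       cell_at = \<lambda>f\<in>Arr (rev_tensor C). semi_monoidal_2category.inv2 (rev_tensor C) (w f)\<rparr>"
  proof (rule semi_monoidal_2category.left_constraintI[OF rev_semi_monoidal])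
    show "semi_monoidal_2category.cancellable (rev_tensor C) I" using J by (simp add: rev_cancellable)
    show "semi_monoidal_2category.left_data (rev_tensor C) I \<alpha> X (p X) (inv2 (R X))" if "X \<in> Obj (rev_tensor C)" for X
      by (rule rev_left_data[OF p(1)]) (use that in simp)
    show "equi_arrow (rev_tensor C) (p X)" if "X \<in> Obj (rev_tensor C)" for X using p(2) that by simp
    fix f X Y assume "f \<in> homset (rev_tensor C) X Y"
    then have f: "f \<in> homset C X Y" by simp
    then have XY: "X \<in> Obj C" "Y \<in> Obj C" by auto
    have "semi_monoidal_2category.left_square (rev_tensor C) (p X) (inv2 (R X)) (p Y) (inv2 (R Y)) (o1 I) f (a2 (f \<otimes>\<^sub>1 \<alpha>)) (w f)"
      by (subst rev_left_square[OF p(1)[OF XY(1)] p(1)[OF XY(2)] _ f right_base_cell_id[OF I \<alpha> f]])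
        (use w[OF f] I in simp_all)
    then show "semi_monoidal_2category.left_square (rev_tensor C) (p X) (inv2 (R X)) (p Y) (inv2 (R Y)) (Ident (rev_tensor C) I) f
        (Icell (rev_tensor C) (on_arr (Tensor (rev_tensor C)) (\<alpha>, f))) (w f)" by simp
  qed
  then show ?thesis by (simp add: rev_constraint rev_inv2)
qed

lemma left_constraintD:
  assumes "left_constraint I l"
  shows "X \<in> Obj C \<Longrightarrow> comp_at l X \<in> homset C (I \<otimes>\<^sub>0 X) X" "X \<in> Obj C \<Longrightarrow> equi (comp_at l X)"
    "f \<in> homset C X Y \<Longrightarrow> cell_at l f \<in> isocells C ((o1 I \<otimes>\<^sub>1 f) \<sharp>\<^sub>1 comp_at l Y) (comp_at l X \<sharp>\<^sub>1 f)"
    "X \<in> Obj C \<Longrightarrow> cell_at l (o1 X) = a2 (comp_at l X)"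
  using assms unfolding left_constraint_def pseudonatural_def by auto

lemma right_constraintD:
  assumes "right_constraint I r"
  shows "X \<in> Obj C \<Longrightarrow> comp_at r X \<in> homset C (X \<otimes>\<^sub>0 I) X" "X \<in> Obj C \<Longrightarrow> equi (comp_at r X)"
    "f \<in> homset C X Y \<Longrightarrow> cell_at r f \<in> isocells C ((f \<otimes>\<^sub>1 o1 I) \<sharp>\<^sub>1 comp_at r Y) (comp_at r X \<sharp>\<^sub>1 f)"
    "X \<in> Obj C \<Longrightarrow> cell_at r (o1 X) = a2 (comp_at r X)"
  using assms unfolding right_constraint_def pseudonatural_def by auto

text \<open>The modification axiom for \<open>L\<close> at \<open>f\<close> is nothing but the
  equation of the naturality square at \<open>f\<close>; thus the naturality of \<open>L\<close>
  demanded of a unit fits into the calculus of squares.\<close>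

lemma left_square_iff_natural:
  assumes l: "left_constraint I l" and d: "left_data I \<alpha> X (comp_at l X) L" "left_data I \<alpha> Y (comp_at l Y) M"
    and f: "f \<in> homset C X Y"
  shows "left_square (comp_at l X) L (comp_at l Y) M (o1 I) f (a2 (\<alpha> \<otimes>\<^sub>1 f)) (inv2 (cell_at l f)) \<longleftrightarrow>
    (a2 (o1 (I \<otimes>\<^sub>0 I) \<otimes>\<^sub>1 f) \<sharp>\<^sub>2 M) \<bullet> a2 (\<alpha> \<otimes>\<^sub>1 f) = (o2 I \<otimes>\<^sub>2 cell_at l f) \<bullet> (L \<sharp>\<^sub>2 a2 (o1 I \<otimes>\<^sub>1 f))"
proof -
  note [simp] = left_dataD[OF d(1)] left_dataD[OF d(2)] f[unfolded homset_iff]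
    left_constraintD(3)[OF l f, unfolded isocells_iff] merge
  let ?Q = "a2 (o1 (I \<otimes>\<^sub>0 I) \<otimes>\<^sub>1 f) \<sharp>\<^sub>2 M" and ?P = "L \<sharp>\<^sub>2 a2 (o1 I \<otimes>\<^sub>1 f)"
  have 1: "o1 I \<otimes>\<^sub>1 o1 I \<otimes>\<^sub>1 f = o1 (I \<otimes>\<^sub>0 I) \<otimes>\<^sub>1 f"
    using tensor_assoc(2)[of "o1 I" "o1 I" f] by simp
  have 2: "inv2 (o2 I \<otimes>\<^sub>2 cell_at l f) = o2 I \<otimes>\<^sub>2 inv2 (cell_at l f)"
    by (simp add: inv2_tensor inv2_a2)
  have "left_square (comp_at l X) L (comp_at l Y) M (o1 I) f (a2 (\<alpha> \<otimes>\<^sub>1 f)) (inv2 (cell_at l f)) \<longleftrightarrow>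
      ?P \<bullet> a2 (\<alpha> \<otimes>\<^sub>1 f) = inv2 (o2 I \<otimes>\<^sub>2 cell_at l f) \<bullet> ?Q"
    unfolding left_square_def 1 2 by simp
  also have "\<dots> \<longleftrightarrow> (o2 I \<otimes>\<^sub>2 cell_at l f) \<bullet> ?P = ?Q \<bullet> a2 (\<alpha> \<otimes>\<^sub>1 f)"
    using inv2_swap[of "o2 I \<otimes>\<^sub>2 cell_at l f" "a2 (\<alpha> \<otimes>\<^sub>1 f)" ?P ?Q] by (simp add: inv2_a2 1 flip: 1)
  finally show ?thesis by metis
qed

lemma right_square_iff_natural:
  assumes r: "right_constraint I r" and d: "right_data I \<alpha> X (comp_at r X) R" "right_data I \<alpha> Y (comp_at r Y) S"
    and f: "f \<in> homset C X Y"
  shows "right_square (comp_at r X) R (comp_at r Y) S (o1 I) f (a2 (f \<otimes>\<^sub>1 \<alpha>)) (inv2 (cell_at r f)) \<longleftrightarrow>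
    (a2 (f \<otimes>\<^sub>1 o1 (I \<otimes>\<^sub>0 I)) \<sharp>\<^sub>2 S) \<bullet> (cell_at r f \<otimes>\<^sub>2 o2 I) = a2 (f \<otimes>\<^sub>1 \<alpha>) \<bullet> (R \<sharp>\<^sub>2 a2 (f \<otimes>\<^sub>1 o1 I))"
proof -
  note [simp] = right_dataD[OF d(1)] right_dataD[OF d(2)] f[unfolded homset_iff]
    right_constraintD(3)[OF r f, unfolded isocells_iff] merge
  let ?Q = "a2 (f \<otimes>\<^sub>1 o1 (I \<otimes>\<^sub>0 I)) \<sharp>\<^sub>2 S" and ?P = "R \<sharp>\<^sub>2 a2 (f \<otimes>\<^sub>1 o1 I)"
  have 2: "inv2 (cell_at r f \<otimes>\<^sub>2 o2 I) = inv2 (cell_at r f) \<otimes>\<^sub>2 o2 I"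
    by (simp add: inv2_tensor inv2_a2)
  have "right_square (comp_at r X) R (comp_at r Y) S (o1 I) f (a2 (f \<otimes>\<^sub>1 \<alpha>)) (inv2 (cell_at r f)) \<longleftrightarrow>
      ?P \<bullet> inv2 (cell_at r f \<otimes>\<^sub>2 o2 I) = inv2 (a2 (f \<otimes>\<^sub>1 \<alpha>)) \<bullet> ?Q"
    unfolding right_square_def 2 by (simp add: inv2_a2)
  also have "\<dots> \<longleftrightarrow> a2 (f \<otimes>\<^sub>1 \<alpha>) \<bullet> ?P = ?Q \<bullet> (cell_at r f \<otimes>\<^sub>2 o2 I)"
    by (rule inv2_swap[symmetric]) (use tensor_Comp[of "f \<otimes>\<^sub>1 o1 I" "comp_at r Y" "o1 I" "o1 I"] in simp_all)
  finally show ?thesis by metis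
qed

text \<open>Moves the naturality cells to the other sides as inverses, since these inverses are the
  squares to which \<open>Kelly_compat\<close> and \<open>Kelly_iff\<close> apply.\<close>

lemma Kelly_natural_iff:
  assumes l: "left_constraint I l" and r: "right_constraint I r" and f: "f \<in> homset C X X'" and g: "g \<in> homset C Y Y'"
    and I: "I \<in> Obj C"
    and k: "k \<in> isocells C (o1 X \<otimes>\<^sub>1 comp_at l Y) (comp_at r X \<otimes>\<^sub>1 o1 Y)"
    and k': "k' \<in> isocells C (o1 X' \<otimes>\<^sub>1 comp_at l Y') (comp_at r X' \<otimes>\<^sub>1 o1 Y')"
  shows "(a2 (f \<otimes>\<^sub>1 o1 I \<otimes>\<^sub>1 g) \<sharp>\<^sub>2 k') \<bullet> (cell_at r f \<otimes>\<^sub>2 a2 g) = (a2 f \<otimes>\<^sub>2 cell_at l g) \<bullet> (k \<sharp>\<^sub>2 a2 (f \<otimes>\<^sub>1 g)) \<longleftrightarrow>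
    (k \<sharp>\<^sub>2 a2 (f \<otimes>\<^sub>1 g)) \<bullet> (inv2 (cell_at r f) \<otimes>\<^sub>2 a2 g) = (a2 f \<otimes>\<^sub>2 inv2 (cell_at l g)) \<bullet> (a2 (f \<otimes>\<^sub>1 o1 I \<otimes>\<^sub>1 g) \<sharp>\<^sub>2 k')"
proof -
  have O: "X \<in> Obj C" "X' \<in> Obj C" "Y \<in> Obj C" "Y' \<in> Obj C" using f g by auto
  note [simp] = O I f[unfolded homset_iff] g[unfolded homset_iff] k[unfolded isocells_iff] k'[unfolded isocells_iff]
    left_constraintD(3)[OF l g, unfolded isocells_iff] right_constraintD(3)[OF r f, unfolded isocells_iff]
    left_constraintD(1)[OF l O(3), unfolded homset_iff] left_constraintD(1)[OF l O(4), unfolded homset_iff]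
    right_constraintD(1)[OF r O(1), unfolded homset_iff] right_constraintD(1)[OF r O(2), unfolded homset_iff] merge
  have 1: "inv2 (cell_at r f \<otimes>\<^sub>2 a2 g) = inv2 (cell_at r f) \<otimes>\<^sub>2 a2 g" "inv2 (a2 f \<otimes>\<^sub>2 cell_at l g) = a2 f \<otimes>\<^sub>2 inv2 (cell_at l g)"
    by (simp_all add: inv2_tensor inv2_a2)
  have "(a2 f \<otimes>\<^sub>2 cell_at l g) \<bullet> (k \<sharp>\<^sub>2 a2 (f \<otimes>\<^sub>1 g)) = (a2 (f \<otimes>\<^sub>1 o1 I \<otimes>\<^sub>1 g) \<sharp>\<^sub>2 k') \<bullet> (cell_at r f \<otimes>\<^sub>2 a2 g) \<longleftrightarrow>
    (k \<sharp>\<^sub>2 a2 (f \<otimes>\<^sub>1 g)) \<bullet> inv2 (cell_at r f \<otimes>\<^sub>2 a2 g) = inv2 (a2 f \<otimes>\<^sub>2 cell_at l g) \<bullet> (a2 (f \<otimes>\<^sub>1 o1 I \<otimes>\<^sub>1 g) \<sharp>\<^sub>2 k')"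
    by (rule inv2_swap) simp_all
  then show ?thesis unfolding 1 by metis
qed

text \<open>The elements of \<open>U_obj\<close> in terms of squares; naturality of \<open>K\<close> is left out since it is automatic.\<close>

definition unit_system ::
  "'o \<Rightarrow> 'a \<Rightarrow> ('o, 'a, 'a, 'c) ptrans \<Rightarrow> ('o, 'a, 'a, 'c) ptrans \<Rightarrow> ('o \<Rightarrow> 'c) \<Rightarrow> ('o \<Rightarrow> 'c) \<Rightarrow> ('o \<times> 'o \<Rightarrow> 'c) \<Rightarrow> bool" where
  "unit_system I \<alpha> l r L R K \<longleftrightarrow> I \<in> Obj C \<and> \<alpha> \<in> homset C (I \<otimes>\<^sub>0 I) I \<and> equi \<alpha> \<and> left_constraint I l \<and> right_constraint I r \<and>
     L \<in> extensional (Obj C) \<and> R \<in> extensional (Obj C) \<and> K \<in> extensional (Obj C \<times> Obj C) \<and>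
     (\<forall>X \<in> Obj C. left_data I \<alpha> X (comp_at l X) (L X)) \<and> (\<forall>X \<in> Obj C. right_data I \<alpha> X (comp_at r X) (R X)) \<and>
     (\<forall>X \<in> Obj C. \<forall>Y \<in> Obj C. \<forall>f \<in> homset C X Y. left_square (comp_at l X) (L X) (comp_at l Y) (L Y) (o1 I) f (a2 (\<alpha> \<otimes>\<^sub>1 f)) (inv2 (cell_at l f))) \<and>
     (\<forall>X \<in> Obj C. \<forall>Y \<in> Obj C. \<forall>f \<in> homset C X Y. right_square (comp_at r X) (R X) (comp_at r Y) (R Y) (o1 I) f (a2 (f \<otimes>\<^sub>1 \<alpha>)) (inv2 (cell_at r f))) \<and>
     (\<forall>X \<in> Obj C. \<forall>Y \<in> Obj C. Kelly_rel I \<alpha> X Y (comp_at r X) (R X) (comp_at l Y) (L Y) (K (X, Y)))"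

text \<open>For arrows \<open>f\<close> and \<open>g\<close> the base cells of the two naturality
  squares are \<open>a2 (f \<otimes>\<^sub>1 \<alpha>)\<close> and
  \<open>a2 (\<alpha> \<otimes>\<^sub>1 g)\<close>. Tensored with the other arrow both become the
  identity 2-cell of \<open>f \<otimes>\<^sub>1 \<alpha> \<otimes>\<^sub>1 g\<close>, so
  \<open>Kelly_compat\<close> applies.\<close>

lemma Kelly_cellsI:
  assumes U: "unit_system I \<alpha> l r L R K"
  shows "Kelly_cells I l r K"
proof -
  have I: "I \<in> Obj C" and \<alpha>: "\<alpha> \<in> homset C (I \<otimes>\<^sub>0 I) I" "equi \<alpha>" and l: "left_constraint I l" and r: "right_constraint I r"
    using U unfolding unit_system_def by auto
  have K: "Kelly_rel I \<alpha> X Y (comp_at r X) (R X) (comp_at l Y) (L Y) (K (X, Y))" if "X \<in> Obj C" "Y \<in> Obj C" for X Y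
    using U that unfolding unit_system_def by blast
  have Kc: "K (X, Y) \<in> isocells C (o1 X \<otimes>\<^sub>1 comp_at l Y) (comp_at r X \<otimes>\<^sub>1 o1 Y)" if "X \<in> Obj C" "Y \<in> Obj C" for X Y
    using K[OF that] unfolding Kelly_rel_def by blast
  have nat: "(a2 (f \<otimes>\<^sub>1 o1 I \<otimes>\<^sub>1 g) \<sharp>\<^sub>2 K (X', Y')) \<bullet> (cell_at r f \<otimes>\<^sub>2 a2 g) = (a2 f \<otimes>\<^sub>2 cell_at l g) \<bullet> (K (X, Y) \<sharp>\<^sub>2 a2 (f \<otimes>\<^sub>1 g))"
    if f: "f \<in> homset C X X'" and g: "g \<in> homset C Y Y'" for f g X X' Y Y'
  proof -
    have O: "X \<in> Obj C" "X' \<in> Obj C" "Y \<in> Obj C" "Y' \<in> Obj C" using f g by auto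
    show ?thesis
      unfolding Kelly_natural_iff[OF l r f g I Kc[OF O(1,3)] Kc[OF O(2,4)]]
    proof (rule Kelly_compat[OF K[OF O(1,3)] K[OF O(2,4)] _ f g base_cell_id[OF I \<alpha>(1) g] _ right_base_cell_id[OF I \<alpha>(1) f]])
      show "o1 I \<in> homset C I I" using I by simp
      show "left_square (comp_at l Y) (L Y) (comp_at l Y') (L Y') (o1 I) g (a2 (\<alpha> \<otimes>\<^sub>1 g)) (inv2 (cell_at l g))"
        "right_square (comp_at r X) (R X) (comp_at r X') (R X') (o1 I) f (a2 (f \<otimes>\<^sub>1 \<alpha>)) (inv2 (cell_at r f))"
        using U f g O unfolding unit_system_def by blast+
      show "a2 f \<otimes>\<^sub>2 a2 (\<alpha> \<otimes>\<^sub>1 g) = a2 (f \<otimes>\<^sub>1 \<alpha>) \<otimes>\<^sub>2 a2 g" using f g \<alpha> by simp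
      show "equi (comp_at l Y')" by (rule left_constraintD(2)[OF l O(4)])
    qed (rule \<alpha>)
  qed
  show ?thesis
    unfolding Kelly_cells_def inv_modification_def modification_def
  proof (intro conjI ballI; (elim SigmaE, simp only: prod2_simps mem_Times_iff)?)
    show "K \<in> extensional (Obj (prod2 C C))" using U unfolding unit_system_def by simp
  next
    fix Z assume "Z \<in> Obj (prod2 C C)"
    then show "K Z \<in> cells C (comp_at (lext l) Z) (comp_at (rext r) Z)" "iso (K Z)"
      using Kc by (cases Z; simp)+
  next
    fix h assume "h \<in> Arr (prod2 C C)"
    then obtain f g where h: "h = (f, g)" "f \<in> Arr C" "g \<in> Arr C" by auto
    show "(a2 (on_arr (mten I) h) \<sharp>\<^sub>2 K (Cod (prod2 C C) h)) \<bullet> cell_at (rext r) h =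
        cell_at (lext l) h \<bullet> (K (Dom (prod2 C C) h) \<sharp>\<^sub>2 a2 (on_arr (Tensor C) h))"
      using nat[of f "Dom C f" "Cod C f" g "Dom C g" "Cod C g"] h by simp
  qed
qed

lemma U_obj_iff: "(I, \<alpha>, l, r, L, R, K) \<in> U_obj \<longleftrightarrow> unit_system I \<alpha> l r L R K"
proof
  assume U: "(I, \<alpha>, l, r, L, R, K) \<in> U_obj"
  then have I: "I \<in> Obj C" and \<alpha>: "\<alpha> \<in> homset C (I \<otimes>\<^sub>0 I) I" "equi \<alpha>" and l: "left_constraint I l" and r: "right_constraint I r"
    and L: "inv_modification C C (lten (I \<otimes>\<^sub>0 I)) (lten I) (lwhisk I l) (larr \<alpha>) L"
    and R: "inv_modification C C (rten (I \<otimes>\<^sub>0 I)) (rten I) (rarr \<alpha>) (rwhisk r I) R"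
    and K: "Kelly_cells I l r K"
    and eq: "\<And>X Y. X \<in> Obj C \<Longrightarrow> Y \<in> Obj C \<Longrightarrow> ((R X \<otimes>\<^sub>2 o2 Y) \<sharp>\<^sub>2 a2 (o1 X \<otimes>\<^sub>1 comp_at l Y)) \<bullet>
        ((o2 X \<otimes>\<^sub>2 L Y) \<sharp>\<^sub>2 a2 (comp_at r X \<otimes>\<^sub>1 o1 Y)) = a2 (o1 X \<otimes>\<^sub>1 \<alpha> \<otimes>\<^sub>1 o1 Y) \<sharp>\<^sub>2 K (X, Y)"
    unfolding U_obj_def by auto
  have Ld: "left_data I \<alpha> X (comp_at l X) (L X)" if "X \<in> Obj C" for X
    using L I \<alpha> left_constraintD(1)[OF l] that unfolding left_data_def inv_modification_def modification_def by simp
  have Rd: "right_data I \<alpha> X (comp_at r X) (R X)" if "X \<in> Obj C" for X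
    using R I \<alpha> right_constraintD(1)[OF r] that unfolding right_data_def inv_modification_def modification_def by simp
  have "left_square (comp_at l X) (L X) (comp_at l Y) (L Y) (o1 I) f (a2 (\<alpha> \<otimes>\<^sub>1 f)) (inv2 (cell_at l f))"
    if f: "f \<in> homset C X Y" and O: "X \<in> Obj C" "Y \<in> Obj C" for X Y f
    unfolding left_square_iff_natural[OF l Ld[OF O(1)] Ld[OF O(2)] f]
    using L f unfolding inv_modification_def modification_def by auto
  moreover have "right_square (comp_at r X) (R X) (comp_at r Y) (R Y) (o1 I) f (a2 (f \<otimes>\<^sub>1 \<alpha>)) (inv2 (cell_at r f))"
    if f: "f \<in> homset C X Y" and O: "X \<in> Obj C" "Y \<in> Obj C" for X Y f
    unfolding right_square_iff_natural[OF r Rd[OF O(1)] Rd[OF O(2)] f]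
    using R f unfolding inv_modification_def modification_def by auto
  moreover have "Kelly_rel I \<alpha> X Y (comp_at r X) (R X) (comp_at l Y) (L Y) (K (X, Y))" if O: "X \<in> Obj C" "Y \<in> Obj C" for X Y
    unfolding Kelly_rel_def using Ld[OF O(2)] Rd[OF O(1)] eq[OF O] K O
    unfolding Kelly_cells_def inv_modification_def modification_def by simp
  moreover have "L \<in> extensional (Obj C)" "R \<in> extensional (Obj C)" "K \<in> extensional (Obj C \<times> Obj C)"
    using L R K unfolding Kelly_cells_def inv_modification_def modification_def by simp_all
  ultimately show "unit_system I \<alpha> l r L R K"
    unfolding unit_system_def using I \<alpha> l r Ld Rd by blast
next
  assume U: "unit_system I \<alpha> l r L R K"
  then have I: "I \<in> Obj C" and \<alpha>: "\<alpha> \<in> homset C (I \<otimes>\<^sub>0 I) I" "equi \<alpha>" and l: "left_constraint I l" and r: "right_constraint I r"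
    and ext: "L \<in> extensional (Obj C)" "R \<in> extensional (Obj C)"
    unfolding unit_system_def by auto
  have Ld: "left_data I \<alpha> X (comp_at l X) (L X)" and Rd: "right_data I \<alpha> X (comp_at r X) (R X)" if "X \<in> Obj C" for X
    using U that unfolding unit_system_def by auto
  have "inv_modification C C (lten (I \<otimes>\<^sub>0 I)) (lten I) (lwhisk I l) (larr \<alpha>) L"
    unfolding inv_modification_def modification_def
  proof (intro conjI ballI ext)
    fix f assume f: "f \<in> Arr C"
    then have f': "f \<in> homset C (Dom C f) (Cod C f)" "Dom C f \<in> Obj C" "Cod C f \<in> Obj C" by simp_all
    have "left_square (comp_at l (Dom C f)) (L (Dom C f)) (comp_at l (Cod C f)) (L (Cod C f)) (o1 I) f (a2 (\<alpha> \<otimes>\<^sub>1 f)) (inv2 (cell_at l f))"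
      using U f' unfolding unit_system_def by blast
    then show "(a2 (on_arr (lten (I \<otimes>\<^sub>0 I)) f) \<sharp>\<^sub>2 L (Cod C f)) \<bullet> cell_at (larr \<alpha>) f =
      cell_at (lwhisk I l) f \<bullet> (L (Dom C f) \<sharp>\<^sub>2 a2 (on_arr (lten I) f))"
      unfolding left_square_iff_natural[OF l Ld[OF f'(2)] Ld[OF f'(3)] f'(1)] by simp
  qed (use left_dataD[OF Ld] in simp_all)
  moreover have "inv_modification C C (rten (I \<otimes>\<^sub>0 I)) (rten I) (rarr \<alpha>) (rwhisk r I) R"
    unfolding inv_modification_def modification_def
  proof (intro conjI ballI ext)
    fix f assume f: "f \<in> Arr C"
    then have f': "f \<in> homset C (Dom C f) (Cod C f)" "Dom C f \<in> Obj C" "Cod C f \<in> Obj C" by simp_all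
    have "right_square (comp_at r (Dom C f)) (R (Dom C f)) (comp_at r (Cod C f)) (R (Cod C f)) (o1 I) f (a2 (f \<otimes>\<^sub>1 \<alpha>)) (inv2 (cell_at r f))"
      using U f' unfolding unit_system_def by blast
    then show "(a2 (on_arr (rten (I \<otimes>\<^sub>0 I)) f) \<sharp>\<^sub>2 R (Cod C f)) \<bullet> cell_at (rwhisk r I) f =
      cell_at (rarr \<alpha>) f \<bullet> (R (Dom C f) \<sharp>\<^sub>2 a2 (on_arr (rten I) f))"
      unfolding right_square_iff_natural[OF r Rd[OF f'(2)] Rd[OF f'(3)] f'(1)] by simp
  qed (use right_dataD[OF Rd] in simp_all)
  ultimately show "(I, \<alpha>, l, r, L, R, K) \<in> U_obj"
    using I \<alpha> l r Kelly_cellsI[OF U] U unfolding U_obj_def unit_system_def Kelly_rel_def by simp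
qed

lemma left_system_exists:
  assumes I: "cancellable I" and \<alpha>: "\<alpha> \<in> homset C (I \<otimes>\<^sub>0 I) I" "equi \<alpha>"
  obtains l L where "left_constraint I l" "L \<in> extensional (Obj C)" "\<And>X. X \<in> Obj C \<Longrightarrow> left_data I \<alpha> X (comp_at l X) (L X)"
    "\<And>f X Y. f \<in> homset C X Y \<Longrightarrow>
      left_square (comp_at l X) (L X) (comp_at l Y) (L Y) (o1 I) f (a2 (\<alpha> \<otimes>\<^sub>1 f)) (inv2 (cell_at l f))"
proof -
  note IO = cancellable_Obj[OF I]
  have "\<exists>p L. left_data I \<alpha> X p L \<and> equi p" if X: "X \<in> Obj C" for X
  proof -
    \<comment> \<open>Read as an arrow from I(IX) to IX, so that cancelling the outer
      \<open>I\<close> yields the arrow \<open>p\<close> together with \<open>L\<close>.\<close>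
    have h: "\<alpha> \<otimes>\<^sub>1 o1 X \<in> homset C (I \<otimes>\<^sub>0 I \<otimes>\<^sub>0 X) (I \<otimes>\<^sub>0 X)" using X \<alpha> IO by simp
    obtain p L where p: "p \<in> homset C (I \<otimes>\<^sub>0 X) X" "L \<in> isocells C (o1 I \<otimes>\<^sub>1 p) (\<alpha> \<otimes>\<^sub>1 o1 X)"
      using cancellable_left(2)[OF I _ X h] X IO by auto
    have "equi (\<alpha> \<otimes>\<^sub>1 o1 X)" using X \<alpha>(2) by (intro equi_tensor equi_id)
    moreover have "inv2 L \<in> isocells C (\<alpha> \<otimes>\<^sub>1 o1 X) (o1 I \<otimes>\<^sub>1 p)" using p(2) by simp
    ultimately have "equi (o1 I \<otimes>\<^sub>1 p)" by (rule equi_iso)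
    then have "equi p" by (rule equi_reflect_left[OF I]) (use p in simp)
    then show ?thesis using p IO \<alpha> X unfolding left_data_def by blast
  qed
  then obtain p L where p: "\<And>X. X \<in> Obj C \<Longrightarrow> left_data I \<alpha> X (p X) (L X)" "\<And>X. X \<in> Obj C \<Longrightarrow> equi (p X)"
    by metis
  have "\<exists>w. left_square (p (Dom C f)) (L (Dom C f)) (p (Cod C f)) (L (Cod C f)) (o1 I) f (a2 (\<alpha> \<otimes>\<^sub>1 f)) w"
    if f: "f \<in> Arr C" for f
  proof -
    have f': "f \<in> homset C (Dom C f) (Cod C f)" and O: "Dom C f \<in> Obj C" "Cod C f \<in> Obj C" using f by simp_all
    have "o1 I \<in> homset C I I" using IO by simp
    then show ?thesis
      using left_square_ex1[OF p(1)[OF O(1)] p(1)[OF O(2)] I equi_id[OF IO] _ f' base_cell_id[OF IO \<alpha>(1) f']] by blast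
  qed
  then obtain w where "\<And>f. f \<in> Arr C \<Longrightarrow>
      left_square (p (Dom C f)) (L (Dom C f)) (p (Cod C f)) (L (Cod C f)) (o1 I) f (a2 (\<alpha> \<otimes>\<^sub>1 f)) (w f)"
    by metis
  then have w: "left_square (p X) (L X) (p Y) (L Y) (o1 I) f (a2 (\<alpha> \<otimes>\<^sub>1 f)) (w f)" if "f \<in> homset C X Y" for f X Y
    using that by auto
  let ?l = "\<lparr>comp_at = restrict p (Obj C), cell_at = \<lambda>f\<in>Arr C. inv2 (w f)\<rparr>"
  have "left_constraint I ?l" by (rule left_constraintI[OF I p w])
  moreover have "inv2 (inv2 (w f)) = w f" if "f \<in> homset C X Y" for f X Y
    using w[OF that] unfolding left_square_def by (simp add: inv2_inv2)
  ultimately show thesis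
    using p(1) w by (intro that[of ?l "restrict L (Obj C)"]) auto
qed

lemma right_system_exists:
  assumes I: "cancellable I" and \<alpha>: "\<alpha> \<in> homset C (I \<otimes>\<^sub>0 I) I" "equi \<alpha>"
  obtains r R where "right_constraint I r" "R \<in> extensional (Obj C)" "\<And>X. X \<in> Obj C \<Longrightarrow> right_data I \<alpha> X (comp_at r X) (R X)"
    "\<And>f X Y. f \<in> homset C X Y \<Longrightarrow>
      right_square (comp_at r X) (R X) (comp_at r Y) (R Y) (o1 I) f (a2 (f \<otimes>\<^sub>1 \<alpha>)) (inv2 (cell_at r f))"
proof -
  note IO = cancellable_Obj[OF I]
  have "\<exists>p R. right_data I \<alpha> X p R \<and> equi p" if X: "X \<in> Obj C" for X
  proof -
    \<comment> \<open>The bracketing displays the outer \<open>I\<close> on the right that is to be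
      cancelled.\<close>
    have h: "o1 X \<otimes>\<^sub>1 \<alpha> \<in> homset C ((X \<otimes>\<^sub>0 I) \<otimes>\<^sub>0 I) (X \<otimes>\<^sub>0 I)" using X \<alpha> IO by simp
    obtain p R where p: "p \<in> homset C (X \<otimes>\<^sub>0 I) X" "R \<in> isocells C (p \<otimes>\<^sub>1 o1 I) (o1 X \<otimes>\<^sub>1 \<alpha>)"
      using cancellable_right(2)[OF I _ X h] X IO by auto
    have "equi (o1 X \<otimes>\<^sub>1 \<alpha>)" using X \<alpha>(2) by (intro equi_tensor equi_id)
    moreover have R: "inv2 R \<in> isocells C (o1 X \<otimes>\<^sub>1 \<alpha>) (p \<otimes>\<^sub>1 o1 I)" using p(2) by simp
    ultimately have "equi (p \<otimes>\<^sub>1 o1 I)" by (rule equi_iso)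
    then have "equi p" by (rule equi_reflect_right[OF I]) (use p in simp)
    then show ?thesis using p R IO \<alpha> X unfolding right_data_def by blast
  qed
  then obtain p R where p: "\<And>X. X \<in> Obj C \<Longrightarrow> right_data I \<alpha> X (p X) (R X)" "\<And>X. X \<in> Obj C \<Longrightarrow> equi (p X)"
    by metis
  have "\<exists>w. right_square (p (Dom C f)) (R (Dom C f)) (p (Cod C f)) (R (Cod C f)) (o1 I) f (a2 (f \<otimes>\<^sub>1 \<alpha>)) w"
    if f: "f \<in> Arr C" for f
  proof -
    have f': "f \<in> homset C (Dom C f) (Cod C f)" and O: "Dom C f \<in> Obj C" "Cod C f \<in> Obj C" using f by simp_all
    have "o1 I \<in> homset C I I" using IO by simp
    then show ?thesis
      using right_square_ex1[OF p(1)[OF O(1)] p(1)[OF O(2)] I equi_id[OF IO] _ f' right_base_cell_id[OF IO \<alpha>(1) f']] by blast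
  qed
  then obtain w where "\<And>f. f \<in> Arr C \<Longrightarrow>
      right_square (p (Dom C f)) (R (Dom C f)) (p (Cod C f)) (R (Cod C f)) (o1 I) f (a2 (f \<otimes>\<^sub>1 \<alpha>)) (w f)"
    by metis
  then have w: "right_square (p X) (R X) (p Y) (R Y) (o1 I) f (a2 (f \<otimes>\<^sub>1 \<alpha>)) (w f)" if "f \<in> homset C X Y" for f X Y
    using that by auto
  let ?r = "\<lparr>comp_at = restrict p (Obj C), cell_at = \<lambda>f\<in>Arr C. inv2 (w f)\<rparr>"
  have "right_constraint I ?r" by (rule right_constraintI[OF I p w])
  moreover have "inv2 (inv2 (w f)) = w f" if "f \<in> homset C X Y" for f X Y
    using w[OF that] unfolding right_square_def by (simp add: inv2_inv2)
  ultimately show thesis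
    using p(1) w by (intro that[of ?r "restrict R (Obj C)"]) auto
qed

lemma unit_systemD:
  assumes "unit_system I \<alpha> l r L R K"
  shows "I \<in> Obj C" "\<alpha> \<in> homset C (I \<otimes>\<^sub>0 I) I" "equi \<alpha>" "left_constraint I l" "right_constraint I r" "cancellable I"
    "X \<in> Obj C \<Longrightarrow> left_data I \<alpha> X (comp_at l X) (L X)" "X \<in> Obj C \<Longrightarrow> right_data I \<alpha> X (comp_at r X) (R X)"
    "X \<in> Obj C \<Longrightarrow> equi (comp_at l X)" "X \<in> Obj C \<Longrightarrow> equi (comp_at r X)"
    "f \<in> homset C X Y \<Longrightarrow> left_square (comp_at l X) (L X) (comp_at l Y) (L Y) (o1 I) f (a2 (\<alpha> \<otimes>\<^sub>1 f)) (inv2 (cell_at l f))"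
    "f \<in> homset C X Y \<Longrightarrow> right_square (comp_at r X) (R X) (comp_at r Y) (R Y) (o1 I) f (a2 (f \<otimes>\<^sub>1 \<alpha>)) (inv2 (cell_at r f))"
    "\<lbrakk>X \<in> Obj C; Y \<in> Obj C\<rbrakk> \<Longrightarrow> Kelly_rel I \<alpha> X Y (comp_at r X) (R X) (comp_at l Y) (L Y) (K (X, Y))"
proof -
  show "I \<in> Obj C" "\<alpha> \<in> homset C (I \<otimes>\<^sub>0 I) I" "equi \<alpha>" and l: "left_constraint I l" and r: "right_constraint I r"
    using assms unfolding unit_system_def by auto
  then show "cancellable I" by (metis constraints_cancellable)
  show "X \<in> Obj C \<Longrightarrow> left_data I \<alpha> X (comp_at l X) (L X)" "X \<in> Obj C \<Longrightarrow> right_data I \<alpha> X (comp_at r X) (R X)"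
    "\<lbrakk>X \<in> Obj C; Y \<in> Obj C\<rbrakk> \<Longrightarrow> Kelly_rel I \<alpha> X Y (comp_at r X) (R X) (comp_at l Y) (L Y) (K (X, Y))"
    using assms unfolding unit_system_def by blast+
  show "X \<in> Obj C \<Longrightarrow> equi (comp_at l X)" "X \<in> Obj C \<Longrightarrow> equi (comp_at r X)"
    using left_constraintD(2)[OF l] right_constraintD(2)[OF r] by blast+
  have "f \<in> homset C X Y \<Longrightarrow> X \<in> Obj C \<and> Y \<in> Obj C" by auto
  then show "f \<in> homset C X Y \<Longrightarrow> left_square (comp_at l X) (L X) (comp_at l Y) (L Y) (o1 I) f (a2 (\<alpha> \<otimes>\<^sub>1 f)) (inv2 (cell_at l f))"
    "f \<in> homset C X Y \<Longrightarrow> right_square (comp_at r X) (R X) (comp_at r Y) (R Y) (o1 I) f (a2 (f \<otimes>\<^sub>1 \<alpha>)) (inv2 (cell_at r f))"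
    using assms unfolding unit_system_def by blast+
qed

lemma E_obj_lift:
  assumes "(I, \<alpha>) \<in> E_obj"
  obtains l r L R K where "(I, \<alpha>, l, r, L, R, K) \<in> U_obj"
proof -
  have I: "cancellable I" and \<alpha>: "\<alpha> \<in> homset C (I \<otimes>\<^sub>0 I) I" "equi \<alpha>" using assms unfolding E_obj_def by auto
  note IO = cancellable_Obj[OF I]
  obtain l L where l: "left_constraint I l" "L \<in> extensional (Obj C)" "\<And>X. X \<in> Obj C \<Longrightarrow> left_data I \<alpha> X (comp_at l X) (L X)"
    "\<And>f X Y. f \<in> homset C X Y \<Longrightarrow>
      left_square (comp_at l X) (L X) (comp_at l Y) (L Y) (o1 I) f (a2 (\<alpha> \<otimes>\<^sub>1 f)) (inv2 (cell_at l f))"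
    by (rule left_system_exists[OF I \<alpha>]) blast
  obtain r R where r: "right_constraint I r" "R \<in> extensional (Obj C)" "\<And>X. X \<in> Obj C \<Longrightarrow> right_data I \<alpha> X (comp_at r X) (R X)"
    "\<And>f X Y. f \<in> homset C X Y \<Longrightarrow>
      right_square (comp_at r X) (R X) (comp_at r Y) (R Y) (o1 I) f (a2 (f \<otimes>\<^sub>1 \<alpha>)) (inv2 (cell_at r f))"
    by (rule right_system_exists[OF I \<alpha>]) blast
  let ?P = "\<lambda>Z k. Kelly_rel I \<alpha> (fst Z) (snd Z) (comp_at r (fst Z)) (R (fst Z)) (comp_at l (snd Z)) (L (snd Z)) k"
  have "?P (X, Y) (SOME k. ?P (X, Y) k)" if "X \<in> Obj C" "Y \<in> Obj C" for X Y
    by (rule someI_ex) (use Kelly_rel_exists[OF r(3)[OF that(1)] l(3)[OF that(2)] \<alpha>(2)] in simp)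
  then have "unit_system I \<alpha> l r L R (\<lambda>Z \<in> Obj C \<times> Obj C. SOME k. ?P Z k)"
    unfolding unit_system_def using IO \<alpha> l r by (simp del: homset_iff)
  then show thesis using that U_obj_iff by blast
qed

subsection \<open>Coherence\<close>

text \<open>The whole equation is tensored with \<open>Z\<close>. In this way the constraint at
  \<open>Y\<close> tensored with \<open>Z\<close> becomes a second candidate for the left data at
  YZ, to be compared with the constraint at YZ itself.\<close>

lemma Kelly_rel_tensor_right:
  assumes "Kelly_rel I \<alpha> X Y r R l L k" "Z \<in> Obj C"
  shows "Kelly_rel I \<alpha> X (Y \<otimes>\<^sub>0 Z) r R (l \<otimes>\<^sub>1 o1 Z) (L \<otimes>\<^sub>2 o2 Z) (k \<otimes>\<^sub>2 o2 Z)"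
proof -
  have d: "right_data I \<alpha> X r R" "left_data I \<alpha> Y l L" and k: "k \<in> isocells C (o1 X \<otimes>\<^sub>1 l) (r \<otimes>\<^sub>1 o1 Y)"
    and eq: "((R \<otimes>\<^sub>2 o2 Y) \<sharp>\<^sub>2 a2 (o1 X \<otimes>\<^sub>1 l)) \<bullet> ((o2 X \<otimes>\<^sub>2 L) \<sharp>\<^sub>2 a2 (r \<otimes>\<^sub>1 o1 Y)) = a2 (o1 X \<otimes>\<^sub>1 \<alpha> \<otimes>\<^sub>1 o1 Y) \<sharp>\<^sub>2 k"
    using assms unfolding Kelly_rel_def by blast+
  note [simp] = right_dataD[OF d(1)] left_dataD[OF d(2)] k[unfolded isocells_iff] assms(2)
  have a: "a2 (o1 X \<otimes>\<^sub>1 \<alpha> \<otimes>\<^sub>1 o1 (Y \<otimes>\<^sub>0 Z)) = a2 ((o1 X \<otimes>\<^sub>1 \<alpha> \<otimes>\<^sub>1 o1 Y) \<otimes>\<^sub>1 o1 Z)" by simp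
  have b: "R \<otimes>\<^sub>2 o2 (Y \<otimes>\<^sub>0 Z) = (R \<otimes>\<^sub>2 o2 Y) \<otimes>\<^sub>2 o2 Z" by simp
  have c: "a2 (o1 X \<otimes>\<^sub>1 l \<otimes>\<^sub>1 o1 Z) = a2 ((o1 X \<otimes>\<^sub>1 l) \<otimes>\<^sub>1 o1 Z)" by simp
  have e: "a2 (r \<otimes>\<^sub>1 o1 (Y \<otimes>\<^sub>0 Z)) = a2 ((r \<otimes>\<^sub>1 o1 Y) \<otimes>\<^sub>1 o1 Z)" by simp
  have f: "o2 X \<otimes>\<^sub>2 L \<otimes>\<^sub>2 o2 Z = (o2 X \<otimes>\<^sub>2 L) \<otimes>\<^sub>2 o2 Z" by simp
  have t1: "((R \<otimes>\<^sub>2 o2 Y) \<otimes>\<^sub>2 o2 Z) \<sharp>\<^sub>2 a2 ((o1 X \<otimes>\<^sub>1 l) \<otimes>\<^sub>1 o1 Z) = ((R \<otimes>\<^sub>2 o2 Y) \<sharp>\<^sub>2 a2 (o1 X \<otimes>\<^sub>1 l)) \<otimes>\<^sub>2 o2 Z"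
    by (subst tensor_whisker(2)) simp_all
  have t2: "((o2 X \<otimes>\<^sub>2 L) \<otimes>\<^sub>2 o2 Z) \<sharp>\<^sub>2 a2 ((r \<otimes>\<^sub>1 o1 Y) \<otimes>\<^sub>1 o1 Z) = ((o2 X \<otimes>\<^sub>2 L) \<sharp>\<^sub>2 a2 (r \<otimes>\<^sub>1 o1 Y)) \<otimes>\<^sub>2 o2 Z"
    by (subst tensor_whisker(2)) simp_all
  have "left_data I \<alpha> (Y \<otimes>\<^sub>0 Z) (l \<otimes>\<^sub>1 o1 Z) (L \<otimes>\<^sub>2 o2 Z)" unfolding left_data_def by simp
  moreover have "k \<otimes>\<^sub>2 o2 Z \<in> isocells C (o1 X \<otimes>\<^sub>1 l \<otimes>\<^sub>1 o1 Z) (r \<otimes>\<^sub>1 o1 (Y \<otimes>\<^sub>0 Z))" by simp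
  moreover have "((R \<otimes>\<^sub>2 o2 (Y \<otimes>\<^sub>0 Z)) \<sharp>\<^sub>2 a2 (o1 X \<otimes>\<^sub>1 l \<otimes>\<^sub>1 o1 Z)) \<bullet>
      ((o2 X \<otimes>\<^sub>2 L \<otimes>\<^sub>2 o2 Z) \<sharp>\<^sub>2 a2 (r \<otimes>\<^sub>1 o1 (Y \<otimes>\<^sub>0 Z)))
    = (((R \<otimes>\<^sub>2 o2 Y) \<sharp>\<^sub>2 a2 (o1 X \<otimes>\<^sub>1 l)) \<bullet> ((o2 X \<otimes>\<^sub>2 L) \<sharp>\<^sub>2 a2 (r \<otimes>\<^sub>1 o1 Y))) \<otimes>\<^sub>2 o2 Z"
    unfolding b c e f t1 t2 by (subst whisker_Vcomp(4)) (simp_all add: merge)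
  moreover have "\<dots> = a2 (o1 X \<otimes>\<^sub>1 \<alpha> \<otimes>\<^sub>1 o1 (Y \<otimes>\<^sub>0 Z)) \<sharp>\<^sub>2 (k \<otimes>\<^sub>2 o2 Z)"
    unfolding eq a by (subst tensor_whisker(1)) simp_all
  ultimately show ?thesis unfolding Kelly_rel_def using d by simp
qed

lemma Kelly_rel_tensor_left:
  assumes "Kelly_rel I \<alpha> X Y r R l L k" "Z \<in> Obj C"
  shows "Kelly_rel I \<alpha> (Z \<otimes>\<^sub>0 X) Y (o1 Z \<otimes>\<^sub>1 r) (o2 Z \<otimes>\<^sub>2 R) l L (o2 Z \<otimes>\<^sub>2 k)"
proof -
  have d: "right_data I \<alpha> X r R" "left_data I \<alpha> Y l L" and k: "k \<in> isocells C (o1 X \<otimes>\<^sub>1 l) (r \<otimes>\<^sub>1 o1 Y)"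
    and eq: "((R \<otimes>\<^sub>2 o2 Y) \<sharp>\<^sub>2 a2 (o1 X \<otimes>\<^sub>1 l)) \<bullet> ((o2 X \<otimes>\<^sub>2 L) \<sharp>\<^sub>2 a2 (r \<otimes>\<^sub>1 o1 Y)) = a2 (o1 X \<otimes>\<^sub>1 \<alpha> \<otimes>\<^sub>1 o1 Y) \<sharp>\<^sub>2 k"
    using assms unfolding Kelly_rel_def by blast+
  note [simp] = right_dataD[OF d(1)] left_dataD[OF d(2)] k[unfolded isocells_iff] assms(2)
  \<comment> \<open>The simplifier merges the product of two identities into a single one but keeps
    them apart in front of a third factor; these rules split the merged form again.\<close>
  have ZX: "o1 (Z \<otimes>\<^sub>0 X) \<otimes>\<^sub>1 h = o1 Z \<otimes>\<^sub>1 o1 X \<otimes>\<^sub>1 h" if "h \<in> Arr C" for h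
    using tensor_assoc(2)[of "o1 Z" "o1 X" h] that by simp
  have ZX2: "o2 (Z \<otimes>\<^sub>0 X) \<otimes>\<^sub>2 h = o2 Z \<otimes>\<^sub>2 o2 X \<otimes>\<^sub>2 h" if "h \<in> Cell C" for h
    using tensor_assoc(3)[of "o2 Z" "o2 X" h] that by simp
  have t1: "(o2 Z \<otimes>\<^sub>2 R \<otimes>\<^sub>2 o2 Y) \<sharp>\<^sub>2 a2 (o1 Z \<otimes>\<^sub>1 o1 X \<otimes>\<^sub>1 l) = o2 Z \<otimes>\<^sub>2 ((R \<otimes>\<^sub>2 o2 Y) \<sharp>\<^sub>2 a2 (o1 X \<otimes>\<^sub>1 l))"
    by (subst tensor_whisker(2)) simp_all
  have t2: "(o2 Z \<otimes>\<^sub>2 o2 X \<otimes>\<^sub>2 L) \<sharp>\<^sub>2 a2 (o1 Z \<otimes>\<^sub>1 r \<otimes>\<^sub>1 o1 Y) = o2 Z \<otimes>\<^sub>2 ((o2 X \<otimes>\<^sub>2 L) \<sharp>\<^sub>2 a2 (r \<otimes>\<^sub>1 o1 Y))"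
    by (subst tensor_whisker(2)) simp_all
  have "right_data I \<alpha> (Z \<otimes>\<^sub>0 X) (o1 Z \<otimes>\<^sub>1 r) (o2 Z \<otimes>\<^sub>2 R)" unfolding right_data_def by (simp add: ZX)
  moreover have "o2 Z \<otimes>\<^sub>2 k \<in> isocells C (o1 (Z \<otimes>\<^sub>0 X) \<otimes>\<^sub>1 l) ((o1 Z \<otimes>\<^sub>1 r) \<otimes>\<^sub>1 o1 Y)" by (simp add: ZX)
  moreover have "(((o2 Z \<otimes>\<^sub>2 R) \<otimes>\<^sub>2 o2 Y) \<sharp>\<^sub>2 a2 (o1 (Z \<otimes>\<^sub>0 X) \<otimes>\<^sub>1 l)) \<bullet>
      ((o2 (Z \<otimes>\<^sub>0 X) \<otimes>\<^sub>2 L) \<sharp>\<^sub>2 a2 ((o1 Z \<otimes>\<^sub>1 r) \<otimes>\<^sub>1 o1 Y))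
    = o2 Z \<otimes>\<^sub>2 (((R \<otimes>\<^sub>2 o2 Y) \<sharp>\<^sub>2 a2 (o1 X \<otimes>\<^sub>1 l)) \<bullet> ((o2 X \<otimes>\<^sub>2 L) \<sharp>\<^sub>2 a2 (r \<otimes>\<^sub>1 o1 Y)))"
    by (subst whisker_Vcomp(3)) (simp_all add: merge ZX ZX2 t1 t2)
  moreover have "\<dots> = a2 (o1 (Z \<otimes>\<^sub>0 X) \<otimes>\<^sub>1 \<alpha> \<otimes>\<^sub>1 o1 Y) \<sharp>\<^sub>2 (o2 Z \<otimes>\<^sub>2 k)"
    unfolding eq by (subst ZX, simp, subst tensor_whisker(1)) simp_all
  ultimately show ?thesis unfolding Kelly_rel_def using d by simp
qed

text \<open>Here the square \<open>k\<close> lies over an identity 2-cell and compares the left data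
  at XY with those at \<open>X\<close> tensored with \<open>Y\<close>. \<open>Kelly_compat\<close>
  proves the coherence equation with \<open>k\<close> for every object in front. The case of
  \<open>I\<close> in front is the defining equation of \<open>Klam\<close>, so \<open>k\<close> is
  that 2-cell.\<close>

lemma Klam_coherent:
  assumes U: "unit_system I \<alpha> l r L R K" and O: "X \<in> Obj C" "Y \<in> Obj C" "Z \<in> Obj C"
  shows "(o2 Z \<otimes>\<^sub>2 Klam I l K X Y) \<bullet> (K (Z, X) \<otimes>\<^sub>2 o2 Y) = K (Z, X \<otimes>\<^sub>0 Y)"
proof -
  note u = unit_systemD[OF U]
  have XY: "X \<otimes>\<^sub>0 Y \<in> Obj C" using O by simp
  have d: "left_data I \<alpha> (X \<otimes>\<^sub>0 Y) (comp_at l X \<otimes>\<^sub>1 o1 Y) (L X \<otimes>\<^sub>2 o2 Y)"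
    using Kelly_rel_tensor_right[OF u(13)[OF O(1) O(1)] O(2)] unfolding Kelly_rel_def by blast
  have h: "o1 I \<in> homset C I I" "o1 (X \<otimes>\<^sub>0 Y) \<in> homset C (X \<otimes>\<^sub>0 Y) (X \<otimes>\<^sub>0 Y)" using u(1) O by simp_all
  note b = base_cell_id[OF u(1,2) h(2)]
  obtain k where k: "left_square (comp_at l (X \<otimes>\<^sub>0 Y)) (L (X \<otimes>\<^sub>0 Y)) (comp_at l X \<otimes>\<^sub>1 o1 Y) (L X \<otimes>\<^sub>2 o2 Y)
      (o1 I) (o1 (X \<otimes>\<^sub>0 Y)) (a2 (\<alpha> \<otimes>\<^sub>1 o1 (X \<otimes>\<^sub>0 Y))) k"
    using left_square_ex1[OF u(7)[OF XY] d u(6) equi_id[OF u(1)] h b] by blast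
  note lD = left_constraintD(1)[OF u(4), unfolded homset_iff] and rD = right_constraintD(1)[OF u(5), unfolded homset_iff]
  have kc: "k \<in> isocells C (comp_at l (X \<otimes>\<^sub>0 Y)) (comp_at l X \<otimes>\<^sub>1 o1 Y)"
    using k u(1) O lD[OF O(1)] lD[OF XY] unfolding left_square_def by simp
  have Kc: "K (A, B) \<in> isocells C (o1 A \<otimes>\<^sub>1 comp_at l B) (comp_at r A \<otimes>\<^sub>1 o1 B)" if "A \<in> Obj C" "B \<in> Obj C" for A B
    using u(13)[OF that] unfolding Kelly_rel_def by blast
  have coh: "(o2 A \<otimes>\<^sub>2 k) \<bullet> (K (A, X) \<otimes>\<^sub>2 o2 Y) = K (A, X \<otimes>\<^sub>0 Y)" if A: "A \<in> Obj C" for A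
  proof -
    have hA: "o1 A \<in> homset C A A" using A by simp
    have "(K (A, X \<otimes>\<^sub>0 Y) \<sharp>\<^sub>2 a2 (o1 A \<otimes>\<^sub>1 o1 (X \<otimes>\<^sub>0 Y))) \<bullet> (a2 (comp_at r A) \<otimes>\<^sub>2 a2 (o1 (X \<otimes>\<^sub>0 Y)))
        = (a2 (o1 A) \<otimes>\<^sub>2 k) \<bullet> (a2 (o1 A \<otimes>\<^sub>1 o1 I \<otimes>\<^sub>1 o1 (X \<otimes>\<^sub>0 Y)) \<sharp>\<^sub>2 (K (A, X) \<otimes>\<^sub>2 o2 Y))"
    proof (rule Kelly_compat[OF u(13)[OF A XY] Kelly_rel_tensor_right[OF u(13)[OF A O(1)] O(2)] h(1) hA h(2) b k
          right_base_cell_id[OF u(1,2) hA] right_square_id[OF u(8)[OF A]] _ u(3)])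
      show "equi (comp_at l X \<otimes>\<^sub>1 o1 Y)" using u(9)[OF O(1)] O by (intro equi_tensor equi_id)
    qed (use u(2) A O in simp)
    then show ?thesis
      using A O u(1) Kc[OF A O(1)] Kc[OF A XY] kc lD[OF O(1)] lD[OF XY] rD[OF A] by simp
  qed
  \<comment> \<open>Uniqueness: in the defining equation the invertible \<open>K (I, X)\<close>
    tensored with \<open>Y\<close> is cancelled first, and then the factor \<open>I\<close>.\<close>
  have "Klam I l K X Y = k"
    unfolding Klam_def
  proof (rule the_equality)
    show "k \<in> cells C (comp_at l (X \<otimes>\<^sub>0 Y)) (comp_at l X \<otimes>\<^sub>1 o1 Y) \<and> (o2 I \<otimes>\<^sub>2 k) \<bullet> (K (I, X) \<otimes>\<^sub>2 o2 Y) = K (I, X \<otimes>\<^sub>0 Y)"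
      using kc coh[OF u(1)] by simp
  next
    fix k' assume k': "k' \<in> cells C (comp_at l (X \<otimes>\<^sub>0 Y)) (comp_at l X \<otimes>\<^sub>1 o1 Y) \<and> (o2 I \<otimes>\<^sub>2 k') \<bullet> (K (I, X) \<otimes>\<^sub>2 o2 Y) = K (I, X \<otimes>\<^sub>0 Y)"
    have "(o2 I \<otimes>\<^sub>2 k') \<bullet> (K (I, X) \<otimes>\<^sub>2 o2 Y) = (o2 I \<otimes>\<^sub>2 k) \<bullet> (K (I, X) \<otimes>\<^sub>2 o2 Y)"
      using k' coh[OF u(1)] by simp
    then have "o2 I \<otimes>\<^sub>2 k' = o2 I \<otimes>\<^sub>2 k"
      by (subst (asm) Vcomp_cancel_right) (use kc k' Kc[OF u(1) O(1)] u(1) O lD[OF O(1)] in simp_all)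
    then show "k' = k"
      by (subst (asm) ff_on_eq_iff[OF cancellable_left(1)[OF u(6), of "I \<otimes>\<^sub>0 X \<otimes>\<^sub>0 Y" "X \<otimes>\<^sub>0 Y"]])
        (use kc k' lD[OF XY] in simp_all)
  qed
  then show ?thesis using coh[OF O(3)] by simp
qed

text \<open>The mirror image of \<open>Klam_coherent\<close>, with a right square from the data at
  \<open>Y\<close> tensored with \<open>X\<close> to the data at XY. The roles in
  \<open>Kelly_compat\<close> are exchanged: the left square is now an identity.\<close>

lemma Krho_coherent:
  assumes U: "unit_system I \<alpha> l r L R K" and O: "X \<in> Obj C" "Y \<in> Obj C" "Z \<in> Obj C"
  shows "(o2 X \<otimes>\<^sub>2 K (Y, Z)) \<bullet> (Krho I r K X Y \<otimes>\<^sub>2 o2 Z) = K (X \<otimes>\<^sub>0 Y, Z)"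
proof -
  note u = unit_systemD[OF U]
  have XY: "X \<otimes>\<^sub>0 Y \<in> Obj C" using O by simp
  have d: "right_data I \<alpha> (X \<otimes>\<^sub>0 Y) (o1 X \<otimes>\<^sub>1 comp_at r Y) (o2 X \<otimes>\<^sub>2 R Y)"
    using Kelly_rel_tensor_left[OF u(13)[OF O(2) O(2)] O(1)] unfolding Kelly_rel_def by blast
  have h: "o1 I \<in> homset C I I" "o1 (X \<otimes>\<^sub>0 Y) \<in> homset C (X \<otimes>\<^sub>0 Y) (X \<otimes>\<^sub>0 Y)" using u(1) O by simp_all
  note b = right_base_cell_id[OF u(1,2) h(2)]
  obtain k where k: "right_square (o1 X \<otimes>\<^sub>1 comp_at r Y) (o2 X \<otimes>\<^sub>2 R Y) (comp_at r (X \<otimes>\<^sub>0 Y)) (R (X \<otimes>\<^sub>0 Y))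
      (o1 I) (o1 (X \<otimes>\<^sub>0 Y)) (a2 (o1 (X \<otimes>\<^sub>0 Y) \<otimes>\<^sub>1 \<alpha>)) k"
    using right_square_ex1[OF d u(8)[OF XY] u(6) equi_id[OF u(1)] h b] by blast
  note lD = left_constraintD(1)[OF u(4), unfolded homset_iff] and rD = right_constraintD(1)[OF u(5), unfolded homset_iff]
  have kc: "k \<in> isocells C (o1 X \<otimes>\<^sub>1 comp_at r Y) (comp_at r (X \<otimes>\<^sub>0 Y))"
    using k u(1) O rD[OF O(2)] rD[OF XY] unfolding right_square_def by simp
  have Kc: "K (A, B) \<in> isocells C (o1 A \<otimes>\<^sub>1 comp_at l B) (comp_at r A \<otimes>\<^sub>1 o1 B)" if "A \<in> Obj C" "B \<in> Obj C" for A B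
    using u(13)[OF that] unfolding Kelly_rel_def by blast
  have coh: "(o2 X \<otimes>\<^sub>2 K (Y, A)) \<bullet> (k \<otimes>\<^sub>2 o2 A) = K (X \<otimes>\<^sub>0 Y, A)" if A: "A \<in> Obj C" for A
  proof -
    have hA: "o1 A \<in> homset C A A" using A by simp
    have "((o2 X \<otimes>\<^sub>2 K (Y, A)) \<sharp>\<^sub>2 a2 (o1 (X \<otimes>\<^sub>0 Y) \<otimes>\<^sub>1 o1 A)) \<bullet> (k \<otimes>\<^sub>2 a2 (o1 A))
        = (a2 (o1 (X \<otimes>\<^sub>0 Y)) \<otimes>\<^sub>2 a2 (comp_at l A)) \<bullet> (a2 (o1 (X \<otimes>\<^sub>0 Y) \<otimes>\<^sub>1 o1 I \<otimes>\<^sub>1 o1 A) \<sharp>\<^sub>2 K (X \<otimes>\<^sub>0 Y, A))"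
    proof (rule Kelly_compat[OF Kelly_rel_tensor_left[OF u(13)[OF O(2) A] O(1)] u(13)[OF XY A] h(1) h(2) hA
          base_cell_id[OF u(1,2) hA] left_square_id[OF u(7)[OF A]] b k _ u(3)])
      show "equi (comp_at l A)" by (rule u(9)[OF A])
    qed (use u(2) A O in simp)
    moreover have "o1 X \<otimes>\<^sub>1 o1 Y \<otimes>\<^sub>1 comp_at l A = o1 (X \<otimes>\<^sub>0 Y) \<otimes>\<^sub>1 comp_at l A"
      using tensor_assoc(2)[of "o1 X" "o1 Y" "comp_at l A"] O lD[OF A] by simp
    ultimately show ?thesis
      using A O u(1) Kc[OF O(2) A] Kc[OF XY A] kc lD[OF A] rD[OF O(2)] rD[OF XY] by simp
  qed
  have "Krho I r K X Y = k"
    unfolding Krho_def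
  proof (rule the_equality)
    show "k \<in> cells C (o1 X \<otimes>\<^sub>1 comp_at r Y) (comp_at r (X \<otimes>\<^sub>0 Y)) \<and> (o2 X \<otimes>\<^sub>2 K (Y, I)) \<bullet> (k \<otimes>\<^sub>2 o2 I) = K (X \<otimes>\<^sub>0 Y, I)"
      using kc coh[OF u(1)] by simp
  next
    fix k' assume k': "k' \<in> cells C (o1 X \<otimes>\<^sub>1 comp_at r Y) (comp_at r (X \<otimes>\<^sub>0 Y)) \<and> (o2 X \<otimes>\<^sub>2 K (Y, I)) \<bullet> (k' \<otimes>\<^sub>2 o2 I) = K (X \<otimes>\<^sub>0 Y, I)"
    have "(o2 X \<otimes>\<^sub>2 K (Y, I)) \<bullet> (k' \<otimes>\<^sub>2 o2 I) = (o2 X \<otimes>\<^sub>2 K (Y, I)) \<bullet> (k \<otimes>\<^sub>2 o2 I)"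
      using k' coh[OF u(1)] by simp
    then have "k' \<otimes>\<^sub>2 o2 I = k \<otimes>\<^sub>2 o2 I"
      by (subst (asm) Vcomp_cancel_left) (use kc k' Kc[OF O(2) u(1)] u(1) O rD[OF O(2)] in simp_all)
    then show "k' = k"
      by (subst (asm) ff_on_eq_iff[OF cancellable_right(1)[OF u(6), of "X \<otimes>\<^sub>0 Y \<otimes>\<^sub>0 I" "X \<otimes>\<^sub>0 Y"]])
        (use kc k' u(1) O rD[OF O(2)] in simp_all)
  qed
  then show ?thesis using coh[OF O(3)] by simp
qed

lemma Psi_obj_G_obj:
  assumes "(I, \<alpha>, l, r, L, R, K) \<in> U_obj" shows "(I, l, r, K) \<in> G_obj"
proof -
  have U: "unit_system I \<alpha> l r L R K" using assms unfolding U_obj_iff .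
  show ?thesis
    using unit_systemD(1,4,5)[OF U] Kelly_cellsI[OF U] Klam_coherent[OF U] Krho_coherent[OF U]
    unfolding G_obj_def coherent_def by simp
qed

lemma Phi_obj_E_obj:
  assumes "(I, \<alpha>, l, r, L, R, K) \<in> U_obj" shows "(I, \<alpha>) \<in> E_obj"
  using unit_systemD(2,3,6)[OF assms[unfolded U_obj_iff]] unfolding E_obj_def by simp

text \<open>For a GPS unit this is needed before any unit system exists, so the 2-cell is found by
  solving its defining equation and cancelling \<open>I\<close> on the right.\<close>

lemma Krho_isocell:
  assumes I: "cancellable I" and l: "left_constraint I l" and r: "right_constraint I r"
    and K: "\<And>X Y. \<lbrakk>X \<in> Obj C; Y \<in> Obj C\<rbrakk> \<Longrightarrow> K (X, Y) \<in> isocells C (o1 X \<otimes>\<^sub>1 comp_at l Y) (comp_at r X \<otimes>\<^sub>1 o1 Y)"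
    and O: "X \<in> Obj C" "Y \<in> Obj C"
  shows "Krho I r K X Y \<in> isocells C (o1 X \<otimes>\<^sub>1 comp_at r Y) (comp_at r (X \<otimes>\<^sub>0 Y))"
proof -
  note IO = cancellable_Obj[OF I]
  have XY: "X \<otimes>\<^sub>0 Y \<in> Obj C" using O by simp
  note [simp] = O IO left_constraintD(1)[OF l IO, unfolded homset_iff]
    right_constraintD(1)[OF r O(2), unfolded homset_iff] right_constraintD(1)[OF r XY, unfolded homset_iff]
    K[OF O(2) IO, unfolded isocells_iff] K[OF XY IO, unfolded isocells_iff]
  have a: "o1 (X \<otimes>\<^sub>0 Y) \<otimes>\<^sub>1 comp_at l I = o1 X \<otimes>\<^sub>1 o1 Y \<otimes>\<^sub>1 comp_at l I"
    using tensor_assoc(2)[of "o1 X" "o1 Y" "comp_at l I"] by simp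
  note ff = cancellable_right(1)[OF I, of "X \<otimes>\<^sub>0 Y \<otimes>\<^sub>0 I" "X \<otimes>\<^sub>0 Y"]
  obtain k where k: "k \<in> isocells C (o1 X \<otimes>\<^sub>1 comp_at r Y) (comp_at r (X \<otimes>\<^sub>0 Y))"
    "k \<otimes>\<^sub>2 o2 I = inv2 (o2 X \<otimes>\<^sub>2 K (Y, I)) \<bullet> K (X \<otimes>\<^sub>0 Y, I)"
    by (rule ff_on_isocell[OF ff, of "o1 X \<otimes>\<^sub>1 comp_at r Y" "comp_at r (X \<otimes>\<^sub>0 Y)"
        "inv2 (o2 X \<otimes>\<^sub>2 K (Y, I)) \<bullet> K (X \<otimes>\<^sub>0 Y, I)"]) (simp_all add: a)
  have "Krho I r K X Y = k"
    unfolding Krho_def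
  proof (rule the_equality)
    show "k \<in> cells C (o1 X \<otimes>\<^sub>1 comp_at r Y) (comp_at r (X \<otimes>\<^sub>0 Y)) \<and> (o2 X \<otimes>\<^sub>2 K (Y, I)) \<bullet> (k \<otimes>\<^sub>2 o2 I) = K (X \<otimes>\<^sub>0 Y, I)"
      unfolding k(2) using k(1) by (simp add: a)
  next
    fix k' assume k': "k' \<in> cells C (o1 X \<otimes>\<^sub>1 comp_at r Y) (comp_at r (X \<otimes>\<^sub>0 Y)) \<and> (o2 X \<otimes>\<^sub>2 K (Y, I)) \<bullet> (k' \<otimes>\<^sub>2 o2 I) = K (X \<otimes>\<^sub>0 Y, I)"
    then have "k' \<otimes>\<^sub>2 o2 I = k \<otimes>\<^sub>2 o2 I" unfolding k(2) conjunct2[OF k', symmetric] by simp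
    then show "k' = k" by (subst (asm) ff_on_eq_iff[OF ff]) (use k(1) k' in simp_all)
  qed
  then show ?thesis using k(1) by simp
qed

text \<open>
  The unit system on a GPS unit has \<open>\<alpha> = \<rho>\<^sub>I\<close> and \<open>L\<^sub>X = K\<^sub>I\<^sub>X\<close>, while \<open>R\<^sub>X\<close> is \<open>K\<^sup>\<rho>\<^sub>X\<^sub>I\<close> followed by
  the comparison of \<open>\<rho>\<^sub>X\<^sub>I\<close> with \<open>\<rho>\<^sub>XI\<close> which comes from naturality of \<open>\<rho>\<close> at \<open>\<rho>\<^sub>X\<close>.
\<close>

lemma G_obj_lift:
  assumes "(I, l, r, K) \<in> G_obj"
  obtains \<alpha> L R where "(I, \<alpha>, l, r, L, R, K) \<in> U_obj"
proof -
  have IO: "I \<in> Obj C" and l: "left_constraint I l" and r: "right_constraint I r" and Kel: "Kelly_cells I l r K"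
    and coh: "\<And>X Y Z. \<lbrakk>X \<in> Obj C; Y \<in> Obj C; Z \<in> Obj C\<rbrakk> \<Longrightarrow>
      (o2 X \<otimes>\<^sub>2 K (Y, Z)) \<bullet> (Krho I r K X Y \<otimes>\<^sub>2 o2 Z) = K (X \<otimes>\<^sub>0 Y, Z)"
    using assms unfolding G_obj_def coherent_def by auto
  have I: "cancellable I" by (rule constraints_cancellable[OF IO l r])
  have K: "K (X, Y) \<in> isocells C (o1 X \<otimes>\<^sub>1 comp_at l Y) (comp_at r X \<otimes>\<^sub>1 o1 Y)" if "X \<in> Obj C" "Y \<in> Obj C" for X Y
    using Kel that unfolding Kelly_cells_def inv_modification_def modification_def by simp
  have nat: "(a2 (f \<otimes>\<^sub>1 o1 I \<otimes>\<^sub>1 g) \<sharp>\<^sub>2 K (X', Y')) \<bullet> (cell_at r f \<otimes>\<^sub>2 a2 g) = (a2 f \<otimes>\<^sub>2 cell_at l g) \<bullet> (K (X, Y) \<sharp>\<^sub>2 a2 (f \<otimes>\<^sub>1 g))"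
    if "f \<in> homset C X X'" "g \<in> homset C Y Y'" for f g X X' Y Y'
    using Kel that unfolding Kelly_cells_def inv_modification_def modification_def by auto
  note lD = left_constraintD(1)[OF l, unfolded homset_iff] and rD = right_constraintD(1)[OF r, unfolded homset_iff]
  let ?\<alpha> = "comp_at r I"
  have \<alpha>: "?\<alpha> \<in> homset C (I \<otimes>\<^sub>0 I) I" "equi ?\<alpha>" using rD[OF IO] right_constraintD(2)[OF r IO] by simp_all
  have rr: "comp_at r X \<in> homset C (X \<otimes>\<^sub>0 I) X" if "X \<in> Obj C" for X using rD[OF that] by simp
  \<comment> \<open>Naturality of the right constraint at its own component compares two arrows that
    both end with \<open>comp_at r X\<close>; since this is an equi-arrow, the common factor can be
    stripped off.\<close>
  have N_ex: "\<exists>N. N \<in> isocells C (comp_at r (X \<otimes>\<^sub>0 I)) (comp_at r X \<otimes>\<^sub>1 o1 I) \<and>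
      N \<sharp>\<^sub>2 a2 (comp_at r X) = inv2 (cell_at r (comp_at r X))" if X: "X \<in> Obj C" for X
  proof -
    have XI: "X \<otimes>\<^sub>0 I \<in> Obj C" using X IO by simp
    note c = right_constraintD(3)[OF r rr[OF X], unfolded isocells_iff]
    show ?thesis
      by (rule ff_on_isocell[OF ff_post[OF right_constraintD(2)[OF r X] refl],
        of "comp_at r (X \<otimes>\<^sub>0 I)" "X \<otimes>\<^sub>0 I \<otimes>\<^sub>0 I" "comp_at r X \<otimes>\<^sub>1 o1 I" "inv2 (cell_at r (comp_at r X))"])
        (use c X IO rD[OF X] rD[OF XI] in auto)
  qed
  then obtain N where N: "\<And>X. X \<in> Obj C \<Longrightarrow> N X \<in> isocells C (comp_at r (X \<otimes>\<^sub>0 I)) (comp_at r X \<otimes>\<^sub>1 o1 I)"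
    "\<And>X. X \<in> Obj C \<Longrightarrow> N X \<sharp>\<^sub>2 a2 (comp_at r X) = inv2 (cell_at r (comp_at r X))"
    by metis
  define L where "L = (\<lambda>X\<in>Obj C. K (I, X))"
  define R where "R = (\<lambda>X\<in>Obj C. Krho I r K X I \<bullet> N X)"
  have Ld: "left_data I ?\<alpha> X (comp_at l X) (L X)" if "X \<in> Obj C" for X
    using that IO \<alpha> lD[OF that] K[OF IO that] unfolding left_data_def L_def by simp
  have Rd: "right_data I ?\<alpha> X (comp_at r X) (R X)" if X: "X \<in> Obj C" for X
    using X IO \<alpha> rD[OF X] N(1)[OF X] Krho_isocell[OF I l r K X IO] unfolding right_data_def R_def by simp
  have Ksys: "Kelly_rel I ?\<alpha> X Y (comp_at r X) (R X) (comp_at l Y) (L Y) (K (X, Y))" if X: "X \<in> Obj C" and Y: "Y \<in> Obj C" for X Y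
  proof -
    have XI: "X \<otimes>\<^sub>0 I \<in> Obj C" using X IO by simp
    note [simp] = X Y IO lD[OF Y] rD[OF X] rD[OF IO] rD[OF XI] K[OF X Y, unfolded isocells_iff] K[OF IO Y, unfolded isocells_iff]
      K[OF XI Y, unfolded isocells_iff] Krho_isocell[OF I l r K X IO, unfolded isocells_iff] N(1)[OF X, unfolded isocells_iff]
      right_constraintD(3)[OF r rr[OF X], unfolded isocells_iff] right_dataD[OF Rd[OF X]] merge
    have XIl: "o1 X \<otimes>\<^sub>1 o1 I \<otimes>\<^sub>1 comp_at l Y = o1 (X \<otimes>\<^sub>0 I) \<otimes>\<^sub>1 comp_at l Y"
      using tensor_assoc(2)[of "o1 X" "o1 I" "comp_at l Y"] by simp
    let ?q = "a2 (comp_at r X \<otimes>\<^sub>1 o1 Y)" and ?p = "a2 (o1 X \<otimes>\<^sub>1 comp_at l Y)"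
    let ?A = "(o2 X \<otimes>\<^sub>2 K (I, Y)) \<sharp>\<^sub>2 ?q"
    have RXY: "R X \<otimes>\<^sub>2 o2 Y = (Krho I r K X I \<otimes>\<^sub>2 o2 Y) \<bullet> (N X \<otimes>\<^sub>2 o2 Y)"
      unfolding R_def using X by simp
    \<comment> \<open>Coherence absorbs \<open>Krho\<close> into
      \<open>K (X \<otimes>\<^sub>0 I, Y)\<close>, and naturality of \<open>K\<close> at
      \<open>comp_at r X\<close> absorbs \<open>N X\<close>.\<close>
    have "?A \<bullet> ((R X \<otimes>\<^sub>2 o2 Y) \<sharp>\<^sub>2 ?q)
        = (((o2 X \<otimes>\<^sub>2 K (I, Y)) \<bullet> (Krho I r K X I \<otimes>\<^sub>2 o2 Y)) \<sharp>\<^sub>2 ?q) \<bullet> ((N X \<otimes>\<^sub>2 o2 Y) \<sharp>\<^sub>2 ?q)"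
      unfolding RXY by (simp add: XIl)
    also have "\<dots> = (K (X \<otimes>\<^sub>0 I, Y) \<sharp>\<^sub>2 ?q) \<bullet> (inv2 (cell_at r (comp_at r X)) \<otimes>\<^sub>2 o2 Y)"
      unfolding coh[OF X IO Y] by (simp add: N(2)[OF X])
    also have "\<dots> = a2 (comp_at r X \<otimes>\<^sub>1 o1 (I \<otimes>\<^sub>0 Y)) \<sharp>\<^sub>2 K (X, Y)"
    proof -
      have "o1 Y \<in> homset C Y Y" by simp
      from nat[OF rr[OF X] this]
      have "(a2 (comp_at r X \<otimes>\<^sub>1 o1 (I \<otimes>\<^sub>0 Y)) \<sharp>\<^sub>2 K (X, Y)) \<bullet> (cell_at r (comp_at r X) \<otimes>\<^sub>2 o2 Y) = K (X \<otimes>\<^sub>0 I, Y) \<sharp>\<^sub>2 ?q"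
        using left_constraintD(4)[OF l Y] by (simp add: XIl)
      then have "(K (X \<otimes>\<^sub>0 I, Y) \<sharp>\<^sub>2 ?q) \<bullet> inv2 (cell_at r (comp_at r X) \<otimes>\<^sub>2 o2 Y)
         = ((a2 (comp_at r X \<otimes>\<^sub>1 o1 (I \<otimes>\<^sub>0 Y)) \<sharp>\<^sub>2 K (X, Y)) \<bullet> (cell_at r (comp_at r X) \<otimes>\<^sub>2 o2 Y)) \<bullet> inv2 (cell_at r (comp_at r X) \<otimes>\<^sub>2 o2 Y)"
        by simp
      also have "\<dots> = a2 (comp_at r X \<otimes>\<^sub>1 o1 (I \<otimes>\<^sub>0 Y)) \<sharp>\<^sub>2 K (X, Y)"
        using tensor_Comp[of "comp_at r X \<otimes>\<^sub>1 o1 I" "comp_at r X" "o1 Y" "o1 Y"] by simp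
      also have "inv2 (cell_at r (comp_at r X) \<otimes>\<^sub>2 o2 Y) = inv2 (cell_at r (comp_at r X)) \<otimes>\<^sub>2 o2 Y"
        by (simp add: inv2_tensor inv2_a2)
      finally show ?thesis .
    qed
    finally have 1: "?A \<bullet> ((R X \<otimes>\<^sub>2 o2 Y) \<sharp>\<^sub>2 ?q) = a2 (comp_at r X \<otimes>\<^sub>1 o1 (I \<otimes>\<^sub>0 Y)) \<sharp>\<^sub>2 K (X, Y)" .
    have 2: "((R X \<otimes>\<^sub>2 o2 Y) \<sharp>\<^sub>2 ?p) \<bullet> (a2 (comp_at r X \<otimes>\<^sub>1 o1 (I \<otimes>\<^sub>0 Y)) \<sharp>\<^sub>2 K (X, Y))
        = (a2 (o1 X \<otimes>\<^sub>1 ?\<alpha> \<otimes>\<^sub>1 o1 Y) \<sharp>\<^sub>2 K (X, Y)) \<bullet> ((R X \<otimes>\<^sub>2 o2 Y) \<sharp>\<^sub>2 ?q)"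
      by (rule exchange_swap) simp_all
    \<comment> \<open>The desired equation is shown after composition with the invertible 2-cell
      \<open>R X\<close> tensored with \<open>Y\<close> and whiskered; exchanging that cell with
      \<open>K (X, Y)\<close> closes the gap, and then it is cancelled.\<close>
    have "(((R X \<otimes>\<^sub>2 o2 Y) \<sharp>\<^sub>2 ?p) \<bullet> ?A) \<bullet> ((R X \<otimes>\<^sub>2 o2 Y) \<sharp>\<^sub>2 ?q)
        = ((R X \<otimes>\<^sub>2 o2 Y) \<sharp>\<^sub>2 ?p) \<bullet> ?A \<bullet> ((R X \<otimes>\<^sub>2 o2 Y) \<sharp>\<^sub>2 ?q)"
      by (simp add: XIl)
    also have "\<dots> = (a2 (o1 X \<otimes>\<^sub>1 ?\<alpha> \<otimes>\<^sub>1 o1 Y) \<sharp>\<^sub>2 K (X, Y)) \<bullet> ((R X \<otimes>\<^sub>2 o2 Y) \<sharp>\<^sub>2 ?q)"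
      unfolding 1 2 ..
    finally have "((R X \<otimes>\<^sub>2 o2 Y) \<sharp>\<^sub>2 ?p) \<bullet> ?A = a2 (o1 X \<otimes>\<^sub>1 ?\<alpha> \<otimes>\<^sub>1 o1 Y) \<sharp>\<^sub>2 K (X, Y)"
      by (subst (asm) Vcomp_cancel_right) (simp_all add: XIl)
    then show ?thesis
      unfolding Kelly_rel_def using Ld[OF Y] Rd[OF X] K[OF X Y] by (simp add: L_def)
  qed
  \<comment> \<open>Naturality of \<open>K\<close> at the identity of \<open>I\<close> and at
    \<open>f\<close>: the naturality cell of the right constraint at an identity is trivial, and
    what remains is naturality of \<open>L\<close>.\<close>
  have Lsq: "left_square (comp_at l X) (L X) (comp_at l Y) (L Y) (o1 I) f (a2 (?\<alpha> \<otimes>\<^sub>1 f)) (inv2 (cell_at l f))"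
    if f: "f \<in> homset C X Y" for f X Y
  proof -
    have O: "X \<in> Obj C" "Y \<in> Obj C" using f by auto
    have h: "o1 I \<in> homset C I I" using IO by simp
    have II: "o1 I \<otimes>\<^sub>1 o1 I \<otimes>\<^sub>1 f = o1 (I \<otimes>\<^sub>0 I) \<otimes>\<^sub>1 f" using tensor_assoc(2)[of "o1 I" "o1 I" f] f IO by simp
    show ?thesis
      unfolding left_square_iff_natural[OF l Ld[OF O(1)] Ld[OF O(2)] f]
      using nat[OF h f] II right_constraintD(4)[OF r IO] O IO f \<alpha> by (simp add: L_def)
  qed
  \<comment> \<open>Naturality of \<open>K\<close> at \<open>f\<close> and at the identity of
    \<open>I\<close> passes through \<open>Kelly_iff\<close> to the equation for \<open>R\<close>
    tensored with \<open>I\<close> on the right. Cancelling this \<open>I\<close> leaves the right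
    square.\<close>
  have Rsq: "right_square (comp_at r X) (R X) (comp_at r Y) (R Y) (o1 I) f (a2 (f \<otimes>\<^sub>1 ?\<alpha>)) (inv2 (cell_at r f))"
    if f: "f \<in> homset C X Y" for f X Y
  proof -
    have O: "X \<in> Obj C" "Y \<in> Obj C" using f by auto
    have h: "o1 I \<in> homset C I I" using IO by simp
    note [simp] = O IO f[unfolded homset_iff] right_dataD[OF Rd[OF O(1)]] right_dataD[OF Rd[OF O(2)]]
      right_constraintD(3)[OF r f, unfolded isocells_iff] lD[OF IO] merge
    let ?c = "inv2 (cell_at r f)"
    have c: "?c \<in> isocells C (comp_at r X \<sharp>\<^sub>1 f) ((f \<otimes>\<^sub>1 o1 I) \<sharp>\<^sub>1 comp_at r Y)" by simp
    have II: "(f \<otimes>\<^sub>1 o1 (I \<otimes>\<^sub>0 I)) \<sharp>\<^sub>1 (comp_at r Y \<otimes>\<^sub>1 o1 I) = ((f \<otimes>\<^sub>1 o1 I) \<sharp>\<^sub>1 comp_at r Y) \<otimes>\<^sub>1 o1 I"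
      using tensor_Comp[of "f \<otimes>\<^sub>1 o1 I" "comp_at r Y" "o1 I" "o1 I"] by simp
    have "(K (X, I) \<sharp>\<^sub>2 a2 (f \<otimes>\<^sub>1 o1 I)) \<bullet> (?c \<otimes>\<^sub>2 a2 (o1 I)) = (a2 f \<otimes>\<^sub>2 a2 (comp_at l I)) \<bullet> (a2 (f \<otimes>\<^sub>1 o1 I \<otimes>\<^sub>1 o1 I) \<sharp>\<^sub>2 K (Y, I))"
      using nat[OF f h] unfolding Kelly_natural_iff[OF l r f h IO K[OF O(1) IO] K[OF O(2) IO]]
      by (simp add: left_constraintD(4)[OF l IO] inv2_a2)
    then have "((R X \<sharp>\<^sub>2 a2 (f \<otimes>\<^sub>1 o1 I)) \<bullet> (?c \<otimes>\<^sub>2 a2 (o1 I))) \<otimes>\<^sub>2 a2 (o1 I)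
        = (a2 f \<otimes>\<^sub>2 a2 (?\<alpha> \<otimes>\<^sub>1 o1 I)) \<bullet> ((a2 (f \<otimes>\<^sub>1 o1 I \<otimes>\<^sub>1 o1 I) \<sharp>\<^sub>2 R Y) \<otimes>\<^sub>2 a2 (o1 I))"
      unfolding Kelly_iff[OF Ksys[OF O(1) IO] Ksys[OF O(2) IO] h f h base_cell_id[OF IO \<alpha>(1) h]
          left_square_id[OF Ld[OF IO]] c \<alpha>(2) left_constraintD(2)[OF l IO]] .
    also have "\<dots> = (a2 (f \<otimes>\<^sub>1 ?\<alpha>) \<bullet> (a2 (f \<otimes>\<^sub>1 o1 I \<otimes>\<^sub>1 o1 I) \<sharp>\<^sub>2 R Y)) \<otimes>\<^sub>2 a2 (o1 I)"
      by simp
    finally have "(R X \<sharp>\<^sub>2 a2 (f \<otimes>\<^sub>1 o1 I)) \<bullet> (?c \<otimes>\<^sub>2 a2 (o1 I)) = a2 (f \<otimes>\<^sub>1 ?\<alpha>) \<bullet> (a2 (f \<otimes>\<^sub>1 o1 I \<otimes>\<^sub>1 o1 I) \<sharp>\<^sub>2 R Y)"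
      by (subst (asm) ff_on_eq_iff[OF cancellable_right(1)[OF I, of "X \<otimes>\<^sub>0 I \<otimes>\<^sub>0 I" "Y \<otimes>\<^sub>0 I"]]) (simp_all add: II)
    then show ?thesis unfolding right_square_def using c by simp
  qed
  have "L \<in> extensional (Obj C)" "R \<in> extensional (Obj C)" "K \<in> extensional (Obj C \<times> Obj C)"
    using Kel unfolding Kelly_cells_def inv_modification_def modification_def by (simp_all add: L_def R_def)
  then have "unit_system I ?\<alpha> l r L R K"
    unfolding unit_system_def using IO \<alpha> l r Ld Rd Lsq Rsq Ksys by (simp del: homset_iff)
  then show thesis using that U_obj_iff by blast
qed

subsection \<open>Arrows\<close>

lemma base_cell_tensor:
  assumes "\<alpha> \<in> homset C (I \<otimes>\<^sub>0 I) I" "\<beta> \<in> homset C (J \<otimes>\<^sub>0 J) J" "u \<in> homset C I J"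
    "U \<in> isocells C (\<alpha> \<sharp>\<^sub>1 u) ((u \<otimes>\<^sub>1 u) \<sharp>\<^sub>1 \<beta>)" "f \<in> homset C X Y"
  shows "base_cell \<alpha> X \<beta> Y u f (U \<otimes>\<^sub>2 a2 f)" "right_base_cell \<alpha> X \<beta> Y u f (a2 f \<otimes>\<^sub>2 U)"
proof -
  have "X \<in> Obj C" "Y \<in> Obj C" "I \<in> Obj C" "J \<in> Obj C" using assms(3,5) by auto
  then show "base_cell \<alpha> X \<beta> Y u f (U \<otimes>\<^sub>2 a2 f)" "right_base_cell \<alpha> X \<beta> Y u f (a2 f \<otimes>\<^sub>2 U)"
    using assms by (simp_all add: base_cell_def right_base_cell_def merge)
qed

text \<open>The cell at \<open>X\<close> followed by naturality at \<open>f\<close>, and naturality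
  at \<open>f\<close> followed by the cell at \<open>Y\<close>, are both squares over
  \<open>U \<otimes>\<^sub>2 a2 f\<close>, hence equal.\<close>

lemma left_squares_natural:
  assumes S: "unit_system I \<alpha> l r L R K" and S': "unit_system J \<beta> l' r' L' R' H"
    and u: "u \<in> homset C I J" "equi u" and U: "U \<in> isocells C (\<alpha> \<sharp>\<^sub>1 u) ((u \<otimes>\<^sub>1 u) \<sharp>\<^sub>1 \<beta>)"
    and Ul: "\<And>X. X \<in> Obj C \<Longrightarrow> left_square (comp_at l X) (L X) (comp_at l' X) (L' X) u (o1 X) (U \<otimes>\<^sub>2 o2 X) (Ul X)"
    and ext: "Ul \<in> extensional (Obj C)"
  shows "inv_modification C C (lten I) id2 l (pcomp C C (larr u) l') Ul"
proof -
  note s = unit_systemD[OF S] and s' = unit_systemD[OF S']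
  note lD = left_constraintD(1)[OF s(4), unfolded homset_iff] and lD' = left_constraintD(1)[OF s'(4), unfolded homset_iff]
  have Uc: "Ul X \<in> isocells C (comp_at l X) ((u \<otimes>\<^sub>1 o1 X) \<sharp>\<^sub>1 comp_at l' X)" if "X \<in> Obj C" for X
    using Ul[OF that] lD[OF that] unfolding left_square_def by simp
  have nat: "(a2 (o1 I \<otimes>\<^sub>1 f) \<sharp>\<^sub>2 Ul Y) \<bullet> (a2 (u \<otimes>\<^sub>1 o1 X) \<sharp>\<^sub>2 cell_at l' f) = cell_at l f \<bullet> (Ul X \<sharp>\<^sub>2 a2 f)"
    if f: "f \<in> homset C X Y" for f X Y
  proof -
    have O: "X \<in> Obj C" "Y \<in> Obj C" using f by auto
    note [simp] = O s(1) s'(1) s(2)[unfolded homset_iff] s'(2)[unfolded homset_iff] f[unfolded homset_iff] u(1)[unfolded homset_iff]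
      U[unfolded isocells_iff] lD[OF O(1)] lD[OF O(2)] lD'[OF O(1)] lD'[OF O(2)]
      Uc[OF O(1), unfolded isocells_iff] Uc[OF O(2), unfolded isocells_iff]
      left_constraintD(3)[OF s(4) f, unfolded isocells_iff] left_constraintD(3)[OF s'(4) f, unfolded isocells_iff] merge
    have h: "o1 I \<in> homset C I I" "o1 J \<in> homset C J J" "o1 X \<in> homset C X X" "o1 Y \<in> homset C Y Y" by simp_all
    note b = base_cell_tensor(1)[OF s(2) s'(2) u(1) U]
    have e1: "((U \<otimes>\<^sub>2 o2 X) \<sharp>\<^sub>2 a2 (o1 J \<otimes>\<^sub>1 f)) \<bullet> (a2 (u \<otimes>\<^sub>1 u \<otimes>\<^sub>1 o1 X) \<sharp>\<^sub>2 a2 (\<beta> \<otimes>\<^sub>1 f)) = U \<otimes>\<^sub>2 a2 f" by simp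
    have IIf: "o1 I \<otimes>\<^sub>1 o1 I \<otimes>\<^sub>1 f = o1 (I \<otimes>\<^sub>0 I) \<otimes>\<^sub>1 f" using tensor_assoc(2)[of "o1 I" "o1 I" f] by simp
    have e2: "(a2 (\<alpha> \<otimes>\<^sub>1 f) \<sharp>\<^sub>2 a2 (u \<otimes>\<^sub>1 o1 Y)) \<bullet> (a2 (o1 I \<otimes>\<^sub>1 o1 I \<otimes>\<^sub>1 f) \<sharp>\<^sub>2 (U \<otimes>\<^sub>2 o2 Y)) = U \<otimes>\<^sub>2 a2 f"
      unfolding IIf by simp
    have 1: "left_square (comp_at l X) (L X) (comp_at l' Y) (L' Y) u f (U \<otimes>\<^sub>2 a2 f)
        ((Ul X \<sharp>\<^sub>2 a2 f) \<bullet> (a2 (u \<otimes>\<^sub>1 o1 X) \<sharp>\<^sub>2 inv2 (cell_at l' f)))"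
      using left_square_comp[OF s(7)[OF O(1)] s'(7)[OF O(1)] s'(7)[OF O(2)] u(1) h(3) b[OF h(3)] h(2) f
          base_cell_id[OF s'(1,2) f] Ul[OF O(1)] s'(11)[OF f]] unfolding e1 by simp
    have 2: "left_square (comp_at l X) (L X) (comp_at l' Y) (L' Y) u f (U \<otimes>\<^sub>2 a2 f)
        (inv2 (cell_at l f) \<bullet> (a2 (o1 I \<otimes>\<^sub>1 f) \<sharp>\<^sub>2 Ul Y))"
      using left_square_comp[OF s(7)[OF O(1)] s(7)[OF O(2)] s'(7)[OF O(2)] h(1) f base_cell_id[OF s(1,2) f] u(1) h(4)
          b[OF h(4)] s(11)[OF f] Ul[OF O(2)]] unfolding e2 by simp
    have "(Ul X \<sharp>\<^sub>2 a2 f) \<bullet> (a2 (u \<otimes>\<^sub>1 o1 X) \<sharp>\<^sub>2 inv2 (cell_at l' f)) = inv2 (cell_at l f) \<bullet> (a2 (o1 I \<otimes>\<^sub>1 f) \<sharp>\<^sub>2 Ul Y)"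
      using left_square_ex1[OF s(7)[OF O(1)] s'(7)[OF O(2)] s'(6) u(2,1) f b[OF f]] 1 2 by blast
    moreover have "a2 (u \<otimes>\<^sub>1 o1 X) \<sharp>\<^sub>2 inv2 (cell_at l' f) = inv2 (a2 (u \<otimes>\<^sub>1 o1 X) \<sharp>\<^sub>2 cell_at l' f)"
      by (simp add: inv2_Hcomp inv2_a2)
    ultimately have "(Ul X \<sharp>\<^sub>2 a2 f) \<bullet> inv2 (a2 (u \<otimes>\<^sub>1 o1 X) \<sharp>\<^sub>2 cell_at l' f) = inv2 (cell_at l f) \<bullet> (a2 (o1 I \<otimes>\<^sub>1 f) \<sharp>\<^sub>2 Ul Y)"
      by metis
    then show ?thesis by (subst (asm) inv2_swap[symmetric]) simp_all
  qed
  show ?thesis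
    unfolding inv_modification_def modification_def
  proof (intro conjI ballI ext)
    fix f assume f: "f \<in> Arr C"
    then have f': "f \<in> homset C (Dom C f) (Cod C f)" and O: "Dom C f \<in> Obj C" "Cod C f \<in> Obj C" by simp_all
    have "(a2 (u \<otimes>\<^sub>1 f) \<sharp>\<^sub>2 a2 (comp_at l' (Cod C f))) \<bullet> (a2 (u \<otimes>\<^sub>1 o1 (Dom C f)) \<sharp>\<^sub>2 cell_at l' f)
        = a2 (u \<otimes>\<^sub>1 o1 (Dom C f)) \<sharp>\<^sub>2 cell_at l' f"
      using f O u(1) s'(1) lD'[OF O(2)] left_constraintD(3)[OF s'(4) f'] by (simp add: merge)
    then show "(a2 (on_arr (lten I) f) \<sharp>\<^sub>2 Ul (Cod C f)) \<bullet> cell_at (pcomp C C (larr u) l') f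
        = cell_at l f \<bullet> (Ul (Dom C f) \<sharp>\<^sub>2 a2 (on_arr id2 f))"
      using nat[OF f'] by simp
  qed (use Uc in simp_all)
qed

lemma right_squares_natural:
  assumes S: "unit_system I \<alpha> l r L R K" and S': "unit_system J \<beta> l' r' L' R' H"
    and u: "u \<in> homset C I J" "equi u" and U: "U \<in> isocells C (\<alpha> \<sharp>\<^sub>1 u) ((u \<otimes>\<^sub>1 u) \<sharp>\<^sub>1 \<beta>)"
    and Ur: "\<And>X. X \<in> Obj C \<Longrightarrow> right_square (comp_at r X) (R X) (comp_at r' X) (R' X) u (o1 X) (o2 X \<otimes>\<^sub>2 U) (Ur X)"
    and ext: "Ur \<in> extensional (Obj C)"
  shows "inv_modification C C (rten I) id2 r (pcomp C C (rarr u) r') Ur"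
proof -
  note s = unit_systemD[OF S] and s' = unit_systemD[OF S']
  note rD = right_constraintD(1)[OF s(5), unfolded homset_iff] and rD' = right_constraintD(1)[OF s'(5), unfolded homset_iff]
  have Uc: "Ur X \<in> isocells C (comp_at r X) ((o1 X \<otimes>\<^sub>1 u) \<sharp>\<^sub>1 comp_at r' X)" if "X \<in> Obj C" for X
    using Ur[OF that] rD[OF that] unfolding right_square_def by simp
  have nat: "(a2 (f \<otimes>\<^sub>1 o1 I) \<sharp>\<^sub>2 Ur Y) \<bullet> (a2 (o1 X \<otimes>\<^sub>1 u) \<sharp>\<^sub>2 cell_at r' f) = cell_at r f \<bullet> (Ur X \<sharp>\<^sub>2 a2 f)"
    if f: "f \<in> homset C X Y" for f X Y
  proof -
    have O: "X \<in> Obj C" "Y \<in> Obj C" using f by auto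
    note [simp] = O s(1) s'(1) s(2)[unfolded homset_iff] s'(2)[unfolded homset_iff] f[unfolded homset_iff] u(1)[unfolded homset_iff]
      U[unfolded isocells_iff] rD[OF O(1)] rD[OF O(2)] rD'[OF O(1)] rD'[OF O(2)]
      Uc[OF O(1), unfolded isocells_iff] Uc[OF O(2), unfolded isocells_iff]
      right_constraintD(3)[OF s(5) f, unfolded isocells_iff] right_constraintD(3)[OF s'(5) f, unfolded isocells_iff] merge
    have h: "o1 I \<in> homset C I I" "o1 J \<in> homset C J J" "o1 X \<in> homset C X X" "o1 Y \<in> homset C Y Y" by simp_all
    note b = base_cell_tensor(2)[OF s(2) s'(2) u(1) U]
    have e1: "((o2 X \<otimes>\<^sub>2 U) \<sharp>\<^sub>2 a2 (f \<otimes>\<^sub>1 o1 J)) \<bullet> (a2 (o1 X \<otimes>\<^sub>1 u \<otimes>\<^sub>1 u) \<sharp>\<^sub>2 a2 (f \<otimes>\<^sub>1 \<beta>)) = a2 f \<otimes>\<^sub>2 U" by simp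
    have e2: "(a2 (f \<otimes>\<^sub>1 \<alpha>) \<sharp>\<^sub>2 a2 (o1 Y \<otimes>\<^sub>1 u)) \<bullet> (a2 (f \<otimes>\<^sub>1 o1 I \<otimes>\<^sub>1 o1 I) \<sharp>\<^sub>2 (o2 Y \<otimes>\<^sub>2 U)) = a2 f \<otimes>\<^sub>2 U" by simp
    have 1: "right_square (comp_at r X) (R X) (comp_at r' Y) (R' Y) u f (a2 f \<otimes>\<^sub>2 U)
        ((Ur X \<sharp>\<^sub>2 a2 f) \<bullet> (a2 (o1 X \<otimes>\<^sub>1 u) \<sharp>\<^sub>2 inv2 (cell_at r' f)))"
      using right_square_comp[OF s(8)[OF O(1)] s'(8)[OF O(1)] s'(8)[OF O(2)] u(1) h(3) b[OF h(3)] h(2) f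
          right_base_cell_id[OF s'(1,2) f] Ur[OF O(1)] s'(12)[OF f]] unfolding e1 by simp
    have 2: "right_square (comp_at r X) (R X) (comp_at r' Y) (R' Y) u f (a2 f \<otimes>\<^sub>2 U)
        (inv2 (cell_at r f) \<bullet> (a2 (f \<otimes>\<^sub>1 o1 I) \<sharp>\<^sub>2 Ur Y))"
      using right_square_comp[OF s(8)[OF O(1)] s(8)[OF O(2)] s'(8)[OF O(2)] h(1) f right_base_cell_id[OF s(1,2) f] u(1) h(4)
          b[OF h(4)] s(12)[OF f] Ur[OF O(2)]] unfolding e2 by simp
    have "(Ur X \<sharp>\<^sub>2 a2 f) \<bullet> (a2 (o1 X \<otimes>\<^sub>1 u) \<sharp>\<^sub>2 inv2 (cell_at r' f)) = inv2 (cell_at r f) \<bullet> (a2 (f \<otimes>\<^sub>1 o1 I) \<sharp>\<^sub>2 Ur Y)"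
      using right_square_ex1[OF s(8)[OF O(1)] s'(8)[OF O(2)] s'(6) u(2,1) f b[OF f]] 1 2 by blast
    moreover have "a2 (o1 X \<otimes>\<^sub>1 u) \<sharp>\<^sub>2 inv2 (cell_at r' f) = inv2 (a2 (o1 X \<otimes>\<^sub>1 u) \<sharp>\<^sub>2 cell_at r' f)"
      by (simp add: inv2_Hcomp inv2_a2)
    ultimately have "(Ur X \<sharp>\<^sub>2 a2 f) \<bullet> inv2 (a2 (o1 X \<otimes>\<^sub>1 u) \<sharp>\<^sub>2 cell_at r' f) = inv2 (cell_at r f) \<bullet> (a2 (f \<otimes>\<^sub>1 o1 I) \<sharp>\<^sub>2 Ur Y)"
      by metis
    then show ?thesis by (subst (asm) inv2_swap[symmetric]) simp_all
  qed
  show ?thesis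
    unfolding inv_modification_def modification_def
  proof (intro conjI ballI ext)
    fix f assume f: "f \<in> Arr C"
    then have f': "f \<in> homset C (Dom C f) (Cod C f)" and O: "Dom C f \<in> Obj C" "Cod C f \<in> Obj C" by simp_all
    have "(a2 (f \<otimes>\<^sub>1 u) \<sharp>\<^sub>2 a2 (comp_at r' (Cod C f))) \<bullet> (a2 (o1 (Dom C f) \<otimes>\<^sub>1 u) \<sharp>\<^sub>2 cell_at r' f)
        = a2 (o1 (Dom C f) \<otimes>\<^sub>1 u) \<sharp>\<^sub>2 cell_at r' f"
      using f O u(1) s'(1) rD'[OF O(2)] right_constraintD(3)[OF s'(5) f'] by (simp add: merge)
    then show "(a2 (on_arr (rten I) f) \<sharp>\<^sub>2 Ur (Cod C f)) \<bullet> cell_at (pcomp C C (rarr u) r') f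
        = cell_at r f \<bullet> (Ur (Dom C f) \<sharp>\<^sub>2 a2 (on_arr id2 f))"
      using nat[OF f'] by simp
  qed (use Uc in simp_all)
qed

lemma G_hom_cells:
  assumes "(u, Ul, Ur) \<in> G_hom (I, l, r, K) (J, l', r', H)"
  shows "u \<in> homset C I J" "Ul \<in> extensional (Obj C)" "Ur \<in> extensional (Obj C)"
    "X \<in> Obj C \<Longrightarrow> Ul X \<in> isocells C (comp_at l X) ((u \<otimes>\<^sub>1 o1 X) \<sharp>\<^sub>1 comp_at l' X)"
    "X \<in> Obj C \<Longrightarrow> Ur X \<in> isocells C (comp_at r X) ((o1 X \<otimes>\<^sub>1 u) \<sharp>\<^sub>1 comp_at r' X)"
    "\<lbrakk>X \<in> Obj C; Y \<in> Obj C\<rbrakk> \<Longrightarrow> K (X, Y) \<bullet> (Ur X \<otimes>\<^sub>2 o2 Y) = (o2 X \<otimes>\<^sub>2 Ul Y) \<bullet> (a2 (o1 X \<otimes>\<^sub>1 u \<otimes>\<^sub>1 o1 Y) \<sharp>\<^sub>2 H (X, Y))"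
  using assms unfolding G_hom_def inv_modification_def modification_def by auto

text \<open>\<open>Ul J\<close> makes the constraint of the first unit at \<open>J\<close>
  isomorphic to uJ followed by that of the second. Both constraints are equi-arrows, so uJ is one by
  two out of three, and \<open>J\<close> can be cancelled. Thus the arrows of \<open>\<G>\<close>
  and \<open>\<U>\<close> satisfy the condition imposed in \<open>\<E>\<close>.\<close>

lemma G_hom_equi:
  assumes S: "unit_system I \<alpha> l r L R K" and S': "unit_system J \<beta> l' r' L' R' H"
    and f: "(u, Ul, Ur) \<in> G_hom (I, l, r, K) (J, l', r', H)"
  shows "equi u"
proof -
  note s = unit_systemD[OF S] and s' = unit_systemD[OF S'] and g = G_hom_cells[OF f]
  have "equi ((u \<otimes>\<^sub>1 o1 J) \<sharp>\<^sub>1 comp_at l' J)" by (rule equi_iso[OF s(9)[OF s'(1)] g(4)[OF s'(1)]])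
  then have "equi (u \<otimes>\<^sub>1 o1 J)"
    by (rule equi_cancel(1)[OF _ _ _ _ s'(9)[OF s'(1)]])
      (use g(1) s'(1) left_constraintD(1)[OF s'(4,1)] in simp_all)
  then show ?thesis by (rule equi_reflect_right[OF s'(6)]) (use g(1) in simp)
qed

text \<open>Reduces an arrow of \<open>\<U>\<close> to families of squares. Conversely the
  naturality of these families follows from uniqueness of squares, and (PK) from
  \<open>Kelly_compat\<close>, since the two base cells tensored with the other object are both
  XUY.\<close>

lemma U_hom_iff:
  assumes S: "unit_system I \<alpha> l r L R K" and S': "unit_system J \<beta> l' r' L' R' H"
  shows "(u, Ul, Ur, U) \<in> U_hom (I, \<alpha>, l, r, L, R, K) (J, \<beta>, l', r', L', R', H) \<longleftrightarrow>
    u \<in> homset C I J \<and> equi u \<and> U \<in> isocells C (\<alpha> \<sharp>\<^sub>1 u) ((u \<otimes>\<^sub>1 u) \<sharp>\<^sub>1 \<beta>) \<and>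
    Ul \<in> extensional (Obj C) \<and> Ur \<in> extensional (Obj C) \<and>
    (\<forall>X \<in> Obj C. left_square (comp_at l X) (L X) (comp_at l' X) (L' X) u (o1 X) (U \<otimes>\<^sub>2 o2 X) (Ul X)) \<and>
    (\<forall>X \<in> Obj C. right_square (comp_at r X) (R X) (comp_at r' X) (R' X) u (o1 X) (o2 X \<otimes>\<^sub>2 U) (Ur X))"
    (is "?h \<longleftrightarrow> ?s")
proof
  note s = unit_systemD[OF S] and s' = unit_systemD[OF S']
  note lD = left_constraintD(1)[OF s(4), unfolded homset_iff] and rD = right_constraintD(1)[OF s(5), unfolded homset_iff]
  assume h: ?h
  then have g: "(u, Ul, Ur) \<in> G_hom (I, l, r, K) (J, l', r', H)" and U: "U \<in> isocells C (\<alpha> \<sharp>\<^sub>1 u) ((u \<otimes>\<^sub>1 u) \<sharp>\<^sub>1 \<beta>)"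
    and eq: "\<And>X. X \<in> Obj C \<Longrightarrow> (L X \<sharp>\<^sub>2 a2 (u \<otimes>\<^sub>1 o1 X)) \<bullet> (U \<otimes>\<^sub>2 o2 X) = (a2 u \<otimes>\<^sub>2 Ul X) \<bullet> (a2 (u \<otimes>\<^sub>1 u \<otimes>\<^sub>1 o1 X) \<sharp>\<^sub>2 L' X)"
      "\<And>X. X \<in> Obj C \<Longrightarrow> (R X \<sharp>\<^sub>2 a2 (o1 X \<otimes>\<^sub>1 u)) \<bullet> (Ur X \<otimes>\<^sub>2 a2 u) = (o2 X \<otimes>\<^sub>2 U) \<bullet> (a2 (o1 X \<otimes>\<^sub>1 u \<otimes>\<^sub>1 u) \<sharp>\<^sub>2 R' X)"
    unfolding U_hom_def by auto
  note c = G_hom_cells[OF g]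
  show ?s
    using c(1-3) G_hom_equi[OF S S' g] U eq c(4,5) lD rD unfolding left_square_def right_square_def by simp
next
  note s = unit_systemD[OF S] and s' = unit_systemD[OF S']
  note lD = left_constraintD(1)[OF s(4), unfolded homset_iff] and rD = right_constraintD(1)[OF s(5), unfolded homset_iff]
  assume h: ?s
  then have u: "u \<in> homset C I J" "equi u" and U: "U \<in> isocells C (\<alpha> \<sharp>\<^sub>1 u) ((u \<otimes>\<^sub>1 u) \<sharp>\<^sub>1 \<beta>)"
    and ext: "Ul \<in> extensional (Obj C)" "Ur \<in> extensional (Obj C)"
    and Ul: "\<And>X. X \<in> Obj C \<Longrightarrow> left_square (comp_at l X) (L X) (comp_at l' X) (L' X) u (o1 X) (U \<otimes>\<^sub>2 o2 X) (Ul X)"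
    and Ur: "\<And>X. X \<in> Obj C \<Longrightarrow> right_square (comp_at r X) (R X) (comp_at r' X) (R' X) u (o1 X) (o2 X \<otimes>\<^sub>2 U) (Ur X)"
    by auto
  have K: "K (X, Y) \<bullet> (Ur X \<otimes>\<^sub>2 o2 Y) = (o2 X \<otimes>\<^sub>2 Ul Y) \<bullet> (a2 (o1 X \<otimes>\<^sub>1 u \<otimes>\<^sub>1 o1 Y) \<sharp>\<^sub>2 H (X, Y))"
    if O: "X \<in> Obj C" "Y \<in> Obj C" for X Y
  proof -
    have h: "o1 X \<in> homset C X X" "o1 Y \<in> homset C Y Y" using O by simp_all
    have "(K (X, Y) \<sharp>\<^sub>2 a2 (o1 X \<otimes>\<^sub>1 o1 Y)) \<bullet> (Ur X \<otimes>\<^sub>2 o2 Y) = (o2 X \<otimes>\<^sub>2 Ul Y) \<bullet> (a2 (o1 X \<otimes>\<^sub>1 u \<otimes>\<^sub>1 o1 Y) \<sharp>\<^sub>2 H (X, Y))"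
      by (rule Kelly_compat[OF s(13)[OF O] s'(13)[OF O] u(1) h base_cell_tensor(1)[OF s(2) s'(2) u(1) U h(2)] Ul[OF O(2)]
          base_cell_tensor(2)[OF s(2) s'(2) u(1) U h(1)] Ur[OF O(1)] _ s(3) s'(9)[OF O(2)]]) (use O U in simp)
    moreover have "K (X, Y) \<in> isocells C (o1 X \<otimes>\<^sub>1 comp_at l Y) (comp_at r X \<otimes>\<^sub>1 o1 Y)"
      using s(13)[OF O] unfolding Kelly_rel_def by blast
    ultimately show ?thesis using O lD[OF O(2)] by simp
  qed
  have "(u, Ul, Ur) \<in> G_hom (I, l, r, K) (J, l', r', H)"
    unfolding G_hom_def
    using u K left_squares_natural[OF S S' u U Ul ext(1)] right_squares_natural[OF S S' u U Ur ext(2)] by simp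
  then show ?h using U Ul Ur unfolding U_hom_def left_square_def right_square_def by simp
qed

text \<open>Each component is the unique square over \<open>U \<otimes>\<^sub>2 o2 X\<close> or
  \<open>o2 X \<otimes>\<^sub>2 U\<close>; extensionality makes the families unique as
  functions.\<close>

lemma E_hom_lift:
  assumes S: "unit_system I \<alpha> l r L R K" and S': "unit_system J \<beta> l' r' L' R' H"
    and f: "(u, U) \<in> E_hom (I, \<alpha>) (J, \<beta>)"
  shows "\<exists>!(Ul, Ur). (u, Ul, Ur, U) \<in> U_hom (I, \<alpha>, l, r, L, R, K) (J, \<beta>, l', r', L', R', H)"
proof -
  note s = unit_systemD[OF S] and s' = unit_systemD[OF S']
  have u: "u \<in> homset C I J" "equi u" and U: "U \<in> isocells C (\<alpha> \<sharp>\<^sub>1 u) ((u \<otimes>\<^sub>1 u) \<sharp>\<^sub>1 \<beta>)"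
    using f unfolding E_hom_def by auto
  have l: "\<exists>!w. left_square (comp_at l X) (L X) (comp_at l' X) (L' X) u (o1 X) (U \<otimes>\<^sub>2 o2 X) w" if X: "X \<in> Obj C" for X
    by (rule left_square_ex1[OF s(7)[OF X] s'(7)[OF X] s'(6) u(2,1) _ base_cell_tensor(1)[OF s(2) s'(2) u(1) U]])
      (use X in simp_all)
  have r: "\<exists>!w. right_square (comp_at r X) (R X) (comp_at r' X) (R' X) u (o1 X) (o2 X \<otimes>\<^sub>2 U) w" if X: "X \<in> Obj C" for X
    by (rule right_square_ex1[OF s(8)[OF X] s'(8)[OF X] s'(6) u(2,1) _ base_cell_tensor(2)[OF s(2) s'(2) u(1) U]])
      (use X in simp_all)
  obtain Ul where Ul: "\<And>X. X \<in> Obj C \<Longrightarrow> left_square (comp_at l X) (L X) (comp_at l' X) (L' X) u (o1 X) (U \<otimes>\<^sub>2 o2 X) (Ul X)"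
    using l by metis
  obtain Ur where Ur: "\<And>X. X \<in> Obj C \<Longrightarrow> right_square (comp_at r X) (R X) (comp_at r' X) (R' X) u (o1 X) (o2 X \<otimes>\<^sub>2 U) (Ur X)"
    using r by metis
  show ?thesis
  proof (rule ex1I[of _ "(restrict Ul (Obj C), restrict Ur (Obj C))"])
    show "case (restrict Ul (Obj C), restrict Ur (Obj C)) of (Ul, Ur) \<Rightarrow> (u, Ul, Ur, U) \<in> U_hom (I, \<alpha>, l, r, L, R, K) (J, \<beta>, l', r', L', R', H)"
      unfolding prod.case U_hom_iff[OF S S'] using u U Ul Ur by simp
  next
    fix V assume "case V of (Ul, Ur) \<Rightarrow> (u, Ul, Ur, U) \<in> U_hom (I, \<alpha>, l, r, L, R, K) (J, \<beta>, l', r', L', R', H)"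
    then obtain Vl Vr where V: "V = (Vl, Vr)" "Vl \<in> extensional (Obj C)" "Vr \<in> extensional (Obj C)"
      "\<And>X. X \<in> Obj C \<Longrightarrow> left_square (comp_at l X) (L X) (comp_at l' X) (L' X) u (o1 X) (U \<otimes>\<^sub>2 o2 X) (Vl X)"
      "\<And>X. X \<in> Obj C \<Longrightarrow> right_square (comp_at r X) (R X) (comp_at r' X) (R' X) u (o1 X) (o2 X \<otimes>\<^sub>2 U) (Vr X)"
      by (cases V) (auto simp: U_hom_iff[OF S S'])
    have "Vl = restrict Ul (Obj C)"
      by (rule extensionalityI[OF V(2) restrict_extensional]) (metis V(4) Ul l restrict_apply')
    moreover have "Vr = restrict Ur (Obj C)"
      by (rule extensionalityI[OF V(3) restrict_extensional]) (metis V(5) Ur r restrict_apply')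
    ultimately show "V = (restrict Ul (Obj C), restrict Ur (Obj C))" using V(1) by simp
  qed
qed

text \<open>The two families of squares prescribe both UX and XU for all \<open>X\<close>, so the
  question is whether one \<open>U\<close> fits all prescriptions. This is what (PK) decides, by way
  of the prism.\<close>

lemma G_hom_lift:
  assumes S: "unit_system I \<alpha> l r L R K" and S': "unit_system J \<beta> l' r' L' R' H"
    and f: "(u, Ul, Ur) \<in> G_hom (I, l, r, K) (J, l', r', H)"
  shows "\<exists>!U. (u, Ul, Ur, U) \<in> U_hom (I, \<alpha>, l, r, L, R, K) (J, \<beta>, l', r', L', R', H)"
proof -
  note s = unit_systemD[OF S] and s' = unit_systemD[OF S'] and c = G_hom_cells[OF f]
  note lD = left_constraintD(1)[OF s(4), unfolded homset_iff] and rD = right_constraintD(1)[OF s(5), unfolded homset_iff]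
  note lD' = left_constraintD(1)[OF s'(4), unfolded homset_iff] and rD' = right_constraintD(1)[OF s'(5), unfolded homset_iff]
  note u = c(1) G_hom_equi[OF S S' f]
  note [simp] = s(1) s'(1) s(2)[unfolded homset_iff] s'(2)[unfolded homset_iff] u(1)[unfolded homset_iff] merge
  \<comment> \<open>The square equations solved for the base cell: \<open>?WL X\<close> and
    \<open>?WR X\<close> are the only possible values of UX and of XU.\<close>
  let ?WL = "\<lambda>X. inv2 (L X \<sharp>\<^sub>2 a2 (u \<otimes>\<^sub>1 o1 X)) \<bullet> (a2 u \<otimes>\<^sub>2 Ul X) \<bullet> (a2 (u \<otimes>\<^sub>1 u \<otimes>\<^sub>1 o1 X) \<sharp>\<^sub>2 L' X)"
  let ?WR = "\<lambda>X. (R X \<sharp>\<^sub>2 a2 (o1 X \<otimes>\<^sub>1 u)) \<bullet> (Ur X \<otimes>\<^sub>2 a2 u) \<bullet> inv2 (a2 (o1 X \<otimes>\<^sub>1 u \<otimes>\<^sub>1 u) \<sharp>\<^sub>2 R' X)"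
  have WLb: "base_cell \<alpha> X \<beta> X u (o1 X) (?WL X)" if X: "X \<in> Obj C" for X
    unfolding base_cell_def
    by (simp add: X left_dataD[OF s(7)[OF X]] left_dataD[OF s'(7)[OF X]] c(4)[OF X, unfolded isocells_iff])
  have WLs: "left_square (comp_at l X) (L X) (comp_at l' X) (L' X) u (o1 X) W (Ul X) \<longleftrightarrow> W = ?WL X"
    if X: "X \<in> Obj C"
      and W: "W \<in> isocells C ((\<alpha> \<otimes>\<^sub>1 o1 X) \<sharp>\<^sub>1 (u \<otimes>\<^sub>1 o1 X)) ((u \<otimes>\<^sub>1 u \<otimes>\<^sub>1 o1 X) \<sharp>\<^sub>1 (\<beta> \<otimes>\<^sub>1 o1 X))" for W X
  proof -
    note [simp] = X left_dataD[OF s(7)[OF X]] left_dataD[OF s'(7)[OF X]] c(4)[OF X, unfolded isocells_iff]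
    have "left_square (comp_at l X) (L X) (comp_at l' X) (L' X) u (o1 X) W (Ul X) \<longleftrightarrow>
        (L X \<sharp>\<^sub>2 a2 (u \<otimes>\<^sub>1 o1 X)) \<bullet> W = (L X \<sharp>\<^sub>2 a2 (u \<otimes>\<^sub>1 o1 X)) \<bullet> ?WL X"
      unfolding left_square_def by simp
    also have "\<dots> \<longleftrightarrow> W = ?WL X" by (rule Vcomp_cancel_left) (use W in simp_all)
    finally show ?thesis .
  qed
  have WRc: "?WR X \<in> isocells C ((o1 X \<otimes>\<^sub>1 \<alpha>) \<sharp>\<^sub>1 (o1 X \<otimes>\<^sub>1 u)) ((o1 X \<otimes>\<^sub>1 u \<otimes>\<^sub>1 u) \<sharp>\<^sub>1 (o1 X \<otimes>\<^sub>1 \<beta>))"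
    and WRs: "?WR X \<bullet> (a2 (o1 X \<otimes>\<^sub>1 u \<otimes>\<^sub>1 u) \<sharp>\<^sub>2 R' X) = (R X \<sharp>\<^sub>2 a2 (o1 X \<otimes>\<^sub>1 u)) \<bullet> (Ur X \<otimes>\<^sub>2 a2 u)" if X: "X \<in> Obj C" for X
    by (simp_all add: X right_dataD[OF s(8)[OF X]] right_dataD[OF s'(8)[OF X]] c(5)[OF X, unfolded isocells_iff])
  have WLc: "?WL X \<in> isocells C ((\<alpha> \<otimes>\<^sub>1 o1 X) \<sharp>\<^sub>1 (u \<otimes>\<^sub>1 o1 X)) ((u \<otimes>\<^sub>1 u \<otimes>\<^sub>1 o1 X) \<sharp>\<^sub>1 (\<beta> \<otimes>\<^sub>1 o1 X))" if X: "X \<in> Obj C" for X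
    using WLb[OF X] unfolding base_cell_def .
  \<comment> \<open>With the left square over \<open>?WL Y\<close>, the prism turns (PK) into the
    equation whose right-hand side contains \<open>?WL Y\<close>. Its left-hand side is rewritten by
    \<open>?WR X\<close>, and the common invertible cell built from \<open>R' X\<close> is
    cancelled.\<close>
  have eq: "?WR X \<otimes>\<^sub>2 o2 Y = o2 X \<otimes>\<^sub>2 ?WL Y" if O: "X \<in> Obj C" "Y \<in> Obj C" for X Y
  proof -
    have h: "o1 X \<in> homset C X X" "o1 Y \<in> homset C Y Y" using O by simp_all
    have wr: "Ur X \<in> isocells C (comp_at r X \<sharp>\<^sub>1 o1 X) ((o1 X \<otimes>\<^sub>1 u) \<sharp>\<^sub>1 comp_at r' X)" using c(5)[OF O(1)] rD[OF O(1)] O by simp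
    have K: "K (X, Y) \<in> isocells C (o1 X \<otimes>\<^sub>1 comp_at l Y) (comp_at r X \<otimes>\<^sub>1 o1 Y)"
      using s(13)[OF O] unfolding Kelly_rel_def by blast
    define A B where "A = ?WR X" and "B = ?WL Y"
    have A: "A \<in> isocells C ((o1 X \<otimes>\<^sub>1 \<alpha>) \<sharp>\<^sub>1 (o1 X \<otimes>\<^sub>1 u)) ((o1 X \<otimes>\<^sub>1 u \<otimes>\<^sub>1 u) \<sharp>\<^sub>1 (o1 X \<otimes>\<^sub>1 \<beta>))"
      and B: "B \<in> isocells C ((\<alpha> \<otimes>\<^sub>1 o1 Y) \<sharp>\<^sub>1 (u \<otimes>\<^sub>1 o1 Y)) ((u \<otimes>\<^sub>1 u \<otimes>\<^sub>1 o1 Y) \<sharp>\<^sub>1 (\<beta> \<otimes>\<^sub>1 o1 Y))"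
      unfolding A_def B_def using WRc[OF O(1)] WLc[OF O(2)] .
    let ?r = "a2 (o1 X \<otimes>\<^sub>1 u \<otimes>\<^sub>1 u) \<sharp>\<^sub>2 R' X"
    have "(K (X, Y) \<sharp>\<^sub>2 a2 (o1 X \<otimes>\<^sub>1 o1 Y)) \<bullet> (Ur X \<otimes>\<^sub>2 a2 (o1 Y)) = (a2 (o1 X) \<otimes>\<^sub>2 Ul Y) \<bullet> (a2 (o1 X \<otimes>\<^sub>1 u \<otimes>\<^sub>1 o1 Y) \<sharp>\<^sub>2 H (X, Y))"
      using c(6)[OF O] K O lD[OF O(2)] by simp
    then have "((R X \<sharp>\<^sub>2 a2 (o1 X \<otimes>\<^sub>1 u)) \<bullet> (Ur X \<otimes>\<^sub>2 a2 u)) \<otimes>\<^sub>2 a2 (o1 Y) = (a2 (o1 X) \<otimes>\<^sub>2 B) \<bullet> (?r \<otimes>\<^sub>2 a2 (o1 Y))"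
      unfolding B_def
      by (subst (asm) Kelly_iff[OF s(13)[OF O] s'(13)[OF O] u(1) h WLb[OF O(2)] _ wr s(3) s'(9)[OF O(2)]])
        (use WLs[OF O(2) WLc[OF O(2)]] in blast)+
    then have "(A \<bullet> ?r) \<otimes>\<^sub>2 o2 Y = (o2 X \<otimes>\<^sub>2 B) \<bullet> (?r \<otimes>\<^sub>2 o2 Y)" unfolding A_def WRs[OF O(1)] .
    then have "(A \<otimes>\<^sub>2 o2 Y) \<bullet> (?r \<otimes>\<^sub>2 o2 Y) = (o2 X \<otimes>\<^sub>2 B) \<bullet> (?r \<otimes>\<^sub>2 o2 Y)"
      using O A right_dataD[OF s'(8)[OF O(1)]] by simp
    then have "A \<otimes>\<^sub>2 o2 Y = o2 X \<otimes>\<^sub>2 B"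
      by (subst (asm) Vcomp_cancel_right) (use A B O right_dataD[OF s'(8)[OF O(1)]] in simp_all)
    then show ?thesis unfolding A_def B_def .
  qed
  note J = s'(1)
  note ffr = cancellable_right(1)[OF s'(6)] and ffl = cancellable_left(1)[OF s'(6)]
  \<comment> \<open>\<open>?WL J\<close> runs between arrows that are tensored with \<open>J\<close>
    on the right, so it determines \<open>U\<close> by cancelling \<open>J\<close>.\<close>
  obtain U where U: "U \<in> isocells C (\<alpha> \<sharp>\<^sub>1 u) ((u \<otimes>\<^sub>1 u) \<sharp>\<^sub>1 \<beta>)" and UJ: "U \<otimes>\<^sub>2 o2 J = ?WL J"
    by (rule ff_on_isocell[OF ffr, of "\<alpha> \<sharp>\<^sub>1 u" "I \<otimes>\<^sub>0 I" J "(u \<otimes>\<^sub>1 u) \<sharp>\<^sub>1 \<beta>" "?WL J"]) (use WLc[OF J] in simp_all)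
  \<comment> \<open>The compatibility of the families at the pair \<open>X\<close>,
    \<open>J\<close>, with \<open>J\<close> cancelled on the right.\<close>
  have UR: "o2 X \<otimes>\<^sub>2 U = ?WR X" if X: "X \<in> Obj C" for X
  proof -
    define A where "A = ?WR X"
    have "A \<otimes>\<^sub>2 o2 J = o2 X \<otimes>\<^sub>2 U \<otimes>\<^sub>2 o2 J" unfolding UJ A_def by (rule eq[OF X J])
    then have "(o2 X \<otimes>\<^sub>2 U) \<otimes>\<^sub>2 o2 J = A \<otimes>\<^sub>2 o2 J" using X U by simp
    then have "o2 X \<otimes>\<^sub>2 U = A"
      by (subst (asm) ff_on_eq_iff[OF ffr, of _ _ "X \<otimes>\<^sub>0 I \<otimes>\<^sub>0 I" "X \<otimes>\<^sub>0 J"]) (use U X WRc[OF X, folded A_def] in simp_all)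
    then show ?thesis unfolding A_def .
  qed
  \<comment> \<open>The compatibility at the pair \<open>J\<close>, \<open>X\<close>: now that
    \<open>?WR J\<close> is known to be JU, the factor \<open>J\<close> is cancelled on the
    left.\<close>
  have UL: "U \<otimes>\<^sub>2 o2 X = ?WL X" if X: "X \<in> Obj C" for X
  proof -
    define B where "B = ?WL X"
    have "o2 J \<otimes>\<^sub>2 (U \<otimes>\<^sub>2 o2 X) = (o2 J \<otimes>\<^sub>2 U) \<otimes>\<^sub>2 o2 X" using X U by simp
    also have "\<dots> = o2 J \<otimes>\<^sub>2 B" unfolding UR[OF J] B_def by (rule eq[OF J X])
    finally have "U \<otimes>\<^sub>2 o2 X = B"
      by (subst (asm) ff_on_eq_iff[OF ffl, of _ _ "I \<otimes>\<^sub>0 I \<otimes>\<^sub>0 X" "J \<otimes>\<^sub>0 X"]) (use U X WLc[OF X, folded B_def] in simp_all)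
    then show ?thesis unfolding B_def .
  qed
  have lsq: "left_square (comp_at l X) (L X) (comp_at l' X) (L' X) u (o1 X) (U \<otimes>\<^sub>2 o2 X) (Ul X)" if X: "X \<in> Obj C" for X
    unfolding UL[OF X] using WLs[OF X WLc[OF X]] by blast
  have rsq: "right_square (comp_at r X) (R X) (comp_at r' X) (R' X) u (o1 X) (o2 X \<otimes>\<^sub>2 U) (Ur X)" if X: "X \<in> Obj C" for X
    unfolding right_square_def UR[OF X] WRs[OF X] using c(5)[OF X] rD[OF X] X by simp
  show ?thesis
  proof (rule ex1I[of _ U])
    show "(u, Ul, Ur, U) \<in> U_hom (I, \<alpha>, l, r, L, R, K) (J, \<beta>, l', r', L', R', H)"
      unfolding U_hom_iff[OF S S'] using u U c(2,3) lsq rsq by blast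
  next
    fix V assume "(u, Ul, Ur, V) \<in> U_hom (I, \<alpha>, l, r, L, R, K) (J, \<beta>, l', r', L', R', H)"
    then have V: "V \<in> isocells C (\<alpha> \<sharp>\<^sub>1 u) ((u \<otimes>\<^sub>1 u) \<sharp>\<^sub>1 \<beta>)"
      and Vs: "left_square (comp_at l J) (L J) (comp_at l' J) (L' J) u (o1 J) (V \<otimes>\<^sub>2 o2 J) (Ul J)"
      unfolding U_hom_iff[OF S S'] using J by blast+
    have "V \<otimes>\<^sub>2 o2 J = ?WL J" by (subst WLs[OF J, symmetric]) (use V Vs in simp_all)
    then have "V \<otimes>\<^sub>2 o2 J = U \<otimes>\<^sub>2 o2 J" unfolding UJ .
    then show "V = U" by (subst (asm) ff_on_eq_iff[OF ffr, of _ _ "I \<otimes>\<^sub>0 I" J]) (use U V in simp_all)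
  qed
qed

subsection \<open>2-cells\<close>

text \<open>The criterion for 2-cells between squares with an identity as second 2-cell: (T1) and
  (T2) at \<open>X\<close> are (T0) tensored with \<open>X\<close> on either side.\<close>

lemma T1_iff_T0:
  assumes S: "unit_system I \<alpha> l r L R K" and S': "unit_system J \<beta> l' r' L' R' H"
    and f: "(u, Ul, Ur, U) \<in> U_hom (I, \<alpha>, l, r, L, R, K) (J, \<beta>, l', r', L', R', H)"
    and g: "(v, Vl, Vr, V) \<in> U_hom (I, \<alpha>, l, r, L, R, K) (J, \<beta>, l', r', L', R', H)"
    and T: "T \<in> isocells C u v" and X: "X \<in> Obj C"
  shows "Ul X \<bullet> ((T \<otimes>\<^sub>2 o2 X) \<sharp>\<^sub>2 a2 (comp_at l' X)) = Vl X \<longleftrightarrow>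
      (U \<bullet> ((T \<otimes>\<^sub>2 T) \<sharp>\<^sub>2 a2 \<beta>)) \<otimes>\<^sub>2 o2 X = ((a2 \<alpha> \<sharp>\<^sub>2 T) \<bullet> V) \<otimes>\<^sub>2 o2 X"
    and "Ur X \<bullet> ((o2 X \<otimes>\<^sub>2 T) \<sharp>\<^sub>2 a2 (comp_at r' X)) = Vr X \<longleftrightarrow>
      o2 X \<otimes>\<^sub>2 (U \<bullet> ((T \<otimes>\<^sub>2 T) \<sharp>\<^sub>2 a2 \<beta>)) = o2 X \<otimes>\<^sub>2 ((a2 \<alpha> \<sharp>\<^sub>2 T) \<bullet> V)"
proof -
  note s = unit_systemD[OF S] and s' = unit_systemD[OF S']
  have u: "u \<in> homset C I J" and U: "U \<in> isocells C (\<alpha> \<sharp>\<^sub>1 u) ((u \<otimes>\<^sub>1 u) \<sharp>\<^sub>1 \<beta>)"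
    and Us: "left_square (comp_at l X) (L X) (comp_at l' X) (L' X) u (o1 X) (U \<otimes>\<^sub>2 o2 X) (Ul X)"
      "right_square (comp_at r X) (R X) (comp_at r' X) (R' X) u (o1 X) (o2 X \<otimes>\<^sub>2 U) (Ur X)"
    using f X unfolding U_hom_iff[OF S S'] by auto
  have v: "v \<in> homset C I J" "equi v" and V: "V \<in> isocells C (\<alpha> \<sharp>\<^sub>1 v) ((v \<otimes>\<^sub>1 v) \<sharp>\<^sub>1 \<beta>)"
    and Vs: "left_square (comp_at l X) (L X) (comp_at l' X) (L' X) v (o1 X) (V \<otimes>\<^sub>2 o2 X) (Vl X)"
      "right_square (comp_at r X) (R X) (comp_at r' X) (R' X) v (o1 X) (o2 X \<otimes>\<^sub>2 V) (Vr X)"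
    using g X unfolding U_hom_iff[OF S S'] by auto
  have h: "o1 X \<in> homset C X X" "o2 X \<in> cells C (o1 X) (o1 X)" using X by simp_all
  note [simp] = X s(1) s'(1) s(2)[unfolded homset_iff] s'(2)[unfolded homset_iff] u[unfolded homset_iff] v(1)[unfolded homset_iff]
    U[unfolded isocells_iff] V[unfolded isocells_iff] T[unfolded isocells_iff] merge
  have "Vl X \<in> isocells C (comp_at l X) ((v \<otimes>\<^sub>1 o1 X) \<sharp>\<^sub>1 comp_at l' X)" "Vr X \<in> isocells C (comp_at r X) ((o1 X \<otimes>\<^sub>1 v) \<sharp>\<^sub>1 comp_at r' X)"
    using Vs left_constraintD(1)[OF s(4) X] right_constraintD(1)[OF s(5) X] unfolding left_square_def right_square_def by simp_all
  then have e: "(a2 (comp_at l X) \<sharp>\<^sub>2 o2 X) \<bullet> Vl X = Vl X" "(a2 (comp_at r X) \<sharp>\<^sub>2 o2 X) \<bullet> Vr X = Vr X"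
    using left_constraintD(1)[OF s(4) X] right_constraintD(1)[OF s(5) X] by simp_all
  have "(U \<otimes>\<^sub>2 o2 X) \<bullet> ((T \<otimes>\<^sub>2 T \<otimes>\<^sub>2 o2 X) \<sharp>\<^sub>2 a2 (\<beta> \<otimes>\<^sub>1 o1 X)) = (U \<bullet> ((T \<otimes>\<^sub>2 T) \<sharp>\<^sub>2 a2 \<beta>)) \<otimes>\<^sub>2 o2 X"
    "(a2 (\<alpha> \<otimes>\<^sub>1 o1 X) \<sharp>\<^sub>2 (T \<otimes>\<^sub>2 o2 X)) \<bullet> (V \<otimes>\<^sub>2 o2 X) = ((a2 \<alpha> \<sharp>\<^sub>2 T) \<bullet> V) \<otimes>\<^sub>2 o2 X"
    "(o2 X \<otimes>\<^sub>2 U) \<bullet> ((o2 X \<otimes>\<^sub>2 T \<otimes>\<^sub>2 T) \<sharp>\<^sub>2 a2 (o1 X \<otimes>\<^sub>1 \<beta>)) = o2 X \<otimes>\<^sub>2 (U \<bullet> ((T \<otimes>\<^sub>2 T) \<sharp>\<^sub>2 a2 \<beta>))"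
    "(a2 (o1 X \<otimes>\<^sub>1 \<alpha>) \<sharp>\<^sub>2 (o2 X \<otimes>\<^sub>2 T)) \<bullet> (o2 X \<otimes>\<^sub>2 V) = o2 X \<otimes>\<^sub>2 ((a2 \<alpha> \<sharp>\<^sub>2 T) \<bullet> V)"
    by simp_all
  then show "Ul X \<bullet> ((T \<otimes>\<^sub>2 o2 X) \<sharp>\<^sub>2 a2 (comp_at l' X)) = Vl X \<longleftrightarrow>
      (U \<bullet> ((T \<otimes>\<^sub>2 T) \<sharp>\<^sub>2 a2 \<beta>)) \<otimes>\<^sub>2 o2 X = ((a2 \<alpha> \<sharp>\<^sub>2 T) \<bullet> V) \<otimes>\<^sub>2 o2 X"
    "Ur X \<bullet> ((o2 X \<otimes>\<^sub>2 T) \<sharp>\<^sub>2 a2 (comp_at r' X)) = Vr X \<longleftrightarrow>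
      o2 X \<otimes>\<^sub>2 (U \<bullet> ((T \<otimes>\<^sub>2 T) \<sharp>\<^sub>2 a2 \<beta>)) = o2 X \<otimes>\<^sub>2 ((a2 \<alpha> \<sharp>\<^sub>2 T) \<bullet> V)"
    using left_square_cell[OF s(7)[OF X] s'(7)[OF X] s'(6) v(2,1) u h(1) h(1) base_cell_tensor(1)[OF s(2) s'(2) u U h(1)]
        base_cell_tensor(1)[OF s(2) s'(2) v(1) V h(1)] T h(2) Us(1) Vs(1)]
      right_square_cell[OF s(8)[OF X] s'(8)[OF X] s'(6) v(2,1) u h(1) h(1) base_cell_tensor(2)[OF s(2) s'(2) u U h(1)]
        base_cell_tensor(2)[OF s(2) s'(2) v(1) V h(1)] T h(2) Us(2) Vs(2)]
    unfolding e by metis+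
qed

text \<open>Invertibility is part of the definition of a 2-cell only in \<open>\<E>\<close>.
  Elsewhere it follows from (T1) at \<open>J\<close>, because \<open>Ul J\<close> and
  \<open>Vl J\<close> are invertible and both whiskering with an equi-arrow and tensoring with
  \<open>J\<close> reflect invertibility.\<close>

lemma T1_iso:
  assumes S: "unit_system I \<alpha> l r L R K" and S': "unit_system J \<beta> l' r' L' R' H"
    and f: "(u, Ul, Ur) \<in> G_hom (I, l, r, K) (J, l', r', H)" and g: "(v, Vl, Vr) \<in> G_hom (I, l, r, K) (J, l', r', H)"
    and T: "T \<in> cells C u v" "Ul J \<bullet> ((T \<otimes>\<^sub>2 o2 J) \<sharp>\<^sub>2 a2 (comp_at l' J)) = Vl J"
  shows "iso T"
proof -
  note s = unit_systemD[OF S] and s' = unit_systemD[OF S'] and c = G_hom_cells[OF f] and d = G_hom_cells[OF g]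
  note J = s'(1)
  note [simp] = J c(1)[unfolded homset_iff] d(1)[unfolded homset_iff] c(4)[OF J, unfolded isocells_iff] d(4)[OF J, unfolded isocells_iff]
    T(1)[unfolded cells_iff] left_constraintD(1)[OF s'(4) J, unfolded homset_iff]
  have "iso ((T \<otimes>\<^sub>2 o2 J) \<sharp>\<^sub>2 a2 (comp_at l' J))"
    by (rule iso_cancel(2)[of "Ul J"]) (use T(2) in simp_all)
  then have "iso (T \<otimes>\<^sub>2 o2 J)"
    by (subst (asm) ff_on_iso[OF ff_post[OF s'(9)[OF J] refl, of "I \<otimes>\<^sub>0 J"]]) simp_all
  then show "iso T"
    by (subst (asm) ff_on_iso[OF cancellable_right(1)[OF s'(6), of I J]]) simp_all
qed

text \<open>(T1) at the single object \<open>J\<close> already gives (T0), by cancelling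
  \<open>J\<close>; (T0) in turn gives (T1) and (T2) at every object by tensoring. Hence all three
  kinds of 2-cells coincide.\<close>

lemma U_cell_iff:
  assumes S: "unit_system I \<alpha> l r L R K" and S': "unit_system J \<beta> l' r' L' R' H"
    and f: "(u, Ul, Ur, U) \<in> U_hom (I, \<alpha>, l, r, L, R, K) (J, \<beta>, l', r', L', R', H)" (is "_ \<in> U_hom ?X ?Y")
    and g: "(v, Vl, Vr, V) \<in> U_hom (I, \<alpha>, l, r, L, R, K) (J, \<beta>, l', r', L', R', H)"
  shows "U_cell ?X ?Y (u, Ul, Ur, U) (v, Vl, Vr, V) = E_cell (I, \<alpha>) (J, \<beta>) (u, U) (v, V)"
    and "U_cell ?X ?Y (u, Ul, Ur, U) (v, Vl, Vr, V) = G_cell (I, l, r, K) (J, l', r', H) (u, Ul, Ur) (v, Vl, Vr)"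
proof -
  note s = unit_systemD[OF S] and s' = unit_systemD[OF S']
  note J = s'(1)
  have f': "(u, Ul, Ur) \<in> G_hom (I, l, r, K) (J, l', r', H)" and g': "(v, Vl, Vr) \<in> G_hom (I, l, r, K) (J, l', r', H)"
    using f g unfolding U_hom_def by auto
  have hom: "u \<in> homset C I J" "v \<in> homset C I J" "U \<in> isocells C (\<alpha> \<sharp>\<^sub>1 u) ((u \<otimes>\<^sub>1 u) \<sharp>\<^sub>1 \<beta>)"
    "V \<in> isocells C (\<alpha> \<sharp>\<^sub>1 v) ((v \<otimes>\<^sub>1 v) \<sharp>\<^sub>1 \<beta>)"
    using f g unfolding U_hom_iff[OF S S'] by auto
  have 1: "iso T \<and> T0 (I, \<alpha>) (J, \<beta>) (u, U) (v, V) T"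
    if T: "T \<in> cells C u v" "T12 (I, l, r, K) (J, l', r', H) (u, Ul, Ur) (v, Vl, Vr) T" for T
  proof -
    have e: "Ul J \<bullet> ((T \<otimes>\<^sub>2 o2 J) \<sharp>\<^sub>2 a2 (comp_at l' J)) = Vl J" using T(2) J unfolding T12_def by simp
    have i: "iso T" by (rule T1_iso[OF S S' f' g' T(1) e])
    then have T': "T \<in> isocells C u v" using T(1) by simp
    have "U \<bullet> ((T \<otimes>\<^sub>2 T) \<sharp>\<^sub>2 a2 \<beta>) = (a2 \<alpha> \<sharp>\<^sub>2 T) \<bullet> V"
      using e unfolding T1_iff_T0(1)[OF S S' f g T' J]
      by (subst (asm) ff_on_eq_iff[OF cancellable_right(1)[OF s'(6), of "I \<otimes>\<^sub>0 I" J]])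
        (use hom s(1,2) s'(1,2) T' in \<open>simp_all add: merge\<close>)
    then show ?thesis using i unfolding T0_def by simp
  qed
  have 2: "T12 (I, l, r, K) (J, l', r', H) (u, Ul, Ur) (v, Vl, Vr) T"
    if "T \<in> isocells C u v" "T0 (I, \<alpha>) (J, \<beta>) (u, U) (v, V) T" for T
    using that T1_iff_T0[OF S S' f g that(1)] unfolding T12_def T0_def by simp
  show "U_cell ?X ?Y (u, Ul, Ur, U) (v, Vl, Vr, V) = E_cell (I, \<alpha>) (J, \<beta>) (u, U) (v, V)"
    unfolding U_cell_def E_cell_def Phi_obj_def Psi_obj_def Phi_hom_def Psi_hom_def using 1 2 by auto
  show "U_cell ?X ?Y (u, Ul, Ur, U) (v, Vl, Vr, V) = G_cell (I, l, r, K) (J, l', r', H) (u, Ul, Ur) (v, Vl, Vr)"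
    unfolding U_cell_def G_cell_def Phi_obj_def Psi_obj_def Phi_hom_def Psi_hom_def using 1 by auto
qed

text \<open>Closure under composition is checked for (T0) only; through \<open>U_cell_iff\<close> it
  then holds for the 2-cells of \<open>\<U>\<close> as well.\<close>

lemma T0_Vcomp:
  assumes "\<alpha> \<in> homset C (I \<otimes>\<^sub>0 I) I" "\<beta> \<in> homset C (J \<otimes>\<^sub>0 J) J" "u \<in> homset C I J" "v \<in> homset C I J" "w \<in> homset C I J"
    "U \<in> isocells C (\<alpha> \<sharp>\<^sub>1 u) ((u \<otimes>\<^sub>1 u) \<sharp>\<^sub>1 \<beta>)" "V \<in> isocells C (\<alpha> \<sharp>\<^sub>1 v) ((v \<otimes>\<^sub>1 v) \<sharp>\<^sub>1 \<beta>)"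
    "W \<in> isocells C (\<alpha> \<sharp>\<^sub>1 w) ((w \<otimes>\<^sub>1 w) \<sharp>\<^sub>1 \<beta>)"
    and a: "a \<in> E_cell (I, \<alpha>) (J, \<beta>) (u, U) (v, V)" and b: "b \<in> E_cell (I, \<alpha>) (J, \<beta>) (v, V) (w, W)"
  shows "a \<bullet> b \<in> E_cell (I, \<alpha>) (J, \<beta>) (u, U) (w, W)"
proof -
  have e1: "U \<bullet> ((a \<otimes>\<^sub>2 a) \<sharp>\<^sub>2 a2 \<beta>) = (a2 \<alpha> \<sharp>\<^sub>2 a) \<bullet> V" and e2: "V \<bullet> ((b \<otimes>\<^sub>2 b) \<sharp>\<^sub>2 a2 \<beta>) = (a2 \<alpha> \<sharp>\<^sub>2 b) \<bullet> W"
    and ab: "a \<in> isocells C u v" "b \<in> isocells C v w"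
    using a b unfolding E_cell_def T0_def by auto
  note [simp] = assms(1-5)[unfolded homset_iff] assms(6-8)[unfolded isocells_iff] ab[unfolded isocells_iff]
  have "U \<bullet> (((a \<bullet> b) \<otimes>\<^sub>2 (a \<bullet> b)) \<sharp>\<^sub>2 a2 \<beta>) = (U \<bullet> ((a \<otimes>\<^sub>2 a) \<sharp>\<^sub>2 a2 \<beta>)) \<bullet> ((b \<otimes>\<^sub>2 b) \<sharp>\<^sub>2 a2 \<beta>)"
    by (simp add: tensor_Vcomp[symmetric])
  also have "\<dots> = (a2 \<alpha> \<sharp>\<^sub>2 a) \<bullet> (V \<bullet> ((b \<otimes>\<^sub>2 b) \<sharp>\<^sub>2 a2 \<beta>))" unfolding e1 by simp
  also have "\<dots> = (a2 \<alpha> \<sharp>\<^sub>2 (a \<bullet> b)) \<bullet> W" unfolding e2 by simp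
  finally show ?thesis unfolding E_cell_def T0_def by simp
qed

lemma T0_Hcomp:
  assumes "\<alpha> \<in> homset C (I \<otimes>\<^sub>0 I) I" "\<beta> \<in> homset C (J \<otimes>\<^sub>0 J) J" "\<gamma> \<in> homset C (M \<otimes>\<^sub>0 M) M"
    "u \<in> homset C I J" "v \<in> homset C I J" "u' \<in> homset C J M" "v' \<in> homset C J M"
    "U \<in> isocells C (\<alpha> \<sharp>\<^sub>1 u) ((u \<otimes>\<^sub>1 u) \<sharp>\<^sub>1 \<beta>)" "V \<in> isocells C (\<alpha> \<sharp>\<^sub>1 v) ((v \<otimes>\<^sub>1 v) \<sharp>\<^sub>1 \<beta>)"
    "U' \<in> isocells C (\<beta> \<sharp>\<^sub>1 u') ((u' \<otimes>\<^sub>1 u') \<sharp>\<^sub>1 \<gamma>)" "V' \<in> isocells C (\<beta> \<sharp>\<^sub>1 v') ((v' \<otimes>\<^sub>1 v') \<sharp>\<^sub>1 \<gamma>)"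
    and a: "a \<in> E_cell (I, \<alpha>) (J, \<beta>) (u, U) (v, V)" and b: "b \<in> E_cell (J, \<beta>) (M, \<gamma>) (u', U') (v', V')"
  shows "a \<sharp>\<^sub>2 b \<in> E_cell (I, \<alpha>) (M, \<gamma>) (E_comp (u, U) (u', U')) (E_comp (v, V) (v', V'))"
proof -
  have e1: "U \<bullet> ((a \<otimes>\<^sub>2 a) \<sharp>\<^sub>2 a2 \<beta>) = (a2 \<alpha> \<sharp>\<^sub>2 a) \<bullet> V" and e2: "U' \<bullet> ((b \<otimes>\<^sub>2 b) \<sharp>\<^sub>2 a2 \<gamma>) = (a2 \<beta> \<sharp>\<^sub>2 b) \<bullet> V'"
    and ab: "a \<in> isocells C u v" "b \<in> isocells C u' v'"
    using a b unfolding E_cell_def T0_def by auto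
  note [simp] = assms(1-7)[unfolded homset_iff] assms(8-11)[unfolded isocells_iff] ab[unfolded isocells_iff]
  let ?aa = "a \<otimes>\<^sub>2 a"
  have x: "(a \<sharp>\<^sub>2 b) \<otimes>\<^sub>2 (a \<sharp>\<^sub>2 b) = ?aa \<sharp>\<^sub>2 (b \<otimes>\<^sub>2 b)" by (simp add: tensor_Hcomp)
  have "(a2 (u \<otimes>\<^sub>1 u) \<sharp>\<^sub>2 U') \<bullet> (?aa \<sharp>\<^sub>2 ((b \<otimes>\<^sub>2 b) \<sharp>\<^sub>2 a2 \<gamma>)) = ?aa \<sharp>\<^sub>2 (U' \<bullet> ((b \<otimes>\<^sub>2 b) \<sharp>\<^sub>2 a2 \<gamma>))"
    by (subst interchange[symmetric]) simp_all
  also have "\<dots> = (?aa \<sharp>\<^sub>2 (a2 \<beta> \<sharp>\<^sub>2 b)) \<bullet> (a2 (v \<otimes>\<^sub>1 v) \<sharp>\<^sub>2 V')"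
    unfolding e2 by (subst interchange[symmetric]) simp_all
  finally have 1: "(a2 (u \<otimes>\<^sub>1 u) \<sharp>\<^sub>2 U') \<bullet> (?aa \<sharp>\<^sub>2 ((b \<otimes>\<^sub>2 b) \<sharp>\<^sub>2 a2 \<gamma>)) = (?aa \<sharp>\<^sub>2 (a2 \<beta> \<sharp>\<^sub>2 b)) \<bullet> (a2 (v \<otimes>\<^sub>1 v) \<sharp>\<^sub>2 V')" .
  have "(U \<sharp>\<^sub>2 a2 u') \<bullet> (?aa \<sharp>\<^sub>2 (a2 \<beta> \<sharp>\<^sub>2 b)) = (U \<sharp>\<^sub>2 a2 u') \<bullet> ((?aa \<sharp>\<^sub>2 a2 \<beta>) \<sharp>\<^sub>2 b)" by simp
  also have "\<dots> = (U \<bullet> (?aa \<sharp>\<^sub>2 a2 \<beta>)) \<sharp>\<^sub>2 b" by (subst interchange[symmetric]) simp_all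
  also have "\<dots> = ((a2 \<alpha> \<sharp>\<^sub>2 a) \<sharp>\<^sub>2 b) \<bullet> (V \<sharp>\<^sub>2 a2 v')" unfolding e1 by (subst interchange[symmetric]) simp_all
  finally have 2: "(U \<sharp>\<^sub>2 a2 u') \<bullet> (?aa \<sharp>\<^sub>2 (a2 \<beta> \<sharp>\<^sub>2 b)) = (a2 \<alpha> \<sharp>\<^sub>2 a \<sharp>\<^sub>2 b) \<bullet> (V \<sharp>\<^sub>2 a2 v')" by simp
  have y: "(u \<sharp>\<^sub>1 u') \<otimes>\<^sub>1 (u \<sharp>\<^sub>1 u') = (u \<otimes>\<^sub>1 u) \<sharp>\<^sub>1 (u' \<otimes>\<^sub>1 u')" by (simp add: tensor_Comp)
  have "((U \<sharp>\<^sub>2 a2 u') \<bullet> (a2 (u \<otimes>\<^sub>1 u) \<sharp>\<^sub>2 U')) \<bullet> (((a \<sharp>\<^sub>2 b) \<otimes>\<^sub>2 (a \<sharp>\<^sub>2 b)) \<sharp>\<^sub>2 a2 \<gamma>)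
      = (U \<sharp>\<^sub>2 a2 u') \<bullet> (a2 (u \<otimes>\<^sub>1 u) \<sharp>\<^sub>2 U') \<bullet> (?aa \<sharp>\<^sub>2 ((b \<otimes>\<^sub>2 b) \<sharp>\<^sub>2 a2 \<gamma>))"
    unfolding x by simp
  also have "\<dots> = ((U \<sharp>\<^sub>2 a2 u') \<bullet> (?aa \<sharp>\<^sub>2 (a2 \<beta> \<sharp>\<^sub>2 b))) \<bullet> (a2 (v \<otimes>\<^sub>1 v) \<sharp>\<^sub>2 V')"
    unfolding 1 by simp
  also have "\<dots> = (a2 \<alpha> \<sharp>\<^sub>2 (a \<sharp>\<^sub>2 b)) \<bullet> ((V \<sharp>\<^sub>2 a2 v') \<bullet> (a2 (v \<otimes>\<^sub>1 v) \<sharp>\<^sub>2 V'))"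
    unfolding 2 by simp
  finally show ?thesis unfolding E_cell_def T0_def E_comp_def by simp
qed

subsection \<open>The 2-category of units\<close>

lemma U_id_hom:
  assumes S: "unit_system I \<alpha> l r L R K"
  shows "U_id (I, \<alpha>, l, r, L, R, K) \<in> U_hom (I, \<alpha>, l, r, L, R, K) (I, \<alpha>, l, r, L, R, K)"
proof -
  note s = unit_systemD[OF S]
  have "left_square (comp_at l X) (L X) (comp_at l X) (L X) (o1 I) (o1 X) (a2 \<alpha> \<otimes>\<^sub>2 o2 X) (a2 (comp_at l X))"
    "right_square (comp_at r X) (R X) (comp_at r X) (R X) (o1 I) (o1 X) (o2 X \<otimes>\<^sub>2 a2 \<alpha>) (a2 (comp_at r X))"
    if X: "X \<in> Obj C" for X
    using left_square_id[OF s(7)[OF X]] right_square_id[OF s(8)[OF X]] X s(2) by simp_all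
  then show ?thesis
    unfolding U_id_def prod.case U_hom_iff[OF S S] using s(1,2) equi_id[OF s(1)] by simp
qed

text \<open>Composed squares lie over the pasting of \<open>U\<close> and \<open>V\<close> tensored
  with \<open>X\<close>, which is the tensor product of the composite structure cell with
  \<open>X\<close>. By \<open>U_hom_iff\<close> naturality and (PK) for the composite come for
  free.\<close>

lemma U_comp_hom:
  assumes S: "unit_system I \<alpha> l r L R K" and S': "unit_system J \<beta> l' r' L' R' H" and S'': "unit_system M \<gamma> l'' r'' L'' R'' N"
    and f: "(u, Ul, Ur, U) \<in> U_hom (I, \<alpha>, l, r, L, R, K) (J, \<beta>, l', r', L', R', H)"
    and g: "(v, Vl, Vr, V) \<in> U_hom (J, \<beta>, l', r', L', R', H) (M, \<gamma>, l'', r'', L'', R'', N)"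
  shows "U_comp (u, Ul, Ur, U) (v, Vl, Vr, V) \<in> U_hom (I, \<alpha>, l, r, L, R, K) (M, \<gamma>, l'', r'', L'', R'', N)"
proof -
  note s = unit_systemD[OF S] and s' = unit_systemD[OF S'] and s'' = unit_systemD[OF S'']
  have u: "u \<in> homset C I J" "equi u" and U: "U \<in> isocells C (\<alpha> \<sharp>\<^sub>1 u) ((u \<otimes>\<^sub>1 u) \<sharp>\<^sub>1 \<beta>)"
    and Us: "\<And>X. X \<in> Obj C \<Longrightarrow> left_square (comp_at l X) (L X) (comp_at l' X) (L' X) u (o1 X) (U \<otimes>\<^sub>2 o2 X) (Ul X)"
      "\<And>X. X \<in> Obj C \<Longrightarrow> right_square (comp_at r X) (R X) (comp_at r' X) (R' X) u (o1 X) (o2 X \<otimes>\<^sub>2 U) (Ur X)"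
    using f unfolding U_hom_iff[OF S S'] by auto
  have v: "v \<in> homset C J M" "equi v" and V: "V \<in> isocells C (\<beta> \<sharp>\<^sub>1 v) ((v \<otimes>\<^sub>1 v) \<sharp>\<^sub>1 \<gamma>)"
    and Vs: "\<And>X. X \<in> Obj C \<Longrightarrow> left_square (comp_at l' X) (L' X) (comp_at l'' X) (L'' X) v (o1 X) (V \<otimes>\<^sub>2 o2 X) (Vl X)"
      "\<And>X. X \<in> Obj C \<Longrightarrow> right_square (comp_at r' X) (R' X) (comp_at r'' X) (R'' X) v (o1 X) (o2 X \<otimes>\<^sub>2 V) (Vr X)"
    using g unfolding U_hom_iff[OF S' S''] by auto
  note [simp] = s(1) s'(1) s''(1) s(2)[unfolded homset_iff] s'(2)[unfolded homset_iff] s''(2)[unfolded homset_iff]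
    u(1)[unfolded homset_iff] v(1)[unfolded homset_iff] U[unfolded isocells_iff] V[unfolded isocells_iff] merge
  let ?W = "(U \<sharp>\<^sub>2 a2 v) \<bullet> (a2 (u \<otimes>\<^sub>1 u) \<sharp>\<^sub>2 V)"
  have sq: "left_square (comp_at l X) (L X) (comp_at l'' X) (L'' X) (u \<sharp>\<^sub>1 v) (o1 X) (?W \<otimes>\<^sub>2 o2 X) (Ul X \<bullet> (a2 (u \<otimes>\<^sub>1 o1 X) \<sharp>\<^sub>2 Vl X))"
    "right_square (comp_at r X) (R X) (comp_at r'' X) (R'' X) (u \<sharp>\<^sub>1 v) (o1 X) (o2 X \<otimes>\<^sub>2 ?W) (Ur X \<bullet> (a2 (o1 X \<otimes>\<^sub>1 u) \<sharp>\<^sub>2 Vr X))"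
    if X: "X \<in> Obj C" for X
  proof -
    note [simp] = X
    have h: "o1 X \<in> homset C X X" by simp
    have UV: "Ul X \<in> Cell C" "Src C (Ul X) = comp_at l X \<sharp>\<^sub>1 o1 X" "Ur X \<in> Cell C" "Src C (Ur X) = comp_at r X \<sharp>\<^sub>1 o1 X"
      using Us[OF X] unfolding left_square_def right_square_def by auto
    have U1: "Ul X \<sharp>\<^sub>2 o2 X = Ul X" "Ur X \<sharp>\<^sub>2 o2 X = Ur X"
      using UV left_constraintD(1)[OF s(4) X] right_constraintD(1)[OF s(5) X] by simp_all
    have W: "((U \<otimes>\<^sub>2 o2 X) \<sharp>\<^sub>2 a2 (v \<otimes>\<^sub>1 o1 X)) \<bullet> (a2 (u \<otimes>\<^sub>1 u \<otimes>\<^sub>1 o1 X) \<sharp>\<^sub>2 (V \<otimes>\<^sub>2 o2 X)) = ?W \<otimes>\<^sub>2 o2 X"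
      "((o2 X \<otimes>\<^sub>2 U) \<sharp>\<^sub>2 a2 (o1 X \<otimes>\<^sub>1 v)) \<bullet> (a2 (o1 X \<otimes>\<^sub>1 u \<otimes>\<^sub>1 u) \<sharp>\<^sub>2 (o2 X \<otimes>\<^sub>2 V)) = o2 X \<otimes>\<^sub>2 ?W"
      by simp_all
    have X1: "o1 X \<sharp>\<^sub>1 o1 X = o1 X" by simp
    show "left_square (comp_at l X) (L X) (comp_at l'' X) (L'' X) (u \<sharp>\<^sub>1 v) (o1 X) (?W \<otimes>\<^sub>2 o2 X) (Ul X \<bullet> (a2 (u \<otimes>\<^sub>1 o1 X) \<sharp>\<^sub>2 Vl X))"
      using left_square_comp[OF s(7)[OF X] s'(7)[OF X] s''(7)[OF X] u(1) h base_cell_tensor(1)[OF s(2) s'(2) u(1) U h]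
          v(1) h base_cell_tensor(1)[OF s'(2) s''(2) v(1) V h] Us(1)[OF X] Vs(1)[OF X]]
      unfolding W U1 X1 .
    show "right_square (comp_at r X) (R X) (comp_at r'' X) (R'' X) (u \<sharp>\<^sub>1 v) (o1 X) (o2 X \<otimes>\<^sub>2 ?W) (Ur X \<bullet> (a2 (o1 X \<otimes>\<^sub>1 u) \<sharp>\<^sub>2 Vr X))"
      using right_square_comp[OF s(8)[OF X] s'(8)[OF X] s''(8)[OF X] u(1) h base_cell_tensor(2)[OF s(2) s'(2) u(1) U h]
          v(1) h base_cell_tensor(2)[OF s'(2) s''(2) v(1) V h] Us(2)[OF X] Vs(2)[OF X]]
      unfolding W U1 X1 .
  qed
  have uv: "u \<sharp>\<^sub>1 v \<in> homset C I M" by simp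
  have "equi (u \<sharp>\<^sub>1 v)" by (rule equi_comp[OF u(2) v(2)]) simp
  moreover have "?W \<in> isocells C (\<alpha> \<sharp>\<^sub>1 u \<sharp>\<^sub>1 v) (((u \<sharp>\<^sub>1 v) \<otimes>\<^sub>1 (u \<sharp>\<^sub>1 v)) \<sharp>\<^sub>1 \<gamma>)" by simp
  ultimately show ?thesis
    unfolding U_comp_def prod.case U_hom_iff[OF S S''] using uv sq by simp
qed

lemma whisker_comp_assoc:
  assumes "f \<in> Arr C" "g \<in> Arr C" "a \<in> Cell C" "b \<in> Cell C" "c \<in> Cell C" "Cod C f = Dom C g" "Cod C g = Dom C (Src C c)"
    "Trg C a = f \<sharp>\<^sub>1 Src C b" "Trg C b = g \<sharp>\<^sub>1 Src C c" "Cod C f = Dom C (Src C b)"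
  shows "(a \<bullet> (a2 f \<sharp>\<^sub>2 b)) \<bullet> (a2 (f \<sharp>\<^sub>1 g) \<sharp>\<^sub>2 c) = a \<bullet> (a2 f \<sharp>\<^sub>2 (b \<bullet> (a2 g \<sharp>\<^sub>2 c)))"
  using assms by simp

text \<open>The only one of the three 2-categories whose axioms are checked directly; the other two
  receive theirs along the forgetful maps.\<close>

lemma U_structured: "structured C U_obj U_hom U_cell fst U_id U_comp fst"
proof (intro structured.intro structured_axioms.intro strict_2category_axioms)
  fix X assume X: "X \<in> U_obj"
  obtain I \<alpha> l r L R K where Xe: "X = (I, \<alpha>, l, r, L, R, K)" by (cases X rule: prod_cases7)
  have S: "unit_system I \<alpha> l r L R K" using X unfolding Xe U_obj_iff .
  note s = unit_systemD[OF S]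
  note lD = left_constraintD(1)[OF s(4), unfolded homset_iff] and rD = right_constraintD(1)[OF s(5), unfolded homset_iff]
  show "fst X \<in> Obj C" unfolding Xe using s(1) by simp
  show "U_id X \<in> U_hom X X" unfolding Xe by (rule U_id_hom[OF S])
  show "fst (U_id X) = o1 (fst X)" unfolding Xe U_id_def by simp
  fix Y assume Y: "Y \<in> U_obj"
  obtain J \<beta> l' r' L' R' H where Ye: "Y = (J, \<beta>, l', r', L', R', H)" by (cases Y rule: prod_cases7)
  have S': "unit_system J \<beta> l' r' L' R' H" using Y unfolding Ye U_obj_iff .
  note s' = unit_systemD[OF S']
  note lD' = left_constraintD(1)[OF s'(4), unfolded homset_iff] and rD' = right_constraintD(1)[OF s'(5), unfolded homset_iff]
  have G: "(u, Ul, Ur) \<in> G_hom (I, l, r, K) (J, l', r', H)" if "(u, Ul, Ur, U) \<in> U_hom X Y" for u Ul Ur U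
    using that unfolding Xe Ye U_hom_def by simp
  have Ud: "U \<in> isocells C (\<alpha> \<sharp>\<^sub>1 u) ((u \<otimes>\<^sub>1 u) \<sharp>\<^sub>1 \<beta>)" if "(u, Ul, Ur, U) \<in> U_hom X Y" for u Ul Ur U
    using that unfolding Xe Ye U_hom_def by simp
  \<comment> \<open>From here on membership of a 2-cell is a matter of (T0) and invertibility
    alone.\<close>
  have cellE: "U_cell X Y f g = E_cell (I, \<alpha>) (J, \<beta>) (Phi_hom f) (Phi_hom g)" if "f \<in> U_hom X Y" "g \<in> U_hom X Y" for f g
    using that U_cell_iff(1)[OF S S'] unfolding Xe Ye by (cases f rule: prod_cases4; cases g rule: prod_cases4) (simp add: Phi_hom_def)
  fix f assume f: "f \<in> U_hom X Y"
  obtain u Ul Ur U where fe: "f = (u, Ul, Ur, U)" by (cases f rule: prod_cases4)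
  note c = G_hom_cells[OF G[OF f[unfolded fe]]] and U = Ud[OF f[unfolded fe]]
  show "fst f \<in> homset C (fst X) (fst Y)" unfolding Xe Ye fe using c(1) by simp
  show "U_comp (U_id X) f = f"
  proof -
    have "(\<lambda>X\<in>Obj C. restrict (\<lambda>X. a2 (comp_at l X)) (Obj C) X \<bullet> (a2 (o1 I \<otimes>\<^sub>1 o1 X) \<sharp>\<^sub>2 Ul X)) = Ul"
      by (rule extensionalityI[OF restrict_extensional c(2)]) (use c(1,4) lD s(1) in simp)
    moreover have "(\<lambda>X\<in>Obj C. restrict (\<lambda>X. a2 (comp_at r X)) (Obj C) X \<bullet> (a2 (o1 X \<otimes>\<^sub>1 o1 I) \<sharp>\<^sub>2 Ur X)) = Ur"
      by (rule extensionalityI[OF restrict_extensional c(3)]) (use c(1,5) rD s(1) in simp)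
    ultimately show ?thesis unfolding Xe fe U_id_def U_comp_def prod.case using c(1) U s(1,2) by simp
  qed
  show "U_comp f (U_id Y) = f"
  proof -
    have "(\<lambda>X\<in>Obj C. Ul X \<bullet> (a2 (u \<otimes>\<^sub>1 o1 X) \<sharp>\<^sub>2 restrict (\<lambda>X. a2 (comp_at l' X)) (Obj C) X)) = Ul"
      by (rule extensionalityI[OF restrict_extensional c(2)]) (use c(1,4) lD' s'(1) in simp)
    moreover have "(\<lambda>X\<in>Obj C. Ur X \<bullet> (a2 (o1 X \<otimes>\<^sub>1 u) \<sharp>\<^sub>2 restrict (\<lambda>X. a2 (comp_at r' X)) (Obj C) X)) = Ur"
      by (rule extensionalityI[OF restrict_extensional c(3)]) (use c(1,5) rD' s'(1) in simp)
    ultimately show ?thesis unfolding Ye fe U_id_def U_comp_def prod.case using c(1) U s(2) s'(1,2) by simp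
  qed
  show "a2 (fst f) \<in> U_cell X Y f f"
    unfolding cellE[OF f f] unfolding fe Phi_hom_def prod.case E_cell_def T0_def using c(1) U s(1,2) s'(1,2) by simp
  {
    fix g assume g: "g \<in> U_hom X Y"
    obtain v Vl Vr V where ge: "g = (v, Vl, Vr, V)" by (cases g rule: prod_cases4)
    note d = G_hom_cells[OF G[OF g[unfolded ge]]] and V = Ud[OF g[unfolded ge]]
    fix a assume a: "a \<in> U_cell X Y f g"
    then show "a \<in> cells C (fst f) (fst g)" unfolding U_cell_def by simp
    have aE: "a \<in> E_cell (I, \<alpha>) (J, \<beta>) (u, U) (v, V)" using a unfolding cellE[OF f g] unfolding fe ge Phi_hom_def by simp
    {
      fix h b assume h: "h \<in> U_hom X Y" and b: "b \<in> U_cell X Y g h"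
      obtain w Wl Wr W where he: "h = (w, Wl, Wr, W)" by (cases h rule: prod_cases4)
      note e = G_hom_cells[OF G[OF h[unfolded he]]] and W = Ud[OF h[unfolded he]]
      have bE: "b \<in> E_cell (I, \<alpha>) (J, \<beta>) (v, V) (w, W)" using b unfolding cellE[OF g h] unfolding ge he Phi_hom_def by simp
      show "a \<bullet> b \<in> U_cell X Y f h"
        unfolding cellE[OF f h] unfolding fe he Phi_hom_def prod.case
        by (rule T0_Vcomp[OF s(2) s'(2) c(1) d(1) e(1) U V W aE bE])
    }
    fix Z f' g' b assume Z: "Z \<in> U_obj" and f': "f' \<in> U_hom Y Z" and g': "g' \<in> U_hom Y Z" and b: "b \<in> U_cell Y Z f' g'"
    obtain M \<gamma> l'' r'' L'' R'' N where Ze: "Z = (M, \<gamma>, l'', r'', L'', R'', N)" by (cases Z rule: prod_cases7)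
    have S'': "unit_system M \<gamma> l'' r'' L'' R'' N" using Z unfolding Ze U_obj_iff .
    note s'' = unit_systemD[OF S'']
    obtain u' Ul' Ur' U' where f'e: "f' = (u', Ul', Ur', U')" by (cases f' rule: prod_cases4)
    obtain v' Vl' Vr' V' where g'e: "g' = (v', Vl', Vr', V')" by (cases g' rule: prod_cases4)
    note F = f[unfolded fe Xe Ye] and G' = g[unfolded ge Xe Ye] and F' = f'[unfolded f'e Ye Ze] and G'' = g'[unfolded g'e Ye Ze]
    have hs: "u' \<in> homset C J M" "v' \<in> homset C J M" "U' \<in> isocells C (\<beta> \<sharp>\<^sub>1 u') ((u' \<otimes>\<^sub>1 u') \<sharp>\<^sub>1 \<gamma>)"
      "V' \<in> isocells C (\<beta> \<sharp>\<^sub>1 v') ((v' \<otimes>\<^sub>1 v') \<sharp>\<^sub>1 \<gamma>)"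
      using F' G'' unfolding U_hom_iff[OF S' S''] by auto
    have bE: "b \<in> E_cell (J, \<beta>) (M, \<gamma>) (u', U') (v', V')"
      using b unfolding f'e g'e Ye Ze U_cell_iff(1)[OF S' S'' F' G''] .
    have "a \<sharp>\<^sub>2 b \<in> E_cell (I, \<alpha>) (M, \<gamma>) (E_comp (u, U) (u', U')) (E_comp (v, V) (v', V'))"
      by (rule T0_Hcomp[OF s(2) s'(2) s''(2) c(1) d(1) hs(1,2) U V hs(3,4) aE bE])
    then show "a \<sharp>\<^sub>2 b \<in> U_cell X Z (U_comp f f') (U_comp g g')"
      using U_cell_iff(1)[OF S S'' U_comp_hom[OF S S' S'' F F', unfolded U_comp_def prod.case]
          U_comp_hom[OF S S' S'' G' G'', unfolded U_comp_def prod.case]]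
      unfolding Xe Ze fe ge f'e g'e U_comp_def E_comp_def prod.case by simp
  }
  fix Z g assume Z: "Z \<in> U_obj" and g: "g \<in> U_hom Y Z"
  obtain M \<gamma> l'' r'' L'' R'' N where Ze: "Z = (M, \<gamma>, l'', r'', L'', R'', N)" by (cases Z rule: prod_cases7)
  have S'': "unit_system M \<gamma> l'' r'' L'' R'' N" using Z unfolding Ze U_obj_iff .
  note s'' = unit_systemD[OF S'']
  obtain v Vl Vr V where ge: "g = (v, Vl, Vr, V)" by (cases g rule: prod_cases4)
  show "U_comp f g \<in> U_hom X Z"
    using U_comp_hom[OF S S' S''] f g unfolding Xe Ye Ze fe ge by blast
  show "fst (U_comp f g) = fst f \<sharp>\<^sub>1 fst g" unfolding fe ge U_comp_def by simp
  have Gg: "(v, Vl, Vr) \<in> G_hom (J, l', r', H) (M, l'', r'', N)" and V: "V \<in> isocells C (\<beta> \<sharp>\<^sub>1 v) ((v \<otimes>\<^sub>1 v) \<sharp>\<^sub>1 \<gamma>)"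
    using g unfolding Ye Ze ge U_hom_def by auto
  note d = G_hom_cells[OF Gg]
  note lD'' = left_constraintD(1)[OF s''(4), unfolded homset_iff] and rD'' = right_constraintD(1)[OF s''(5), unfolded homset_iff]
  fix W h assume W: "W \<in> U_obj" and h: "h \<in> U_hom Z W"
  obtain O' \<delta> l3 r3 L3 R3 N3 where We: "W = (O', \<delta>, l3, r3, L3, R3, N3)" by (cases W rule: prod_cases7)
  have S3: "unit_system O' \<delta> l3 r3 L3 R3 N3" using W unfolding We U_obj_iff .
  note s3 = unit_systemD[OF S3]
  obtain w Wl Wr T where he: "h = (w, Wl, Wr, T)" by (cases h rule: prod_cases4)
  have Gh: "(w, Wl, Wr) \<in> G_hom (M, l'', r'', N) (O', l3, r3, N3)" and T: "T \<in> isocells C (\<gamma> \<sharp>\<^sub>1 w) ((w \<otimes>\<^sub>1 w) \<sharp>\<^sub>1 \<delta>)"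
    using h unfolding Ze We he U_hom_def by auto
  note e = G_hom_cells[OF Gh]
  note [simp] = s(1) s'(1) s''(1) s3(1) s(2)[unfolded homset_iff] s'(2)[unfolded homset_iff] s''(2)[unfolded homset_iff] s3(2)[unfolded homset_iff]
    c(1)[unfolded homset_iff] d(1)[unfolded homset_iff] e(1)[unfolded homset_iff] U[unfolded isocells_iff] V[unfolded isocells_iff] T[unfolded isocells_iff]
  have uvw: "(u \<sharp>\<^sub>1 v) \<otimes>\<^sub>1 (u \<sharp>\<^sub>1 v) = (u \<otimes>\<^sub>1 u) \<sharp>\<^sub>1 (v \<otimes>\<^sub>1 v)" by (simp add: tensor_Comp)
  have uX: "(u \<sharp>\<^sub>1 v) \<otimes>\<^sub>1 o1 A = (u \<otimes>\<^sub>1 o1 A) \<sharp>\<^sub>1 (v \<otimes>\<^sub>1 o1 A)" "o1 A \<otimes>\<^sub>1 (u \<sharp>\<^sub>1 v) = (o1 A \<otimes>\<^sub>1 u) \<sharp>\<^sub>1 (o1 A \<otimes>\<^sub>1 v)" if "A \<in> Obj C" for A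
    using that by (simp_all add: tensor_Comp)
  have "(\<lambda>X\<in>Obj C. (\<lambda>X\<in>Obj C. Ul X \<bullet> (a2 (u \<otimes>\<^sub>1 o1 X) \<sharp>\<^sub>2 Vl X)) X \<bullet> (a2 ((u \<sharp>\<^sub>1 v) \<otimes>\<^sub>1 o1 X) \<sharp>\<^sub>2 Wl X))
      = (\<lambda>X\<in>Obj C. Ul X \<bullet> (a2 (u \<otimes>\<^sub>1 o1 X) \<sharp>\<^sub>2 (\<lambda>X\<in>Obj C. Vl X \<bullet> (a2 (v \<otimes>\<^sub>1 o1 X) \<sharp>\<^sub>2 Wl X)) X))"
  proof (rule restrict_ext)
    fix A assume A: "A \<in> Obj C"
    show "(\<lambda>X\<in>Obj C. Ul X \<bullet> (a2 (u \<otimes>\<^sub>1 o1 X) \<sharp>\<^sub>2 Vl X)) A \<bullet> (a2 ((u \<sharp>\<^sub>1 v) \<otimes>\<^sub>1 o1 A) \<sharp>\<^sub>2 Wl A)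
      = Ul A \<bullet> (a2 (u \<otimes>\<^sub>1 o1 A) \<sharp>\<^sub>2 (\<lambda>X\<in>Obj C. Vl X \<bullet> (a2 (v \<otimes>\<^sub>1 o1 X) \<sharp>\<^sub>2 Wl X)) A)"
      unfolding restrict_apply'[OF A] uX(1)[OF A]
      by (rule whisker_comp_assoc) (simp_all add: A c(4)[OF A, unfolded isocells_iff] d(4)[OF A, unfolded isocells_iff]
          e(4)[OF A, unfolded isocells_iff] lD[OF A] lD'[OF A] lD''[OF A])
  qed
  moreover have "(\<lambda>X\<in>Obj C. (\<lambda>X\<in>Obj C. Ur X \<bullet> (a2 (o1 X \<otimes>\<^sub>1 u) \<sharp>\<^sub>2 Vr X)) X \<bullet> (a2 (o1 X \<otimes>\<^sub>1 (u \<sharp>\<^sub>1 v)) \<sharp>\<^sub>2 Wr X))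
      = (\<lambda>X\<in>Obj C. Ur X \<bullet> (a2 (o1 X \<otimes>\<^sub>1 u) \<sharp>\<^sub>2 (\<lambda>X\<in>Obj C. Vr X \<bullet> (a2 (o1 X \<otimes>\<^sub>1 v) \<sharp>\<^sub>2 Wr X)) X))"
  proof (rule restrict_ext)
    fix A assume A: "A \<in> Obj C"
    show "(\<lambda>X\<in>Obj C. Ur X \<bullet> (a2 (o1 X \<otimes>\<^sub>1 u) \<sharp>\<^sub>2 Vr X)) A \<bullet> (a2 (o1 A \<otimes>\<^sub>1 (u \<sharp>\<^sub>1 v)) \<sharp>\<^sub>2 Wr A)
      = Ur A \<bullet> (a2 (o1 A \<otimes>\<^sub>1 u) \<sharp>\<^sub>2 (\<lambda>X\<in>Obj C. Vr X \<bullet> (a2 (o1 X \<otimes>\<^sub>1 v) \<sharp>\<^sub>2 Wr X)) A)"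
      unfolding restrict_apply'[OF A] uX(2)[OF A]
      by (rule whisker_comp_assoc) (simp_all add: A c(5)[OF A, unfolded isocells_iff] d(5)[OF A, unfolded isocells_iff]
          e(5)[OF A, unfolded isocells_iff] rD[OF A] rD'[OF A] rD''[OF A])
  qed
  moreover have "(((U \<sharp>\<^sub>2 a2 v) \<bullet> (a2 (u \<otimes>\<^sub>1 u) \<sharp>\<^sub>2 V)) \<sharp>\<^sub>2 a2 w) \<bullet> (a2 ((u \<sharp>\<^sub>1 v) \<otimes>\<^sub>1 (u \<sharp>\<^sub>1 v)) \<sharp>\<^sub>2 T)
      = (U \<sharp>\<^sub>2 a2 (v \<sharp>\<^sub>1 w)) \<bullet> (a2 (u \<otimes>\<^sub>1 u) \<sharp>\<^sub>2 ((V \<sharp>\<^sub>2 a2 w) \<bullet> (a2 (v \<otimes>\<^sub>1 v) \<sharp>\<^sub>2 T)))"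
    unfolding uvw by simp
  ultimately show "U_comp (U_comp f g) h = U_comp f (U_comp g h)"
    unfolding fe ge he U_comp_def prod.case by simp
qed

section \<open>The two forgetful 2-functors as bijections on structured arrows and 2-cells\<close>

lemma Phi_structured_forget:
  "structured_forget C U_obj U_hom U_cell fst U_id U_comp fst E_obj E_hom E_cell fst E_id E_comp Phi_obj Phi_hom"
proof (intro structured_forget.intro structured_forget_axioms.intro U_structured)
  show "Phi_obj ` U_obj = E_obj"
  proof
    show "Phi_obj ` U_obj \<subseteq> E_obj" using Phi_obj_E_obj by (auto simp: Phi_obj_def)
    show "E_obj \<subseteq> Phi_obj ` U_obj"
    proof
      fix Z assume "Z \<in> E_obj"
      then obtain I \<alpha> l r L R K where "Z = (I, \<alpha>)" "(I, \<alpha>, l, r, L, R, K) \<in> U_obj" by (metis E_obj_lift surj_pair)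
      then show "Z \<in> Phi_obj ` U_obj" by (intro image_eqI[of _ _ "(I, \<alpha>, l, r, L, R, K)"]) (simp_all add: Phi_obj_def)
    qed
  qed
  fix X Y assume X: "X \<in> U_obj" and Y: "Y \<in> U_obj"
  show "Phi_obj X = Phi_obj Y \<Longrightarrow> fst X = fst Y" by (auto simp: Phi_obj_def split: prod.splits)
  obtain I \<alpha> l r L R K where Xe: "X = (I, \<alpha>, l, r, L, R, K)" by (cases X rule: prod_cases7)
  obtain J \<beta> l' r' L' R' H where Ye: "Y = (J, \<beta>, l', r', L', R', H)" by (cases Y rule: prod_cases7)
  have S: "unit_system I \<alpha> l r L R K" and S': "unit_system J \<beta> l' r' L' R' H"
    using X Y unfolding Xe Ye U_obj_iff by simp_all
  note lift = E_hom_lift[OF S S', folded Xe Ye]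
  have e: "Phi_obj X = (I, \<alpha>)" "Phi_obj Y = (J, \<beta>)" unfolding Xe Ye Phi_obj_def by simp_all
  have hom: "(u, U) \<in> E_hom (I, \<alpha>) (J, \<beta>)" if "(u, Ul, Ur, U) \<in> U_hom X Y" for u Ul Ur U
    using that unfolding Xe Ye U_hom_iff[OF S S'] E_hom_def by simp
  show "bij_betw Phi_hom (U_hom X Y) (E_hom (Phi_obj X) (Phi_obj Y))"
    unfolding bij_betw_def e
  proof
    show "inj_on Phi_hom (U_hom X Y)"
    proof (rule inj_onI)
      fix f g assume f: "f \<in> U_hom X Y" and g: "g \<in> U_hom X Y" and fg: "Phi_hom f = Phi_hom g"
      obtain u Ul Ur U where fe: "f = (u, Ul, Ur, U)" by (cases f rule: prod_cases4)
      obtain Vl Vr where ge: "g = (u, Vl, Vr, U)" using fg unfolding fe by (cases g rule: prod_cases4) (simp add: Phi_hom_def)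
      show "f = g" using lift[OF hom[OF f[unfolded fe]]] f g unfolding fe ge by auto
    qed
    show "Phi_hom ` U_hom X Y = E_hom (I, \<alpha>) (J, \<beta>)"
    proof
      show "Phi_hom ` U_hom X Y \<subseteq> E_hom (I, \<alpha>) (J, \<beta>)"
      proof
        fix k assume "k \<in> Phi_hom ` U_hom X Y"
        then obtain f where f: "f \<in> U_hom X Y" "k = Phi_hom f" by blast
        then show "k \<in> E_hom (I, \<alpha>) (J, \<beta>)" using hom by (cases f rule: prod_cases4) (simp add: Phi_hom_def)
      qed
      show "E_hom (I, \<alpha>) (J, \<beta>) \<subseteq> Phi_hom ` U_hom X Y"
      proof
        fix k assume k: "k \<in> E_hom (I, \<alpha>) (J, \<beta>)"
        obtain u U where ke: "k = (u, U)" by (cases k)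
        obtain Ul Ur where "(u, Ul, Ur, U) \<in> U_hom X Y" using lift[OF k[unfolded ke]] by auto
        then show "k \<in> Phi_hom ` U_hom X Y" unfolding ke by (intro image_eqI[of _ _ "(u, Ul, Ur, U)"]) (simp_all add: Phi_hom_def)
      qed
    qed
  qed
  show "E_cell (Phi_obj X) (Phi_obj Y) (Phi_hom f) (Phi_hom g) = U_cell X Y f g" if "f \<in> U_hom X Y" "g \<in> U_hom X Y" for f g
    using that U_cell_iff(1)[OF S S'] unfolding Xe Ye
    by (cases f rule: prod_cases4; cases g rule: prod_cases4) (simp add: Phi_hom_def Phi_obj_def)
qed (auto simp: Phi_hom_def Phi_obj_def U_id_def E_id_def U_comp_def E_comp_def split: prod.splits)

lemma Psi_structured_forget:
  "structured_forget C U_obj U_hom U_cell fst U_id U_comp fst G_obj G_hom G_cell fst G_id G_comp Psi_obj Psi_hom"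
proof (intro structured_forget.intro structured_forget_axioms.intro U_structured)
  show "Psi_obj ` U_obj = G_obj"
  proof
    show "Psi_obj ` U_obj \<subseteq> G_obj" using Psi_obj_G_obj by (auto simp: Psi_obj_def)
    show "G_obj \<subseteq> Psi_obj ` U_obj"
    proof
      fix Z assume "Z \<in> G_obj"
      then obtain I \<alpha> l r L R K where "Z = (I, l, r, K)" "(I, \<alpha>, l, r, L, R, K) \<in> U_obj" by (metis G_obj_lift prod_cases4)
      then show "Z \<in> Psi_obj ` U_obj" by (intro image_eqI[of _ _ "(I, \<alpha>, l, r, L, R, K)"]) (simp_all add: Psi_obj_def)
    qed
  qed
  fix X Y assume X: "X \<in> U_obj" and Y: "Y \<in> U_obj"
  show "Psi_obj X = Psi_obj Y \<Longrightarrow> fst X = fst Y" by (auto simp: Psi_obj_def split: prod.splits)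
  obtain I \<alpha> l r L R K where Xe: "X = (I, \<alpha>, l, r, L, R, K)" by (cases X rule: prod_cases7)
  obtain J \<beta> l' r' L' R' H where Ye: "Y = (J, \<beta>, l', r', L', R', H)" by (cases Y rule: prod_cases7)
  have S: "unit_system I \<alpha> l r L R K" and S': "unit_system J \<beta> l' r' L' R' H"
    using X Y unfolding Xe Ye U_obj_iff by simp_all
  note lift = G_hom_lift[OF S S', folded Xe Ye]
  have e: "Psi_obj X = (I, l, r, K)" "Psi_obj Y = (J, l', r', H)" unfolding Xe Ye Psi_obj_def by simp_all
  have hom: "(u, Ul, Ur) \<in> G_hom (I, l, r, K) (J, l', r', H)" if "(u, Ul, Ur, U) \<in> U_hom X Y" for u Ul Ur U
    using that unfolding Xe Ye U_hom_def by simp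
  show "bij_betw Psi_hom (U_hom X Y) (G_hom (Psi_obj X) (Psi_obj Y))"
    unfolding bij_betw_def e
  proof
    show "inj_on Psi_hom (U_hom X Y)"
    proof (rule inj_onI)
      fix f g assume f: "f \<in> U_hom X Y" and g: "g \<in> U_hom X Y" and fg: "Psi_hom f = Psi_hom g"
      obtain u Ul Ur U where fe: "f = (u, Ul, Ur, U)" by (cases f rule: prod_cases4)
      obtain V where ge: "g = (u, Ul, Ur, V)" using fg unfolding fe by (cases g rule: prod_cases4) (simp add: Psi_hom_def)
      show "f = g" using lift[OF hom[OF f[unfolded fe]]] f g unfolding fe ge by auto
    qed
    show "Psi_hom ` U_hom X Y = G_hom (I, l, r, K) (J, l', r', H)"
    proof
      show "Psi_hom ` U_hom X Y \<subseteq> G_hom (I, l, r, K) (J, l', r', H)"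
      proof
        fix k assume "k \<in> Psi_hom ` U_hom X Y"
        then obtain f where f: "f \<in> U_hom X Y" "k = Psi_hom f" by blast
        then show "k \<in> G_hom (I, l, r, K) (J, l', r', H)" using hom by (cases f rule: prod_cases4) (simp add: Psi_hom_def)
      qed
      show "G_hom (I, l, r, K) (J, l', r', H) \<subseteq> Psi_hom ` U_hom X Y"
      proof
        fix k assume k: "k \<in> G_hom (I, l, r, K) (J, l', r', H)"
        obtain u Ul Ur where ke: "k = (u, Ul, Ur)" by (cases k)
        obtain U where "(u, Ul, Ur, U) \<in> U_hom X Y" using lift[OF k[unfolded ke]] by auto
        then show "k \<in> Psi_hom ` U_hom X Y" unfolding ke by (intro image_eqI[of _ _ "(u, Ul, Ur, U)"]) (simp_all add: Psi_hom_def)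
      qed
    qed
  qed
  show "G_cell (Psi_obj X) (Psi_obj Y) (Psi_hom f) (Psi_hom g) = U_cell X Y f g" if "f \<in> U_hom X Y" "g \<in> U_hom X Y" for f g
    using that U_cell_iff(2)[OF S S'] unfolding Xe Ye
    by (cases f rule: prod_cases4; cases g rule: prod_cases4) (simp add: Psi_hom_def Psi_obj_def)
qed (auto simp: Psi_hom_def Psi_obj_def U_id_def G_id_def U_comp_def G_comp_def split: prod.splits)

end

theorem theoremE:
  fixes C :: "('o, 'a, 'c) semi_monoidal"
  assumes "semi_monoidal_2category C"
  shows
    "two_equivalence (\<U> C) (\<E> C) Phi \<and>
     surjective_on_objects (\<U> C) (\<E> C) Phi \<and>
     strongly_fully_faithful (\<U> C) (\<E> C) Phi \<and>
     two_equivalence (\<U> C) (\<G> C) Psi \<and>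
     surjective_on_objects (\<U> C) (\<G> C) Psi \<and>
     strongly_fully_faithful (\<U> C) (\<G> C) Psi"
proof -
  interpret semi_monoidal_2category C by (rule assms)
  note P = Phi_structured_forget and Q = Psi_structured_forget
  show ?thesis
    unfolding U_cat_def E_cat_def G_cat_def Phi_def Psi_def
    using structured_forget.fun2_two_equivalence[OF P] structured_forget.fun2_surjective[OF P]
      structured_forget.fun2_strongly_fully_faithful[OF P] structured_forget.fun2_two_equivalence[OF Q]
      structured_forget.fun2_surjective[OF Q] structured_forget.fun2_strongly_fully_faithful[OF Q]
    by blast
qed

end
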